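(* Let $\mathcal{H}$ be a Hopf algebra over a field $\mathbb{K}$, let $W(\mathcal{H})$ be its Weil algebra endowed with its canonical structure $(i,W(\mathcal{H}),\alpha_W)$ of $\mathcal{H}$-operation with connection, and let $\Omega$ be an $\mathcal{H}$-operation with connection. Then there is a unique morphism of $\mathcal{H}$-operations with connection from $W(\mathcal{H})$ to $\Omega$.
   Context: Algebras are unital associative over $\mathbb{K}$, graded algebras are $\mathbb{N}$-graded, a graded differential algebra is a graded algebra with a differential $d$ (graded derivation of degree $1$, $d^2=0$), no graded commutativity assumed. $\mathcal{H}$ has coproduct $\Delta$, counit $\varepsilon$, antipode $S$; $\Delta h=\sum_j h^{(1)}_j\otimes h^{(2)}_j$; $\mathrm{ad}(h)g=\sum_j S(h^{(1)}_j)gh^{(2)}_j$. $\mathcal{H}$-operations. An operation of $\mathcal{H}$ in a graded differential algebra $\Omega$ (an $\mathcal{H}$-operation $(i,\Omega)$) is a linear map $h\mapsto i_h$ from $\mathcal{H}$ into the linear endomorphisms of $\Omega$ homogeneous of degree $-1$ with $i_1=0$ and such that, setting $L_h=di_h+i_hd+\varepsilon(h)I_\Omega$, for all $g,h\in\mathcal{H}$: (i) $i_h(\alpha\beta)=\sum_j i_{h^{(1)}_j}(\alpha)L_{h^{(2)}_j}(\beta)+(-1)^a\alpha\, i_h(\beta)$ for $\alpha\in\Omega^a$, $\beta\in\Omega$; (ii) $i_gL_h=\sum_j L_{h^{(1)}_j}i_{\mathrm{ad}(h^{(2)}_j)g}$; (iii) $L_hL_g=L_{hg}$. A morphism of $\mathcal{H}$-operations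 $(i,\Omega)\to(i',\Omega')$ is a homomorphism $f:\Omega\to\Omega'$ of graded differential algebras with $f\circ i_h=i'_h\circ f$ for all $h\in\mathcal{H}$. The algebra $C(\mathcal{H})$. $C(\mathcal{H})=\oplus_n C^n(\mathcal{H})$ with $C^n(\mathcal{H})=(\mathcal{H}^{\otimes n})^*$ ($n$-linear forms on $\mathcal{H}$, $C^0(\mathcal H)=\mathbb{K}$), with product the tensor product of multilinear forms. It is a graded differential algebra with the Hochschild differential $$d\Psi(h_0,\dots,h_n)=\varepsilon(h_0)\Psi(h_1,\dots,h_n)+\sum_{k=1}^n(-1)^k\Psi(h_0,\dots,h_{k-1}h_k,\dots,h_n)+(-1)^{n+1}\Psi(h_0,\dots,h_{n-1})\varepsilon(h_n)$$ for $\Psi\in C^n(\mathcal{H})$. It carries the operation of $\mathcal{H}$ given, for $\Psi\in C^n(\mathcal{H})$, $n\ge1$ (and $i_h=0$ on $C^0(\mathcal H)$), by $$i_h(\Psi)(g_1,\dots,g_{n-1})=\sum_{p=0}^{n-2}(-1)^p\sum\Psi\big(g_1,\dots,g_p,h^{(1)}-\varepsilon(h^{(1)})1,\mathrm{ad}(h^{(2)})g_{p+1},\dots,\mathrm{ad}(h^{(n-p)})g_{n-1}\big)+(-1)^{n-1}\Psi(g_1,\dots,g_{n-1},h-\varepsilon(h)1),$$ where the inner sum is over the iterated coproduct $\sum h^{(1)}\otimes\cdots\otimes h^{(n-p)}$ of $h$; the associated $L_h$ is $L_h(\Psi)(g_1,\dots,g_n)=\sum\Psi(\mathrm{ad}(h^{(1)})g_1,\dots,\mathrm{ad}(h^{(n)})g_n)$.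 Connections. A connection on an $\mathcal{H}$-operation $(i,\Omega)$ is a homomorphism of graded algebras $\alpha:C(\mathcal{H})\to\Omega$ (not required to commute with differentials) such that $i_h(\alpha(\Psi))=\alpha(i_h(\Psi))$ and $L_h(\alpha(\Psi))=\alpha(L_h(\Psi))$ for all $h\in\mathcal{H}$, $\Psi\in C(\mathcal{H})$. An $\mathcal{H}$-operation with connection $(i,\Omega,\alpha)$ is an $\mathcal{H}$-operation equipped with a connection; a morphism $(i,\Omega,\alpha)\to(i',\Omega',\alpha')$ is a morphism $f$ of $\mathcal{H}$-operations with $f\circ\alpha=\alpha'$. Graded differential envelope. For a graded algebra $\mathcal{A}=\oplus_n\mathcal{A}^n$, let $J\subset\mathcal{A}\otimes\mathcal{A}$ be the kernel of $a\otimes b\mapsto(-1)^s ab$ ($b\in\mathcal{A}^s$), a sub-bimodule for $x(a\otimes b)y=xa\otimes by$, graded by $J^{n+1}=J\cap\oplus_{r+s=n}\mathcal{A}^r\otimes\mathcal{A}^s$; call this graded bimodule $\Omega^1_{gr}(\mathcal{A})$. Let $d:\mathcal{A}\to\Omega^1_{gr}(\mathcal{A})$, $d(x)=1\otimes x-(-1)^nx\otimes 1$ for $x\in\mathcal{A}^n$. $\Omega_{gr}(\mathcal{A})$ is the tensor algebra over $\mathcal{A}$ of the bimodule $\Omega^1_{gr}(\mathcal{A})$, with the algebra grading inducing the given gradings on $\mathcal{A}$ and $\Omega^1_{gr}(\mathcal{A})$, and with the unique differential (graded derivation of degree $1$, square zero) extending $d$. Weil algebra. $W(\mathcal{H})=\Omega_{gr}(C(\mathcal{H}))$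 as a graded differential algebra (using only the graded algebra structure of $C(\mathcal{H})$); $\alpha_W:C(\mathcal{H})\to W(\mathcal{H})$ is the canonical injection, and $W(\mathcal{H})$ is endowed with the unique operation $h\mapsto i_h$ of $\mathcal{H}$ for which $\alpha_W$ is a connection. *)

theory Defs
  imports "HOL-Algebra.Module" "HOL-Algebra.Ring" "HOL-Library.FuncSet"
begin

section \<open>Graded differential algebras\<close>

definition lsum :: "('a, 'm) ring_scheme \<Rightarrow> 'a list \<Rightarrow> 'a" where
  "lsum G xs = foldr (\<lambda>x y. x \<oplus>\<^bsub>G\<^esub> y) xs \<zero>\<^bsub>G\<^esub>"

text \<open>\<open>gsign G n x\<close> is $(-1)^n x$.\<close>

definition gsign :: "('a, 'm) ring_scheme \<Rightarrow> nat \<Rightarrow> 'a \<Rightarrow> 'a" where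
  "gsign G n x = (if even n then x else \<ominus>\<^bsub>G\<^esub> x)"

definition linear_maps ::
  "('k, 'c) ring_scheme \<Rightarrow> ('k, 'a, 'm) module_scheme \<Rightarrow> ('k, 'b, 'n) module_scheme \<Rightarrow> ('a \<Rightarrow> 'b) set" where
  "linear_maps K M N = {f \<in> carrier M \<rightarrow> carrier N.
     (\<forall>x\<in>carrier M. \<forall>y\<in>carrier M. f (x \<oplus>\<^bsub>M\<^esub> y) = f x \<oplus>\<^bsub>N\<^esub> f y) \<and>
     (\<forall>k\<in>carrier K. \<forall>x\<in>carrier M. f (k \<odot>\<^bsub>M\<^esub> x) = k \<odot>\<^bsub>N\<^esub> f x)}"

text \<open>The locale \<^locale>\<open>algebra\<close> of the library is restricted to commutative algebras.\<close>

locale assoc_algebra = module K A + field K + ring A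
  for K :: "('k, 'c) ring_scheme" (structure) and A :: "('k, 'a, 'm) module_scheme" (structure) +
  assumes smult_mult_left:
      "\<lbrakk>k \<in> carrier K; x \<in> carrier A; y \<in> carrier A\<rbrakk> \<Longrightarrow>
       (k \<odot>\<^bsub>A\<^esub> x) \<otimes>\<^bsub>A\<^esub> y = k \<odot>\<^bsub>A\<^esub> (x \<otimes>\<^bsub>A\<^esub> y)"
    and smult_mult_right:
      "\<lbrakk>k \<in> carrier K; x \<in> carrier A; y \<in> carrier A\<rbrakk> \<Longrightarrow>
       x \<otimes>\<^bsub>A\<^esub> (k \<odot>\<^bsub>A\<^esub> y) = k \<odot>\<^bsub>A\<^esub> (x \<otimes>\<^bsub>A\<^esub> y)"

record ('k, 'a) galgebra = "('k, 'a) module" +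
  gr :: "nat \<Rightarrow> 'a set"

definition homogeneous_decomposition :: "('k, 'a, 'm) galgebra_scheme \<Rightarrow> 'a \<Rightarrow> (nat \<Rightarrow> 'a) \<Rightarrow> bool" where
  "homogeneous_decomposition A x c \<longleftrightarrow>
     (\<forall>n. c n \<in> gr A n) \<and> finite {n. c n \<noteq> \<zero>\<^bsub>A\<^esub>} \<and> x = (\<Oplus>\<^bsub>A\<^esub>n\<in>{n. c n \<noteq> \<zero>\<^bsub>A\<^esub>}. c n)"

locale graded_algebra = assoc_algebra K A
  for K :: "('k, 'c) ring_scheme" (structure) and A :: "('k, 'a, 'm) galgebra_scheme" (structure) +
  assumes gr_submodule: "submodule (gr A n) K A"
    and gr_decomposition: "x \<in> carrier A \<Longrightarrow> \<exists>!c. homogeneous_decomposition A x c"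
    and gr_one: "\<one>\<^bsub>A\<^esub> \<in> gr A 0"
    and gr_mult: "\<lbrakk>x \<in> gr A m; y \<in> gr A n\<rbrakk> \<Longrightarrow> x \<otimes>\<^bsub>A\<^esub> y \<in> gr A (m + n)"

text \<open>\<open>parity A\<close> is the linear map which is multiplication by $(-1)^n$ on the component of
  degree \<open>n\<close>.\<close>

definition hcomponent :: "('k, 'a, 'm) galgebra_scheme \<Rightarrow> 'a \<Rightarrow> nat \<Rightarrow> 'a" where
  "hcomponent A x = (THE c. homogeneous_decomposition A x c)"

definition parity :: "('k, 'a, 'm) galgebra_scheme \<Rightarrow> 'a \<Rightarrow> 'a" where
  "parity A x = (\<Oplus>\<^bsub>A\<^esub>n\<in>{n. hcomponent A x n \<noteq> \<zero>\<^bsub>A\<^esub>}. gsign A n (hcomponent A x n))"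

locale graded_differential_algebra = graded_algebra K A
  for K :: "('k, 'c) ring_scheme" (structure) and A :: "('k, 'a, 'm) galgebra_scheme" (structure) +
  fixes d :: "'a \<Rightarrow> 'a"
  assumes d_linear: "d \<in> linear_maps K A A"
    and d_degree: "x \<in> gr A n \<Longrightarrow> d x \<in> gr A (Suc n)"
    and d_square: "x \<in> carrier A \<Longrightarrow> d (d x) = \<zero>\<^bsub>A\<^esub>"
    and d_derivation: "\<lbrakk>x \<in> gr A n; y \<in> carrier A\<rbrakk> \<Longrightarrow>
      d (x \<otimes>\<^bsub>A\<^esub> y) = d x \<otimes>\<^bsub>A\<^esub> y \<oplus>\<^bsub>A\<^esub> gsign A n (x \<otimes>\<^bsub>A\<^esub> d y)"

definition graded_algebra_hom ::
  "('k, 'c) ring_scheme \<Rightarrow> ('k, 'a, 'm) galgebra_scheme \<Rightarrow> ('k, 'b, 'n) galgebra_scheme \<Rightarrow> ('a \<Rightarrow> 'b) set" where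
  "graded_algebra_hom K A B =
     {f \<in> linear_maps K A B \<inter> ring_hom A B. \<forall>n. \<forall>x\<in>gr A n. f x \<in> gr B n}"

section \<open>Tensor products\<close>

text \<open>
  Let \<open>M\<close> be a bimodule over \<open>R\<close>, with left action \<open>smult M\<close> and right action \<open>ract\<close>.
  A nonempty list \<open>[m\<^sub>1, \<dots>, m\<^sub>n]\<close> stands for the pure tensor $m_1 \otimes_R \dots \otimes_R m_n$,
  and a list of such lists for the sum of its members. Every element of
  $\bigoplus_{n \in N} M^{\otimes_R n}$, for a set \<open>N\<close> of positive exponents, is such a sum, and
  \<open>tensor_cong R M ract N\<close> is the congruence on formal sums generated by multi-additivity and
  \<open>R\<close>-balancedness. Negatives need no rule, since $(-m) \otimes m'$ is an additive inverse of
  $m \otimes m'$. An element of the tensor product is a congruence class.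
\<close>

definition words :: "'m set \<Rightarrow> nat set \<Rightarrow> 'm list set" where
  "words S N = {w \<in> lists S. length w \<in> N}"

inductive tensor_cong ::
  "('r, 'c) ring_scheme \<Rightarrow> ('r, 'm, 'n) module_scheme \<Rightarrow> ('m \<Rightarrow> 'r \<Rightarrow> 'm) \<Rightarrow> nat set \<Rightarrow>
    'm list list \<Rightarrow> 'm list list \<Rightarrow> bool"
  for R M ract N where
  refl: "X \<in> lists (words (carrier M) N) \<Longrightarrow> tensor_cong R M ract N X X"
| sym: "tensor_cong R M ract N X Y \<Longrightarrow> tensor_cong R M ract N Y X"
| trans: "tensor_cong R M ract N X Y \<Longrightarrow> tensor_cong R M ract N Y Z \<Longrightarrow> tensor_cong R M ract N X Z"
| sum: "tensor_cong R M ract N X X' \<Longrightarrow> tensor_cong R M ract N Y Y' \<Longrightarrow>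
    tensor_cong R M ract N (X @ Y) (X' @ Y')"
| comm: "X \<in> lists (words (carrier M) N) \<Longrightarrow> Y \<in> lists (words (carrier M) N) \<Longrightarrow>
    tensor_cong R M ract N (X @ Y) (Y @ X)"
| zero: "us @ [\<zero>\<^bsub>M\<^esub>] @ vs \<in> words (carrier M) N \<Longrightarrow>
    tensor_cong R M ract N [us @ [\<zero>\<^bsub>M\<^esub>] @ vs] []"
| add: "us @ [x] @ vs \<in> words (carrier M) N \<Longrightarrow> us @ [y] @ vs \<in> words (carrier M) N \<Longrightarrow>
    tensor_cong R M ract N [us @ [x \<oplus>\<^bsub>M\<^esub> y] @ vs] [us @ [x] @ vs, us @ [y] @ vs]"
| balanced: "us @ [x, y] @ vs \<in> words (carrier M) N \<Longrightarrow> r \<in> carrier R \<Longrightarrow>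
    tensor_cong R M ract N [us @ [ract x r, y] @ vs] [us @ [x, r \<odot>\<^bsub>M\<^esub> y] @ vs]"

definition tensor_class ::
  "('r, 'c) ring_scheme \<Rightarrow> ('r, 'm, 'n) module_scheme \<Rightarrow> ('m \<Rightarrow> 'r \<Rightarrow> 'm) \<Rightarrow> nat set \<Rightarrow>
    'm list list \<Rightarrow> 'm list list set" where
  "tensor_class R M ract N X = {Y. tensor_cong R M ract N X Y}"

text \<open>The \<open>n\<close>-th tensor power, \<open>n \<ge> 1\<close>, of a module over a commutative ring.\<close>

definition ktensor ::
  "('k, 'c) ring_scheme \<Rightarrow> ('k, 'm, 'n) module_scheme \<Rightarrow> nat \<Rightarrow> 'm list list \<Rightarrow> 'm list list set" where
  "ktensor K V n = tensor_class K V (\<lambda>v k. k \<odot>\<^bsub>V\<^esub> v) {n}"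

definition ktensor_power ::
  "('k, 'c) ring_scheme \<Rightarrow> ('k, 'm, 'n) module_scheme \<Rightarrow> nat \<Rightarrow> 'm list list set set" where
  "ktensor_power K V n = ktensor K V n ` lists (words (carrier V) {n})"

section \<open>Hopf algebras\<close>

record ('k, 'h) hopf = "('k, 'h) module" +
  comult :: "'h \<Rightarrow> 'h list list set"
  counit :: "'h \<Rightarrow> 'k"
  antipode :: "'h \<Rightarrow> 'h"

text \<open>
  \<open>sweedler H h\<close> lists the pairs $[h^{(1)}_j, h^{(2)}_j]$ of a chosen decomposition
  $\Delta h = \sum_j h^{(1)}_j \otimes h^{(2)}_j$. It is only ever used inside expressions which do
  not depend on the choice.
\<close>

definition sweedler :: "('k, 'h, 'm) hopf_scheme \<Rightarrow> 'h \<Rightarrow> 'h list list" where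
  "sweedler H h = (SOME X. X \<in> comult H h)"

locale hopf_algebra = assoc_algebra K H
  for K :: "('k, 'c) ring_scheme" (structure) and H :: "('k, 'h, 'm) hopf_scheme" (structure) +
  assumes comult_closed: "x \<in> carrier H \<Longrightarrow> comult H x \<in> ktensor_power K H 2"
    and comult_add: "\<lbrakk>x \<in> carrier H; y \<in> carrier H\<rbrakk> \<Longrightarrow>
      comult H (x \<oplus>\<^bsub>H\<^esub> y) = ktensor K H 2 (sweedler H x @ sweedler H y)"
    and comult_smult: "\<lbrakk>k \<in> carrier K; x \<in> carrier H\<rbrakk> \<Longrightarrow>
      comult H (k \<odot>\<^bsub>H\<^esub> x) = ktensor K H 2 [[k \<odot>\<^bsub>H\<^esub> (u ! 0), u ! 1]. u \<leftarrow> sweedler H x]"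
    and comult_one: "comult H \<one>\<^bsub>H\<^esub> = ktensor K H 2 [[\<one>\<^bsub>H\<^esub>, \<one>\<^bsub>H\<^esub>]]"
    and comult_mult: "\<lbrakk>x \<in> carrier H; y \<in> carrier H\<rbrakk> \<Longrightarrow>
      comult H (x \<otimes>\<^bsub>H\<^esub> y) = ktensor K H 2
        [[u ! 0 \<otimes>\<^bsub>H\<^esub> v ! 0, u ! 1 \<otimes>\<^bsub>H\<^esub> v ! 1]. u \<leftarrow> sweedler H x, v \<leftarrow> sweedler H y]"
    and coassoc: "x \<in> carrier H \<Longrightarrow>
      ktensor K H 3 [[v ! 0, v ! 1, u ! 1]. u \<leftarrow> sweedler H x, v \<leftarrow> sweedler H (u ! 0)] =
      ktensor K H 3 [[u ! 0, v ! 0, v ! 1]. u \<leftarrow> sweedler H x, v \<leftarrow> sweedler H (u ! 1)]"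
    and counit_closed: "x \<in> carrier H \<Longrightarrow> counit H x \<in> carrier K"
    and counit_add: "\<lbrakk>x \<in> carrier H; y \<in> carrier H\<rbrakk> \<Longrightarrow>
      counit H (x \<oplus>\<^bsub>H\<^esub> y) = counit H x \<oplus>\<^bsub>K\<^esub> counit H y"
    and counit_smult: "\<lbrakk>k \<in> carrier K; x \<in> carrier H\<rbrakk> \<Longrightarrow>
      counit H (k \<odot>\<^bsub>H\<^esub> x) = k \<otimes>\<^bsub>K\<^esub> counit H x"
    and counit_one: "counit H \<one>\<^bsub>H\<^esub> = \<one>\<^bsub>K\<^esub>"
    and counit_mult: "\<lbrakk>x \<in> carrier H; y \<in> carrier H\<rbrakk> \<Longrightarrow>
      counit H (x \<otimes>\<^bsub>H\<^esub> y) = counit H x \<otimes>\<^bsub>K\<^esub> counit H y"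
    and counit_left: "x \<in> carrier H \<Longrightarrow>
      lsum H [counit H (u ! 0) \<odot>\<^bsub>H\<^esub> (u ! 1). u \<leftarrow> sweedler H x] = x"
    and counit_right: "x \<in> carrier H \<Longrightarrow>
      lsum H [counit H (u ! 1) \<odot>\<^bsub>H\<^esub> (u ! 0). u \<leftarrow> sweedler H x] = x"
    and antipode_linear: "antipode H \<in> linear_maps K H H"
    and antipode_left: "x \<in> carrier H \<Longrightarrow>
      lsum H [antipode H (u ! 0) \<otimes>\<^bsub>H\<^esub> (u ! 1). u \<leftarrow> sweedler H x] = counit H x \<odot>\<^bsub>H\<^esub> \<one>\<^bsub>H\<^esub>"
    and antipode_right: "x \<in> carrier H \<Longrightarrow>
      lsum H [(u ! 0) \<otimes>\<^bsub>H\<^esub> antipode H (u ! 1). u \<leftarrow> sweedler H x] = counit H x \<odot>\<^bsub>H\<^esub> \<one>\<^bsub>H\<^esub>"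

definition adj :: "('k, 'h, 'm) hopf_scheme \<Rightarrow> 'h \<Rightarrow> 'h \<Rightarrow> 'h" where
  "adj H h g = lsum H [antipode H (u ! 0) \<otimes>\<^bsub>H\<^esub> g \<otimes>\<^bsub>H\<^esub> (u ! 1). u \<leftarrow> sweedler H h]"

text \<open>\<open>iter_sweedler H n h\<close> lists the words $[h^{(1)}, \dots, h^{(n+1)}]$ of the \<open>n\<close>-fold iterated
  coproduct; note the \<open>n + 1\<close> factors.\<close>

primrec iter_sweedler :: "('k, 'h, 'm) hopf_scheme \<Rightarrow> nat \<Rightarrow> 'h \<Rightarrow> 'h list list" where
  "iter_sweedler H 0 h = [[h]]"
| "iter_sweedler H (Suc n) h = [u ! 0 # w. u \<leftarrow> sweedler H h, w \<leftarrow> iter_sweedler H n (u ! 1)]"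

section \<open>Operations of a Hopf algebra\<close>

definition lie ::
  "('k, 'h, 'n) hopf_scheme \<Rightarrow> ('k, 'w, 'm) galgebra_scheme \<Rightarrow> ('w \<Rightarrow> 'w) \<Rightarrow>
    ('h \<Rightarrow> 'w \<Rightarrow> 'w) \<Rightarrow> 'h \<Rightarrow> 'w \<Rightarrow> 'w" where
  "lie H \<Omega> d i h x = d (i h x) \<oplus>\<^bsub>\<Omega>\<^esub> i h (d x) \<oplus>\<^bsub>\<Omega>\<^esub> (counit H h \<odot>\<^bsub>\<Omega>\<^esub> x)"

locale hopf_operation = hopf_algebra K H + graded_differential_algebra K \<Omega> d
  for K :: "('k, 'c) ring_scheme" (structure) and H :: "('k, 'h, 'n) hopf_scheme" (structure)
    and \<Omega> :: "('k, 'w, 'm) galgebra_scheme" (structure) and d :: "'w \<Rightarrow> 'w" +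
  fixes i :: "'h \<Rightarrow> 'w \<Rightarrow> 'w"
  assumes i_linear: "h \<in> carrier H \<Longrightarrow> i h \<in> linear_maps K \<Omega> \<Omega>"
    and i_linear_hopf: "x \<in> carrier \<Omega> \<Longrightarrow> (\<lambda>h. i h x) \<in> linear_maps K H \<Omega>"
    and i_degree: "\<lbrakk>h \<in> carrier H; x \<in> gr \<Omega> (Suc n)\<rbrakk> \<Longrightarrow> i h x \<in> gr \<Omega> n"
    and i_degree_0: "\<lbrakk>h \<in> carrier H; x \<in> gr \<Omega> 0\<rbrakk> \<Longrightarrow> i h x = \<zero>\<^bsub>\<Omega>\<^esub>"
    and i_one: "x \<in> carrier \<Omega> \<Longrightarrow> i \<one>\<^bsub>H\<^esub> x = \<zero>\<^bsub>\<Omega>\<^esub>"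
    and i_mult: "\<lbrakk>h \<in> carrier H; x \<in> gr \<Omega> a; y \<in> carrier \<Omega>\<rbrakk> \<Longrightarrow>
      i h (x \<otimes>\<^bsub>\<Omega>\<^esub> y) =
        lsum \<Omega> [i (u ! 0) x \<otimes>\<^bsub>\<Omega>\<^esub> lie H \<Omega> d i (u ! 1) y. u \<leftarrow> sweedler H h]
        \<oplus>\<^bsub>\<Omega>\<^esub> gsign \<Omega> a (x \<otimes>\<^bsub>\<Omega>\<^esub> i h y)"
    and i_lie: "\<lbrakk>g \<in> carrier H; h \<in> carrier H; x \<in> carrier \<Omega>\<rbrakk> \<Longrightarrow>
      i g (lie H \<Omega> d i h x) =
        lsum \<Omega> [lie H \<Omega> d i (u ! 0) (i (adj H (u ! 1) g) x). u \<leftarrow> sweedler H h]"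
    and lie_mult: "\<lbrakk>g \<in> carrier H; h \<in> carrier H; x \<in> carrier \<Omega>\<rbrakk> \<Longrightarrow>
      lie H \<Omega> d i h (lie H \<Omega> d i g x) = lie H \<Omega> d i (h \<otimes>\<^bsub>H\<^esub> g) x"

section \<open>The algebra of multilinear forms and connections\<close>

text \<open>
  An element of $C(H)$ is a function on all words over \<open>H\<close>: its restriction to words of length
  \<open>n\<close> is its component in $C^n(H)$, an \<open>n\<close>-linear form.
\<close>

definition forms_carrier :: "('k, 'c) ring_scheme \<Rightarrow> ('k, 'h, 'm) module_scheme \<Rightarrow> ('h list \<Rightarrow> 'k) set" where
  "forms_carrier K H = {f \<in> lists (carrier H) \<rightarrow>\<^sub>E carrier K.
     (\<forall>us\<in>lists (carrier H). \<forall>vs\<in>lists (carrier H). \<forall>x\<in>carrier H. \<forall>y\<in>carrier H.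
        f (us @ [x \<oplus>\<^bsub>H\<^esub> y] @ vs) = f (us @ [x] @ vs) \<oplus>\<^bsub>K\<^esub> f (us @ [y] @ vs)) \<and>
     (\<forall>us\<in>lists (carrier H). \<forall>vs\<in>lists (carrier H). \<forall>k\<in>carrier K. \<forall>x\<in>carrier H.
        f (us @ [k \<odot>\<^bsub>H\<^esub> x] @ vs) = k \<otimes>\<^bsub>K\<^esub> f (us @ [x] @ vs)) \<and>
     (\<exists>N. \<forall>w\<in>lists (carrier H). length w \<ge> N \<longrightarrow> f w = \<zero>\<^bsub>K\<^esub>)}"

definition forms :: "('k, 'c) ring_scheme \<Rightarrow> ('k, 'h, 'm) module_scheme \<Rightarrow> ('k, 'h list \<Rightarrow> 'k) galgebra" where
  "forms K H = \<lparr>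
     carrier = forms_carrier K H,
     mult = (\<lambda>f g. \<lambda>w\<in>lists (carrier H).
        \<Oplus>\<^bsub>K\<^esub>p\<in>{..length w}. f (take p w) \<otimes>\<^bsub>K\<^esub> g (drop p w)),
     one = (\<lambda>w\<in>lists (carrier H). if w = [] then \<one>\<^bsub>K\<^esub> else \<zero>\<^bsub>K\<^esub>),
     zero = (\<lambda>w\<in>lists (carrier H). \<zero>\<^bsub>K\<^esub>),
     add = (\<lambda>f g. \<lambda>w\<in>lists (carrier H). f w \<oplus>\<^bsub>K\<^esub> g w),
     smult = (\<lambda>k f. \<lambda>w\<in>lists (carrier H). k \<otimes>\<^bsub>K\<^esub> f w),
     gr = (\<lambda>n. {f \<in> forms_carrier K H. \<forall>w\<in>lists (carrier H). length w \<noteq> n \<longrightarrow> f w = \<zero>\<^bsub>K\<^esub>})\<rparr>"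

text \<open>
  For \<open>w\<close> of length $n - 1$ the right-hand side only involves words of length \<open>n\<close>, so the formula
  for $\Psi \in C^n(H)$ is here at once the linear extension to $C(H)$, and vanishes on
  $C^0(H)$.
\<close>

definition forms_op ::
  "('k, 'c) ring_scheme \<Rightarrow> ('k, 'h, 'm) hopf_scheme \<Rightarrow> 'h \<Rightarrow> ('h list \<Rightarrow> 'k) \<Rightarrow> 'h list \<Rightarrow> 'k" where
  "forms_op K H h f = (\<lambda>w\<in>lists (carrier H).
     (\<Oplus>\<^bsub>K\<^esub>p\<in>{..<length w}. gsign K p (lsum K
        [f (take p w @ [hd u \<ominus>\<^bsub>H\<^esub> counit H (hd u) \<odot>\<^bsub>H\<^esub> \<one>\<^bsub>H\<^esub>] @ map2 (adj H) (tl u) (drop p w)).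
         u \<leftarrow> iter_sweedler H (length w - p) h]))
     \<oplus>\<^bsub>K\<^esub> gsign K (length w) (f (w @ [h \<ominus>\<^bsub>H\<^esub> counit H h \<odot>\<^bsub>H\<^esub> \<one>\<^bsub>H\<^esub>])))"

definition forms_lie ::
  "('k, 'c) ring_scheme \<Rightarrow> ('k, 'h, 'm) hopf_scheme \<Rightarrow> 'h \<Rightarrow> ('h list \<Rightarrow> 'k) \<Rightarrow> 'h list \<Rightarrow> 'k" where
  "forms_lie K H h f = (\<lambda>w\<in>lists (carrier H).
     if w = [] then counit H h \<otimes>\<^bsub>K\<^esub> f []
     else lsum K [f (map2 (adj H) u w). u \<leftarrow> iter_sweedler H (length w - 1) h])"

locale hopf_operation_with_connection = hopf_operation K H \<Omega> d i
  for K :: "('k, 'c) ring_scheme" (structure) and H :: "('k, 'h, 'n) hopf_scheme" (structure)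
    and \<Omega> :: "('k, 'w, 'm) galgebra_scheme" (structure) and d :: "'w \<Rightarrow> 'w"
    and i :: "'h \<Rightarrow> 'w \<Rightarrow> 'w" +
  fixes \<alpha> :: "('h list \<Rightarrow> 'k) \<Rightarrow> 'w"
  assumes connection_hom: "\<alpha> \<in> graded_algebra_hom K (forms K H) \<Omega>"
    and connection_op: "\<lbrakk>h \<in> carrier H; \<Psi> \<in> carrier (forms K H)\<rbrakk> \<Longrightarrow>
      i h (\<alpha> \<Psi>) = \<alpha> (forms_op K H h \<Psi>)"
    and connection_lie: "\<lbrakk>h \<in> carrier H; \<Psi> \<in> carrier (forms K H)\<rbrakk> \<Longrightarrow>
      lie H \<Omega> d i h (\<alpha> \<Psi>) = \<alpha> (forms_lie K H h \<Psi>)"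

definition connection_morphism ::
  "('k, 'c) ring_scheme \<Rightarrow> ('k, 'h, 'n) hopf_scheme \<Rightarrow>
    ('k, 'a, 'm) galgebra_scheme \<Rightarrow> ('a \<Rightarrow> 'a) \<Rightarrow> ('h \<Rightarrow> 'a \<Rightarrow> 'a) \<Rightarrow> (('h list \<Rightarrow> 'k) \<Rightarrow> 'a) \<Rightarrow>
    ('k, 'b, 'l) galgebra_scheme \<Rightarrow> ('b \<Rightarrow> 'b) \<Rightarrow> ('h \<Rightarrow> 'b \<Rightarrow> 'b) \<Rightarrow> (('h list \<Rightarrow> 'k) \<Rightarrow> 'b) \<Rightarrow>
    ('a \<Rightarrow> 'b) \<Rightarrow> bool" where
  "connection_morphism K H \<Omega> d i \<alpha> \<Omega>' d' i' \<alpha>' f \<longleftrightarrow>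
     f \<in> graded_algebra_hom K \<Omega> \<Omega>' \<and>
     (\<forall>x\<in>carrier \<Omega>. f (d x) = d' (f x)) \<and>
     (\<forall>h\<in>carrier H. \<forall>x\<in>carrier \<Omega>. f (i h x) = i' h (f x)) \<and>
     (\<forall>\<Psi>\<in>carrier (forms K H). f (\<alpha> \<Psi>) = \<alpha>' \<Psi>)"

section \<open>Graded bimodules and their tensor algebras\<close>

text \<open>The left action is \<open>smult\<close>; as usual for modules, \<open>mult\<close> and \<open>one\<close> are irrelevant.\<close>

record ('a, 'm) gbimodule = "('a, 'm) module" +
  rsmult :: "'m \<Rightarrow> 'a \<Rightarrow> 'm"
  bgr :: "nat \<Rightarrow> 'm set"

text \<open>
  The tensor algebra $T_A(M) = A \oplus \bigoplus_{n \ge 1} M^{\otimes_A n}$: a pair consists of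
  the component in \<open>A\<close> and the sum of the other components, represented by a formal sum of
  nonempty words.
\<close>

definition btensor :: "('a, 'n) ring_scheme \<Rightarrow> ('a, 'm, 'l) gbimodule_scheme \<Rightarrow> 'm list list \<Rightarrow> 'm list list set" where
  "btensor A M = tensor_class A M (rsmult M) {1..}"

definition word_degree :: "('a, 'm, 'l) gbimodule_scheme \<Rightarrow> 'm list \<Rightarrow> nat \<Rightarrow> bool" where
  "word_degree M w n \<longleftrightarrow> (\<exists>ns. list_all2 (\<lambda>m k. m \<in> bgr M k) w ns \<and> sum_list ns = n)"

definition tensor_add where
  "tensor_add A M S T = (\<Union>X\<in>S. \<Union>Y\<in>T. btensor A M (X @ Y))"

definition tensor_mult where
  "tensor_mult A M S T = (\<Union>X\<in>S. \<Union>Y\<in>T. btensor A M [u @ v. u \<leftarrow> X, v \<leftarrow> Y])"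

definition tensor_lact where
  "tensor_lact A M a T = (\<Union>X\<in>T. btensor A M [(a \<odot>\<^bsub>M\<^esub> hd w) # tl w. w \<leftarrow> X])"

definition tensor_ract where
  "tensor_ract A M T a = (\<Union>X\<in>T. btensor A M [butlast w @ [rsmult M (last w) a]. w \<leftarrow> X])"

definition tensor_algebra ::
  "('k, 'a, 'n) galgebra_scheme \<Rightarrow> ('a, 'm, 'l) gbimodule_scheme \<Rightarrow> ('k, 'a \<times> 'm list list set) galgebra" where
  "tensor_algebra A M = \<lparr>
     carrier = carrier A \<times> btensor A M ` lists (words (carrier M) {1..}),
     mult = (\<lambda>(a, S) (b, T). (a \<otimes>\<^bsub>A\<^esub> b,
        tensor_add A M (tensor_add A M (tensor_lact A M a T) (tensor_ract A M S b)) (tensor_mult A M S T))),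
     one = (\<one>\<^bsub>A\<^esub>, btensor A M []),
     zero = (\<zero>\<^bsub>A\<^esub>, btensor A M []),
     add = (\<lambda>(a, S) (b, T). (a \<oplus>\<^bsub>A\<^esub> b, tensor_add A M S T)),
     smult = (\<lambda>k (a, S). (k \<odot>\<^bsub>A\<^esub> a, tensor_lact A M (k \<odot>\<^bsub>A\<^esub> \<one>\<^bsub>A\<^esub>) S)),
     gr = (\<lambda>n. gr A n \<times> btensor A M ` lists {w \<in> words (carrier M) {1..}. word_degree M w n})\<rparr>"

section \<open>The graded differential envelope\<close>

text \<open>On $A \otimes A$, the map $a \otimes b \mapsto (-1)^s a b$ for \<open>b\<close> of degree \<open>s\<close>.\<close>

definition signed_mult :: "('k, 'a, 'n) galgebra_scheme \<Rightarrow> 'a list list \<Rightarrow> 'a" where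
  "signed_mult A X = lsum A [w ! 0 \<otimes>\<^bsub>A\<^esub> parity A (w ! 1). w \<leftarrow> X]"

definition env_bimodule ::
  "('k, 'c) ring_scheme \<Rightarrow> ('k, 'a, 'n) galgebra_scheme \<Rightarrow> ('a, 'a list list set) gbimodule" where
  "env_bimodule K A =
     (let J = {T \<in> ktensor_power K A 2. \<forall>X\<in>T. signed_mult A X = \<zero>\<^bsub>A\<^esub>} in
      \<lparr>carrier = J,
       mult = undefined,
       one = undefined,
       zero = ktensor K A 2 [],
       add = (\<lambda>S T. \<Union>X\<in>S. \<Union>Y\<in>T. ktensor K A 2 (X @ Y)),
       smult = (\<lambda>x T. \<Union>X\<in>T. ktensor K A 2 [[x \<otimes>\<^bsub>A\<^esub> w ! 0, w ! 1]. w \<leftarrow> X]),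
       rsmult = (\<lambda>T y. \<Union>X\<in>T. ktensor K A 2 [[w ! 0, w ! 1 \<otimes>\<^bsub>A\<^esub> y]. w \<leftarrow> X]),
       bgr = (\<lambda>m. case m of 0 \<Rightarrow> {ktensor K A 2 []}
                | Suc n \<Rightarrow> J \<inter> ktensor K A 2 ` lists {[a, b] | a b. \<exists>r s. r + s = n \<and> a \<in> gr A r \<and> b \<in> gr A s})\<rparr>)"

definition env_d1 ::
  "('k, 'c) ring_scheme \<Rightarrow> ('k, 'a, 'n) galgebra_scheme \<Rightarrow> 'a \<Rightarrow> 'a list list set" where
  "env_d1 K A x = ktensor K A 2 [[\<one>\<^bsub>A\<^esub>, x], [\<ominus>\<^bsub>A\<^esub> parity A x, \<one>\<^bsub>A\<^esub>]]"

definition env ::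
  "('k, 'c) ring_scheme \<Rightarrow> ('k, 'a, 'n) galgebra_scheme \<Rightarrow> ('k, 'a \<times> 'a list list set list list set) galgebra" where
  "env K A = tensor_algebra A (env_bimodule K A)"

definition env_inj ::
  "('k, 'c) ring_scheme \<Rightarrow> ('k, 'a, 'n) galgebra_scheme \<Rightarrow> 'a \<Rightarrow> 'a \<times> 'a list list set list list set" where
  "env_inj K A a = (a, btensor A (env_bimodule K A) [])"

definition env_d ::
  "('k, 'c) ring_scheme \<Rightarrow> ('k, 'a, 'n) galgebra_scheme \<Rightarrow>
    'a \<times> 'a list list set list list set \<Rightarrow> 'a \<times> 'a list list set list list set" where
  "env_d K A = (THE d. d \<in> extensional (carrier (env K A)) \<and>
     graded_differential_algebra K (env K A) d \<and>
     (\<forall>a\<in>carrier A. d (env_inj K A a) = (\<zero>\<^bsub>A\<^esub>, btensor A (env_bimodule K A) [[env_d1 K A a]])))"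

section \<open>The Weil algebra of a Hopf algebra\<close>

type_synonym ('k, 'h) weil_elt =
  "('h list \<Rightarrow> 'k) \<times> ('h list \<Rightarrow> 'k) list list set list list set"

definition weil ::
  "('k, 'c) ring_scheme \<Rightarrow> ('k, 'h, 'n) hopf_scheme \<Rightarrow> ('k, ('k, 'h) weil_elt) galgebra" where
  "weil K H = env K (forms K H)"

definition weil_d ::
  "('k, 'c) ring_scheme \<Rightarrow> ('k, 'h, 'n) hopf_scheme \<Rightarrow> ('k, 'h) weil_elt \<Rightarrow> ('k, 'h) weil_elt" where
  "weil_d K H = env_d K (forms K H)"

definition weil_conn ::
  "('k, 'c) ring_scheme \<Rightarrow> ('k, 'h, 'n) hopf_scheme \<Rightarrow> ('h list \<Rightarrow> 'k) \<Rightarrow> ('k, 'h) weil_elt" where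
  "weil_conn K H = env_inj K (forms K H)"

definition weil_op ::
  "('k, 'c) ring_scheme \<Rightarrow> ('k, 'h, 'n) hopf_scheme \<Rightarrow> 'h \<Rightarrow> ('k, 'h) weil_elt \<Rightarrow> ('k, 'h) weil_elt" where
  "weil_op K H = (THE i.
     i \<in> carrier H \<rightarrow>\<^sub>E extensional (carrier (weil K H)) \<and>
     hopf_operation_with_connection K H (weil K H) (weil_d K H) i (weil_conn K H))"

end

theory Submission
  imports Defs "HOL-Algebra.UnivPoly"
begin

text \<open>The envelope $W = \Omega_{gr}(C)$ of $C = C(H)$ is the free graded differential algebra on the
graded algebra \<open>C\<close>: an element $\sum_i a_i \otimes b_i$ of \<open>J\<close> equals $\sum_i a_i\,d b_i$, so a
homomorphism \<open>\<alpha>\<close> of graded algebras from \<open>C\<close> to a graded differential algebra has exactly one extension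
to \<open>W\<close> commuting with the differentials (\<open>env_dga_hom_exists\<close>, \<open>env_dga_hom_unique\<close>). For a
connection \<open>\<alpha>\<close> this is the only candidate for the morphism. It intertwines the operations
(\<open>operation_compatible\<close>): on \<open>C\<close> both operations are prescribed by the connection, on $dC$ they are
prescribed as well, because $i_h d = L_h - d i_h - \varepsilon(h)$, and the product rule carries the
agreement to the algebra generated by $C$ and $dC$. The same argument applied to the identity of \<open>W\<close>
shows that \<open>W\<close> has at most one operation for which the canonical injection is a connection.

The existence of that operation is the main work. The maps $i_h$ are neither derivations nor
multiplicative, but with \<open>\<sigma>\<close> the parity automorphism the product rules of $i_h$ and $L_h$ say exactly
that
\[ x \mapsto \Bigl( h \mapsto \begin{pmatrix} \varepsilon(h)\,\sigma x & i_h x \cr 0 & L_h x \end{pmatrix} \Bigr) \]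
is a homomorphism into the convolution ring of linear maps from \<open>H\<close> to triangular matrices over \<open>W\<close>.
Ring homomorphisms out of \<open>W\<close> are determined by their values on $C$ and $dC$, and they exist
whenever the values on $dC$ form a twisted derivation along those on $C$ (\<open>env_hom_exists\<close>); this
yields $i_h$ and $L_h$ on \<open>W\<close> (\<open>weil_hom_exists\<close>). The remaining axioms hold on forms and are inherited
by products and differentials; for the commutation of $i_g$ with $L_h$ the inheritance is an identity
for the coproduct of $\mathrm{ad}(h)g$ (\<open>adj_comult\<close>). On forms the axioms are proved by induction on
the word of arguments.

The universal property \<open>env_hom_exists\<close> concerns arbitrary rings as targets. With triangular matrices
over \<open>W\<close> as target it also produces the differential of \<open>W\<close>, and with polynomials over \<open>W\<close> the
projections which show that the grading of \<open>W\<close> is direct.\<close>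

section \<open>Sums over lists and additive maps\<close>

lemma lsum_Nil [simp]: "lsum G [] = \<zero>\<^bsub>G\<^esub>"
  by (simp add: lsum_def)

lemma lsum_Cons [simp]: "lsum G (x # xs) = x \<oplus>\<^bsub>G\<^esub> lsum G xs"
  by (simp add: lsum_def)

lemma lsum_cong: "(\<And>x. x \<in> set xs ==> f x = g x) ==> lsum G (map f xs) = lsum G (map g xs)"
  by (induction xs) auto

context abelian_monoid
begin

lemma lsum_closed: "set xs \<subseteq> carrier G ==> lsum G xs \<in> carrier G"
  by (induction xs) auto

lemma lsum_map_closed: "(\<And>x. x \<in> set xs ==> f x \<in> carrier G) ==> lsum G (map f xs) \<in> carrier G"
  by (induction xs) auto

lemma lsum_append:
  "set xs \<subseteq> carrier G ==> set ys \<subseteq> carrier G ==> lsum G (xs @ ys) = lsum G xs \<oplus> lsum G ys"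
  by (induction xs) (auto simp: lsum_closed a_assoc)

lemma lsum_zero: "lsum G (map (%x. \<zero>) xs) = \<zero>"
  by (induction xs) auto

lemma lsum_add:
  "(\<And>x. x \<in> set xs ==> f x \<in> carrier G) ==> (\<And>x. x \<in> set xs ==> g x \<in> carrier G) ==>
   lsum G (map (%x. f x \<oplus> g x) xs) = lsum G (map f xs) \<oplus> lsum G (map g xs)"
  by (induction xs) (auto simp: lsum_map_closed a_ac)

lemma lsum_concat:
  "(\<And>x. x \<in> set xs ==> set (f x) \<subseteq> carrier G) ==>
   lsum G (concat (map f xs)) = lsum G (map (%x. lsum G (f x)) xs)"
  by (induction xs) (auto simp: lsum_append UN_subset_iff)

lemma lsum_swap:
  "(\<And>x y. x \<in> set xs ==> y \<in> set ys ==> f x y \<in> carrier G) ==>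
   lsum G (map (%x. lsum G (map (f x) ys)) xs) =
   lsum G (map (%y. lsum G (map (%x. f x y) xs)) ys)"
proof (induction xs)
  case Nil
  then show ?case by (simp add: lsum_zero)
next
  case (Cons a xs)
  have "lsum G (map (%y. lsum G (map (%x. f x y) (a # xs))) ys) =
      lsum G (map (f a) ys) \<oplus> lsum G (map (%y. lsum G (map (%x. f x y) xs)) ys)"
    by (simp, intro lsum_add lsum_map_closed) (auto simp: Cons.prems)
  with Cons show ?case by simp
qed

end

definition additive_maps :: "('a, 'm) ring_scheme \<Rightarrow> ('b, 'n) ring_scheme \<Rightarrow> ('a \<Rightarrow> 'b) set" where
  "additive_maps G G' = {f \<in> carrier G \<rightarrow> carrier G'.
     \<forall>x\<in>carrier G. \<forall>y\<in>carrier G. f (x \<oplus>\<^bsub>G\<^esub> y) = f x \<oplus>\<^bsub>G'\<^esub> f y}"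

lemma additive_mapsI:
  "(\<And>x. x \<in> carrier G ==> f x \<in> carrier G') ==>
   (\<And>x y. x \<in> carrier G ==> y \<in> carrier G ==> f (x \<oplus>\<^bsub>G\<^esub> y) = f x \<oplus>\<^bsub>G'\<^esub> f y) ==>
   f \<in> additive_maps G G'"
  by (auto simp: additive_maps_def)

lemma additive_closed: "f \<in> additive_maps G G' ==> x \<in> carrier G ==> f x \<in> carrier G'"
  by (auto simp: additive_maps_def)

lemma additive_add:
  "f \<in> additive_maps G G' ==> x \<in> carrier G ==> y \<in> carrier G ==>
   f (x \<oplus>\<^bsub>G\<^esub> y) = f x \<oplus>\<^bsub>G'\<^esub> f y"
  by (auto simp: additive_maps_def)

lemma additive_zero:
  assumes "abelian_group G" "abelian_group G'" "f \<in> additive_maps G G'"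
  shows "f \<zero>\<^bsub>G\<^esub> = \<zero>\<^bsub>G'\<^esub>"
proof -
  interpret G: abelian_group G by fact
  interpret G': abelian_group G' by fact
  have "f \<zero>\<^bsub>G\<^esub> = f \<zero>\<^bsub>G\<^esub> \<oplus>\<^bsub>G'\<^esub> f \<zero>\<^bsub>G\<^esub>"
    using additive_add[OF assms(3) G.zero_closed G.zero_closed] by simp
  then show ?thesis
    using additive_closed[OF assms(3) G.zero_closed] G'.add.l_cancel_one' by simp
qed

lemma additive_neg:
  assumes "abelian_group G" "abelian_group G'" "f \<in> additive_maps G G'" "x \<in> carrier G"
  shows "f (\<ominus>\<^bsub>G\<^esub> x) = \<ominus>\<^bsub>G'\<^esub> f x"
proof -
  interpret G: abelian_group G by fact
  interpret G': abelian_group G' by fact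
  have "f (\<ominus>\<^bsub>G\<^esub> x) \<oplus>\<^bsub>G'\<^esub> f x = \<zero>\<^bsub>G'\<^esub>"
    using additive_add[OF assms(3) G.a_inv_closed[OF assms(4)] assms(4)] assms(4)
      additive_zero[OF assms(1-3)] by (simp add: G.l_neg)
  then show ?thesis
    using assms(3,4) by (simp add: G'.minus_equality additive_closed)
qed

lemma additive_minus:
  assumes "abelian_group G" "abelian_group G'" "f \<in> additive_maps G G'"
    "x \<in> carrier G" "y \<in> carrier G"
  shows "f (x \<ominus>\<^bsub>G\<^esub> y) = f x \<ominus>\<^bsub>G'\<^esub> f y"
  using assms by (simp add: a_minus_def additive_neg additive_add abelian_group.a_inv_closed)

lemma additive_gsign:
  assumes "abelian_group G" "abelian_group G'" "f \<in> additive_maps G G'" "x \<in> carrier G"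
  shows "f (gsign G n x) = gsign G' n (f x)"
  using assms by (simp add: gsign_def additive_neg)

lemma additive_lsum:
  assumes "abelian_group G" "abelian_group G'" "f \<in> additive_maps G G'" "set xs \<subseteq> carrier G"
  shows "f (lsum G xs) = lsum G' (map f xs)"
proof -
  interpret G: abelian_group G by fact
  show ?thesis using assms(4)
    by (induction xs) (simp_all add: additive_zero[OF assms(1-3)] additive_add[OF assms(3)] G.lsum_closed)
qed

lemma additive_lsum_map:
  assumes "abelian_group G" "abelian_group G'" "f \<in> additive_maps G G'"
    "\<And>x. x \<in> set xs ==> g x \<in> carrier G"
  shows "f (lsum G (map g xs)) = lsum G' (map (%x. f (g x)) xs)"
  using additive_lsum[OF assms(1-3), of "map g xs"] assms(4) by (auto simp: comp_def)

lemma (in abelian_group) gsign_closed [simp]: "x \<in> carrier G ==> gsign G n x \<in> carrier G"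
  by (simp add: gsign_def)

lemma (in abelian_group) gsign_Suc: "x \<in> carrier G ==> gsign G (Suc n) x = \<ominus> gsign G n x"
  by (simp add: gsign_def)

lemma (in abelian_group) gsign_0 [simp]: "gsign G 0 x = x"
  by (simp add: gsign_def)

lemma (in abelian_group) gsign_zero [simp]: "gsign G n \<zero> = \<zero>"
  by (simp add: gsign_def)

lemma (in abelian_group) gsign_gsign: "x \<in> carrier G ==> gsign G n (gsign G n x) = x"
  by (simp add: gsign_def)

lemma (in abelian_group) gsign_add:
  "x \<in> carrier G ==> y \<in> carrier G ==> gsign G n (x \<oplus> y) = gsign G n x \<oplus> gsign G n y"
  by (simp add: gsign_def minus_add)

lemma (in ring) gsign_mult:
  "x \<in> carrier R ==> y \<in> carrier R ==> gsign R (m + n) (x \<otimes> y) = gsign R m x \<otimes> gsign R n y"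
  by (simp add: gsign_def l_minus r_minus)

section \<open>Tensor products of bimodules\<close>

lemma words_append [simp]: "us @ vs \<in> words S N \<longleftrightarrow> us \<in> lists S \<and> vs \<in> lists S \<and> length us + length vs \<in> N"
  by (auto simp: words_def)

lemma words_Cons [simp]: "x # vs \<in> words S N \<longleftrightarrow> x \<in> S \<and> vs \<in> lists S \<and> Suc (length vs) \<in> N"
  by (auto simp: words_def)

definition tensor_group ::
  "('r, 'c) ring_scheme \<Rightarrow> ('r, 'm, 'n) module_scheme \<Rightarrow> ('m \<Rightarrow> 'r \<Rightarrow> 'm) \<Rightarrow> nat set \<Rightarrow> 'm list list set ring" where
  "tensor_group R M ract N = \<lparr>
     carrier = tensor_class R M ract N ` lists (words (carrier M) N),
     mult = undefined, one = undefined,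
     zero = tensor_class R M ract N [],
     add = (%S T. \<Union>X\<in>S. \<Union>Y\<in>T. tensor_class R M ract N (X @ Y))\<rparr>"

definition balanced_maps ::
  "('r, 'c) ring_scheme \<Rightarrow> ('r, 'm, 'n) module_scheme \<Rightarrow> ('m \<Rightarrow> 'r \<Rightarrow> 'm) \<Rightarrow> nat set \<Rightarrow>
    ('g, 'l) ring_scheme \<Rightarrow> ('m list \<Rightarrow> 'g) set" where
  "balanced_maps R M ract N G = {F \<in> words (carrier M) N \<rightarrow> carrier G.
     (\<forall>us vs x y. us @ [x] @ vs \<in> words (carrier M) N \<longrightarrow> us @ [y] @ vs \<in> words (carrier M) N \<longrightarrow>
        F (us @ [x \<oplus>\<^bsub>M\<^esub> y] @ vs) = F (us @ [x] @ vs) \<oplus>\<^bsub>G\<^esub> F (us @ [y] @ vs)) \<and>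
     (\<forall>us vs x y r. us @ [x, y] @ vs \<in> words (carrier M) N \<longrightarrow> r \<in> carrier R \<longrightarrow>
        F (us @ [ract x r, y] @ vs) = F (us @ [x, r \<odot>\<^bsub>M\<^esub> y] @ vs))}"

text \<open>By \<open>balanced_cong\<close> below, the value does not depend on the chosen formal sum when \<open>F\<close> is balanced.\<close>

definition tensor_lift :: "('g, 'l) ring_scheme \<Rightarrow> ('m list \<Rightarrow> 'g) \<Rightarrow> 'm list list set \<Rightarrow> 'g" where
  "tensor_lift G F S = lsum G (map F (SOME X. X \<in> S))"

locale tensor_product = abelian_group M
  for R :: "('r, 'c) ring_scheme" and M :: "('r, 'm, 'n) module_scheme"
    and ract :: "'m \<Rightarrow> 'r \<Rightarrow> 'm" and N :: "nat set" +
  assumes lact_closed: "r \<in> carrier R ==> x \<in> carrier M ==> r \<odot>\<^bsub>M\<^esub> x \<in> carrier M"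
    and ract_closed: "r \<in> carrier R ==> x \<in> carrier M ==> ract x r \<in> carrier M"
begin

abbreviation "tcong \<equiv> tensor_cong R M ract N"
abbreviation "cls \<equiv> tensor_class R M ract N"
abbreviation "wds \<equiv> words (carrier M) N"
abbreviation "TG \<equiv> tensor_group R M ract N"
abbreviation "balanced_to \<equiv> balanced_maps R M ract N"

lemma tcong_words: "tcong X Y ==> X \<in> lists wds \<and> Y \<in> lists wds"
  by (induction rule: tensor_cong.induct) (auto simp: lact_closed ract_closed)

lemma cls_eqI: "tcong X Y ==> cls X = cls Y"
  unfolding tensor_class_def by (blast intro: tensor_cong.trans tensor_cong.sym)

lemma cls_self: "X \<in> lists wds ==> X \<in> cls X"
  unfolding tensor_class_def by (blast intro: tensor_cong.refl)

lemma mem_cls: "Y \<in> cls X ==> Y \<in> lists wds \<and> cls Y = cls X"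
  using tcong_words cls_eqI unfolding tensor_class_def by blast

lemma UN_cls:
  assumes "X \<in> lists wds" "\<And>Y. Y \<in> lists wds ==> cls Y = cls X ==> f Y = f X"
  shows "(\<Union>Y\<in>cls X. f Y) = f X"
proof -
  have "f Y = f X" if "Y \<in> cls X" for Y using that assms(2) mem_cls by blast
  then show ?thesis using UN_constant_eq[OF cls_self[OF assms(1)], of f "f X"] by blast
qed

lemma cls_append_cong:
  assumes "cls X = cls X'" "cls Y = cls Y'" "X \<in> lists wds" "X' \<in> lists wds" "Y \<in> lists wds" "Y' \<in> lists wds"
  shows "cls (X @ Y) = cls (X' @ Y')"
proof -
  have "tcong X X'" "tcong Y Y'"
    using assms cls_self[of X'] cls_self[of Y'] unfolding tensor_class_def by auto
  then show ?thesis by (intro cls_eqI tensor_cong.sum)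
qed

lemma TG_carrier: "carrier TG = cls ` lists wds"
  and TG_zero: "\<zero>\<^bsub>TG\<^esub> = cls []"
  by (simp_all add: tensor_group_def)

lemma cls_closed: "X \<in> lists wds ==> cls X \<in> carrier TG"
  by (simp add: TG_carrier)

lemma TG_cases: "S \<in> carrier TG ==> (\<And>X. X \<in> lists wds ==> S = cls X ==> P) ==> P"
  by (auto simp: TG_carrier)

lemma cls_add:
  assumes X: "X \<in> lists wds" and Y: "Y \<in> lists wds"
  shows "cls X \<oplus>\<^bsub>TG\<^esub> cls Y = cls (X @ Y)"
proof -
  have "(\<Union>Y'\<in>cls Y. cls (X' @ Y')) = cls (X @ Y)" if "X' \<in> lists wds" "cls X' = cls X" for X'
    using UN_cls[OF Y, of "%Y'. cls (X' @ Y')"] cls_append_cong that X Y by metis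
  then show ?thesis
    using X by (simp add: tensor_group_def UN_cls del: in_lists_conv_set)
qed

lemma cls_word_add:
  assumes "us @ [x] @ vs \<in> wds" "us @ [y] @ vs \<in> wds"
  shows "cls [us @ [x \<oplus>\<^bsub>M\<^esub> y] @ vs] = cls [us @ [x] @ vs] \<oplus>\<^bsub>TG\<^esub> cls [us @ [y] @ vs]"
proof -
  have "cls [us @ [x \<oplus>\<^bsub>M\<^esub> y] @ vs] = cls [us @ [x] @ vs, us @ [y] @ vs]"
    by (intro cls_eqI tensor_cong.add assms)
  then show ?thesis using assms by (simp add: cls_add)
qed

lemma cls_word_balanced:
  assumes "us @ [x, y] @ vs \<in> wds" "r \<in> carrier R"
  shows "cls [us @ [ract x r, y] @ vs] = cls [us @ [x, r \<odot>\<^bsub>M\<^esub> y] @ vs]"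
  by (intro cls_eqI tensor_cong.balanced assms)

text \<open>Negatives of classes are obtained by negating one letter, which is why words must be nonempty for
  classes to form a group.\<close>

lemma word_neg:
  assumes "us @ [x] @ vs \<in> wds"
  shows "cls [us @ [\<ominus>\<^bsub>M\<^esub> x] @ vs] \<oplus>\<^bsub>TG\<^esub> cls [us @ [x] @ vs] = \<zero>\<^bsub>TG\<^esub>"
proof -
  have "cls [us @ [\<ominus>\<^bsub>M\<^esub> x] @ vs] \<oplus>\<^bsub>TG\<^esub> cls [us @ [x] @ vs] = cls [us @ [\<zero>\<^bsub>M\<^esub>] @ vs]"
    using assms by (subst cls_word_add[symmetric]) (auto simp: l_neg)
  also have "\<dots> = cls []" using assms by (intro cls_eqI tensor_cong.zero) auto
  finally show ?thesis by (simp add: TG_zero)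
qed

lemma exists_neg:
  assumes "X \<in> lists wds" "0 \<notin> N"
  shows "\<exists>Y\<in>lists wds. cls Y \<oplus>\<^bsub>TG\<^esub> cls X = \<zero>\<^bsub>TG\<^esub>"
  using assms(1)
proof (induction X)
  case Nil
  then show ?case by (intro bexI[of _ "[]"]) (auto simp: cls_add TG_zero)
next
  case (Cons w X)
  from Cons obtain Y where Y: "Y \<in> lists wds" "cls Y \<oplus>\<^bsub>TG\<^esub> cls X = \<zero>\<^bsub>TG\<^esub>" by auto
  from Cons assms obtain x vs where w: "w = x # vs" "x \<in> carrier M" "vs \<in> lists (carrier M)" "Suc (length vs) \<in> N"
    by (cases w) (auto simp: words_def)
  let ?w = "(\<ominus>\<^bsub>M\<^esub> x) # vs"
  have W: "?w \<in> wds" "w \<in> wds" using w by auto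
  have neg: "cls [?w, w] = cls []"
    using word_neg[of "[]" x vs] w cls_add[of "[?w]" "[w]"] by (auto simp: TG_zero)
  have "cls (?w # Y) \<oplus>\<^bsub>TG\<^esub> cls (w # X) = cls ([?w] @ (Y @ [w]) @ X)"
    using W Y Cons by (simp add: cls_add)
  also have "\<dots> = cls ([?w] @ ([w] @ Y) @ X)"
    using W Y Cons by (intro cls_eqI tensor_cong.sum tensor_cong.comm tensor_cong.refl) auto
  also have "\<dots> = cls ([?w, w] @ (Y @ X))" by simp
  also have "\<dots> = cls ([] @ (Y @ X))"
    using W Y Cons neg by (intro cls_append_cong) auto
  also have "\<dots> = \<zero>\<^bsub>TG\<^esub>" using Y Cons by (simp add: cls_add)
  finally show ?case using W Y by (intro bexI[of _ "?w # Y"]) auto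
qed

lemma TG_group:
  assumes "0 \<notin> N"
  shows "abelian_group TG"
proof (rule abelian_groupI)
  fix S T assume "S \<in> carrier TG" "T \<in> carrier TG"
  then obtain X Y where XY: "X \<in> lists wds" "S = cls X" "Y \<in> lists wds" "T = cls Y"
    by (metis TG_cases)
  then show "S \<oplus>\<^bsub>TG\<^esub> T \<in> carrier TG" by (simp add: cls_add cls_closed del: in_lists_conv_set)
  show "S \<oplus>\<^bsub>TG\<^esub> T = T \<oplus>\<^bsub>TG\<^esub> S"
    using XY by (simp add: cls_add cls_eqI tensor_cong.comm del: in_lists_conv_set)
next
  fix S T U assume "S \<in> carrier TG" "T \<in> carrier TG" "U \<in> carrier TG"
  then obtain X Y Z where "X \<in> lists wds" "S = cls X" "Y \<in> lists wds" "T = cls Y" "Z \<in> lists wds" "U = cls Z"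
    by (metis TG_cases)
  then show "S \<oplus>\<^bsub>TG\<^esub> T \<oplus>\<^bsub>TG\<^esub> U = S \<oplus>\<^bsub>TG\<^esub> (T \<oplus>\<^bsub>TG\<^esub> U)"
    by (simp add: cls_add)
next
  fix S assume "S \<in> carrier TG"
  then obtain X where X: "X \<in> lists wds" "S = cls X" by (metis TG_cases)
  show "\<zero>\<^bsub>TG\<^esub> \<oplus>\<^bsub>TG\<^esub> S = S" using X by (simp add: TG_zero cls_add del: in_lists_conv_set)
  show "\<exists>T\<in>carrier TG. T \<oplus>\<^bsub>TG\<^esub> S = \<zero>\<^bsub>TG\<^esub>" using exists_neg[OF X(1) assms] X cls_closed by auto
qed (simp add: TG_zero cls_closed)

lemma cls_Cons: "w \<in> wds ==> X \<in> lists wds ==> cls (w # X) = cls [w] \<oplus>\<^bsub>TG\<^esub> cls X"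
  using cls_add[of "[w]" X] by simp

lemma cls_lsum: "X \<in> lists wds ==> cls X = lsum TG (map (%w. cls [w]) X)"
proof (induction X)
  case (Cons w X)
  then show ?case using cls_Cons[of w X] by auto
qed (simp add: TG_zero)

text \<open>Each rule of the congruence preserves the image; the rule for a letter \<open>\<zero>\<close> does because an additive
  map kills \<open>\<zero>\<close>.\<close>

lemma balanced_cong:
  assumes G: "abelian_group G" and F: "F \<in> balanced_to G" and "tcong X Y"
  shows "lsum G (map F X) = lsum G (map F Y)"
  using assms(3)
proof (induction rule: tensor_cong.induct)
  interpret G: abelian_group G by fact
  have cl: "w \<in> wds ==> F w \<in> carrier G" for w using F by (auto simp: balanced_maps_def)
  {
    case (sum X X' Y Y')
    have *: "set (map F X) \<subseteq> carrier G" "set (map F X') \<subseteq> carrier G"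
      "set (map F Y) \<subseteq> carrier G" "set (map F Y') \<subseteq> carrier G"
      using sum.hyps[THEN tcong_words] cl by auto
    show ?case using sum.IH * by (simp add: G.lsum_append del: set_map)
  next
    case (comm X Y)
    have *: "set (map F X) \<subseteq> carrier G" "set (map F Y) \<subseteq> carrier G"
      using comm.hyps cl by auto
    show ?case using * by (simp add: G.lsum_append G.lsum_closed G.a_comm del: set_map)
  next
    case (zero us vs)
    let ?z = "F (us @ [\<zero>\<^bsub>M\<^esub>] @ vs)"
    have "?z = ?z \<oplus>\<^bsub>G\<^esub> ?z"
      using F zero unfolding balanced_maps_def
      by clarify (metis r_zero zero_closed)
    moreover have "?z \<in> carrier G" using cl zero by auto
    ultimately have "?z = \<zero>\<^bsub>G\<^esub>" by (metis G.add.l_cancel_one')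
    then show ?case by simp
  next
    case (add us x vs y)
    then have "F (us @ [x \<oplus>\<^bsub>M\<^esub> y] @ vs) = F (us @ [x] @ vs) \<oplus>\<^bsub>G\<^esub> F (us @ [y] @ vs)"
      "F (us @ [x] @ vs) \<in> carrier G" "F (us @ [y] @ vs) \<in> carrier G"
      using F cl unfolding balanced_maps_def by blast+
    then show ?case by simp
  next
    case (balanced us x y vs r)
    then have "F (us @ [ract x r, y] @ vs) = F (us @ [x, r \<odot>\<^bsub>M\<^esub> y] @ vs)"
      using F unfolding balanced_maps_def by blast
    then show ?case by simp
  }
qed auto

lemma lift_cls:
  assumes "abelian_group G" "F \<in> balanced_to G" "X \<in> lists wds"
  shows "tensor_lift G F (cls X) = lsum G (map F X)"
proof -
  have "(SOME Y. Y \<in> cls X) \<in> cls X" using cls_self[OF assms(3)] by (rule someI)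
  then have "tcong X (SOME Y. Y \<in> cls X)" unfolding tensor_class_def by simp
  then show ?thesis unfolding tensor_lift_def using balanced_cong assms(1,2) by metis
qed

lemma balanced_cls_eq:
  assumes "abelian_group G" "F \<in> balanced_to G" "X \<in> lists wds" "Y \<in> lists wds" "cls X = cls Y"
  shows "lsum G (map F X) = lsum G (map F Y)"
  using lift_cls[OF assms(1,2,3)] lift_cls[OF assms(1,2,4)] assms(5) by simp

lemma lift_additive:
  assumes "abelian_group G" "F \<in> balanced_to G"
  shows "tensor_lift G F \<in> additive_maps TG G"
proof (rule additive_mapsI)
  interpret G: abelian_group G by fact
  have cl: "X \<in> lists wds ==> set (map F X) \<subseteq> carrier G" for X
    using assms(2) by (auto simp: balanced_maps_def)
  fix S assume "S \<in> carrier TG"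
  then obtain X where X: "X \<in> lists wds" "S = cls X" by (metis TG_cases)
  then show "tensor_lift G F S \<in> carrier G" using cl by (simp only: lift_cls[OF assms]) (blast intro: G.lsum_closed)
  fix T assume "T \<in> carrier TG"
  then obtain Y where Y: "Y \<in> lists wds" "T = cls Y" by (metis TG_cases)
  have "X @ Y \<in> lists wds" using X Y by simp
  then show "tensor_lift G F (S \<oplus>\<^bsub>TG\<^esub> T) = tensor_lift G F S \<oplus>\<^bsub>G\<^esub> tensor_lift G F T"
    using X Y cl[OF X(1)] cl[OF Y(1)] by (simp only: cls_add lift_cls[OF assms] map_append G.lsum_append)
qed

text \<open>The classes of single words generate the group.\<close>

lemma TG_ext:
  assumes "0 \<notin> N" "abelian_group G" "f \<in> additive_maps TG G" "g \<in> additive_maps TG G"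
    and "\<And>w. w \<in> wds ==> f (cls [w]) = g (cls [w])" and "S \<in> carrier TG"
  shows "f S = g S"
proof -
  from assms(6) obtain X where X: "X \<in> lists wds" "S = cls X" by (metis TG_cases)
  have "f (lsum TG (map (%w. cls [w]) X)) = g (lsum TG (map (%w. cls [w]) X))"
    using X assms(5)
    by (simp add: additive_lsum_map[OF TG_group[OF assms(1)] assms(2,3)]
        additive_lsum_map[OF TG_group[OF assms(1)] assms(2,4)] cls_closed subset_iff in_lists_conv_set
        cong: map_cong)
  then show ?thesis using X by (simp only: cls_lsum)
qed

lemma TG_balancedI:
  assumes "\<And>w. w \<in> wds ==> F w \<in> carrier G"
    and "\<And>us vs x y. us @ [x] @ vs \<in> wds ==> y \<in> carrier M ==> x \<in> carrier M ==>
      F (us @ [x \<oplus>\<^bsub>M\<^esub> y] @ vs) = F (us @ [x] @ vs) \<oplus>\<^bsub>G\<^esub> F (us @ [y] @ vs)"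
    and "\<And>us vs x y r. us @ [x, y] @ vs \<in> wds ==> x \<in> carrier M ==> y \<in> carrier M ==> r \<in> carrier R ==>
      F (us @ [ract x r, y] @ vs) = F (us @ [x, r \<odot>\<^bsub>M\<^esub> y] @ vs)"
  shows "F \<in> balanced_to G"
  using assms unfolding balanced_maps_def by auto

end

lemma lists_words_2E:
  assumes "w \<in> words S {2}"
  obtains a b where "w = [a, b]" "a \<in> S" "b \<in> S"
  using assms by (auto simp: words_def length_Suc_conv numeral_2_eq_2)

lemma lists_words_3E:
  assumes "w \<in> words S {3}"
  obtains a b c where "w = [a, b, c]" "a \<in> S" "b \<in> S" "c \<in> S"
  using assms by (auto simp: words_def length_Suc_conv numeral_3_eq_3)

lemma balanced_maps_2I:
  assumes "\<And>x y. x \<in> carrier M ==> y \<in> carrier M ==> B x y \<in> carrier G"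
    and "\<And>x x' y. x \<in> carrier M ==> x' \<in> carrier M ==> y \<in> carrier M ==>
      B (x \<oplus>\<^bsub>M\<^esub> x') y = B x y \<oplus>\<^bsub>G\<^esub> B x' y"
    and "\<And>x y y'. x \<in> carrier M ==> y \<in> carrier M ==> y' \<in> carrier M ==>
      B x (y \<oplus>\<^bsub>M\<^esub> y') = B x y \<oplus>\<^bsub>G\<^esub> B x y'"
    and "\<And>x y r. x \<in> carrier M ==> y \<in> carrier M ==> r \<in> carrier R ==>
      B (ract x r) y = B x (r \<odot>\<^bsub>M\<^esub> y)"
  shows "(%u. B (u ! 0) (u ! 1)) \<in> balanced_maps R M ract {2} G"
  unfolding balanced_maps_def
proof (intro CollectI conjI allI impI)
  show "(%u. B (u ! 0) (u ! 1)) \<in> words (carrier M) {2} \<rightarrow> carrier G"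
    by (auto elim!: lists_words_2E simp: assms(1))
next
  fix us vs x y
  assume *: "us @ [x] @ vs \<in> words (carrier M) {2}" "us @ [y] @ vs \<in> words (carrier M) {2}"
  then consider b where "us = []" "vs = [b]" | a where "us = [a]" "vs = []"
    by (cases us) (auto simp: length_Suc_conv numeral_2_eq_2)
  then show "B ((us @ [x \<oplus>\<^bsub>M\<^esub> y] @ vs) ! 0) ((us @ [x \<oplus>\<^bsub>M\<^esub> y] @ vs) ! 1) =
    B ((us @ [x] @ vs) ! 0) ((us @ [x] @ vs) ! 1) \<oplus>\<^bsub>G\<^esub> B ((us @ [y] @ vs) ! 0) ((us @ [y] @ vs) ! 1)"
    using * by cases (auto simp: assms(2,3))
next
  fix us vs x y r
  assume *: "us @ [x, y] @ vs \<in> words (carrier M) {2}" "r \<in> carrier R"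
  then show "B ((us @ [ract x r, y] @ vs) ! 0) ((us @ [ract x r, y] @ vs) ! 1) =
    B ((us @ [x, r \<odot>\<^bsub>M\<^esub> y] @ vs) ! 0) ((us @ [x, r \<odot>\<^bsub>M\<^esub> y] @ vs) ! 1)"
    by (auto simp: assms(4))
qed

lemma balanced_maps_3I:
  assumes "\<And>x y z. x \<in> carrier M ==> y \<in> carrier M ==> z \<in> carrier M ==> B x y z \<in> carrier G"
    and "\<And>x x' y z. x \<in> carrier M ==> x' \<in> carrier M ==> y \<in> carrier M ==> z \<in> carrier M ==>
      B (x \<oplus>\<^bsub>M\<^esub> x') y z = B x y z \<oplus>\<^bsub>G\<^esub> B x' y z"
    and "\<And>x y y' z. x \<in> carrier M ==> y \<in> carrier M ==> y' \<in> carrier M ==> z \<in> carrier M ==>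
      B x (y \<oplus>\<^bsub>M\<^esub> y') z = B x y z \<oplus>\<^bsub>G\<^esub> B x y' z"
    and "\<And>x y z z'. x \<in> carrier M ==> y \<in> carrier M ==> z \<in> carrier M ==> z' \<in> carrier M ==>
      B x y (z \<oplus>\<^bsub>M\<^esub> z') = B x y z \<oplus>\<^bsub>G\<^esub> B x y z'"
    and "\<And>x y z r. x \<in> carrier M ==> y \<in> carrier M ==> z \<in> carrier M ==> r \<in> carrier R ==>
      B (ract x r) y z = B x (r \<odot>\<^bsub>M\<^esub> y) z"
    and "\<And>x y z r. x \<in> carrier M ==> y \<in> carrier M ==> z \<in> carrier M ==> r \<in> carrier R ==>
      B x (ract y r) z = B x y (r \<odot>\<^bsub>M\<^esub> z)"
  shows "(%u. B (u ! 0) (u ! 1) (u ! 2)) \<in> balanced_maps R M ract {3} G"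
  unfolding balanced_maps_def
proof (intro CollectI conjI allI impI)
  show "(%u. B (u ! 0) (u ! 1) (u ! 2)) \<in> words (carrier M) {3} \<rightarrow> carrier G"
    by (auto elim!: lists_words_3E simp: assms(1))
next
  fix us vs x y
  assume *: "us @ [x] @ vs \<in> words (carrier M) {3}" "us @ [y] @ vs \<in> words (carrier M) {3}"
  then consider b c where "us = []" "vs = [b, c]" | a b where "us = [a]" "vs = [b]" | a b where "us = [a, b]" "vs = []"
    by (cases us; cases "tl us") (auto simp: length_Suc_conv numeral_3_eq_3)
  then show "B ((us @ [x \<oplus>\<^bsub>M\<^esub> y] @ vs) ! 0) ((us @ [x \<oplus>\<^bsub>M\<^esub> y] @ vs) ! 1) ((us @ [x \<oplus>\<^bsub>M\<^esub> y] @ vs) ! 2) =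
    B ((us @ [x] @ vs) ! 0) ((us @ [x] @ vs) ! 1) ((us @ [x] @ vs) ! 2) \<oplus>\<^bsub>G\<^esub>
    B ((us @ [y] @ vs) ! 0) ((us @ [y] @ vs) ! 1) ((us @ [y] @ vs) ! 2)"
    using * by cases (auto simp: assms(2,3,4) numeral_2_eq_2)
next
  fix us vs x y r
  assume *: "us @ [x, y] @ vs \<in> words (carrier M) {3}" "r \<in> carrier R"
  then consider c where "us = []" "vs = [c]" | a where "us = [a]" "vs = []"
    by (cases us) (auto simp: length_Suc_conv numeral_3_eq_3)
  then show "B ((us @ [ract x r, y] @ vs) ! 0) ((us @ [ract x r, y] @ vs) ! 1) ((us @ [ract x r, y] @ vs) ! 2) =
    B ((us @ [x, r \<odot>\<^bsub>M\<^esub> y] @ vs) ! 0) ((us @ [x, r \<odot>\<^bsub>M\<^esub> y] @ vs) ! 1) ((us @ [x, r \<odot>\<^bsub>M\<^esub> y] @ vs) ! 2)"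
    using * by cases (auto simp: assms(5,6) numeral_2_eq_2)
qed

section \<open>Linear maps\<close>

lemma linear_mapsI:
  "(\<And>x. x \<in> carrier M ==> f x \<in> carrier N) ==>
   (\<And>x y. x \<in> carrier M ==> y \<in> carrier M ==> f (x \<oplus>\<^bsub>M\<^esub> y) = f x \<oplus>\<^bsub>N\<^esub> f y) ==>
   (\<And>k x. k \<in> carrier K ==> x \<in> carrier M ==> f (k \<odot>\<^bsub>M\<^esub> x) = k \<odot>\<^bsub>N\<^esub> f x) ==>
   f \<in> linear_maps K M N"
  by (auto simp: linear_maps_def)

lemma linear_closed: "f \<in> linear_maps K M N ==> x \<in> carrier M ==> f x \<in> carrier N"
  and linear_add: "f \<in> linear_maps K M N ==> x \<in> carrier M ==> y \<in> carrier M ==> f (x \<oplus>\<^bsub>M\<^esub> y) = f x \<oplus>\<^bsub>N\<^esub> f y"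
  and linear_smult: "f \<in> linear_maps K M N ==> k \<in> carrier K ==> x \<in> carrier M ==> f (k \<odot>\<^bsub>M\<^esub> x) = k \<odot>\<^bsub>N\<^esub> f x"
  by (auto simp: linear_maps_def)

lemma linear_additive: "f \<in> linear_maps K M N ==> f \<in> additive_maps M N"
  by (auto simp: linear_maps_def additive_maps_def)

lemma linear_cong:
  assumes "module K M" "\<And>x. x \<in> carrier M ==> f x = g x" "g \<in> linear_maps K M N"
  shows "f \<in> linear_maps K M N"
proof -
  interpret M: module K M by fact
  show ?thesis using assms by (auto simp: linear_maps_def)
qed

text \<open>A commutative ring as a module over itself, so that linear forms are linear maps.\<close>

definition self_module :: "('k, 'c) ring_scheme \<Rightarrow> ('k, 'k) module" where
  "self_module K = \<lparr>carrier = carrier K, mult = mult K, one = one K, zero = zero K, add = add K, smult = mult K\<rparr>"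

lemma self_module_simps [simp]:
  "carrier (self_module K) = carrier K" "mult (self_module K) = mult K" "one (self_module K) = one K"
  "zero (self_module K) = zero K" "add (self_module K) = add K" "smult (self_module K) = mult K"
  by (simp_all add: self_module_def)

lemma lsum_self_module [simp]: "lsum (self_module K) = lsum K"
  by (simp add: lsum_def fun_eq_iff)

lemma (in cring) module_self: "module R (self_module R)"
proof (rule moduleI)
  show "abelian_group (self_module R)"
  proof (rule abelian_groupI)
    fix x assume "x \<in> carrier (self_module R)"
    then show "\<exists>y\<in>carrier (self_module R). y \<oplus>\<^bsub>self_module R\<^esub> x = \<zero>\<^bsub>self_module R\<^esub>"
      by (intro bexI[of _ "\<ominus> x"]) (auto simp: l_neg)
  qed (auto simp: a_ac)
qed (auto simp: l_distr r_distr m_assoc is_cring)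

lemma (in module) linear_id: "(%x. x) \<in> linear_maps R M M"
  by (auto intro: linear_mapsI)

lemma linear_maps_add:
  assumes "module K N" "f \<in> linear_maps K M N" "g \<in> linear_maps K M N"
  shows "(%x. f x \<oplus>\<^bsub>N\<^esub> g x) \<in> linear_maps K M N"
proof -
  interpret N: module K N by fact
  show ?thesis using assms(2,3)
    by (auto intro!: linear_mapsI simp: linear_closed linear_add linear_smult N.M.a_ac N.smult_r_distr)
qed

lemma linear_maps_neg:
  assumes "module K N" "f \<in> linear_maps K M N"
  shows "(%x. \<ominus>\<^bsub>N\<^esub> f x) \<in> linear_maps K M N"
proof -
  interpret N: module K N by fact
  show ?thesis using assms(2)
    by (auto intro!: linear_mapsI simp: linear_closed linear_add linear_smult N.M.minus_add N.smult_r_minus)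
qed

lemma linear_maps_minus:
  assumes "module K N" "f \<in> linear_maps K M N" "g \<in> linear_maps K M N"
  shows "(%x. f x \<ominus>\<^bsub>N\<^esub> g x) \<in> linear_maps K M N"
  unfolding a_minus_def by (intro linear_maps_add linear_maps_neg assms)

lemma linear_maps_smult:
  assumes "module K N" "k \<in> carrier K" "f \<in> linear_maps K M N"
  shows "(%x. k \<odot>\<^bsub>N\<^esub> f x) \<in> linear_maps K M N"
proof -
  interpret N: module K N by fact
  show ?thesis using assms(2,3)
    by (auto intro!: linear_mapsI simp: linear_closed linear_add linear_smult N.smult_r_distr
        N.smult_assoc1[symmetric] N.R.m_comm)
qed

lemma linear_maps_smult_left:
  assumes "module K N" "f \<in> linear_maps K M (self_module K)" "x \<in> carrier N"
  shows "(%c. f c \<odot>\<^bsub>N\<^esub> x) \<in> linear_maps K M N"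
proof -
  interpret N: module K N by fact
  show ?thesis using assms(3) linear_closed[OF assms(2)] linear_add[OF assms(2)] linear_smult[OF assms(2)]
    by (auto intro!: linear_mapsI simp: N.smult_l_distr N.smult_assoc1)
qed

lemma linear_maps_lsum:
  assumes "module K N" "\<And>u. u \<in> set us ==> (%x. f x u) \<in> linear_maps K M N"
  shows "(%x. lsum N (map (f x) us)) \<in> linear_maps K M N"
  using assms(2)
proof (induction us)
  case Nil
  interpret N: module K N by fact
  show ?case by (auto intro!: linear_mapsI)
next
  case (Cons u us)
  then show ?case by (simp add: linear_maps_add[OF assms(1)])
qed

lemma linear_maps_compose:
  "g \<in> linear_maps K N P ==> f \<in> linear_maps K M N ==> (%x. g (f x)) \<in> linear_maps K M P"
  by (auto intro!: linear_mapsI simp: linear_closed linear_add linear_smult)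

lemma (in assoc_algebra) linear_mult_left:
  "c \<in> carrier A ==> f \<in> linear_maps K M A ==> (%x. c \<otimes>\<^bsub>A\<^esub> f x) \<in> linear_maps K M A"
  by (auto intro!: linear_mapsI simp: linear_closed linear_add linear_smult r_distr smult_mult_right)

lemma (in assoc_algebra) linear_mult_right:
  "c \<in> carrier A ==> f \<in> linear_maps K M A ==> (%x. f x \<otimes>\<^bsub>A\<^esub> c) \<in> linear_maps K M A"
  by (auto intro!: linear_mapsI simp: linear_closed linear_add linear_smult l_distr smult_mult_left)

definition bilinear_maps ::
  "('k, 'c) ring_scheme \<Rightarrow> ('k, 'a, 'm) module_scheme \<Rightarrow> ('k, 'b, 'n) module_scheme \<Rightarrow>
    ('k, 'e, 'l) module_scheme \<Rightarrow> ('a \<Rightarrow> 'b \<Rightarrow> 'e) set" where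
  "bilinear_maps K M M' N = {F. (\<forall>a\<in>carrier M. F a \<in> linear_maps K M' N) \<and>
     (\<forall>b\<in>carrier M'. (%a. F a b) \<in> linear_maps K M N)}"

lemma bilinear_mapsI:
  "(\<And>a. a \<in> carrier M ==> (%b. F a b) \<in> linear_maps K M' N) ==>
   (\<And>b. b \<in> carrier M' ==> (%a. F a b) \<in> linear_maps K M N) ==> F \<in> bilinear_maps K M M' N"
  by (simp add: bilinear_maps_def)

lemma bilinear_closed:
  "F \<in> bilinear_maps K M M' N ==> a \<in> carrier M ==> b \<in> carrier M' ==> F a b \<in> carrier N"
  by (auto simp: bilinear_maps_def intro: linear_closed)

section \<open>Sweedler sums\<close>

text \<open>\<open>sw H N h F\<close> is $\sum_j F(h^{(1)}_j, h^{(2)}_j)$. For a bilinear \<open>F\<close> it does not depend on the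
  decomposition of $\Delta h$, and the axioms of a Hopf algebra become rules for such sums.\<close>

definition sw :: "('k, 'h, 'm) hopf_scheme \<Rightarrow> ('b, 'n) ring_scheme \<Rightarrow> 'h \<Rightarrow> ('h \<Rightarrow> 'h \<Rightarrow> 'b) \<Rightarrow> 'b" where
  "sw H N h F = lsum N (map (%u. F (u ! 0) (u ! 1)) (sweedler H h))"

context hopf_algebra
begin

lemma K_cring: "cring K" by unfold_locales
lemma H_module: "module K H" by unfold_locales
lemma H_group: "abelian_group H" by unfold_locales
lemma K_module: "module K (self_module K)" using K_cring cring.module_self by blast

sublocale H2: tensor_product K H "%v k. k \<odot>\<^bsub>H\<^esub> v" "{2}"
  by unfold_locales auto

sublocale H3: tensor_product K H "%v k. k \<odot>\<^bsub>H\<^esub> v" "{3}"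
  by unfold_locales auto

lemma sweedler_comult:
  assumes "h \<in> carrier H"
  shows "sweedler H h \<in> lists (words (carrier H) {2})" "H2.cls (sweedler H h) = comult H h"
proof -
  from comult_closed[OF assms] obtain X where X: "X \<in> lists (words (carrier H) {2})" "comult H h = H2.cls X"
    unfolding ktensor_power_def ktensor_def by auto
  have "sweedler H h \<in> H2.cls X"
    unfolding sweedler_def X(2) using H2.cls_self[OF X(1)] by (rule someI)
  then show "sweedler H h \<in> lists (words (carrier H) {2})" "H2.cls (sweedler H h) = comult H h"
    using H2.mem_cls X(2) by auto
qed

lemma sweedlerE:
  assumes "h \<in> carrier H" "u \<in> set (sweedler H h)"
  obtains a b where "u = [a, b]" "a \<in> carrier H" "b \<in> carrier H"
proof -
  have "u \<in> words (carrier H) {2}" using sweedler_comult(1)[OF assms(1)] assms(2) by (auto simp: in_lists_conv_set)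
  then show ?thesis using that by (rule lists_words_2E)
qed

lemma sweedler_nth:
  assumes "h \<in> carrier H" "u \<in> set (sweedler H h)"
  shows "u ! 0 \<in> carrier H" "u ! Suc 0 \<in> carrier H" "u ! 1 \<in> carrier H"
  by (rule sweedlerE[OF assms]; simp)+

lemma sw_cong:
  assumes "h \<in> carrier H" "\<And>a b. a \<in> carrier H ==> b \<in> carrier H ==> F a b = G a b"
  shows "sw H N h F = sw H N h G"
  unfolding sw_def by (intro lsum_cong) (auto simp: assms sweedler_nth[OF assms(1)])

lemma bilinear_balanced:
  assumes "F \<in> bilinear_maps K H H N"
  shows "(%u. F (u ! 0) (u ! 1)) \<in> H2.balanced_to N"
proof -
  have 1: "(%b. F a b) \<in> linear_maps K H N" if "a \<in> carrier H" for a
    using assms that by (simp add: bilinear_maps_def)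
  have 2: "(%a. F a b) \<in> linear_maps K H N" if "b \<in> carrier H" for b
    using assms that by (simp add: bilinear_maps_def)
  show ?thesis
    using linear_closed[OF 1] linear_add[OF 1] linear_add[OF 2] linear_smult[OF 1] linear_smult[OF 2]
    by (intro balanced_maps_2I) simp_all
qed

text \<open>A Sweedler sum may be evaluated on any decomposition of $\Delta h$, because bilinear maps are
  balanced; the axioms on $\Delta$ are applied to sums through this rule.\<close>

lemma sw_eqI:
  assumes "module K N" "F \<in> bilinear_maps K H H N" "h \<in> carrier H"
    "X \<in> lists (words (carrier H) {2})" "comult H h = ktensor K H 2 X"
  shows "sw H N h F = lsum N (map (%u. F (u ! 0) (u ! 1)) X)"
proof -
  interpret N: module K N by fact
  show ?thesis unfolding sw_def
    using assms sweedler_comult[OF assms(3)] bilinear_balanced[OF assms(2)] N.M.abelian_group_axioms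
    by (intro H2.balanced_cls_eq) (auto simp: ktensor_def)
qed

lemma sw_closed:
  assumes "abelian_group N" "h \<in> carrier H" "\<And>a b. a \<in> carrier H ==> b \<in> carrier H ==> F a b \<in> carrier N"
  shows "sw H N h F \<in> carrier N"
proof -
  interpret N: abelian_group N by fact
  show ?thesis unfolding sw_def
    by (intro N.lsum_map_closed) (auto simp: assms(3) sweedler_nth[OF assms(2)])
qed

lemma sw_hom:
  assumes "abelian_group N" "abelian_group N'" "f \<in> additive_maps N N'" "h \<in> carrier H"
    "\<And>a b. a \<in> carrier H ==> b \<in> carrier H ==> F a b \<in> carrier N"
  shows "f (sw H N h F) = sw H N' h (%a b. f (F a b))"
  unfolding sw_def
  by (intro additive_lsum_map[OF assms(1-3)]) (auto simp: assms(5) sweedler_nth[OF assms(4)])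

lemma sw_swap:
  assumes "abelian_group N" "h \<in> carrier H" "g \<in> carrier H"
    "\<And>a b c e. a \<in> carrier H ==> b \<in> carrier H ==> c \<in> carrier H ==> e \<in> carrier H ==> F a b c e \<in> carrier N"
  shows "sw H N h (%a b. sw H N g (%c e. F a b c e)) = sw H N g (%c e. sw H N h (%a b. F a b c e))"
proof -
  interpret N: abelian_group N by fact
  show ?thesis unfolding sw_def
    by (intro N.lsum_swap) (auto simp: assms(4) sweedler_nth[OF assms(2)] sweedler_nth[OF assms(3)])
qed

lemma sw_add:
  assumes "abelian_group N" "h \<in> carrier H"
    "\<And>a b. a \<in> carrier H ==> b \<in> carrier H ==> F a b \<in> carrier N"
    "\<And>a b. a \<in> carrier H ==> b \<in> carrier H ==> G a b \<in> carrier N"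
  shows "sw H N h (%a b. F a b \<oplus>\<^bsub>N\<^esub> G a b) = sw H N h F \<oplus>\<^bsub>N\<^esub> sw H N h G"
proof -
  interpret N: abelian_group N by fact
  show ?thesis unfolding sw_def
    by (intro N.lsum_add) (auto simp: assms(3,4) sweedler_nth[OF assms(2)])
qed

lemma sw_neg:
  assumes "abelian_group N" "h \<in> carrier H"
    "\<And>a b. a \<in> carrier H ==> b \<in> carrier H ==> F a b \<in> carrier N"
  shows "sw H N h (%a b. \<ominus>\<^bsub>N\<^esub> F a b) = \<ominus>\<^bsub>N\<^esub> sw H N h F"
proof -
  interpret N: abelian_group N by fact
  have "a_inv N \<in> additive_maps N N" by (auto intro!: additive_mapsI simp: N.minus_add)
  from sw_hom[OF assms(1) assms(1) this assms(2), of F] show ?thesis using assms(3) by simp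
qed

lemma sw_minus:
  assumes "abelian_group N" "h \<in> carrier H"
    "\<And>a b. a \<in> carrier H ==> b \<in> carrier H ==> F a b \<in> carrier N"
    "\<And>a b. a \<in> carrier H ==> b \<in> carrier H ==> G a b \<in> carrier N"
  shows "sw H N h (%a b. F a b \<ominus>\<^bsub>N\<^esub> G a b) = sw H N h F \<ominus>\<^bsub>N\<^esub> sw H N h G"
proof -
  interpret N: abelian_group N by fact
  show ?thesis
    unfolding a_minus_def using assms by (simp add: sw_add[OF assms(1)] sw_neg[OF assms(1)])
qed

lemma sw_smult:
  assumes "module K N" "h \<in> carrier H" "k \<in> carrier K"
    "\<And>a b. a \<in> carrier H ==> b \<in> carrier H ==> F a b \<in> carrier N"
  shows "k \<odot>\<^bsub>N\<^esub> sw H N h F = sw H N h (%a b. k \<odot>\<^bsub>N\<^esub> F a b)"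
proof -
  interpret N: module K N by fact
  show ?thesis
    by (rule sw_hom[of N N]) (auto intro!: additive_mapsI simp: assms N.smult_r_distr N.M.abelian_group_axioms)
qed

lemma sw_linear:
  assumes N: "module K N" and F: "F \<in> bilinear_maps K H H N"
  shows "(%h. sw H N h F) \<in> linear_maps K H N"
proof (rule linear_mapsI)
  interpret N: module K N by fact
  note NG = N.M.abelian_group_axioms
  have Fc: "a \<in> carrier H ==> b \<in> carrier H ==> F a b \<in> carrier N" for a b
    using F by (auto simp: bilinear_maps_def linear_closed)
  fix x assume x: "x \<in> carrier H"
  show "sw H N x F \<in> carrier N" by (rule sw_closed[OF NG x Fc])
  {
    fix y assume y: "y \<in> carrier H"
    have "sw H N (x \<oplus>\<^bsub>H\<^esub> y) F = lsum N (map (%u. F (u ! 0) (u ! 1)) (sweedler H x @ sweedler H y))"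
      using x y sweedler_comult(1) by (intro sw_eqI N F comult_add) auto
    also have "\<dots> = sw H N x F \<oplus>\<^bsub>N\<^esub> sw H N y F"
      unfolding sw_def using Fc sweedler_nth[OF x] sweedler_nth[OF y]
      by (simp only: map_append, intro N.M.lsum_append) auto
    finally show "sw H N (x \<oplus>\<^bsub>H\<^esub> y) F = sw H N x F \<oplus>\<^bsub>N\<^esub> sw H N y F" .
  }
  fix k assume k: "k \<in> carrier K"
  have "sw H N (k \<odot>\<^bsub>H\<^esub> x) F = lsum N (map (%u. F (u ! 0) (u ! 1)) [[k \<odot>\<^bsub>H\<^esub> (u ! 0), u ! 1]. u \<leftarrow> sweedler H x])"
    using x k by (intro sw_eqI N F comult_smult) (auto elim!: sweedlerE[OF x])
  also have "\<dots> = sw H N x (%a b. F (k \<odot>\<^bsub>H\<^esub> a) b)" by (simp add: sw_def comp_def)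
  also have "\<dots> = sw H N x (%a b. k \<odot>\<^bsub>N\<^esub> F a b)"
    using F k x by (intro sw_cong) (auto simp: bilinear_maps_def linear_maps_def)
  also have "\<dots> = k \<odot>\<^bsub>N\<^esub> sw H N x F" by (rule sw_smult[OF N x k Fc, symmetric])
  finally show "sw H N (k \<odot>\<^bsub>H\<^esub> x) F = k \<odot>\<^bsub>N\<^esub> sw H N x F" .
qed

lemma linear_sw_arg:
  "module K N ==> F \<in> bilinear_maps K H H N ==> g \<in> linear_maps K M H ==> (%x. sw H N (g x) F) \<in> linear_maps K M N"
  using linear_maps_compose[OF sw_linear] by blast

lemma linear_sw:
  assumes "module K N" "h \<in> carrier H"
    "\<And>a b. a \<in> carrier H ==> b \<in> carrier H ==> (%x. F x a b) \<in> linear_maps K M N"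
  shows "(%x. sw H N h (F x)) \<in> linear_maps K M N"
  unfolding sw_def by (intro linear_maps_lsum assms sweedler_nth[OF assms(2)])

lemma sw_one:
  assumes "module K N" "F \<in> bilinear_maps K H H N"
  shows "sw H N \<one>\<^bsub>H\<^esub> F = F \<one>\<^bsub>H\<^esub> \<one>\<^bsub>H\<^esub>"
proof -
  interpret N: module K N by fact
  have "sw H N \<one>\<^bsub>H\<^esub> F = lsum N (map (%u. F (u ! 0) (u ! 1)) [[\<one>\<^bsub>H\<^esub>, \<one>\<^bsub>H\<^esub>]])"
    by (intro sw_eqI assms comult_one) auto
  then show ?thesis using bilinear_closed[OF assms(2)] by simp
qed

lemma sw_mult:
  assumes "module K N" "F \<in> bilinear_maps K H H N" "x \<in> carrier H" "y \<in> carrier H"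
  shows "sw H N (x \<otimes>\<^bsub>H\<^esub> y) F = sw H N x (%a b. sw H N y (%c e. F (a \<otimes>\<^bsub>H\<^esub> c) (b \<otimes>\<^bsub>H\<^esub> e)))"
proof -
  interpret N: module K N by fact
  let ?X = "[[u ! 0 \<otimes>\<^bsub>H\<^esub> v ! 0, u ! 1 \<otimes>\<^bsub>H\<^esub> v ! 1]. u \<leftarrow> sweedler H x, v \<leftarrow> sweedler H y]"
  have Fc: "a \<in> carrier H ==> b \<in> carrier H ==> F a b \<in> carrier N" for a b
    using assms(2) by (auto simp: bilinear_maps_def linear_closed)
  have "?X \<in> lists (words (carrier H) {2})"
    using sweedler_nth[OF assms(3)] sweedler_nth[OF assms(4)] by auto
  then have "sw H N (x \<otimes>\<^bsub>H\<^esub> y) F = lsum N (map (%u. F (u ! 0) (u ! 1)) ?X)"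
    by (intro sw_eqI assms comult_mult) (auto simp: assms)
  also have "\<dots> = lsum N (concat (map (%u. map (%v. F (u ! 0 \<otimes>\<^bsub>H\<^esub> v ! 0) (u ! 1 \<otimes>\<^bsub>H\<^esub> v ! 1)) (sweedler H y)) (sweedler H x)))"
    by (simp add: map_concat comp_def)
  also have "\<dots> = sw H N x (%a b. sw H N y (%c e. F (a \<otimes>\<^bsub>H\<^esub> c) (b \<otimes>\<^bsub>H\<^esub> e)))"
    unfolding sw_def using sweedler_nth[OF assms(3)] sweedler_nth[OF assms(4)]
    by (subst N.M.lsum_concat) (auto simp: Fc)
  finally show ?thesis .
qed

text \<open>The two decompositions of $(\Delta \otimes 1)\Delta h = (1 \otimes \Delta)\Delta h$ are formal sums
  of words of length three, evaluated under a trilinear map.\<close>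

lemma sw_coassoc:
  assumes "module K N" "h \<in> carrier H"
    and 1: "\<And>b c. b \<in> carrier H ==> c \<in> carrier H ==> (%a. F a b c) \<in> linear_maps K H N"
    and 2: "\<And>a c. a \<in> carrier H ==> c \<in> carrier H ==> (%b. F a b c) \<in> linear_maps K H N"
    and 3: "\<And>a b. a \<in> carrier H ==> b \<in> carrier H ==> (%c. F a b c) \<in> linear_maps K H N"
  shows "sw H N h (%a b. sw H N a (%c e. F c e b)) = sw H N h (%a b. sw H N b (%c e. F a c e))"
proof -
  interpret N: module K N by fact
  have Fc: "a \<in> carrier H ==> b \<in> carrier H ==> c \<in> carrier H ==> F a b c \<in> carrier N" for a b c
    using linear_closed[OF 1] by simp
  let ?X = "[[v ! 0, v ! 1, u ! 1]. u \<leftarrow> sweedler H h, v \<leftarrow> sweedler H (u ! 0)]"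
  let ?Y = "[[u ! 0, v ! 0, v ! 1]. u \<leftarrow> sweedler H h, v \<leftarrow> sweedler H (u ! 1)]"
  let ?F = "%u. F (u ! 0) (u ! 1) (u ! 2)"
  note nth = sweedler_nth[OF assms(2)] sweedler_nth[OF sweedler_nth(1)[OF assms(2)]]
    sweedler_nth[OF sweedler_nth(2)[OF assms(2)]]
  have "?F \<in> H3.balanced_to N"
    using linear_add[OF 1] linear_add[OF 2] linear_add[OF 3] linear_smult[OF 1] linear_smult[OF 2] linear_smult[OF 3]
    by (intro balanced_maps_3I) (simp_all add: Fc)
  moreover have "?X \<in> lists (words (carrier H) {3})" "?Y \<in> lists (words (carrier H) {3})"
    using nth by (auto simp: numeral_3_eq_3)
  moreover have "H3.cls ?X = H3.cls ?Y" using coassoc[OF assms(2)] by (simp add: ktensor_def)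
  ultimately have "lsum N (map ?F ?X) = lsum N (map ?F ?Y)"
    by (intro H3.balanced_cls_eq N.M.abelian_group_axioms)
  moreover have "lsum N (map ?F ?X) = sw H N h (%a b. sw H N a (%c e. F c e b))"
    unfolding sw_def using nth
    by (simp only: map_concat map_map comp_def, subst N.M.lsum_concat) (auto simp: Fc numeral_2_eq_2 comp_def)
  moreover have "lsum N (map ?F ?Y) = sw H N h (%a b. sw H N b (%c e. F a c e))"
    unfolding sw_def using nth
    by (simp only: map_concat map_map comp_def, subst N.M.lsum_concat) (auto simp: Fc numeral_2_eq_2 comp_def)
  ultimately show ?thesis by simp
qed

lemma counit_linear: "counit H \<in> linear_maps K H (self_module K)"
  by (auto intro: linear_mapsI simp: counit_closed counit_add counit_smult)

lemma sw_counit_left: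
  assumes "module K N" "f \<in> linear_maps K H N" "h \<in> carrier H"
  shows "sw H N h (%a b. counit H a \<odot>\<^bsub>N\<^esub> f b) = f h"
proof -
  interpret N: module K N by fact
  have "sw H N h (%a b. counit H a \<odot>\<^bsub>N\<^esub> f b) = sw H N h (%a b. f (counit H a \<odot>\<^bsub>H\<^esub> b))"
    using assms by (intro sw_cong) (auto simp: linear_smult counit_closed)
  also have "\<dots> = f (sw H H h (%a b. counit H a \<odot>\<^bsub>H\<^esub> b))"
    using assms by (intro sw_hom[symmetric] H_group linear_additive N.M.abelian_group_axioms) (auto simp: counit_closed)
  also have "\<dots> = f h" using counit_left[OF assms(3)] by (simp add: sw_def)
  finally show ?thesis .
qed

lemma sw_counit_right:
  assumes "module K N" "f \<in> linear_maps K H N" "h \<in> carrier H"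
  shows "sw H N h (%a b. counit H b \<odot>\<^bsub>N\<^esub> f a) = f h"
proof -
  interpret N: module K N by fact
  have "sw H N h (%a b. counit H b \<odot>\<^bsub>N\<^esub> f a) = sw H N h (%a b. f (counit H b \<odot>\<^bsub>H\<^esub> a))"
    using assms by (intro sw_cong) (auto simp: linear_smult counit_closed)
  also have "\<dots> = f (sw H H h (%a b. counit H b \<odot>\<^bsub>H\<^esub> a))"
    using assms by (intro sw_hom[symmetric] H_group linear_additive N.M.abelian_group_axioms) (auto simp: counit_closed)
  also have "\<dots> = f h" using counit_right[OF assms(3)] by (simp add: sw_def)
  finally show ?thesis .
qed

lemma antipode_closed [simp]: "h \<in> carrier H ==> antipode H h \<in> carrier H"
  using antipode_linear by (rule linear_closed)

declare counit_closed [simp]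

lemma sw_antipode_left:
  assumes "module K N" "f \<in> linear_maps K H N" "h \<in> carrier H"
  shows "sw H N h (%a b. f (antipode H a \<otimes>\<^bsub>H\<^esub> b)) = counit H h \<odot>\<^bsub>N\<^esub> f \<one>\<^bsub>H\<^esub>"
proof -
  interpret N: module K N by fact
  have "sw H N h (%a b. f (antipode H a \<otimes>\<^bsub>H\<^esub> b)) = f (sw H H h (%a b. antipode H a \<otimes>\<^bsub>H\<^esub> b))"
    using assms by (intro sw_hom[symmetric] H_group linear_additive N.M.abelian_group_axioms) auto
  also have "sw H H h (%a b. antipode H a \<otimes>\<^bsub>H\<^esub> b) = counit H h \<odot>\<^bsub>H\<^esub> \<one>\<^bsub>H\<^esub>"
    using antipode_left[OF assms(3)] by (simp add: sw_def)
  finally show ?thesis using assms by (simp add: linear_smult)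
qed

lemma sw_antipode_right:
  assumes "module K N" "f \<in> linear_maps K H N" "h \<in> carrier H"
  shows "sw H N h (%a b. f (a \<otimes>\<^bsub>H\<^esub> antipode H b)) = counit H h \<odot>\<^bsub>N\<^esub> f \<one>\<^bsub>H\<^esub>"
proof -
  interpret N: module K N by fact
  have "sw H N h (%a b. f (a \<otimes>\<^bsub>H\<^esub> antipode H b)) = f (sw H H h (%a b. a \<otimes>\<^bsub>H\<^esub> antipode H b))"
    using assms by (intro sw_hom[symmetric] H_group linear_additive N.M.abelian_group_axioms) auto
  also have "sw H H h (%a b. a \<otimes>\<^bsub>H\<^esub> antipode H b) = counit H h \<odot>\<^bsub>H\<^esub> \<one>\<^bsub>H\<^esub>"
    using antipode_right[OF assms(3)] by (simp add: sw_def)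
  finally show ?thesis using assms by (simp add: linear_smult)
qed

end

section \<open>The adjoint action\<close>

lemma bilinear_left:
  "F \<in> bilinear_maps K M M' N ==> f \<in> linear_maps K L M ==> b \<in> carrier M' ==> (%x. F (f x) b) \<in> linear_maps K L N"
  and bilinear_right:
  "F \<in> bilinear_maps K M M' N ==> a \<in> carrier M ==> f \<in> linear_maps K L M' ==> (%x. F a (f x)) \<in> linear_maps K L N"
  by (auto simp: bilinear_maps_def intro: linear_maps_compose)

context hopf_algebra
begin

lemma sw_mult_left:
  assumes "ring A" "c \<in> carrier A" "h \<in> carrier H" "\<And>a b. a \<in> carrier H ==> b \<in> carrier H ==> F a b \<in> carrier A"
  shows "c \<otimes>\<^bsub>A\<^esub> sw H A h F = sw H A h (%a b. c \<otimes>\<^bsub>A\<^esub> F a b)"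
proof -
  interpret A: ring A by fact
  show ?thesis
    by (rule sw_hom[of A A]) (auto intro!: additive_mapsI simp: assms A.r_distr A.abelian_group_axioms)
qed

lemma sw_mult_right:
  assumes "ring A" "c \<in> carrier A" "h \<in> carrier H" "\<And>a b. a \<in> carrier H ==> b \<in> carrier H ==> F a b \<in> carrier A"
  shows "sw H A h F \<otimes>\<^bsub>A\<^esub> c = sw H A h (%a b. F a b \<otimes>\<^bsub>A\<^esub> c)"
proof -
  interpret A: ring A by fact
  show ?thesis
    by (rule sw_hom[of A A "%x. x \<otimes>\<^bsub>A\<^esub> c"]) (auto intro!: additive_mapsI simp: assms A.l_distr A.abelian_group_axioms)
qed

lemma H_ring: "ring H" by unfold_locales

lemmas linear_antipode = linear_maps_compose[OF antipode_linear]
lemmas linear_counit = linear_maps_compose[OF counit_linear]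

lemma adj_sw: "adj H h g = sw H H h (%a b. antipode H a \<otimes>\<^bsub>H\<^esub> g \<otimes>\<^bsub>H\<^esub> b)"
  by (simp add: adj_def sw_def)

lemma adj_closed [simp]: "h \<in> carrier H ==> g \<in> carrier H ==> adj H h g \<in> carrier H"
  unfolding adj_sw by (intro sw_closed H_group) auto

lemmas linear_intros = bilinear_mapsI linear_id linear_maps_smult linear_maps_smult_left linear_mult_left
  linear_mult_right linear_antipode linear_counit linear_sw linear_sw_arg linear_maps_add linear_maps_minus

lemma linear_adj_right:
  "h \<in> carrier H ==> f \<in> linear_maps K M H ==> (%x. adj H h (f x)) \<in> linear_maps K M H"
  unfolding adj_sw by (intro linear_intros) (auto simp: H_module)

lemma linear_adj_left:
  "f \<in> linear_maps K M H ==> g \<in> carrier H ==> (%x. adj H (f x) g) \<in> linear_maps K M H"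
  unfolding adj_sw by (intro linear_intros) (auto simp: H_module)

text \<open>Coassociativity brings $h^{(1)}$ next to $S(h^{(2)})$, where the antipode cancels them. The rule
  $\sum h^{(1)}\,\mathrm{ad}(h^{(2)})g = gh$ moves \<open>h\<close> past \<open>g\<close>, and the properties of \<open>ad\<close> are derived
  from it.\<close>

lemma adj_exchange:
  assumes "h \<in> carrier H" "g \<in> carrier H"
  shows "sw H H h (%a b. a \<otimes>\<^bsub>H\<^esub> adj H b g) = g \<otimes>\<^bsub>H\<^esub> h"
proof -
  have "sw H H h (%a b. a \<otimes>\<^bsub>H\<^esub> adj H b g) = sw H H h (%a b. sw H H b (%c e. a \<otimes>\<^bsub>H\<^esub> (antipode H c \<otimes>\<^bsub>H\<^esub> g \<otimes>\<^bsub>H\<^esub> e)))"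
    using assms by (intro sw_cong) (auto simp: adj_sw intro!: sw_mult_left[OF H_ring])
  also have "\<dots> = sw H H h (%a b. sw H H a (%c e. c \<otimes>\<^bsub>H\<^esub> (antipode H e \<otimes>\<^bsub>H\<^esub> g \<otimes>\<^bsub>H\<^esub> b)))"
    by (rule sw_coassoc[symmetric]; (intro linear_intros)?) (auto simp: assms H_module)
  also have "\<dots> = sw H H h (%a b. sw H H a (%c e. (c \<otimes>\<^bsub>H\<^esub> antipode H e) \<otimes>\<^bsub>H\<^esub> (g \<otimes>\<^bsub>H\<^esub> b)))"
    using assms by (intro sw_cong) (auto simp: m_assoc)
  also have "\<dots> = sw H H h (%a b. counit H a \<odot>\<^bsub>H\<^esub> (\<one>\<^bsub>H\<^esub> \<otimes>\<^bsub>H\<^esub> (g \<otimes>\<^bsub>H\<^esub> b)))"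
    using assms by (intro sw_cong sw_antipode_right; (intro linear_intros)?) (auto simp: H_module)
  also have "\<dots> = \<one>\<^bsub>H\<^esub> \<otimes>\<^bsub>H\<^esub> (g \<otimes>\<^bsub>H\<^esub> h)"
    by (intro sw_counit_left; (intro linear_intros)?) (auto simp: assms H_module)
  finally show ?thesis using assms by simp
qed

lemma adj_one_left: "g \<in> carrier H ==> adj H \<one>\<^bsub>H\<^esub> g = g"
proof -
  assume g: "g \<in> carrier H"
  have "sw H H \<one>\<^bsub>H\<^esub> (%a b. a \<otimes>\<^bsub>H\<^esub> adj H b g) = \<one>\<^bsub>H\<^esub> \<otimes>\<^bsub>H\<^esub> adj H \<one>\<^bsub>H\<^esub> g"
    by (intro sw_one; (intro linear_intros linear_adj_left)?) (auto simp: g H_module)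
  then show ?thesis using adj_exchange[of "\<one>\<^bsub>H\<^esub>" g] g by simp
qed

lemma adj_one_right:
  assumes "h \<in> carrier H"
  shows "adj H h \<one>\<^bsub>H\<^esub> = counit H h \<odot>\<^bsub>H\<^esub> \<one>\<^bsub>H\<^esub>"
proof -
  have "adj H h \<one>\<^bsub>H\<^esub> = sw H H h (%a b. antipode H a \<otimes>\<^bsub>H\<^esub> b)"
    unfolding adj_sw using assms by (intro sw_cong) auto
  then show ?thesis using antipode_left[OF assms] by (simp add: sw_def)
qed

lemma counit_adj:
  assumes "h \<in> carrier H" "g \<in> carrier H"
  shows "counit H (adj H h g) = counit H h \<otimes>\<^bsub>K\<^esub> counit H g"
proof -
  have "counit H (adj H h g) = sw H (self_module K) h (%a b. counit H (antipode H a \<otimes>\<^bsub>H\<^esub> g \<otimes>\<^bsub>H\<^esub> b))"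
    unfolding adj_sw
    by (rule sw_hom) (auto simp: assms H_group linear_additive[OF counit_linear] module.axioms(2)[OF K_module])
  also have "\<dots> = sw H (self_module K) h (%a b. counit H (antipode H a \<otimes>\<^bsub>H\<^esub> b) \<otimes>\<^bsub>K\<^esub> counit H g)"
    using assms by (intro sw_cong) (auto simp: counit_mult R.m_assoc R.m_comm[of "counit H g"])
  also have "\<dots> = counit H h \<odot>\<^bsub>self_module K\<^esub> (counit H \<one>\<^bsub>H\<^esub> \<otimes>\<^bsub>K\<^esub> counit H g)"
    using linear_maps_smult_left[OF K_module counit_linear, of "counit H g"]
    by (intro sw_antipode_left K_module) (auto simp: assms)
  finally show ?thesis using assms by (simp add: counit_one)
qed

text \<open>In $\mathrm{ad}(gh)x = \sum S(g^{(1)}h^{(1)})\,x\,g^{(2)}h^{(2)}$ the exchange rule, used twice,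
  rewrites $x g^{(2)} h^{(2)}$ with $g^{(2)}h^{(2)}$ on the left of the iterated adjoint action, and the
  antipode cancels.\<close>

lemma adj_adj:
  assumes h: "h \<in> carrier H" and g: "g \<in> carrier H" and x: "x \<in> carrier H"
  shows "adj H h (adj H g x) = adj H (g \<otimes>\<^bsub>H\<^esub> h) x"
proof -
  let ?S = "antipode H"
  note [simp] = h g x H_module
  have *: "sw H H b (%b1 b2. sw H H e (%e1 e2. y \<otimes>\<^bsub>H\<^esub> (b1 \<otimes>\<^bsub>H\<^esub> (e1 \<otimes>\<^bsub>H\<^esub> adj H e2 (adj H b2 x))))) =
      y \<otimes>\<^bsub>H\<^esub> (x \<otimes>\<^bsub>H\<^esub> b \<otimes>\<^bsub>H\<^esub> e)"
    if [simp]: "y \<in> carrier H" "b \<in> carrier H" "e \<in> carrier H" for y b e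
  proof -
    have "sw H H b (%b1 b2. sw H H e (%e1 e2. y \<otimes>\<^bsub>H\<^esub> (b1 \<otimes>\<^bsub>H\<^esub> (e1 \<otimes>\<^bsub>H\<^esub> adj H e2 (adj H b2 x))))) =
      sw H H b (%b1 b2. y \<otimes>\<^bsub>H\<^esub> ((b1 \<otimes>\<^bsub>H\<^esub> adj H b2 x) \<otimes>\<^bsub>H\<^esub> e))"
      by (intro sw_cong) (simp_all add: sw_mult_left[OF H_ring, symmetric] adj_exchange m_assoc)
    also have "\<dots> = y \<otimes>\<^bsub>H\<^esub> (x \<otimes>\<^bsub>H\<^esub> b \<otimes>\<^bsub>H\<^esub> e)"
      by (simp add: sw_mult_left[OF H_ring, symmetric] sw_mult_right[OF H_ring, symmetric] adj_exchange)
    finally show ?thesis .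
  qed
  let ?G = "%a1 c1 a2 c2 b e. ?S (a1 \<otimes>\<^bsub>H\<^esub> c1) \<otimes>\<^bsub>H\<^esub> (a2 \<otimes>\<^bsub>H\<^esub> (c2 \<otimes>\<^bsub>H\<^esub> adj H e (adj H b x)))"
  have "adj H (g \<otimes>\<^bsub>H\<^esub> h) x = sw H H g (%a b. sw H H h (%c e. ?S (a \<otimes>\<^bsub>H\<^esub> c) \<otimes>\<^bsub>H\<^esub> x \<otimes>\<^bsub>H\<^esub> (b \<otimes>\<^bsub>H\<^esub> e)))"
    unfolding adj_sw by (rule sw_mult; (intro linear_intros)?) auto
  also have "\<dots> = sw H H g (%a b. sw H H h (%c e. sw H H b (%b1 b2. sw H H e (%e1 e2. ?G a c b1 e1 b2 e2))))"
    by (intro sw_cong) (simp_all add: * m_assoc)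
  also have "\<dots> = sw H H g (%a b. sw H H b (%b1 b2. sw H H h (%c e. sw H H e (%e1 e2. ?G a c b1 e1 b2 e2))))"
    by (intro sw_cong sw_swap) (auto intro!: sw_closed H_group)
  also have "\<dots> = sw H H g (%a b. sw H H b (%b1 b2. sw H H h (%c e. sw H H c (%c1 c2. ?G a c1 b1 c2 b2 e))))"
    by (intro sw_cong sw_coassoc[symmetric]; (intro linear_intros linear_adj_left linear_adj_right)?) auto
  also have "\<dots> = sw H H g (%a b. sw H H a (%a1 a2. sw H H h (%c e. sw H H c (%c1 c2. ?G a1 c1 a2 c2 b e))))"
    by (intro sw_coassoc[symmetric]; (intro linear_intros linear_adj_left linear_adj_right)?) auto
  also have "\<dots> = sw H H g (%a b. sw H H h (%c e. sw H H a (%a1 a2. sw H H c (%c1 c2. ?G a1 c1 a2 c2 b e))))"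
    by (intro sw_cong sw_swap) (auto intro!: sw_closed H_group)
  also have "\<dots> = sw H H g (%a b. sw H H h (%c e. sw H H (a \<otimes>\<^bsub>H\<^esub> c) (%p q. ?S p \<otimes>\<^bsub>H\<^esub> q \<otimes>\<^bsub>H\<^esub> adj H e (adj H b x))))"
    by (intro sw_cong, simp_all, subst sw_mult; (intro linear_intros sw_cong)?) (auto simp: m_assoc)
  also have "\<dots> = sw H H g (%a b. sw H H h (%c e. counit H (a \<otimes>\<^bsub>H\<^esub> c) \<odot>\<^bsub>H\<^esub> (\<one>\<^bsub>H\<^esub> \<otimes>\<^bsub>H\<^esub> adj H e (adj H b x))))"
    by (intro sw_cong sw_antipode_left[where f="%y. y \<otimes>\<^bsub>H\<^esub> c" for c]; (intro linear_intros)?) auto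
  also have "\<dots> = sw H H g (%a b. counit H a \<odot>\<^bsub>H\<^esub> sw H H h (%c e. counit H c \<odot>\<^bsub>H\<^esub> adj H e (adj H b x)))"
    by (intro sw_cong) (auto simp: counit_mult sw_smult smult_assoc1 intro!: sw_cong)
  also have "\<dots> = sw H H g (%a b. counit H a \<odot>\<^bsub>H\<^esub> adj H h (adj H b x))"
    by (intro sw_cong arg_cong[where f="%y. c \<odot>\<^bsub>H\<^esub> y" for c] sw_counit_left; (intro linear_intros linear_adj_left)?) auto
  also have "\<dots> = adj H h (adj H g x)"
    by (intro sw_counit_left; (intro linear_intros linear_adj_left linear_adj_right)?) auto
  finally show ?thesis by simp
qed

text \<open>The coproduct of $\mathrm{ad}(h^{(2)})g$, with $h^{(1)}$ multiplied into its second factor: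
  apply $\Delta$ to the exchange rule and cancel the extra factor on the left by the antipode.\<close>

lemma adj_comult:
  assumes N [simp]: "module K N" and F: "F \<in> bilinear_maps K H H N"
    and h [simp]: "h \<in> carrier H" and g [simp]: "g \<in> carrier H"
  shows "sw H N h (%a b. sw H N (adj H b g) (%c e. F c (a \<otimes>\<^bsub>H\<^esub> e))) =
    sw H N h (%a b. sw H N g (%c e. F (adj H a c) (e \<otimes>\<^bsub>H\<^esub> b)))"
proof -
  let ?S = "antipode H"
  interpret N: module K N by fact
  have [simp]: "abelian_group N" by (rule N.M.abelian_group_axioms)
  note [simp] = H_module bilinear_closed[OF F]
  note lin = linear_intros linear_adj_left linear_adj_right bilinear_left[OF F] bilinear_right[OF F]
  have Fadd: "(%x. F x b) \<in> additive_maps H N" if "b \<in> carrier H" for b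
    by (rule linear_additive[where K=K], intro lin) (auto simp: that)
  have Fl: "F (sw H H a G) b = sw H N a (%p q. F (G p q) b)"
    if "a \<in> carrier H" "b \<in> carrier H" "\<And>p q. p \<in> carrier H ==> q \<in> carrier H ==> G p q \<in> carrier H" for a b G
    by (rule sw_hom[OF H_group _ Fadd]) (auto simp: that)
  have "sw H N h (%a b. sw H N g (%c e. F (adj H a c) (e \<otimes>\<^bsub>H\<^esub> b))) =
    sw H N h (%a b. sw H N g (%c e. sw H N a (%p q. F (?S p \<otimes>\<^bsub>H\<^esub> c \<otimes>\<^bsub>H\<^esub> q) (e \<otimes>\<^bsub>H\<^esub> b))))"
    by (intro sw_cong) (simp_all add: adj_sw Fl)
  also have "\<dots> = sw H N h (%a b. sw H N a (%p q. sw H N g (%c e. F (?S p \<otimes>\<^bsub>H\<^esub> c \<otimes>\<^bsub>H\<^esub> q) (e \<otimes>\<^bsub>H\<^esub> b))))"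
    by (intro sw_cong sw_swap) auto
  also have "\<dots> = sw H N h (%a b. sw H N b (%p q. sw H N g (%c e. F (?S a \<otimes>\<^bsub>H\<^esub> c \<otimes>\<^bsub>H\<^esub> p) (e \<otimes>\<^bsub>H\<^esub> q))))"
    by (intro sw_coassoc; (intro lin)?) auto
  also have "\<dots> = sw H N h (%a b. sw H N g (%c e. sw H N b (%p q. F (?S a \<otimes>\<^bsub>H\<^esub> (c \<otimes>\<^bsub>H\<^esub> p)) (e \<otimes>\<^bsub>H\<^esub> q))))"
    by (intro sw_cong HOL.trans[OF sw_swap]) (auto simp: m_assoc intro!: sw_cong)
  also have "\<dots> = sw H N h (%a b. sw H N (g \<otimes>\<^bsub>H\<^esub> b) (%c e. F (?S a \<otimes>\<^bsub>H\<^esub> c) e))"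
    by (intro sw_cong sw_mult[symmetric]; (intro lin)?) auto
  also have "\<dots> = sw H N h (%a b. sw H N (sw H H b (%p q. p \<otimes>\<^bsub>H\<^esub> adj H q g)) (%c e. F (?S a \<otimes>\<^bsub>H\<^esub> c) e))"
    by (intro sw_cong) (simp_all add: adj_exchange)
  also have "\<dots> = sw H N h (%a b. sw H N b (%p q. sw H N (p \<otimes>\<^bsub>H\<^esub> adj H q g) (%c e. F (?S a \<otimes>\<^bsub>H\<^esub> c) e)))"
    by (intro sw_cong sw_hom[OF H_group _ linear_additive[OF sw_linear]]; (intro lin)?) auto
  also have "\<dots> = sw H N h (%a b. sw H N b (%p q. sw H N p (%p1 p2. sw H N (adj H q g) (%c e. F (?S a \<otimes>\<^bsub>H\<^esub> (p1 \<otimes>\<^bsub>H\<^esub> c)) (p2 \<otimes>\<^bsub>H\<^esub> e)))))"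
    by (intro sw_cong sw_mult; (intro lin)?) auto
  also have "\<dots> = sw H N h (%a b. sw H N b (%p q. sw H N q (%q1 q2. sw H N (adj H q2 g) (%c e. F (?S a \<otimes>\<^bsub>H\<^esub> (p \<otimes>\<^bsub>H\<^esub> c)) (q1 \<otimes>\<^bsub>H\<^esub> e)))))"
    by (intro sw_cong sw_coassoc; (intro lin)?) auto
  also have "\<dots> = sw H N h (%a b. sw H N a (%a1 a2. sw H N b (%q1 q2. sw H N (adj H q2 g) (%c e. F (?S a1 \<otimes>\<^bsub>H\<^esub> (a2 \<otimes>\<^bsub>H\<^esub> c)) (q1 \<otimes>\<^bsub>H\<^esub> e)))))"
    by (intro sw_coassoc[symmetric]; (intro lin)?) auto
  also have "\<dots> = sw H N h (%a b. sw H N a (%a1 a2. sw H N b (%q1 q2. sw H N (adj H q2 g) (%c e. F (?S a1 \<otimes>\<^bsub>H\<^esub> a2 \<otimes>\<^bsub>H\<^esub> c) (q1 \<otimes>\<^bsub>H\<^esub> e)))))"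
    by (intro sw_cong) (simp_all add: m_assoc)
  also have "\<dots> = sw H N h (%a b. counit H a \<odot>\<^bsub>N\<^esub> sw H N b (%q1 q2. sw H N (adj H q2 g) (%c e. F (\<one>\<^bsub>H\<^esub> \<otimes>\<^bsub>H\<^esub> c) (q1 \<otimes>\<^bsub>H\<^esub> e))))"
    by (intro sw_cong sw_antipode_left[where f="%y. sw H N b (%q1 q2. sw H N (adj H q2 g) (%c e. F (y \<otimes>\<^bsub>H\<^esub> c) (q1 \<otimes>\<^bsub>H\<^esub> e)))" for b]; (intro lin)?) auto
  also have "\<dots> = sw H N h (%q1 q2. sw H N (adj H q2 g) (%c e. F (\<one>\<^bsub>H\<^esub> \<otimes>\<^bsub>H\<^esub> c) (q1 \<otimes>\<^bsub>H\<^esub> e)))"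
    by (intro sw_counit_left; (intro lin)?) auto
  also have "\<dots> = sw H N h (%a b. sw H N (adj H b g) (%c e. F c (a \<otimes>\<^bsub>H\<^esub> e)))"
    by (intro sw_cong) auto
  finally show ?thesis by simp
qed

end

section \<open>The parity automorphism of a graded algebra\<close>

lemma (in abelian_monoid) finsum_support:
  assumes "finite S" "{n. c n \<noteq> \<zero>} \<subseteq> S" "\<And>n. f n \<in> carrier G" "\<And>n. c n = \<zero> ==> f n = \<zero>"
  shows "finsum G f {n. c n \<noteq> \<zero>} = finsum G f (S :: nat set)"
  using assms by (intro add.finprod_mono_neutral_cong_left) auto

lemma homogeneous_decompositionI:
  assumes A: "abelian_monoid A" "\<And>n. gr A n \<subseteq> carrier A"
    and "finite S" "\<And>n. c n \<in> gr A n" "\<And>n. n \<notin> S ==> c n = \<zero>\<^bsub>A\<^esub>" "x = finsum A c S"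
  shows "homogeneous_decomposition A x c"
proof -
  interpret A: abelian_monoid A by fact
  have "{n. c n \<noteq> \<zero>\<^bsub>A\<^esub>} \<subseteq> S" using assms(5) by auto
  moreover from this have "finsum A c {n. c n \<noteq> \<zero>\<^bsub>A\<^esub>} = finsum A c S"
    using assms(2-4) by (intro A.finsum_support) auto
  ultimately show ?thesis using assms finite_subset
    by (simp add: homogeneous_decomposition_def)
qed

lemma homogeneous_decomposition_add:
  assumes A: "abelian_monoid A" "\<And>n. gr A n \<subseteq> carrier A"
    and add: "\<And>n x y. x \<in> gr A n ==> y \<in> gr A n ==> x \<oplus>\<^bsub>A\<^esub> y \<in> gr A n"
    and x: "homogeneous_decomposition A x c" and y: "homogeneous_decomposition A y c'"
  shows "homogeneous_decomposition A (x \<oplus>\<^bsub>A\<^esub> y) (%n. c n \<oplus>\<^bsub>A\<^esub> c' n)"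
proof -
  interpret A: abelian_monoid A by fact
  let ?S = "{n. c n \<noteq> \<zero>\<^bsub>A\<^esub>} \<union> {n. c' n \<noteq> \<zero>\<^bsub>A\<^esub>}"
  have f: "finite ?S" and g: "\<And>n. c n \<in> gr A n" "\<And>n. c' n \<in> gr A n"
    using x y by (auto simp: homogeneous_decomposition_def)
  have cl: "c n \<in> carrier A" "c' n \<in> carrier A" for n using g A(2) by blast+
  have "x = finsum A c ?S"
    using x A.finsum_support[OF f, of c c] cl by (auto simp: homogeneous_decomposition_def)
  moreover have "y = finsum A c' ?S"
    using y A.finsum_support[OF f, of c' c'] cl by (auto simp: homogeneous_decomposition_def)
  ultimately have s: "x \<oplus>\<^bsub>A\<^esub> y = (\<Oplus>\<^bsub>A\<^esub>n\<in>?S. c n \<oplus>\<^bsub>A\<^esub> c' n)"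
    using cl by (subst A.finsum_addf) auto
  show ?thesis
    by (rule homogeneous_decompositionI[OF A f _ _ s]) (auto simp: g add)
qed

lemma homogeneous_decomposition_single:
  assumes A: "abelian_monoid A" "\<And>n. gr A n \<subseteq> carrier A" and "\<And>n. \<zero>\<^bsub>A\<^esub> \<in> gr A n" "x \<in> gr A n"
  shows "homogeneous_decomposition A x (%m. if m = n then x else \<zero>\<^bsub>A\<^esub>)"
proof -
  interpret A: abelian_monoid A by fact
  have "x \<in> carrier A" using A(2) assms(4) by blast
  then show ?thesis using assms by (intro homogeneous_decompositionI[OF A, of "{n}"]) auto
qed

lemma additive_finsum:
  assumes "abelian_group G" "abelian_group G'" "f \<in> additive_maps G G'" "finite S" "\<And>n. n \<in> S ==> c n \<in> carrier G"
  shows "f (finsum G c S) = finsum G' (%n. f (c n)) S"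
  using assms(4,5)
proof (induction S)
  interpret G: abelian_group G by fact
  interpret G': abelian_group G' by fact
  {
    case empty
    then show ?case by (simp add: additive_zero[OF assms(1-3)])
  next
    case (insert n S)
    then show ?case
      by (simp add: Pi_iff additive_add[OF assms(3)] additive_closed[OF assms(3)])
  }
qed

text \<open>The projections recover the components of any decomposition, which is therefore unique.\<close>

lemma graded_algebraI:
  assumes alg: "assoc_algebra K A" and sub: "\<And>n. submodule (gr A n) K A"
    and one: "\<one>\<^bsub>A\<^esub> \<in> gr A 0"
    and mult: "\<And>m n x y. x \<in> gr A m ==> y \<in> gr A n ==> x \<otimes>\<^bsub>A\<^esub> y \<in> gr A (m + n)"
    and span: "\<And>x. x \<in> carrier A ==> \<exists>xs. set xs \<subseteq> (\<Union>n. gr A n) \<and> x = lsum A xs"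
    and proj_additive: "\<And>k. \<pi> k \<in> additive_maps A A"
    and proj: "\<And>k n x. x \<in> gr A n ==> \<pi> k x = (if k = n then x else \<zero>\<^bsub>A\<^esub>)"
  shows "graded_algebra K A"
proof (intro graded_algebra.intro graded_algebra_axioms.intro alg sub one mult)
  interpret A: assoc_algebra K A by fact
  have mon: "abelian_monoid A" and grp: "abelian_group A" by unfold_locales
  have sub': "\<And>n. gr A n \<subseteq> carrier A" "\<And>n x y. x \<in> gr A n ==> y \<in> gr A n ==> x \<oplus>\<^bsub>A\<^esub> y \<in> gr A n" "\<And>n. \<zero>\<^bsub>A\<^esub> \<in> gr A n"
    using A.submoduleE(1,5)[OF sub] submodule.axioms(1)[OF sub] subgroup.one_closed by fastforce+
  fix x assume x: "x \<in> carrier A"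
  have unique: "c = (%k. \<pi> k x)" if "homogeneous_decomposition A x c" for c
  proof
    fix k
    let ?S = "{n. c n \<noteq> \<zero>\<^bsub>A\<^esub>}"
    have c: "finite ?S" "\<And>n. c n \<in> gr A n" "x = finsum A c ?S"
      using that by (auto simp: homogeneous_decomposition_def)
    have cc: "c n \<in> carrier A" for n using c(2) sub'(1) by blast
    have "\<pi> k x = finsum A (%n. \<pi> k (c n)) ?S"
      by (subst c(3), rule additive_finsum[OF grp grp proj_additive c(1)]) (rule cc)
    also have "\<dots> = finsum A (%n. if k = n then c n else \<zero>\<^bsub>A\<^esub>) ?S"
      using proj[OF c(2)] by simp
    also have "\<dots> = c k"
    proof (cases "k \<in> ?S")
      case True
      then show ?thesis using A.finsum_singleton[OF True c(1), of c] cc by simp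
    next
      case False
      then have "finsum A (%n. if k = n then c n else \<zero>\<^bsub>A\<^esub>) ?S = finsum A (%n. \<zero>\<^bsub>A\<^esub>) ?S"
        by (intro A.finsum_cong') auto
      then show ?thesis using False by simp
    qed
    finally show "c k = \<pi> k x" by simp
  qed
  moreover have "\<exists>c. homogeneous_decomposition A x c"
  proof -
    obtain xs where "set xs \<subseteq> (\<Union>n. gr A n)" "x = lsum A xs" using span[OF x] by blast
    moreover have "\<exists>c. homogeneous_decomposition A (lsum A xs) c" if "set xs \<subseteq> (\<Union>n. gr A n)"
      using that
    proof (induction xs)
      case Nil
      show ?case using homogeneous_decomposition_single[OF mon sub'(1) sub'(3) sub'(3)] by (simp, blast)
    next
      case (Cons y xs)
      then obtain n c where "y \<in> gr A n" "homogeneous_decomposition A (lsum A xs) c" by auto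
      then show ?case
        using homogeneous_decomposition_add[OF mon sub'(1,2) homogeneous_decomposition_single[OF mon sub'(1) sub'(3)]]
        by (simp, blast)
    qed
    ultimately show ?thesis by simp
  qed
  ultimately show "\<exists>!c. homogeneous_decomposition A x c" by blast
qed

context graded_algebra
begin

lemma A_ring: "ring A" by unfold_locales
lemma A_group: "abelian_group A" by unfold_locales

lemma gr_closed: "x \<in> gr A n ==> x \<in> carrier A"
  using submoduleE(1)[OF gr_submodule] by blast

lemma gr_zero [simp]: "\<zero>\<^bsub>A\<^esub> \<in> gr A n"
  using submodule.axioms(1)[OF gr_submodule] subgroup.one_closed by fastforce

lemma gr_add: "x \<in> gr A n ==> y \<in> gr A n ==> x \<oplus>\<^bsub>A\<^esub> y \<in> gr A n"
  using submoduleE(5)[OF gr_submodule] by blast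

lemma gr_neg: "x \<in> gr A n ==> \<ominus>\<^bsub>A\<^esub> x \<in> gr A n"
  using submoduleE(3)[OF gr_submodule] by blast

lemma gr_smult: "k \<in> carrier K ==> x \<in> gr A n ==> k \<odot>\<^bsub>A\<^esub> x \<in> gr A n"
  using submoduleE(4)[OF gr_submodule] by blast

lemma gr_gsign: "x \<in> gr A n ==> gsign A m x \<in> gr A n"
  by (simp add: gsign_def gr_neg)

lemma hcomponent_decomposition:
  assumes "x \<in> carrier A"
  shows "homogeneous_decomposition A x (hcomponent A x)"
  unfolding hcomponent_def using gr_decomposition[OF assms] by (rule theI')

lemma hcomponent_unique:
  assumes "homogeneous_decomposition A x c" "x \<in> carrier A"
  shows "hcomponent A x = c"
  using gr_decomposition[OF assms(2)] hcomponent_decomposition[OF assms(2)] assms(1) by blast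

lemma hcomponent_gr: "x \<in> carrier A ==> hcomponent A x n \<in> gr A n"
  using hcomponent_decomposition unfolding homogeneous_decomposition_def by blast

lemma hcomponent_closed [simp]: "x \<in> carrier A ==> hcomponent A x n \<in> carrier A"
  using hcomponent_gr gr_closed by blast

lemma hcomponent_finite: "x \<in> carrier A ==> finite {n. hcomponent A x n \<noteq> \<zero>\<^bsub>A\<^esub>}"
  using hcomponent_decomposition unfolding homogeneous_decomposition_def by blast

lemma hcomponent_sum:
  assumes "x \<in> carrier A" "finite S" "{n. hcomponent A x n \<noteq> \<zero>\<^bsub>A\<^esub>} \<subseteq> S"
  shows "finsum A (hcomponent A x) S = x"
proof -
  have "x = finsum A (hcomponent A x) {n. hcomponent A x n \<noteq> \<zero>\<^bsub>A\<^esub>}"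
    using hcomponent_decomposition[OF assms(1)] unfolding homogeneous_decomposition_def by blast
  also have "\<dots> = finsum A (hcomponent A x) S" using assms by (intro finsum_support) auto
  finally show ?thesis by simp
qed

lemma gr_subset: "gr A n \<subseteq> carrier A"
  using gr_closed by blast

lemma A_monoid: "abelian_monoid A" by unfold_locales

lemma hcomponent_add:
  assumes "x \<in> carrier A" "y \<in> carrier A"
  shows "hcomponent A (x \<oplus>\<^bsub>A\<^esub> y) n = hcomponent A x n \<oplus>\<^bsub>A\<^esub> hcomponent A y n"
  using hcomponent_unique[OF homogeneous_decomposition_add[OF A_monoid gr_subset gr_add
      hcomponent_decomposition[OF assms(1)] hcomponent_decomposition[OF assms(2)]]] assms by simp

lemma hcomponent_homogeneous:
  assumes "x \<in> gr A n"
  shows "hcomponent A x = (%m. if m = n then x else \<zero>\<^bsub>A\<^esub>)"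
  by (rule hcomponent_unique[OF homogeneous_decomposition_single[OF A_monoid gr_subset gr_zero assms] gr_closed[OF assms]])

lemma homogeneous_induct [consumes 1, case_names homogeneous add]:
  assumes x: "x \<in> carrier A"
    and hom: "\<And>n x. x \<in> gr A n ==> P x"
    and add: "\<And>x y. x \<in> carrier A ==> y \<in> carrier A ==> P x ==> P y ==> P (x \<oplus>\<^bsub>A\<^esub> y)"
  shows "P x"
proof -
  have "P (finsum A (hcomponent A x) S)" if "finite S" for S
    using that
  proof (induction S)
    case empty
    show ?case using hom[OF gr_zero] by simp
  next
    case (insert n S)
    then show ?case using x hom[OF hcomponent_gr] by (auto intro!: add)
  qed
  then show ?thesis using hcomponent_sum[OF x hcomponent_finite[OF x]] hcomponent_finite[OF x] by (metis order_refl)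
qed

lemma parity_sum:
  assumes "x \<in> carrier A" "finite S" "{n. hcomponent A x n \<noteq> \<zero>\<^bsub>A\<^esub>} \<subseteq> S"
  shows "parity A x = (\<Oplus>\<^bsub>A\<^esub>n\<in>S. gsign A n (hcomponent A x n))"
  unfolding parity_def using assms by (intro finsum_support) (auto simp: gsign_def)

lemma parity_closed [simp]: "x \<in> carrier A ==> parity A x \<in> carrier A"
  unfolding parity_def by (intro finsum_closed) auto

lemma parity_add [simp]:
  assumes "x \<in> carrier A" "y \<in> carrier A"
  shows "parity A (x \<oplus>\<^bsub>A\<^esub> y) = parity A x \<oplus>\<^bsub>A\<^esub> parity A y"
proof -
  let ?S = "{n. hcomponent A x n \<noteq> \<zero>\<^bsub>A\<^esub>} \<union> {n. hcomponent A y n \<noteq> \<zero>\<^bsub>A\<^esub>}"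
  have f: "finite ?S" using assms hcomponent_finite by auto
  have "parity A (x \<oplus>\<^bsub>A\<^esub> y) = (\<Oplus>\<^bsub>A\<^esub>n\<in>?S. gsign A n (hcomponent A (x \<oplus>\<^bsub>A\<^esub> y) n))"
    by (rule parity_sum[OF _ f]) (auto simp: assms hcomponent_add)
  also have "\<dots> = (\<Oplus>\<^bsub>A\<^esub>n\<in>?S. gsign A n (hcomponent A x n) \<oplus>\<^bsub>A\<^esub> gsign A n (hcomponent A y n))"
    using assms by (simp add: hcomponent_add gsign_add)
  also have "\<dots> = parity A x \<oplus>\<^bsub>A\<^esub> parity A y"
    using assms by (simp add: finsum_addf parity_sum[OF _ f])
  finally show ?thesis .
qed

lemma parity_homogeneous: "x \<in> gr A n ==> parity A x = gsign A n x"
  by (subst parity_sum[of x "{n}"]) (auto simp: gr_closed hcomponent_homogeneous)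

lemma parity_smult [simp]:
  assumes "k \<in> carrier K" "x \<in> carrier A"
  shows "parity A (k \<odot>\<^bsub>A\<^esub> x) = k \<odot>\<^bsub>A\<^esub> parity A x"
  using assms(2)
proof (induction rule: homogeneous_induct)
  case (homogeneous n x)
  then show ?case using assms(1)
    by (auto simp: parity_homogeneous[where n=n] gr_smult gsign_def gr_closed smult_r_minus)
qed (use assms(1) in \<open>simp add: smult_r_distr\<close>)

lemma parity_mult [simp]:
  assumes "x \<in> carrier A" "y \<in> carrier A"
  shows "parity A (x \<otimes>\<^bsub>A\<^esub> y) = parity A x \<otimes>\<^bsub>A\<^esub> parity A y"
  using assms
proof (induction arbitrary: y rule: homogeneous_induct)
  case (homogeneous m x)
  note x = homogeneous(1)
  from homogeneous(2) show ?case
  proof (induction rule: homogeneous_induct)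
    case (homogeneous n y)
    then show ?case using x
      by (simp add: parity_homogeneous[where n=m] parity_homogeneous[where n=n]
          parity_homogeneous[where n="m + n"] gr_mult gsign_mult gr_closed)
  qed (use gr_closed[OF x] in \<open>simp add: r_distr\<close>)
qed (simp add: l_distr)

lemma parity_one [simp]: "parity A \<one>\<^bsub>A\<^esub> = \<one>\<^bsub>A\<^esub>"
  using parity_homogeneous[OF gr_one] by simp

lemma parity_parity [simp]: "x \<in> carrier A ==> parity A (parity A x) = x"
proof (induction rule: homogeneous_induct)
  case (homogeneous n x)
  then show ?case by (simp add: parity_homogeneous[where n=n] gr_gsign gsign_gsign gr_closed)
qed simp

lemma parity_additive: "parity A \<in> additive_maps A A"
  by (auto intro: additive_mapsI)

lemma parity_linear: "parity A \<in> linear_maps K A A"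
  by (auto intro: linear_mapsI)

lemma parity_neg [simp]: "x \<in> carrier A ==> parity A (\<ominus>\<^bsub>A\<^esub> x) = \<ominus>\<^bsub>A\<^esub> parity A x"
  by (rule additive_neg[OF A_group A_group parity_additive])

lemma parity_gr: "x \<in> gr A n ==> parity A x \<in> gr A n"
  by (simp add: parity_homogeneous[where n=n] gr_gsign)

end

lemma graded_algebra_hom_parity:
  assumes "graded_algebra K A" "graded_algebra K B" "f \<in> graded_algebra_hom K A B" "x \<in> carrier A"
  shows "f (parity A x) = parity B (f x)"
proof -
  interpret A: graded_algebra K A by fact
  interpret B: graded_algebra K B by fact
  have f: "f \<in> linear_maps K A B" "\<And>n x. x \<in> gr A n ==> f x \<in> gr B n"
    using assms(3) by (auto simp: graded_algebra_hom_def)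
  note fa = linear_additive[OF f(1)]
  from assms(4) show ?thesis
  proof (induction rule: A.homogeneous_induct)
    case (homogeneous n x)
    then show ?case
      using A.gr_closed f(2)
      by (auto simp: A.parity_homogeneous[where n=n] B.parity_homogeneous[where n=n]
        additive_gsign[OF A.A_group B.A_group fa])
  next
    case (add x y)
    then show ?case by (simp add: additive_add[OF fa] additive_closed[OF fa])
  qed
qed

context graded_differential_algebra
begin

lemma d_additive: "d \<in> additive_maps A A"
  using d_linear by (rule linear_additive)

lemma d_closed [simp]: "x \<in> carrier A ==> d x \<in> carrier A"
  using d_additive by (rule additive_closed)

lemma d_add [simp]: "x \<in> carrier A ==> y \<in> carrier A ==> d (x \<oplus>\<^bsub>A\<^esub> y) = d x \<oplus>\<^bsub>A\<^esub> d y"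
  using d_additive by (rule additive_add)

lemma d_zero [simp]: "d \<zero>\<^bsub>A\<^esub> = \<zero>\<^bsub>A\<^esub>"
  by (rule additive_zero[OF A_group A_group d_additive])

lemma d_neg [simp]: "x \<in> carrier A ==> d (\<ominus>\<^bsub>A\<^esub> x) = \<ominus>\<^bsub>A\<^esub> d x"
  by (rule additive_neg[OF A_group A_group d_additive])

lemma d_mult:
  assumes "x \<in> carrier A" "y \<in> carrier A"
  shows "d (x \<otimes>\<^bsub>A\<^esub> y) = d x \<otimes>\<^bsub>A\<^esub> y \<oplus>\<^bsub>A\<^esub> parity A x \<otimes>\<^bsub>A\<^esub> d y"
  using assms
proof (induction rule: homogeneous_induct)
  case (homogeneous n x)
  have "gsign A n (x \<otimes>\<^bsub>A\<^esub> d y) = gsign A n x \<otimes>\<^bsub>A\<^esub> d y"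
    using homogeneous gr_closed gsign_mult[of x "d y" n 0] by simp
  with homogeneous show ?case by (simp add: parity_homogeneous[where n=n] d_derivation)
next
  case (add x x')
  then show ?case by (simp add: l_distr a_ac)
qed

lemma d_parity:
  "x \<in> carrier A ==> d (parity A x) = \<ominus>\<^bsub>A\<^esub> parity A (d x)"
proof (induction rule: homogeneous_induct)
  case (homogeneous n x)
  then show ?case using d_degree[of x n]
    by (simp add: parity_homogeneous[where n=n] parity_homogeneous[where n="Suc n"] gsign_Suc gr_closed
        additive_gsign[OF A_group A_group d_additive])
next
  case (add x y)
  then show ?case by (simp add: minus_add)
qed

lemma d_scalar [simp]: "k \<in> carrier K ==> d (k \<odot>\<^bsub>A\<^esub> \<one>\<^bsub>A\<^esub>) = \<zero>\<^bsub>A\<^esub>"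
proof -
  assume k: "k \<in> carrier K"
  have "d \<one>\<^bsub>A\<^esub> = d \<one>\<^bsub>A\<^esub> \<oplus>\<^bsub>A\<^esub> d \<one>\<^bsub>A\<^esub>" using d_mult[of "\<one>\<^bsub>A\<^esub>" "\<one>\<^bsub>A\<^esub>"] by simp
  then have "d \<one>\<^bsub>A\<^esub> = \<zero>\<^bsub>A\<^esub>" by (metis add.l_cancel_one' d_closed one_closed)
  then show ?thesis using k d_linear by (simp add: linear_smult)
qed

end

section \<open>The tensor algebra of a bimodule\<close>

text \<open>A name for the exponents \<open>{1..}\<close>, whose membership simplifies to positivity.\<close>

definition positives :: "nat set" where "positives = {1..}"

lemma mem_positives [simp]: "n \<in> positives \<longleftrightarrow> 0 < n"
  by (auto simp: positives_def)

lemma additive_maps_plus: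
  assumes "abelian_group G'" "f \<in> additive_maps G G'" "g \<in> additive_maps G G'"
  shows "(%x. f x \<oplus>\<^bsub>G'\<^esub> g x) \<in> additive_maps G G'"
proof -
  interpret G': abelian_group G' by fact
  show ?thesis using assms(2,3)
    by (auto intro!: additive_mapsI simp: additive_closed additive_add G'.a_ac)
qed

lemma additive_compose:
  "g \<in> additive_maps G' G'' ==> f \<in> additive_maps G G' ==> (%x. g (f x)) \<in> additive_maps G G''"
  by (auto intro!: additive_mapsI simp: additive_closed additive_add)

lemma additive_id: "(%x. x) \<in> additive_maps G G"
  by (auto intro!: additive_mapsI)

definition word_prod :: "('b, 'n) ring_scheme \<Rightarrow> ('m \<Rightarrow> 'b) \<Rightarrow> 'm list \<Rightarrow> 'b" where
  "word_prod R \<psi> w = foldr (%m x. \<psi> m \<otimes>\<^bsub>R\<^esub> x) w \<one>\<^bsub>R\<^esub>"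

lemma word_prod_simps [simp]: "word_prod R \<psi> [] = \<one>\<^bsub>R\<^esub>" "word_prod R \<psi> (m # w) = \<psi> m \<otimes>\<^bsub>R\<^esub> word_prod R \<psi> w"
  by (simp_all add: word_prod_def)

text \<open>An operation on words induces one on classes as soon as its class is balanced as a function of the
  word. The actions on the first and last letter are instances.\<close>

lemma (in tensor_product) balanced_map_cls:
  assumes N: "0 \<notin> N" and f: "f \<in> wds \<rightarrow> wds" "(%w. cls [f w]) \<in> balanced_to TG"
    and X: "X \<in> lists wds" "Y \<in> lists wds" "cls X = cls Y"
  shows "cls (map f X) = cls (map f Y)"
proof -
  have "cls (map f X) = lsum TG (map (%w. cls [f w]) X)" if "X \<in> lists wds" for X
  proof -
    have "map f X \<in> lists wds" using that f(1) by (auto simp: Pi_iff)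
    then show ?thesis using cls_lsum[of "map f X"] by (simp add: comp_def)
  qed
  then show ?thesis using balanced_cls_eq[OF TG_group[OF N] f(2) X] X by simp
qed

lemma (in tensor_product) UN_map_cls:
  assumes "0 \<notin> N" "f \<in> wds \<rightarrow> wds" "(%w. cls [f w]) \<in> balanced_to TG" "X \<in> lists wds"
  shows "(\<Union>Y\<in>cls X. cls (map f Y)) = cls (map f X)"
  using balanced_map_cls[OF assms(1-3)] assms(4) by (intro UN_cls) blast+

lemma (in tensor_product) map_cls_additive:
  assumes N: "0 \<notin> N" and f: "f \<in> wds \<rightarrow> wds" "(%w. cls [f w]) \<in> balanced_to TG"
    and F: "\<And>X. X \<in> lists wds ==> F (cls X) = cls (map f X)"
  shows "F \<in> additive_maps TG TG"
proof -
  have m: "map f X \<in> lists wds" if "X \<in> lists wds" for X using that f(1) by (auto simp: Pi_iff)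
  show ?thesis
  proof (rule additive_mapsI)
    fix S assume "S \<in> carrier TG"
    then obtain X where X: "X \<in> lists wds" "S = cls X" by (metis TG_cases)
    show "F S \<in> carrier TG" using X F m cls_closed by metis
    fix T assume "T \<in> carrier TG"
    then obtain Y where Y: "Y \<in> lists wds" "T = cls Y" by (metis TG_cases)
    have XY: "X @ Y \<in> lists wds" using X Y by simp
    show "F (S \<oplus>\<^bsub>TG\<^esub> T) = F S \<oplus>\<^bsub>TG\<^esub> F T"
      by (simp only: X(2) Y(2) cls_add[OF X(1) Y(1)] F[OF XY] F[OF X(1)] F[OF Y(1)]
          cls_add[OF m[OF X(1)] m[OF Y(1)]] map_append)
  qed
qed

lemma submodule_iff_gr:
  assumes "module K A"
  shows "submodule B K A \<longleftrightarrow> B \<subseteq> carrier A \<and> \<zero>\<^bsub>A\<^esub> \<in> B \<and>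
    (\<forall>x\<in>B. \<forall>y\<in>B. x \<oplus>\<^bsub>A\<^esub> y \<in> B) \<and> (\<forall>k\<in>carrier K. \<forall>x\<in>B. k \<odot>\<^bsub>A\<^esub> x \<in> B)"
proof -
  interpret A: module K A by fact
  show ?thesis
  proof
    assume s: "submodule B K A"
    then have "\<zero>\<^bsub>A\<^esub> \<in> B"
      using submodule.axioms(1)[OF s] subgroup.one_closed by fastforce
    then show "B \<subseteq> carrier A \<and> \<zero>\<^bsub>A\<^esub> \<in> B \<and>
      (\<forall>x\<in>B. \<forall>y\<in>B. x \<oplus>\<^bsub>A\<^esub> y \<in> B) \<and> (\<forall>k\<in>carrier K. \<forall>x\<in>B. k \<odot>\<^bsub>A\<^esub> x \<in> B)"
      using A.submoduleE[OF s] by blast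
  next
    assume *: "B \<subseteq> carrier A \<and> \<zero>\<^bsub>A\<^esub> \<in> B \<and>
      (\<forall>x\<in>B. \<forall>y\<in>B. x \<oplus>\<^bsub>A\<^esub> y \<in> B) \<and> (\<forall>k\<in>carrier K. \<forall>x\<in>B. k \<odot>\<^bsub>A\<^esub> x \<in> B)"
    have "\<ominus>\<^bsub>A\<^esub> x = (\<ominus>\<^bsub>K\<^esub> \<one>\<^bsub>K\<^esub>) \<odot>\<^bsub>A\<^esub> x" if "x \<in> B" for x
      using that * by (subst A.smult_l_minus) auto
    then have "\<ominus>\<^bsub>A\<^esub> x \<in> B" if "x \<in> B" for x using that * by simp
    then show "submodule B K A" using * by (intro A.submoduleI) auto
  qed
qed

text \<open>The bimodules whose tensor algebra is a graded \<open>K\<close>-algebra: scalars act in the same way from both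
  sides, and the actions are compatible with the gradings.\<close>

locale algebra_bimodule = graded_algebra K A
  for K :: "('k, 'c) ring_scheme" and A :: "('k, 'a, 'm) galgebra_scheme" +
  fixes M :: "('a, 'b, 'l) gbimodule_scheme"
  assumes M_group: "abelian_group M"
    and lact_closed: "a \<in> carrier A ==> x \<in> carrier M ==> a \<odot>\<^bsub>M\<^esub> x \<in> carrier M"
    and ract_closed: "a \<in> carrier A ==> x \<in> carrier M ==> rsmult M x a \<in> carrier M"
    and lact_add_left: "a \<in> carrier A ==> b \<in> carrier A ==> x \<in> carrier M ==>
      (a \<oplus>\<^bsub>A\<^esub> b) \<odot>\<^bsub>M\<^esub> x = a \<odot>\<^bsub>M\<^esub> x \<oplus>\<^bsub>M\<^esub> b \<odot>\<^bsub>M\<^esub> x"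
    and lact_add_right: "a \<in> carrier A ==> x \<in> carrier M ==> y \<in> carrier M ==>
      a \<odot>\<^bsub>M\<^esub> (x \<oplus>\<^bsub>M\<^esub> y) = a \<odot>\<^bsub>M\<^esub> x \<oplus>\<^bsub>M\<^esub> a \<odot>\<^bsub>M\<^esub> y"
    and ract_add_left: "a \<in> carrier A ==> x \<in> carrier M ==> y \<in> carrier M ==>
      rsmult M (x \<oplus>\<^bsub>M\<^esub> y) a = rsmult M x a \<oplus>\<^bsub>M\<^esub> rsmult M y a"
    and ract_add_right: "a \<in> carrier A ==> b \<in> carrier A ==> x \<in> carrier M ==>
      rsmult M x (a \<oplus>\<^bsub>A\<^esub> b) = rsmult M x a \<oplus>\<^bsub>M\<^esub> rsmult M x b"
    and lact_mult: "a \<in> carrier A ==> b \<in> carrier A ==> x \<in> carrier M ==>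
      (a \<otimes>\<^bsub>A\<^esub> b) \<odot>\<^bsub>M\<^esub> x = a \<odot>\<^bsub>M\<^esub> (b \<odot>\<^bsub>M\<^esub> x)"
    and ract_mult: "a \<in> carrier A ==> b \<in> carrier A ==> x \<in> carrier M ==>
      rsmult M x (a \<otimes>\<^bsub>A\<^esub> b) = rsmult M (rsmult M x a) b"
    and lact_one: "x \<in> carrier M ==> \<one>\<^bsub>A\<^esub> \<odot>\<^bsub>M\<^esub> x = x"
    and ract_one: "x \<in> carrier M ==> rsmult M x \<one>\<^bsub>A\<^esub> = x"
    and lact_ract: "a \<in> carrier A ==> b \<in> carrier A ==> x \<in> carrier M ==>
      rsmult M (a \<odot>\<^bsub>M\<^esub> x) b = a \<odot>\<^bsub>M\<^esub> (rsmult M x b)"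
    and scalar_central: "k \<in> carrier K ==> x \<in> carrier M ==>
      rsmult M x (k \<odot>\<^bsub>A\<^esub> \<one>\<^bsub>A\<^esub>) = (k \<odot>\<^bsub>A\<^esub> \<one>\<^bsub>A\<^esub>) \<odot>\<^bsub>M\<^esub> x"
    and bgr_closed: "x \<in> bgr M n ==> x \<in> carrier M"
    and bgr_lact: "a \<in> gr A r ==> x \<in> bgr M n ==> a \<odot>\<^bsub>M\<^esub> x \<in> bgr M (r + n)"
    and bgr_ract: "a \<in> gr A r ==> x \<in> bgr M n ==> rsmult M x a \<in> bgr M (n + r)"
begin

sublocale T: tensor_product A M "rsmult M" positives
  by (intro tensor_product.intro M_group tensor_product_axioms.intro lact_closed ract_closed)

abbreviation "TA \<equiv> tensor_algebra A M"

lemma btensor_eq: "btensor A M = T.cls"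
  by (simp add: btensor_def positives_def fun_eq_iff)

lemma TG_group: "abelian_group T.TG" by (rule T.TG_group) simp

sublocale TG: abelian_group T.TG by (rule TG_group)

lemma tensor_add_eq: "tensor_add A M S U = S \<oplus>\<^bsub>T.TG\<^esub> U"
  by (simp add: tensor_add_def btensor_eq tensor_group_def)

lemma wordE:
  assumes "w \<in> T.wds"
  obtains x vs where "w = x # vs" "x \<in> carrier M" "vs \<in> lists (carrier M)"
  using assms by (cases w) (auto simp: words_def)

lemma word_lastE:
  assumes "w \<in> T.wds"
  obtains x vs where "w = vs @ [x]" "x \<in> carrier M" "vs \<in> lists (carrier M)"
  using assms by (cases w rule: rev_cases) (auto simp: words_def)

definition lact :: "'a \<Rightarrow> 'b list list set \<Rightarrow> 'b list list set" where "lact = tensor_lact A M"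
definition ract :: "'b list list set \<Rightarrow> 'a \<Rightarrow> 'b list list set" where "ract = tensor_ract A M"
definition tmul :: "'b list list set \<Rightarrow> 'b list list set \<Rightarrow> 'b list list set" where "tmul = tensor_mult A M"

lemma lact_balanced:
  assumes a: "a \<in> carrier A"
  shows "(%w. (a \<odot>\<^bsub>M\<^esub> hd w) # tl w) \<in> T.wds \<rightarrow> T.wds"
    "(%w. T.cls [(a \<odot>\<^bsub>M\<^esub> hd w) # tl w]) \<in> T.balanced_to T.TG"
proof -
  show 1: "(%w. (a \<odot>\<^bsub>M\<^esub> hd w) # tl w) \<in> T.wds \<rightarrow> T.wds"
    using a by (auto elim!: wordE simp: lact_closed)
  show "(%w. T.cls [(a \<odot>\<^bsub>M\<^esub> hd w) # tl w]) \<in> T.balanced_to T.TG"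
  proof (rule T.TG_balancedI)
    fix us vs x y assume *: "us @ [x] @ vs \<in> T.wds" "y \<in> carrier M" "x \<in> carrier M"
    let ?f = "%w. T.cls [(a \<odot>\<^bsub>M\<^esub> hd w) # tl w]"
    show "?f (us @ [x \<oplus>\<^bsub>M\<^esub> y] @ vs) = ?f (us @ [x] @ vs) \<oplus>\<^bsub>T.TG\<^esub> ?f (us @ [y] @ vs)"
    proof (cases us)
      case Nil
      then show ?thesis using * a T.cls_word_add[of "[]" "a \<odot>\<^bsub>M\<^esub> x" vs "a \<odot>\<^bsub>M\<^esub> y"]
        by (simp add: lact_add_right lact_closed)
    next
      case (Cons u us')
      then show ?thesis using * a T.cls_word_add[of "(a \<odot>\<^bsub>M\<^esub> u) # us'" x vs y]
        by (simp add: lact_closed)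
    qed
  next
    fix us vs x y r assume *: "us @ [x, y] @ vs \<in> T.wds" "x \<in> carrier M" "y \<in> carrier M" "r \<in> carrier A"
    let ?f = "%w. T.cls [(a \<odot>\<^bsub>M\<^esub> hd w) # tl w]"
    show "?f (us @ [rsmult M x r, y] @ vs) = ?f (us @ [x, r \<odot>\<^bsub>M\<^esub> y] @ vs)"
    proof (cases us)
      case Nil
      then show ?thesis using * a T.cls_word_balanced[of "[]" "a \<odot>\<^bsub>M\<^esub> x" y vs r]
        by (simp add: lact_ract lact_closed)
    next
      case (Cons u us')
      then show ?thesis using * a T.cls_word_balanced[of "(a \<odot>\<^bsub>M\<^esub> u) # us'" x y vs r]
        by (simp add: lact_closed)
    qed
  qed (use 1 in \<open>auto intro!: T.cls_closed\<close>)
qed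

lemma lact_cls: "a \<in> carrier A ==> X \<in> lists T.wds ==> lact a (T.cls X) = T.cls (map (%w. (a \<odot>\<^bsub>M\<^esub> hd w) # tl w) X)"
  unfolding lact_def tensor_lact_def btensor_eq using lact_balanced by (intro T.UN_map_cls) auto

lemma lact_additive: "a \<in> carrier A ==> lact a \<in> additive_maps T.TG T.TG"
  by (rule T.map_cls_additive[OF _ lact_balanced]) (auto simp: lact_cls)

lemma lact_word: "a \<in> carrier A ==> x # w \<in> T.wds ==> lact a (T.cls [x # w]) = T.cls [(a \<odot>\<^bsub>M\<^esub> x) # w]"
  by (simp add: lact_cls)

lemma ract_balanced:
  assumes a: "a \<in> carrier A"
  shows "(%w. butlast w @ [rsmult M (last w) a]) \<in> T.wds \<rightarrow> T.wds"
    "(%w. T.cls [butlast w @ [rsmult M (last w) a]]) \<in> T.balanced_to T.TG"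
proof -
  show 1: "(%w. butlast w @ [rsmult M (last w) a]) \<in> T.wds \<rightarrow> T.wds"
    using a by (auto elim!: word_lastE simp: ract_closed)
  let ?f = "%w. T.cls [butlast w @ [rsmult M (last w) a]]"
  show "?f \<in> T.balanced_to T.TG"
  proof (rule T.TG_balancedI)
    fix us vs x y assume *: "us @ [x] @ vs \<in> T.wds" "y \<in> carrier M" "x \<in> carrier M"
    show "?f (us @ [x \<oplus>\<^bsub>M\<^esub> y] @ vs) = ?f (us @ [x] @ vs) \<oplus>\<^bsub>T.TG\<^esub> ?f (us @ [y] @ vs)"
    proof (cases vs rule: rev_cases)
      case Nil
      then show ?thesis using * a T.cls_word_add[of us "rsmult M x a" "[]" "rsmult M y a"]
        by (simp add: ract_add_left ract_closed)
    next
      case (snoc vs' v)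
      then show ?thesis using * a T.cls_word_add[of us x "vs' @ [rsmult M v a]" y]
        by (simp add: ract_closed butlast_append)
    qed
  next
    fix us vs x y r assume *: "us @ [x, y] @ vs \<in> T.wds" "x \<in> carrier M" "y \<in> carrier M" "r \<in> carrier A"
    show "?f (us @ [rsmult M x r, y] @ vs) = ?f (us @ [x, r \<odot>\<^bsub>M\<^esub> y] @ vs)"
    proof (cases vs rule: rev_cases)
      case Nil
      then show ?thesis using * a T.cls_word_balanced[of us x "rsmult M y a" "[]" r]
        by (simp add: lact_ract ract_closed butlast_append)
    next
      case (snoc vs' v)
      then show ?thesis using * a T.cls_word_balanced[of us x y "vs' @ [rsmult M v a]" r]
        by (simp add: ract_closed butlast_append)
    qed
  qed (use 1 in \<open>auto intro!: T.cls_closed\<close>)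
qed

lemma ract_cls: "a \<in> carrier A ==> X \<in> lists T.wds ==> ract (T.cls X) a = T.cls (map (%w. butlast w @ [rsmult M (last w) a]) X)"
  unfolding ract_def tensor_ract_def btensor_eq using ract_balanced by (intro T.UN_map_cls) auto

lemma ract_additive: "a \<in> carrier A ==> (%S. ract S a) \<in> additive_maps T.TG T.TG"
  by (rule T.map_cls_additive[OF _ ract_balanced]) (auto simp: ract_cls)

lemma ract_word: "a \<in> carrier A ==> w @ [x] \<in> T.wds ==> ract (T.cls [w @ [x]]) a = T.cls [w @ [rsmult M x a]]"
  by (simp add: ract_cls)

lemma append_balanced:
  assumes v: "v \<in> lists (carrier M)"
  shows "(%u. T.cls [u @ v]) \<in> T.balanced_to T.TG" "(%u. T.cls [v @ u]) \<in> T.balanced_to T.TG"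
proof -
  show "(%u. T.cls [u @ v]) \<in> T.balanced_to T.TG"
  proof (rule T.TG_balancedI)
    fix us vs x y assume "us @ [x] @ vs \<in> T.wds" "y \<in> carrier M" "x \<in> carrier M"
    then show "T.cls [(us @ [x \<oplus>\<^bsub>M\<^esub> y] @ vs) @ v] = T.cls [(us @ [x] @ vs) @ v] \<oplus>\<^bsub>T.TG\<^esub> T.cls [(us @ [y] @ vs) @ v]"
      using T.cls_word_add[of us x "vs @ v" y] v by simp
  next
    fix us vs x y r assume "us @ [x, y] @ vs \<in> T.wds" "x \<in> carrier M" "y \<in> carrier M" "r \<in> carrier A"
    then show "T.cls [(us @ [rsmult M x r, y] @ vs) @ v] = T.cls [(us @ [x, r \<odot>\<^bsub>M\<^esub> y] @ vs) @ v]"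
      using T.cls_word_balanced[of us x y "vs @ v" r] v by simp
  qed (use v in \<open>auto intro!: T.cls_closed elim!: wordE\<close>)
  show "(%u. T.cls [v @ u]) \<in> T.balanced_to T.TG"
  proof (rule T.TG_balancedI)
    fix us vs x y assume "us @ [x] @ vs \<in> T.wds" "y \<in> carrier M" "x \<in> carrier M"
    then show "T.cls [v @ (us @ [x \<oplus>\<^bsub>M\<^esub> y] @ vs)] = T.cls [v @ (us @ [x] @ vs)] \<oplus>\<^bsub>T.TG\<^esub> T.cls [v @ (us @ [y] @ vs)]"
      using T.cls_word_add[of "v @ us" x vs y] v by simp
  next
    fix us vs x y r assume "us @ [x, y] @ vs \<in> T.wds" "x \<in> carrier M" "y \<in> carrier M" "r \<in> carrier A"
    then show "T.cls [v @ (us @ [rsmult M x r, y] @ vs)] = T.cls [v @ (us @ [x, r \<odot>\<^bsub>M\<^esub> y] @ vs)]"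
      using T.cls_word_balanced[of "v @ us" x y vs r] v by simp
  qed (use v in \<open>auto intro!: T.cls_closed elim!: wordE\<close>)
qed

lemma words_lists: "X \<in> lists T.wds ==> u \<in> set X ==> u \<in> lists (carrier M)"
  by (auto simp: words_def in_lists_conv_set)

lemma concat_words:
  "X \<in> lists T.wds ==> Y \<in> lists T.wds ==> [u @ v. u \<leftarrow> X, v \<leftarrow> Y] \<in> lists T.wds"
  by (fastforce simp: words_def in_lists_conv_set)

lemma concat_cls_lsum:
  assumes "X \<in> lists T.wds" "Y \<in> lists T.wds"
  shows "T.cls [u @ v. u \<leftarrow> X, v \<leftarrow> Y] = lsum T.TG (map (%u. lsum T.TG (map (%v. T.cls [u @ v]) Y)) X)"
proof -
  have c: "T.cls [u @ v] \<in> carrier T.TG" if "u \<in> set X" "v \<in> set Y" for u v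
    using that assms by (intro T.cls_closed) (auto simp: words_def in_lists_conv_set; fastforce)
  have "T.cls [u @ v. u \<leftarrow> X, v \<leftarrow> Y] = lsum T.TG (concat (map (%u. map (%v. T.cls [u @ v]) Y) X))"
    by (subst T.cls_lsum[OF concat_words[OF assms]]) (simp add: map_concat comp_def)
  also have "\<dots> = lsum T.TG (map (%u. lsum T.TG (map (%v. T.cls [u @ v]) Y)) X)"
    by (subst TG.lsum_concat) (auto simp: c)
  finally show ?thesis .
qed

lemma concat_cls_swap:
  assumes "X \<in> lists T.wds" "Y \<in> lists T.wds"
  shows "lsum T.TG (map (%u. lsum T.TG (map (%v. T.cls [u @ v]) Y)) X) =
    lsum T.TG (map (%v. lsum T.TG (map (%u. T.cls [u @ v]) X)) Y)"
  using assms by (intro TG.lsum_swap T.cls_closed) (auto simp: words_def in_lists_conv_set; fastforce)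

text \<open>Concatenation with a fixed word, on either side, is balanced. The double sum is therefore
  independent of the representative on the right, and after exchanging the summations also of the one on
  the left.\<close>

lemma concat_cls_cong:
  assumes "X \<in> lists T.wds" "Y \<in> lists T.wds" "X' \<in> lists T.wds" "Y' \<in> lists T.wds"
    "T.cls X = T.cls X'" "T.cls Y = T.cls Y'"
  shows "T.cls [u @ v. u \<leftarrow> X, v \<leftarrow> Y] = T.cls [u @ v. u \<leftarrow> X', v \<leftarrow> Y']"
proof -
  have "lsum T.TG (map (%u. lsum T.TG (map (%v. T.cls [u @ v]) Y)) X) =
      lsum T.TG (map (%u. lsum T.TG (map (%v. T.cls [u @ v]) Y')) X)"
    using assms words_lists[OF assms(1)]
    by (intro lsum_cong T.balanced_cls_eq[OF TG_group append_balanced(2)]) auto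
  also have "\<dots> = lsum T.TG (map (%v. lsum T.TG (map (%u. T.cls [u @ v]) X)) Y')"
    by (rule concat_cls_swap) fact+
  also have "\<dots> = lsum T.TG (map (%v. lsum T.TG (map (%u. T.cls [u @ v]) X')) Y')"
    using assms words_lists[OF assms(4)]
    by (intro lsum_cong T.balanced_cls_eq[OF TG_group append_balanced(1)]) auto
  also have "\<dots> = lsum T.TG (map (%u. lsum T.TG (map (%v. T.cls [u @ v]) Y')) X')"
    by (rule concat_cls_swap[symmetric]) fact+
  finally show ?thesis by (simp only: concat_cls_lsum[OF assms(1,2)] concat_cls_lsum[OF assms(3,4)])
qed

lemma tmul_cls:
  assumes "X \<in> lists T.wds" "Y \<in> lists T.wds"
  shows "tmul (T.cls X) (T.cls Y) = T.cls [u @ v. u \<leftarrow> X, v \<leftarrow> Y]"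
proof -
  have *: "(\<Union>Y'\<in>T.cls Y. T.cls [u @ v. u \<leftarrow> X', v \<leftarrow> Y']) = T.cls [u @ v. u \<leftarrow> X', v \<leftarrow> Y]"
    if "X' \<in> lists T.wds" for X'
    using concat_cls_cong that assms(2) by (intro T.UN_cls) blast+
  have "(\<Union>X'\<in>T.cls X. \<Union>Y'\<in>T.cls Y. T.cls [u @ v. u \<leftarrow> X', v \<leftarrow> Y']) =
    (\<Union>Y'\<in>T.cls Y. T.cls [u @ v. u \<leftarrow> X, v \<leftarrow> Y'])"
  proof (rule T.UN_cls[OF assms(1)])
    fix X' assume "X' \<in> lists T.wds" "T.cls X' = T.cls X"
    then show "(\<Union>Y'\<in>T.cls Y. T.cls [u @ v. u \<leftarrow> X', v \<leftarrow> Y']) = (\<Union>Y'\<in>T.cls Y. T.cls [u @ v. u \<leftarrow> X, v \<leftarrow> Y'])"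
      using assms *[of X'] *[of X] concat_cls_cong[of X' Y X Y] by simp
  qed
  then show ?thesis unfolding tmul_def tensor_mult_def btensor_eq using * assms(1) by simp
qed

lemma tmul_additive_left:
  assumes "U \<in> carrier T.TG"
  shows "(%S. tmul S U) \<in> additive_maps T.TG T.TG"
proof -
  from assms obtain Y where Y: "Y \<in> lists T.wds" "U = T.cls Y" by (metis T.TG_cases)
  show ?thesis
  proof (rule additive_mapsI)
    fix S assume "S \<in> carrier T.TG"
    then obtain X where X: "X \<in> lists T.wds" "S = T.cls X" by (metis T.TG_cases)
    show "tmul S U \<in> carrier T.TG" using X Y concat_words[OF X(1) Y(1)] by (simp only: tmul_cls T.cls_closed)
    fix S' assume "S' \<in> carrier T.TG"
    then obtain X' where X': "X' \<in> lists T.wds" "S' = T.cls X'" by (metis T.TG_cases)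
    have XX: "X @ X' \<in> lists T.wds" using X X' by simp
    show "tmul (S \<oplus>\<^bsub>T.TG\<^esub> S') U = tmul S U \<oplus>\<^bsub>T.TG\<^esub> tmul S' U"
      by (simp only: X X' Y T.cls_add[OF X(1) X'(1)] tmul_cls[OF XX Y(1)] tmul_cls[OF X(1) Y(1)]
          tmul_cls[OF X'(1) Y(1)] T.cls_add[OF concat_words[OF X(1) Y(1)] concat_words[OF X'(1) Y(1)]] map_append concat_append)
  qed
qed

lemma tmul_additive_right:
  assumes "S \<in> carrier T.TG"
  shows "tmul S \<in> additive_maps T.TG T.TG"
proof -
  from assms obtain X where X: "X \<in> lists T.wds" "S = T.cls X" by (metis T.TG_cases)
  have eq: "tmul S (T.cls Y) = lsum T.TG (map (%v. lsum T.TG (map (%u. T.cls [u @ v]) X)) Y)"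
    if "Y \<in> lists T.wds" for Y
    using that X by (simp only: tmul_cls concat_cls_lsum concat_cls_swap)
  have cl: "lsum T.TG (map (%u. T.cls [u @ v]) X) \<in> carrier T.TG" if "v \<in> lists (carrier M)" for v
    using that X by (intro TG.lsum_map_closed T.cls_closed) (auto simp: in_lists_conv_set words_def; fastforce)
  show ?thesis
  proof (rule additive_mapsI)
    fix U assume "U \<in> carrier T.TG"
    then obtain Y where Y: "Y \<in> lists T.wds" "U = T.cls Y" by (metis T.TG_cases)
    show "tmul S U \<in> carrier T.TG" using X Y concat_words[OF X(1) Y(1)] by (simp only: tmul_cls T.cls_closed)
    fix U' assume "U' \<in> carrier T.TG"
    then obtain Y' where Y': "Y' \<in> lists T.wds" "U' = T.cls Y'" by (metis T.TG_cases)
    have YY: "Y @ Y' \<in> lists T.wds" using Y Y' by simp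
    show "tmul S (U \<oplus>\<^bsub>T.TG\<^esub> U') = tmul S U \<oplus>\<^bsub>T.TG\<^esub> tmul S U'"
      using words_lists[OF Y(1)] words_lists[OF Y'(1)] cl
      by (simp only: Y Y' T.cls_add[OF Y(1) Y'(1)] eq[OF YY] eq[OF Y(1)] eq[OF Y'(1)] map_append)
        (intro TG.lsum_append; auto)
  qed
qed

lemma tmul_word: "u \<in> T.wds ==> v \<in> T.wds ==> tmul (T.cls [u]) (T.cls [v]) = T.cls [u @ v]"
  by (simp add: tmul_cls)

lemma lact_TG [simp]: "a \<in> carrier A ==> S \<in> carrier T.TG ==> lact a S \<in> carrier T.TG"
  by (rule additive_closed[OF lact_additive])
lemma ract_TG [simp]: "a \<in> carrier A ==> S \<in> carrier T.TG ==> ract S a \<in> carrier T.TG"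
  by (rule additive_closed[OF ract_additive])
lemma tmul_TG [simp]: "S \<in> carrier T.TG ==> U \<in> carrier T.TG ==> tmul S U \<in> carrier T.TG"
  by (rule additive_closed[OF tmul_additive_right])

lemma word_cls_closed [simp]: "w \<in> T.wds ==> T.cls [w] \<in> carrier T.TG"
  by (rule T.cls_closed) simp

lemma append_wds: "u \<in> T.wds ==> v \<in> T.wds ==> u @ v \<in> T.wds"
  by (auto simp: words_def)

text \<open>The compatibilities of the two actions and the product are additive in each argument, so it
  suffices to compare words.\<close>

lemma TG_eqI:
  assumes "S \<in> carrier T.TG" "f \<in> additive_maps T.TG T.TG" "g \<in> additive_maps T.TG T.TG"
    "\<And>w. w \<in> T.wds ==> f (T.cls [w]) = g (T.cls [w])"
  shows "f S = g S"
  by (rule T.TG_ext[OF _ TG_group assms(2,3,4,1)]) auto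

lemmas additive_rules = additive_id additive_maps_plus[OF TG_group] additive_compose[OF lact_additive]
  additive_compose[OF ract_additive] additive_compose[OF tmul_additive_left] additive_compose[OF tmul_additive_right]

lemma lact_mult_TG: "a \<in> carrier A ==> b \<in> carrier A ==> S \<in> carrier T.TG ==> lact (a \<otimes>\<^bsub>A\<^esub> b) S = lact a (lact b S)"
  by (erule TG_eqI[where S=S]; (intro additive_rules)?; (elim wordE)?; simp add: lact_word lact_mult lact_closed)

lemma ract_mult_TG: "a \<in> carrier A ==> b \<in> carrier A ==> S \<in> carrier T.TG ==> ract S (a \<otimes>\<^bsub>A\<^esub> b) = ract (ract S a) b"
  by (erule TG_eqI[where S=S]; (intro additive_rules)?; (elim word_lastE)?; simp add: ract_word ract_mult ract_closed)

lemma lact_one_TG: "S \<in> carrier T.TG ==> lact \<one>\<^bsub>A\<^esub> S = S"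
  by (erule TG_eqI[where S=S]; (intro additive_rules)?; (elim wordE)?; simp add: lact_word lact_one)

lemma ract_one_TG: "S \<in> carrier T.TG ==> ract S \<one>\<^bsub>A\<^esub> = S"
  by (erule TG_eqI[where S=S]; (intro additive_rules)?; (elim word_lastE)?; simp add: ract_word ract_one)

lemma lact_add_TG:
  "a \<in> carrier A ==> b \<in> carrier A ==> S \<in> carrier T.TG ==> lact (a \<oplus>\<^bsub>A\<^esub> b) S = lact a S \<oplus>\<^bsub>T.TG\<^esub> lact b S"
proof (erule TG_eqI[where S=S]; (intro additive_rules)?)
  fix w assume ab: "a \<in> carrier A" "b \<in> carrier A" and "w \<in> T.wds"
  then obtain x vs where "w = x # vs" "x \<in> carrier M" "vs \<in> lists (carrier M)" by (elim wordE)
  then show "lact (a \<oplus>\<^bsub>A\<^esub> b) (T.cls [w]) = lact a (T.cls [w]) \<oplus>\<^bsub>T.TG\<^esub> lact b (T.cls [w])"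
    using ab T.cls_word_add[of "[]" "a \<odot>\<^bsub>M\<^esub> x" vs "b \<odot>\<^bsub>M\<^esub> x"] by (simp add: lact_word lact_add_left lact_closed)
qed auto

lemma ract_add_TG:
  "a \<in> carrier A ==> b \<in> carrier A ==> S \<in> carrier T.TG ==> ract S (a \<oplus>\<^bsub>A\<^esub> b) = ract S a \<oplus>\<^bsub>T.TG\<^esub> ract S b"
proof (erule TG_eqI[where S=S]; (intro additive_rules)?)
  fix w assume ab: "a \<in> carrier A" "b \<in> carrier A" and "w \<in> T.wds"
  then obtain x vs where "w = vs @ [x]" "x \<in> carrier M" "vs \<in> lists (carrier M)" by (elim word_lastE)
  then show "ract (T.cls [w]) (a \<oplus>\<^bsub>A\<^esub> b) = ract (T.cls [w]) a \<oplus>\<^bsub>T.TG\<^esub> ract (T.cls [w]) b"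
    using ab T.cls_word_add[of vs "rsmult M x a" "[]" "rsmult M x b"] by (simp add: ract_word ract_add_right ract_closed)
qed auto

lemma lact_ract_TG: "a \<in> carrier A ==> b \<in> carrier A ==> S \<in> carrier T.TG ==> ract (lact a S) b = lact a (ract S b)"
proof (erule TG_eqI[where S=S]; (intro additive_rules)?)
  fix w assume ab: "a \<in> carrier A" "b \<in> carrier A" and "w \<in> T.wds"
  then obtain x vs where w: "w = x # vs" "x \<in> carrier M" "vs \<in> lists (carrier M)" by (elim wordE)
  show "ract (lact a (T.cls [w])) b = lact a (ract (T.cls [w]) b)"
  proof (cases vs rule: rev_cases)
    case Nil
    then show ?thesis using w ab ract_word[of b "[]"] by (simp add: lact_word lact_ract lact_closed ract_closed)
  next
    case (snoc us y)
    then show ?thesis using w ab ract_word[of b "x # us" y] ract_word[of b "(a \<odot>\<^bsub>M\<^esub> x) # us" y]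
      by (simp add: lact_word lact_closed ract_closed)
  qed
qed auto

lemma tmul_lact: "a \<in> carrier A ==> S \<in> carrier T.TG ==> U \<in> carrier T.TG ==> tmul (lact a S) U = lact a (tmul S U)"
proof (erule TG_eqI[where S=S]; (intro additive_rules)?)
  fix w assume a: "a \<in> carrier A" and U: "U \<in> carrier T.TG" and w: "w \<in> T.wds"
  from U show "tmul (lact a (T.cls [w])) U = lact a (tmul (T.cls [w]) U)"
  proof (rule TG_eqI; (intro additive_rules)?)
    fix v assume "v \<in> T.wds"
    moreover obtain x us where "w = x # us" "x \<in> carrier M" "us \<in> lists (carrier M)" using w by (rule wordE)
    ultimately show "tmul (lact a (T.cls [w])) (T.cls [v]) = lact a (tmul (T.cls [w]) (T.cls [v]))"
      using a by (simp add: lact_word tmul_word lact_closed append_wds words_def)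
  qed (use w a in auto)
qed auto

lemma tmul_ract: "a \<in> carrier A ==> S \<in> carrier T.TG ==> U \<in> carrier T.TG ==> ract (tmul S U) a = tmul S (ract U a)"
proof (erule TG_eqI[where S=S]; (intro additive_rules)?)
  fix w assume a: "a \<in> carrier A" and U: "U \<in> carrier T.TG" and w: "w \<in> T.wds"
  from U show "ract (tmul (T.cls [w]) U) a = tmul (T.cls [w]) (ract U a)"
  proof (rule TG_eqI; (intro additive_rules)?)
    fix v assume "v \<in> T.wds"
    then obtain x vs where "v = vs @ [x]" "x \<in> carrier M" "vs \<in> lists (carrier M)" by (elim word_lastE)
    then show "ract (tmul (T.cls [w]) (T.cls [v])) a = tmul (T.cls [w]) (ract (T.cls [v]) a)"
      using w a ract_word[of a "w @ vs" x] by (simp add: ract_word tmul_word ract_closed) (auto simp: words_def)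
  qed (use w a in auto)
qed auto

lemma tmul_balanced: "a \<in> carrier A ==> S \<in> carrier T.TG ==> U \<in> carrier T.TG ==> tmul (ract S a) U = tmul S (lact a U)"
proof (erule TG_eqI[where S=S]; (intro additive_rules)?)
  fix w assume a: "a \<in> carrier A" and U: "U \<in> carrier T.TG" and w: "w \<in> T.wds"
  then obtain x us where x: "w = us @ [x]" "x \<in> carrier M" "us \<in> lists (carrier M)" by (elim word_lastE)
  from U show "tmul (ract (T.cls [w]) a) U = tmul (T.cls [w]) (lact a U)"
  proof (rule TG_eqI; (intro additive_rules)?)
    fix v assume "v \<in> T.wds"
    then obtain y vs where "v = y # vs" "y \<in> carrier M" "vs \<in> lists (carrier M)" by (elim wordE)
    then show "tmul (ract (T.cls [w]) a) (T.cls [v]) = tmul (T.cls [w]) (lact a (T.cls [v]))"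
      using x a T.cls_word_balanced[of us x y vs a] by (simp add: ract_word lact_word tmul_word ract_closed lact_closed)
  qed (use w a in auto)
qed auto

lemma tmul_assoc: "S \<in> carrier T.TG ==> U \<in> carrier T.TG ==> V \<in> carrier T.TG ==> tmul (tmul S U) V = tmul S (tmul U V)"
proof (erule TG_eqI[where S=S]; (intro additive_rules)?)
  fix u assume U: "U \<in> carrier T.TG" and V: "V \<in> carrier T.TG" and u: "u \<in> T.wds"
  from U show "tmul (tmul (T.cls [u]) U) V = tmul (T.cls [u]) (tmul U V)"
  proof (rule TG_eqI; (intro additive_rules)?)
    fix v assume v: "v \<in> T.wds"
    from V show "tmul (tmul (T.cls [u]) (T.cls [v])) V = tmul (T.cls [u]) (tmul (T.cls [v]) V)"
      by (rule TG_eqI; (intro additive_rules)?) (use u v in \<open>simp_all add: tmul_word append_wds del: words_append\<close>)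
  qed (use u V in auto)
qed auto

text \<open>The scalar acting on the last letter is moved to the first one through the word, letter by letter,
  by centrality on \<open>M\<close> and balancedness.\<close>

lemma scalar_central_TG:
  assumes k: "k \<in> carrier K" and S: "S \<in> carrier T.TG"
  shows "ract S (k \<odot>\<^bsub>A\<^esub> \<one>\<^bsub>A\<^esub>) = lact (k \<odot>\<^bsub>A\<^esub> \<one>\<^bsub>A\<^esub>) S"
proof -
  let ?k = "k \<odot>\<^bsub>A\<^esub> \<one>\<^bsub>A\<^esub>"
  have kc: "?k \<in> carrier A" using k by simp
  have w: "ract (T.cls [x # vs]) ?k = lact ?k (T.cls [x # vs])" if "x \<in> carrier M" "vs \<in> lists (carrier M)" for x vs
    using that
  proof (induction vs arbitrary: x)
    case Nil
    then show ?case using k kc ract_word[of ?k "[]" x] by (simp add: lact_word scalar_central)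
  next
    case (Cons y vs)
    have "ract (T.cls [x # y # vs]) ?k = ract (tmul (T.cls [[x]]) (T.cls [y # vs])) ?k"
      using Cons by (simp add: tmul_word)
    also have "\<dots> = tmul (T.cls [[x]]) (lact ?k (T.cls [y # vs]))"
      using Cons kc by (simp add: tmul_ract)
    also have "\<dots> = tmul (ract (T.cls [[x]]) ?k) (T.cls [y # vs])"
      using Cons kc by (simp add: tmul_balanced)
    also have "\<dots> = tmul (lact ?k (T.cls [[x]])) (T.cls [y # vs])"
      using Cons k kc ract_word[of ?k "[]" x] by (simp add: lact_word scalar_central)
    also have "\<dots> = lact ?k (T.cls [x # y # vs])"
      using Cons kc by (simp add: tmul_lact tmul_word)
    finally show ?case .
  qed
  from S show ?thesis
    by (rule TG_eqI; (intro additive_rules)?; (elim wordE)?; simp add: w kc)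
qed

lemmas TG_distrib = additive_add[OF lact_additive] additive_add[OF ract_additive] additive_add[OF tmul_additive_left]
  additive_add[OF tmul_additive_right]

lemmas TG_zeros = additive_zero[OF TG_group TG_group lact_additive] additive_zero[OF TG_group TG_group ract_additive]
  additive_zero[OF TG_group TG_group tmul_additive_left] additive_zero[OF TG_group TG_group tmul_additive_right]

lemma lact_zero_TG: "S \<in> carrier T.TG ==> lact \<zero>\<^bsub>A\<^esub> S = \<zero>\<^bsub>T.TG\<^esub>"
proof -
  assume S: "S \<in> carrier T.TG"
  have "(%a. lact a S) \<in> additive_maps A T.TG" by (auto intro!: additive_mapsI simp: S lact_add_TG)
  then show ?thesis by (rule additive_zero[OF A_group TG_group])
qed

lemma ract_zero_TG: "S \<in> carrier T.TG ==> ract S \<zero>\<^bsub>A\<^esub> = \<zero>\<^bsub>T.TG\<^esub>"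
proof -
  assume S: "S \<in> carrier T.TG"
  have "(%a. ract S a) \<in> additive_maps A T.TG" by (auto intro!: additive_mapsI simp: S ract_add_TG)
  then show ?thesis by (rule additive_zero[OF A_group TG_group])
qed

lemma TA_carrier: "carrier TA = carrier A \<times> carrier T.TG"
  by (simp add: tensor_algebra_def T.TG_carrier btensor_eq positives_def[symmetric] del: One_nat_def)

lemma TA_simps:
  "(a, S) \<otimes>\<^bsub>TA\<^esub> (b, U) = (a \<otimes>\<^bsub>A\<^esub> b, lact a U \<oplus>\<^bsub>T.TG\<^esub> ract S b \<oplus>\<^bsub>T.TG\<^esub> tmul S U)"
  "(a, S) \<oplus>\<^bsub>TA\<^esub> (b, U) = (a \<oplus>\<^bsub>A\<^esub> b, S \<oplus>\<^bsub>T.TG\<^esub> U)"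
  "\<one>\<^bsub>TA\<^esub> = (\<one>\<^bsub>A\<^esub>, \<zero>\<^bsub>T.TG\<^esub>)" "\<zero>\<^bsub>TA\<^esub> = (\<zero>\<^bsub>A\<^esub>, \<zero>\<^bsub>T.TG\<^esub>)"
  "k \<odot>\<^bsub>TA\<^esub> (a, S) = (k \<odot>\<^bsub>A\<^esub> a, lact (k \<odot>\<^bsub>A\<^esub> \<one>\<^bsub>A\<^esub>) S)"
  by (simp_all add: tensor_algebra_def tensor_add_eq lact_def ract_def tmul_def T.TG_zero btensor_eq)

lemma TA_group: "abelian_group TA"
proof (rule abelian_groupI)
  fix x assume "x \<in> carrier TA"
  then show "\<exists>y\<in>carrier TA. y \<oplus>\<^bsub>TA\<^esub> x = \<zero>\<^bsub>TA\<^esub>"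
    by (intro bexI[of _ "(\<ominus>\<^bsub>A\<^esub> fst x, \<ominus>\<^bsub>T.TG\<^esub> snd x)"]) (auto simp: TA_carrier TA_simps l_neg TG.l_neg)
qed (auto simp: TA_carrier TA_simps a_ac TG.a_ac)

lemma TA_ring: "ring TA"
proof (rule ringI[OF TA_group])
  show "monoid TA"
    by (rule monoidI)
      (auto simp: TA_carrier TA_simps m_assoc TG_distrib TG_zeros lact_mult_TG ract_mult_TG lact_one_TG
        ract_one_TG lact_zero_TG ract_zero_TG lact_ract_TG tmul_lact tmul_ract tmul_balanced tmul_assoc TG.a_ac)
qed (auto simp: TA_carrier TA_simps l_distr r_distr TG_distrib lact_add_TG ract_add_TG TG.a_ac)

lemma TA_module: "module K TA"
proof (rule moduleI[OF _ TA_group])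
  fix k l x assume "k \<in> carrier K" "l \<in> carrier K" "x \<in> carrier TA"
  moreover have "(k \<otimes>\<^bsub>K\<^esub> l) \<odot>\<^bsub>A\<^esub> \<one>\<^bsub>A\<^esub> = (k \<odot>\<^bsub>A\<^esub> \<one>\<^bsub>A\<^esub>) \<otimes>\<^bsub>A\<^esub> (l \<odot>\<^bsub>A\<^esub> \<one>\<^bsub>A\<^esub>)" if "k \<in> carrier K" "l \<in> carrier K"
    using that by (simp add: smult_mult_left smult_assoc1)
  ultimately show "(k \<otimes>\<^bsub>K\<^esub> l) \<odot>\<^bsub>TA\<^esub> x = k \<odot>\<^bsub>TA\<^esub> (l \<odot>\<^bsub>TA\<^esub> x)"
    by (auto simp: TA_carrier TA_simps smult_assoc1 lact_mult_TG[symmetric])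
qed (auto simp: TA_carrier TA_simps smult_l_distr smult_r_distr TG_distrib lact_add_TG lact_one_TG intro: R.is_cring)

lemma TA_algebra: "assoc_algebra K TA"
proof (intro assoc_algebra.intro assoc_algebra_axioms.intro TA_module TA_ring)
  show "field K" by unfold_locales
  fix k x y assume k: "k \<in> carrier K" and xy: "x \<in> carrier TA" "y \<in> carrier TA"
  obtain a S b U where [simp]: "x = (a, S)" "y = (b, U)" by fastforce
  have c: "a \<in> carrier A" "b \<in> carrier A" "S \<in> carrier T.TG" "U \<in> carrier T.TG"
    using xy by (auto simp: TA_carrier)
  let ?k = "k \<odot>\<^bsub>A\<^esub> \<one>\<^bsub>A\<^esub>"
  have kb: "k \<odot>\<^bsub>A\<^esub> b = ?k \<otimes>\<^bsub>A\<^esub> b" "k \<odot>\<^bsub>A\<^esub> a = ?k \<otimes>\<^bsub>A\<^esub> a" "a \<otimes>\<^bsub>A\<^esub> ?k = ?k \<otimes>\<^bsub>A\<^esub> a"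
    using k c by (simp_all add: smult_mult_left smult_mult_right)
  have kc: "?k \<in> carrier A" using k by simp
  have "lact (k \<odot>\<^bsub>A\<^esub> a) U = lact ?k (lact a U)"
    using c kc by (simp only: kb(2) lact_mult_TG)
  then show "k \<odot>\<^bsub>TA\<^esub> x \<otimes>\<^bsub>TA\<^esub> y = k \<odot>\<^bsub>TA\<^esub> (x \<otimes>\<^bsub>TA\<^esub> y)"
    using k kc c by (simp add: TA_simps smult_mult_left TG_distrib lact_ract_TG tmul_lact)
  have "lact a (lact ?k U) = lact ?k (lact a U)"
    using c kc kb(3) by (simp flip: lact_mult_TG)
  moreover have "ract S (k \<odot>\<^bsub>A\<^esub> b) = lact ?k (ract S b)"
    using c kc k by (simp add: kb(1) ract_mult_TG scalar_central_TG lact_ract_TG)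
  moreover have "tmul S (lact ?k U) = lact ?k (tmul S U)"
    using c kc k by (simp add: tmul_balanced[symmetric] scalar_central_TG tmul_lact)
  ultimately show "x \<otimes>\<^bsub>TA\<^esub> (k \<odot>\<^bsub>TA\<^esub> y) = k \<odot>\<^bsub>TA\<^esub> (x \<otimes>\<^bsub>TA\<^esub> y)"
    using k kc c by (simp add: TA_simps smult_mult_right TG_distrib)
qed

end

lemma ring_hom_additive: "f \<in> ring_hom R S ==> f \<in> additive_maps R S"
  by (auto simp: ring_hom_def additive_maps_def)

lemma list_all2_snocE:
  assumes "list_all2 P (xs @ [x]) zs"
  obtains ys y where "zs = ys @ [y]" "list_all2 P xs ys" "P x y"
  using assms by (auto simp: list_all2_append1 list_all2_Cons1)

context algebra_bimodule
begin

lemma letter_additive: "(%m. T.cls [[m]]) \<in> additive_maps M T.TG"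
proof (rule additive_mapsI)
  fix x y assume "x \<in> carrier M" "y \<in> carrier M"
  then show "T.cls [[x \<oplus>\<^bsub>M\<^esub> y]] = T.cls [[x]] \<oplus>\<^bsub>T.TG\<^esub> T.cls [[y]]"
    using T.cls_word_add[of "[]" x "[]" y] by simp
qed simp

text \<open>The extension sends a word to the product of the values of its letters. This is balanced over \<open>A\<close>,
  since \<open>\<psi>\<close> is compatible with both actions, and multiplicative, since the product in the tensor
  algebra is concatenation.\<close>

lemma tensor_hom_exists:
  assumes R: "ring R" and \<phi>: "\<phi> \<in> ring_hom A R" and \<psi>: "\<psi> \<in> additive_maps M R"
    and left: "\<And>a x. a \<in> carrier A ==> x \<in> carrier M ==> \<psi> (a \<odot>\<^bsub>M\<^esub> x) = \<phi> a \<otimes>\<^bsub>R\<^esub> \<psi> x"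
    and right: "\<And>a x. a \<in> carrier A ==> x \<in> carrier M ==> \<psi> (rsmult M x a) = \<psi> x \<otimes>\<^bsub>R\<^esub> \<phi> a"
  shows "\<exists>f. f \<in> ring_hom TA R \<and> (\<forall>a\<in>carrier A. f (a, \<zero>\<^bsub>T.TG\<^esub>) = \<phi> a) \<and>
    (\<forall>x\<in>carrier M. f (\<zero>\<^bsub>A\<^esub>, T.cls [[x]]) = \<psi> x)"
proof -
  interpret R: ring R by fact
  let ?p = "word_prod R \<psi>"
  have \<psi>c [simp]: "x \<in> carrier M ==> \<psi> x \<in> carrier R" for x using \<psi> by (rule additive_closed)
  have \<phi>c [simp]: "a \<in> carrier A ==> \<phi> a \<in> carrier R" for a using \<phi> by (rule ring_hom_closed)
  have pc [simp]: "w \<in> lists (carrier M) ==> ?p w \<in> carrier R" for w by (induction w) auto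
  have p_append: "u \<in> lists (carrier M) ==> v \<in> lists (carrier M) ==> ?p (u @ v) = ?p u \<otimes>\<^bsub>R\<^esub> ?p v" for u v
    by (induction u) (auto simp: R.m_assoc)
  have wl: "w \<in> T.wds ==> w \<in> lists (carrier M)" for w by (simp add: words_def)
  have bal: "?p \<in> T.balanced_to R"
  proof (rule T.TG_balancedI)
    fix us vs x y assume "us @ [x] @ vs \<in> T.wds" "y \<in> carrier M" "x \<in> carrier M"
    then show "?p (us @ [x \<oplus>\<^bsub>M\<^esub> y] @ vs) = ?p (us @ [x] @ vs) \<oplus>\<^bsub>R\<^esub> ?p (us @ [y] @ vs)"
      by (simp add: p_append additive_add[OF \<psi>] R.l_distr R.r_distr)
  next
    fix us vs x y r assume "us @ [x, y] @ vs \<in> T.wds" "x \<in> carrier M" "y \<in> carrier M" "r \<in> carrier A"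
    then show "?p (us @ [rsmult M x r, y] @ vs) = ?p (us @ [x, r \<odot>\<^bsub>M\<^esub> y] @ vs)"
      by (simp add: p_append left right lact_closed ract_closed R.m_assoc)
  qed (simp add: wl)
  have RG: "abelian_group R" by unfold_locales
  define L where "L = tensor_lift R ?p"
  have L: "L \<in> additive_maps T.TG R" unfolding L_def by (rule T.lift_additive[OF RG bal])
  have Lc [simp]: "S \<in> carrier T.TG ==> L S \<in> carrier R" for S using L by (rule additive_closed)
  have Lw: "w \<in> T.wds ==> L (T.cls [w]) = ?p w" for w
    unfolding L_def using T.lift_cls[OF RG bal, of "[w]"] wl by simp
  have ext: "f S = g S" if "S \<in> carrier T.TG" "f \<in> additive_maps T.TG R" "g \<in> additive_maps T.TG R"
    "\<And>w. w \<in> T.wds ==> f (T.cls [w]) = g (T.cls [w])" for S f g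
    by (rule T.TG_ext[OF _ RG that(2,3,4,1)]) auto
  have lm: "(%x. c \<otimes>\<^bsub>R\<^esub> x) \<in> additive_maps R R" "(%x. x \<otimes>\<^bsub>R\<^esub> c) \<in> additive_maps R R" if "c \<in> carrier R" for c
    using that by (auto intro!: additive_mapsI simp: R.l_distr R.r_distr)
  have L1: "L (lact a S) = \<phi> a \<otimes>\<^bsub>R\<^esub> L S" if "a \<in> carrier A" "S \<in> carrier T.TG" for a S
  proof (rule ext[OF that(2) additive_compose[OF L lact_additive[OF that(1)]] additive_compose[OF lm(1) L]])
    fix w assume "w \<in> T.wds"
    then show "L (lact a (T.cls [w])) = \<phi> a \<otimes>\<^bsub>R\<^esub> L (T.cls [w])"
      using that(1) by (elim wordE) (simp add: lact_word Lw lact_closed left R.m_assoc)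
  qed (use that in simp)
  have L2: "L (ract S a) = L S \<otimes>\<^bsub>R\<^esub> \<phi> a" if "a \<in> carrier A" "S \<in> carrier T.TG" for a S
  proof (rule ext[OF that(2) additive_compose[OF L ract_additive[OF that(1)]] additive_compose[OF lm(2) L]])
    fix w assume "w \<in> T.wds"
    then show "L (ract (T.cls [w]) a) = L (T.cls [w]) \<otimes>\<^bsub>R\<^esub> \<phi> a"
      using that(1) by (elim word_lastE) (simp add: ract_word Lw ract_closed right p_append R.m_assoc)
  qed (use that in simp)
  have L3: "L (tmul S U) = L S \<otimes>\<^bsub>R\<^esub> L U" if "S \<in> carrier T.TG" "U \<in> carrier T.TG" for S U
  proof (rule ext[OF that(1) additive_compose[OF L tmul_additive_left[OF that(2)]] additive_compose[OF lm(2) L]])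
    fix u assume u: "u \<in> T.wds"
    then have uc: "T.cls [u] \<in> carrier T.TG" by simp
    show "L (tmul (T.cls [u]) U) = L (T.cls [u]) \<otimes>\<^bsub>R\<^esub> L U"
    proof (rule ext[OF that(2) additive_compose[OF L tmul_additive_right[OF uc]] additive_compose[OF lm(1) L]])
      fix v assume "v \<in> T.wds"
      then show "L (tmul (T.cls [u]) (T.cls [v])) = L (T.cls [u]) \<otimes>\<^bsub>R\<^esub> L (T.cls [v])"
        using u by (simp add: tmul_word Lw p_append wl append_wds del: words_append)
    qed (use uc in simp)
  qed (use that in simp)
  define f where "f x = \<phi> (fst x) \<oplus>\<^bsub>R\<^esub> L (snd x)" for x
  have "f \<in> ring_hom TA R"
  proof (rule ring_hom_memI)
    fix x assume "x \<in> carrier TA"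
    then obtain a S where x: "x = (a, S)" "a \<in> carrier A" "S \<in> carrier T.TG" by (auto simp: TA_carrier)
    show "f x \<in> carrier R" using x by (simp add: f_def)
    fix y assume "y \<in> carrier TA"
    then obtain b U where y: "y = (b, U)" "b \<in> carrier A" "U \<in> carrier T.TG" by (auto simp: TA_carrier)
    show "f (x \<otimes>\<^bsub>TA\<^esub> y) = f x \<otimes>\<^bsub>R\<^esub> f y"
      using x y by (simp add: f_def TA_simps ring_hom_mult[OF \<phi>] additive_add[OF L] L1 L2 L3 R.l_distr R.r_distr R.a_ac)
    show "f (x \<oplus>\<^bsub>TA\<^esub> y) = f x \<oplus>\<^bsub>R\<^esub> f y"
      using x y by (simp add: f_def TA_simps ring_hom_add[OF \<phi>] additive_add[OF L] R.a_ac)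
  next
    show "f \<one>\<^bsub>TA\<^esub> = \<one>\<^bsub>R\<^esub>"
      by (simp add: f_def TA_simps ring_hom_one[OF \<phi>] additive_zero[OF TG_group RG L])
  qed
  moreover have "f (a, \<zero>\<^bsub>T.TG\<^esub>) = \<phi> a" if "a \<in> carrier A" for a
    using that by (simp add: f_def additive_zero[OF TG_group RG L])
  moreover have "f (\<zero>\<^bsub>A\<^esub>, T.cls [[x]]) = \<psi> x" if "x \<in> carrier M" for x
    using that by (simp add: f_def Lw ring_hom_zero[OF \<phi> A_ring R])
  ultimately show ?thesis by blast
qed

definition TG_gr :: "nat \<Rightarrow> 'b list list set set" where
  "TG_gr n = T.cls ` lists {w \<in> T.wds. word_degree M w n}"

lemma TA_gr: "gr TA n = gr A n \<times> TG_gr n"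
  by (simp add: tensor_algebra_def TG_gr_def btensor_eq positives_def[symmetric] del: One_nat_def)

lemma TG_grE:
  assumes "S \<in> TG_gr n"
  obtains X where "S = T.cls X" "X \<in> lists T.wds" "\<And>w. w \<in> set X ==> word_degree M w n"
  using assms by (auto simp: TG_gr_def in_lists_conv_set)

lemma TG_grI: "X \<in> lists T.wds ==> (\<And>w. w \<in> set X ==> word_degree M w n) ==> T.cls X \<in> TG_gr n"
  by (auto simp: TG_gr_def in_lists_conv_set)

lemma TG_gr_closed: "S \<in> TG_gr n ==> S \<in> carrier T.TG"
  by (elim TG_grE) (simp add: T.cls_closed)

lemma TG_gr_zero [simp]: "\<zero>\<^bsub>T.TG\<^esub> \<in> TG_gr n"
  using TG_grI[of "[]"] by (simp add: T.TG_zero)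

lemma TG_gr_add: "S \<in> TG_gr n ==> U \<in> TG_gr n ==> S \<oplus>\<^bsub>T.TG\<^esub> U \<in> TG_gr n"
proof (elim TG_grE)
  fix X Y assume "S = T.cls X" "U = T.cls Y" "X \<in> lists T.wds" "Y \<in> lists T.wds"
    "\<And>w. w \<in> set X ==> word_degree M w n" "\<And>w. w \<in> set Y ==> word_degree M w n"
  then show ?thesis using TG_grI[of "X @ Y" n] by (auto simp: T.cls_add)
qed

lemma word_degree_lact:
  assumes "a \<in> gr A r" "w \<in> T.wds" "word_degree M w n"
  shows "word_degree M ((a \<odot>\<^bsub>M\<^esub> hd w) # tl w) (r + n)"
  using assms(2)
proof (rule wordE)
  fix x vs assume w: "w = x # vs"
  with assms(3) obtain k ks where "list_all2 (%m k. m \<in> bgr M k) vs ks" "x \<in> bgr M k" "k + sum_list ks = n"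
    by (auto simp: word_degree_def list_all2_Cons1)
  then show ?thesis unfolding word_degree_def using w assms(1)
    by (intro exI[of _ "(r + k) # ks"]) (auto simp: bgr_lact)
qed

lemma word_degree_ract:
  assumes "a \<in> gr A r" "w \<in> T.wds" "word_degree M w n"
  shows "word_degree M (butlast w @ [rsmult M (last w) a]) (n + r)"
  using assms(2)
proof (rule word_lastE)
  fix x vs assume w: "w = vs @ [x]"
  with assms(3) obtain ks' where "list_all2 (%m k. m \<in> bgr M k) (vs @ [x]) ks'" "sum_list ks' = n"
    by (auto simp: word_degree_def)
  then obtain ks k where "list_all2 (%m k. m \<in> bgr M k) vs ks" "x \<in> bgr M k" "sum_list ks + k = n"
    by (elim list_all2_snocE) auto
  then show ?thesis unfolding word_degree_def using w assms(1)
    by (intro exI[of _ "ks @ [k + r]"]) (auto simp: bgr_ract list_all2_appendI)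
qed

lemma word_degree_append: "word_degree M u m ==> word_degree M v n ==> word_degree M (u @ v) (m + n)"
  unfolding word_degree_def by (metis list_all2_appendI sum_list_append)

lemma TG_gr_lact:
  assumes a: "a \<in> gr A r" and S: "S \<in> TG_gr n"
  shows "lact a S \<in> TG_gr (r + n)"
proof -
  have ac: "a \<in> carrier A" using a by (rule gr_closed)
  obtain X where X: "S = T.cls X" "X \<in> lists T.wds" "\<And>w. w \<in> set X ==> word_degree M w n" using S by (elim TG_grE) blast
  have "T.cls (map (%w. (a \<odot>\<^bsub>M\<^esub> hd w) # tl w) X) \<in> TG_gr (r + n)"
    using X(2,3) lact_balanced(1)[OF ac] word_degree_lact[OF a] by (intro TG_grI) (auto simp: in_lists_conv_set Pi_iff)
  then show ?thesis using X ac by (simp add: lact_cls)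
qed

lemma TG_gr_ract:
  assumes a: "a \<in> gr A r" and S: "S \<in> TG_gr n"
  shows "ract S a \<in> TG_gr (n + r)"
proof -
  have ac: "a \<in> carrier A" using a by (rule gr_closed)
  obtain X where X: "S = T.cls X" "X \<in> lists T.wds" "\<And>w. w \<in> set X ==> word_degree M w n" using S by (elim TG_grE) blast
  have "T.cls (map (%w. butlast w @ [rsmult M (last w) a]) X) \<in> TG_gr (n + r)"
    using X(2,3) ract_balanced(1)[OF ac] word_degree_ract[OF a] by (intro TG_grI) (auto simp: in_lists_conv_set Pi_iff)
  then show ?thesis using X ac by (simp add: ract_cls)
qed

lemma TG_gr_tmul:
  assumes "S \<in> TG_gr m" "U \<in> TG_gr n"
  shows "tmul S U \<in> TG_gr (m + n)"
proof -
  obtain X where X: "S = T.cls X" "X \<in> lists T.wds" "\<And>w. w \<in> set X ==> word_degree M w m" using assms(1) by (elim TG_grE) blast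
  obtain Y where Y: "U = T.cls Y" "Y \<in> lists T.wds" "\<And>w. w \<in> set Y ==> word_degree M w n" using assms(2) by (elim TG_grE) blast
  have "T.cls [u @ v. u \<leftarrow> X, v \<leftarrow> Y] \<in> TG_gr (m + n)"
    using X Y concat_words[OF X(2) Y(2)] by (intro TG_grI) (auto intro: word_degree_append)
  then show ?thesis using X Y by (simp add: tmul_cls)
qed

lemma TA_gr_submodule: "submodule (gr TA n) K TA"
  unfolding submodule_iff_gr[OF TA_module]
proof (intro conjI ballI subsetI)
  have "k \<odot>\<^bsub>A\<^esub> \<one>\<^bsub>A\<^esub> \<in> gr A 0" if "k \<in> carrier K" for k using that gr_one by (rule gr_smult)
  then show "k \<odot>\<^bsub>TA\<^esub> x \<in> gr TA n" if "k \<in> carrier K" "x \<in> gr TA n" for k x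
    using that TG_gr_lact[of "k \<odot>\<^bsub>A\<^esub> \<one>\<^bsub>A\<^esub>" 0] by (auto simp: TA_gr TA_simps gr_smult)
qed (auto simp: TA_gr TA_carrier TA_simps gr_closed TG_gr_closed gr_add TG_gr_add)

lemma TA_gr_one: "\<one>\<^bsub>TA\<^esub> \<in> gr TA 0"
  by (simp add: TA_gr TA_simps gr_one)

lemma TA_gr_mult: "x \<in> gr TA m ==> y \<in> gr TA n ==> x \<otimes>\<^bsub>TA\<^esub> y \<in> gr TA (m + n)"
  by (auto simp: TA_gr TA_simps gr_mult TG_gr_add TG_gr_lact TG_gr_ract TG_gr_tmul)

lemma TA_letter_Cons:
  assumes "x \<in> carrier M" "w \<in> T.wds"
  shows "(\<zero>\<^bsub>A\<^esub>, T.cls [x # w]) = (\<zero>\<^bsub>A\<^esub>, T.cls [[x]]) \<otimes>\<^bsub>TA\<^esub> (\<zero>\<^bsub>A\<^esub>, T.cls [w])"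
proof -
  have "x # w \<in> T.wds" using assms by (simp add: words_def)
  then show ?thesis using assms by (simp add: TA_simps lact_zero_TG ract_zero_TG tmul_word)
qed

text \<open>The tensor algebra is generated by \<open>A\<close> and \<open>M\<close>; the graded form of this induction has the
  degree as an additional argument of the predicate.\<close>

lemma TA_induct:
  assumes x: "x \<in> carrier TA"
    and inj: "\<And>a. a \<in> carrier A ==> P (a, \<zero>\<^bsub>T.TG\<^esub>)"
    and letter: "\<And>m. m \<in> carrier M ==> P (\<zero>\<^bsub>A\<^esub>, T.cls [[m]])"
    and add: "\<And>x y. x \<in> carrier TA ==> y \<in> carrier TA ==> P x ==> P y ==> P (x \<oplus>\<^bsub>TA\<^esub> y)"
    and mult: "\<And>x y. x \<in> carrier TA ==> y \<in> carrier TA ==> P x ==> P y ==> P (x \<otimes>\<^bsub>TA\<^esub> y)"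
  shows "P x"
proof -
  have word: "P (\<zero>\<^bsub>A\<^esub>, T.cls [m # w])" if "m \<in> carrier M" "w \<in> lists (carrier M)" for m w
    using that
  proof (induction w arbitrary: m)
    case (Cons m' w)
    then have w: "m' # w \<in> T.wds" by simp
    show ?case unfolding TA_letter_Cons[OF Cons.prems(1) w]
      using Cons w by (intro mult letter Cons.IH) (auto simp: TA_carrier)
  qed (simp add: letter)
  have "P (\<zero>\<^bsub>A\<^esub>, T.cls X)" if "X \<in> lists T.wds" for X
    using that
  proof (induction X)
    case Nil
    then show ?case using inj[of "\<zero>\<^bsub>A\<^esub>"] by (simp add: T.TG_zero)
  next
    case (Cons w X)
    have "P (\<zero>\<^bsub>A\<^esub>, T.cls [w])" using Cons(1) word by (elim wordE) simp
    then have "P ((\<zero>\<^bsub>A\<^esub>, T.cls [w]) \<oplus>\<^bsub>TA\<^esub> (\<zero>\<^bsub>A\<^esub>, T.cls X))"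
      using Cons by (intro add) (auto simp: TA_carrier T.cls_closed)
    then show ?case using T.cls_Cons[OF Cons(1,2)] by (simp add: TA_simps)
  qed
  moreover obtain a X where aX: "x = (a, T.cls X)" "a \<in> carrier A" "X \<in> lists T.wds"
  proof -
    obtain a S where "x = (a, S)" "a \<in> carrier A" "S \<in> carrier T.TG" using x by (auto simp: TA_carrier)
    then show ?thesis using that by (metis T.TG_cases)
  qed
  ultimately have "P ((a, \<zero>\<^bsub>T.TG\<^esub>) \<oplus>\<^bsub>TA\<^esub> (\<zero>\<^bsub>A\<^esub>, T.cls X))"
    by (intro add inj) (auto simp: TA_carrier T.cls_closed)
  then show ?thesis using aX by (simp add: TA_simps T.cls_closed)
qed

lemma TA_graded_induct:
  assumes x: "x \<in> gr TA n"
    and inj: "\<And>n a. a \<in> gr A n ==> P n (a, \<zero>\<^bsub>T.TG\<^esub>)"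
    and letter: "\<And>n m. m \<in> bgr M n ==> P n (\<zero>\<^bsub>A\<^esub>, T.cls [[m]])"
    and add: "\<And>n x y. x \<in> gr TA n ==> y \<in> gr TA n ==> P n x ==> P n y ==> P n (x \<oplus>\<^bsub>TA\<^esub> y)"
    and mult: "\<And>m n x y. x \<in> gr TA m ==> y \<in> gr TA n ==> P m x ==> P n y ==> P (m + n) (x \<otimes>\<^bsub>TA\<^esub> y)"
  shows "P n x"
proof -
  have word_gr: "(\<zero>\<^bsub>A\<^esub>, T.cls [w]) \<in> gr TA n" if "w \<in> T.wds" "word_degree M w n" for w n
    using that TG_grI[of "[w]" n] by (simp add: TA_gr)
  have word: "P (sum_list (k # ks)) (\<zero>\<^bsub>A\<^esub>, T.cls [m # w])"
    if "m \<in> bgr M k" "list_all2 (%m k. m \<in> bgr M k) w ks" for m k w ks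
    using that(2,1)
  proof (induction w ks arbitrary: m k rule: list_all2_induct)
    case (Cons m' w k' ks)
    have ml: "set w \<subseteq> carrier M"
    proof
      fix z assume "z \<in> set w"
      then show "z \<in> carrier M" using Cons(2) bgr_closed by (metis in_set_conv_nth list_all2_conv_all_nth)
    qed
    then have w: "m' # w \<in> T.wds" "m \<in> carrier M" using Cons by (auto simp: bgr_closed)
    have "P (k + sum_list (k' # ks)) ((\<zero>\<^bsub>A\<^esub>, T.cls [[m]]) \<otimes>\<^bsub>TA\<^esub> (\<zero>\<^bsub>A\<^esub>, T.cls [m' # w]))"
    proof (intro mult letter Cons.IH word_gr)
      show "word_degree M [m] k" unfolding word_degree_def using Cons.prems by (intro exI[of _ "[k]"]) simp
      show "word_degree M (m' # w) (sum_list (k' # ks))"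
        unfolding word_degree_def using Cons by (intro exI[of _ "k' # ks"]) simp
    qed (use Cons w in auto)
    then show ?case by (simp add: TA_letter_Cons[OF w(2,1)])
  qed (simp add: letter)
  have "P n (\<zero>\<^bsub>A\<^esub>, T.cls X)" if "X \<in> lists {w \<in> T.wds. word_degree M w n}" for X
    using that
  proof (induction X)
    case Nil
    then show ?case using inj[of "\<zero>\<^bsub>A\<^esub>"] by (simp add: T.TG_zero)
  next
    case (Cons w X)
    then have w: "w \<in> T.wds" "word_degree M w n" by auto
    have X: "X \<in> lists T.wds" "\<And>w. w \<in> set X ==> word_degree M w n" using Cons(2) by (auto simp: in_lists_conv_set)
    have "P n (\<zero>\<^bsub>A\<^esub>, T.cls [w])"
      using w(1)
    proof (rule wordE)
      fix m vs assume m: "w = m # vs"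
      with w(2) obtain k ks where "list_all2 (%m k. m \<in> bgr M k) vs ks" "m \<in> bgr M k" "sum_list (k # ks) = n"
        by (auto simp: word_degree_def list_all2_Cons1)
      then show ?thesis using word[of m k vs ks] m by simp
    qed
    then have "P n ((\<zero>\<^bsub>A\<^esub>, T.cls [w]) \<oplus>\<^bsub>TA\<^esub> (\<zero>\<^bsub>A\<^esub>, T.cls X))"
      using Cons.IH w X TG_grI[of X n] by (intro add word_gr) (auto simp: TA_gr)
    then show ?case using T.cls_Cons[OF w(1) X(1)] by (simp add: TA_simps)
  qed
  moreover obtain a X where aX: "x = (a, T.cls X)" "a \<in> gr A n" "X \<in> lists {w \<in> T.wds. word_degree M w n}"
    using x unfolding TA_gr TG_gr_def by auto
  moreover from aX(3) have X: "X \<in> lists T.wds" "\<And>w. w \<in> set X ==> word_degree M w n" by (auto simp: in_lists_conv_set)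
  ultimately have "P n ((a, \<zero>\<^bsub>T.TG\<^esub>) \<oplus>\<^bsub>TA\<^esub> (\<zero>\<^bsub>A\<^esub>, T.cls X))"
    using TG_grI[OF X] by (intro add inj) (auto simp: TA_gr)
  then show ?thesis using aX X by (simp add: TA_simps T.cls_closed gr_closed)
qed

end

section \<open>The graded differential envelope as a tensor algebra\<close>

context graded_algebra
begin

sublocale TK: tensor_product K A "%v k. k \<odot>\<^bsub>A\<^esub> v" "{2}"
  by unfold_locales auto

lemma ktensor_2: "ktensor K A 2 = TK.cls"
  by (simp add: ktensor_def fun_eq_iff)

lemma TK_group: "abelian_group TK.TG" by (rule TK.TG_group) simp

sublocale TKG: abelian_group TK.TG by (rule TK_group)

lemma pair_closed [simp]: "a \<in> carrier A ==> b \<in> carrier A ==> TK.cls [[a, b]] \<in> carrier TK.TG"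
  by (rule TK.cls_closed) simp

lemma pair_add_left:
  "a \<in> carrier A ==> a' \<in> carrier A ==> b \<in> carrier A ==>
   TK.cls [[a \<oplus>\<^bsub>A\<^esub> a', b]] = TK.cls [[a, b]] \<oplus>\<^bsub>TK.TG\<^esub> TK.cls [[a', b]]"
  using TK.cls_word_add[of "[]" a "[b]" a'] by simp

lemma pair_add_right:
  "a \<in> carrier A ==> b \<in> carrier A ==> b' \<in> carrier A ==>
   TK.cls [[a, b \<oplus>\<^bsub>A\<^esub> b']] = TK.cls [[a, b]] \<oplus>\<^bsub>TK.TG\<^esub> TK.cls [[a, b']]"
  using TK.cls_word_add[of "[a]" b "[]" b'] by simp

lemma pair_smult:
  "k \<in> carrier K ==> a \<in> carrier A ==> b \<in> carrier A ==> TK.cls [[k \<odot>\<^bsub>A\<^esub> a, b]] = TK.cls [[a, k \<odot>\<^bsub>A\<^esub> b]]"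
  using TK.cls_word_balanced[of "[]" a b "[]" k] by simp

lemma pair_additive_left: "b \<in> carrier A ==> (%a. TK.cls [[a, b]]) \<in> additive_maps A TK.TG"
  and pair_additive_right: "a \<in> carrier A ==> (%b. TK.cls [[a, b]]) \<in> additive_maps A TK.TG"
  by (auto intro!: additive_mapsI simp: pair_add_left pair_add_right)

lemmas pair_neg_left = additive_neg[OF A_group TK_group pair_additive_left]
  and pair_neg_right = additive_neg[OF A_group TK_group pair_additive_right]
  and pair_zero_left = additive_zero[OF A_group TK_group pair_additive_left]

lemma TK_ext:
  assumes "S \<in> carrier TK.TG" "abelian_group G" "f \<in> additive_maps TK.TG G" "g \<in> additive_maps TK.TG G"
    "\<And>a b. a \<in> carrier A ==> b \<in> carrier A ==> f (TK.cls [[a, b]]) = g (TK.cls [[a, b]])"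
  shows "f S = g S"
  by (rule TK.TG_ext[OF _ assms(2,3,4) _ assms(1)]) (auto elim!: lists_words_2E simp: assms(5))

lemma pair_fun_balanced:
  assumes "abelian_group G" "\<And>a b. a \<in> carrier A ==> b \<in> carrier A ==> B a b \<in> carrier G"
    and "\<And>a. a \<in> carrier A ==> (%b. B a b) \<in> additive_maps A G" "\<And>b. b \<in> carrier A ==> (%a. B a b) \<in> additive_maps A G"
    and "\<And>k a b. k \<in> carrier K ==> a \<in> carrier A ==> b \<in> carrier A ==> B (k \<odot>\<^bsub>A\<^esub> a) b = B a (k \<odot>\<^bsub>A\<^esub> b)"
  shows "(%u. B (u ! 0) (u ! 1)) \<in> TK.balanced_to G"
  using additive_add[OF assms(3)] additive_add[OF assms(4)] assms(2,5) by (intro balanced_maps_2I) simp_all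

definition signed_product :: "'a list list set \<Rightarrow> 'a" where
  "signed_product = tensor_lift A (%w. w ! 0 \<otimes>\<^bsub>A\<^esub> parity A (w ! 1))"

lemma signed_balanced: "(%w. w ! 0 \<otimes>\<^bsub>A\<^esub> parity A (w ! 1)) \<in> TK.balanced_to A"
  by (intro pair_fun_balanced A_group)
    (auto intro!: additive_mapsI simp: l_distr r_distr smult_mult_left smult_mult_right)

lemma signed_product_cls: "X \<in> lists TK.wds ==> signed_product (TK.cls X) = signed_mult A X"
  unfolding signed_product_def signed_mult_def by (rule TK.lift_cls[OF A_group signed_balanced])

lemma signed_product_additive: "signed_product \<in> additive_maps TK.TG A"
  unfolding signed_product_def by (rule TK.lift_additive[OF A_group signed_balanced])

lemma signed_product_pair: "a \<in> carrier A ==> b \<in> carrier A ==> signed_product (TK.cls [[a, b]]) = a \<otimes>\<^bsub>A\<^esub> parity A b"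
  by (simp add: signed_product_cls signed_mult_def)

abbreviation "E \<equiv> env_bimodule K A"

lemma signed_kernel: "{T \<in> ktensor_power K A 2. \<forall>X\<in>T. signed_mult A X = \<zero>\<^bsub>A\<^esub>} =
  {T \<in> carrier TK.TG. signed_product T = \<zero>\<^bsub>A\<^esub>}"
proof -
  have "(\<forall>Y\<in>TK.cls X. signed_mult A Y = \<zero>\<^bsub>A\<^esub>) \<longleftrightarrow> signed_product (TK.cls X) = \<zero>\<^bsub>A\<^esub>" if "X \<in> lists TK.wds" for X
  proof -
    have "signed_mult A Y = signed_product (TK.cls X)" if "Y \<in> TK.cls X" for Y
      using TK.mem_cls[OF that] signed_product_cls[of Y] by simp
    then show ?thesis using TK.cls_self[OF that] by auto
  qed
  then show ?thesis by (auto simp: ktensor_power_def ktensor_2 TK.TG_carrier)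
qed

lemma E_carrier: "carrier E = {T \<in> carrier TK.TG. signed_product T = \<zero>\<^bsub>A\<^esub>}"
  by (simp add: env_bimodule_def Let_def signed_kernel)

lemma E_add: "add E = add TK.TG"
  by (simp add: env_bimodule_def Let_def tensor_group_def ktensor_2)

lemma E_zero: "zero E = zero TK.TG"
  by (simp add: env_bimodule_def Let_def tensor_group_def ktensor_2)

lemma E_lsum: "lsum E = lsum TK.TG"
  by (simp add: lsum_def fun_eq_iff E_add E_zero)

lemma TK_op_balanced:
  assumes "\<And>a b. a \<in> carrier A ==> b \<in> carrier A ==> f a \<in> carrier A \<and> g b \<in> carrier A"
    "f \<in> linear_maps K A A" "g \<in> linear_maps K A A"
  shows "(%w. [f (w ! 0), g (w ! 1)]) \<in> TK.wds \<rightarrow> TK.wds"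
    "(%w. TK.cls [[f (w ! 0), g (w ! 1)]]) \<in> TK.balanced_to TK.TG"
proof -
  show "(%w. [f (w ! 0), g (w ! 1)]) \<in> TK.wds \<rightarrow> TK.wds"
    by (auto elim!: lists_words_2E simp: assms(1))
  show "(%w. TK.cls [[f (w ! 0), g (w ! 1)]]) \<in> TK.balanced_to TK.TG"
    using assms
    by (intro pair_fun_balanced TK_group)
      (auto intro!: additive_mapsI simp: linear_add linear_smult pair_add_left pair_add_right pair_smult)
qed

lemma lact_op: "x \<in> carrier A ==> (%a. x \<otimes>\<^bsub>A\<^esub> a) \<in> linear_maps K A A"
  and ract_op: "x \<in> carrier A ==> (%a. a \<otimes>\<^bsub>A\<^esub> x) \<in> linear_maps K A A"
  and id_op: "(%a. a) \<in> linear_maps K A A"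
  by (auto intro!: linear_mapsI simp: l_distr r_distr smult_mult_left smult_mult_right)

lemma E_lact_cls:
  assumes "x \<in> carrier A" "X \<in> lists TK.wds"
  shows "x \<odot>\<^bsub>E\<^esub> (TK.cls X) = TK.cls (map (%w. [x \<otimes>\<^bsub>A\<^esub> w ! 0, w ! 1]) X)"
  using TK.UN_map_cls[OF _ TK_op_balanced[OF _ lact_op[OF assms(1)] id_op] assms(2)] assms(1)
  by (simp add: env_bimodule_def Let_def ktensor_2)

lemma E_ract_cls:
  assumes "x \<in> carrier A" "X \<in> lists TK.wds"
  shows "rsmult E (TK.cls X) x = TK.cls (map (%w. [w ! 0, w ! 1 \<otimes>\<^bsub>A\<^esub> x]) X)"
  using TK.UN_map_cls[OF _ TK_op_balanced[OF _ id_op ract_op[OF assms(1)]] assms(2)] assms(1)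
  by (simp add: env_bimodule_def Let_def ktensor_2)

lemma E_lact_additive: "x \<in> carrier A ==> (%T. x \<odot>\<^bsub>E\<^esub> T) \<in> additive_maps TK.TG TK.TG"
  by (rule TK.map_cls_additive[OF _ TK_op_balanced[OF _ lact_op id_op]]) (auto simp: E_lact_cls)

lemma E_ract_additive: "x \<in> carrier A ==> (%T. rsmult E T x) \<in> additive_maps TK.TG TK.TG"
  by (rule TK.map_cls_additive[OF _ TK_op_balanced[OF _ id_op ract_op]]) (auto simp: E_ract_cls)

lemma E_lact_pair: "x \<in> carrier A ==> a \<in> carrier A ==> b \<in> carrier A ==> x \<odot>\<^bsub>E\<^esub> (TK.cls [[a, b]]) = TK.cls [[x \<otimes>\<^bsub>A\<^esub> a, b]]"
  by (simp add: E_lact_cls)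

lemma E_ract_pair: "x \<in> carrier A ==> a \<in> carrier A ==> b \<in> carrier A ==> rsmult E (TK.cls [[a, b]]) x = TK.cls [[a, b \<otimes>\<^bsub>A\<^esub> x]]"
  by (simp add: E_ract_cls)

lemma E_lact_closed [simp]: "x \<in> carrier A ==> T \<in> carrier TK.TG ==> x \<odot>\<^bsub>E\<^esub> T \<in> carrier TK.TG"
  by (rule additive_closed[OF E_lact_additive])

lemma E_ract_closed [simp]: "x \<in> carrier A ==> T \<in> carrier TK.TG ==> rsmult E T x \<in> carrier TK.TG"
  by (rule additive_closed[OF E_ract_additive])

lemma mult_additive:
  "x \<in> carrier A ==> (%a. x \<otimes>\<^bsub>A\<^esub> a) \<in> additive_maps A A" "x \<in> carrier A ==> (%a. a \<otimes>\<^bsub>A\<^esub> x) \<in> additive_maps A A"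
  by (auto intro!: additive_mapsI simp: l_distr r_distr)

lemma signed_product_lact: "x \<in> carrier A ==> T \<in> carrier TK.TG ==> signed_product (x \<odot>\<^bsub>E\<^esub> T) = x \<otimes>\<^bsub>A\<^esub> signed_product T"
  by (rule TK_ext[OF _ A_group additive_compose[OF signed_product_additive E_lact_additive]
        additive_compose[OF mult_additive(1) signed_product_additive]])
    (auto simp: E_lact_pair signed_product_pair m_assoc)

lemma signed_product_ract:
  "x \<in> carrier A ==> T \<in> carrier TK.TG ==> signed_product (rsmult E T x) = signed_product T \<otimes>\<^bsub>A\<^esub> parity A x"
  by (rule TK_ext[OF _ A_group additive_compose[OF signed_product_additive E_ract_additive]
        additive_compose[OF mult_additive(2) signed_product_additive]])
    (auto simp: E_ract_pair signed_product_pair m_assoc)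

lemma E_group: "abelian_group E"
proof (rule abelian_groupI)
  fix x assume "x \<in> carrier E"
  then show "\<exists>y\<in>carrier E. y \<oplus>\<^bsub>E\<^esub> x = \<zero>\<^bsub>E\<^esub>"
    by (intro bexI[of _ "\<ominus>\<^bsub>TK.TG\<^esub> x"])
      (auto simp: E_carrier E_add E_zero TKG.l_neg additive_neg[OF TK_group A_group signed_product_additive])
qed (auto simp: E_carrier E_add E_zero TKG.a_ac additive_add[OF signed_product_additive]
    additive_zero[OF TK_group A_group signed_product_additive])

lemmas TK_additive_rules = additive_id additive_maps_plus[OF TK_group]
  additive_compose[OF E_lact_additive] additive_compose[OF E_ract_additive]

lemma E_bgr_0: "bgr E 0 = {\<zero>\<^bsub>TK.TG\<^esub>}"
  by (simp add: env_bimodule_def Let_def ktensor_2 TK.TG_zero)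

lemma E_bgr_Suc: "bgr E (Suc n) = carrier E \<inter> TK.cls ` lists {[a, b] | a b. \<exists>r s. r + s = n \<and> a \<in> gr A r \<and> b \<in> gr A s}"
  by (simp add: env_bimodule_def Let_def ktensor_2)

lemma E_zero_bgr: "\<zero>\<^bsub>TK.TG\<^esub> \<in> bgr E n"
proof (cases n)
  case (Suc m)
  have "\<zero>\<^bsub>TK.TG\<^esub> \<in> carrier E" by (simp add: E_carrier additive_zero[OF TK_group A_group signed_product_additive])
  then show ?thesis unfolding Suc E_bgr_Suc by (auto simp: TK.TG_zero intro!: image_eqI[of _ _ "[]"])
qed (simp add: E_bgr_0)

lemma E_algebra_bimodule: "algebra_bimodule K A E"
proof (intro algebra_bimodule.intro algebra_bimodule_axioms.intro)
  show "graded_algebra K A" by unfold_locales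
  show "abelian_group E" by (rule E_group)
  fix a b x y assume a: "a \<in> carrier A"
  show "x \<in> carrier E ==> a \<odot>\<^bsub>E\<^esub> x \<in> carrier E"
    using a by (simp add: E_carrier signed_product_lact)
  show "x \<in> carrier E ==> rsmult E x a \<in> carrier E"
    using a by (simp add: E_carrier signed_product_ract)
  show "x \<in> carrier E ==> y \<in> carrier E ==> a \<odot>\<^bsub>E\<^esub> (x \<oplus>\<^bsub>E\<^esub> y) = a \<odot>\<^bsub>E\<^esub> x \<oplus>\<^bsub>E\<^esub> a \<odot>\<^bsub>E\<^esub> y"
    using a additive_add[OF E_lact_additive] by (simp add: E_carrier E_add)
  show "x \<in> carrier E ==> y \<in> carrier E ==> rsmult E (x \<oplus>\<^bsub>E\<^esub> y) a = rsmult E x a \<oplus>\<^bsub>E\<^esub> rsmult E y a"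
    using a additive_add[OF E_ract_additive] by (simp add: E_carrier E_add)
  assume b: "b \<in> carrier A"
  {
    assume "x \<in> carrier E"
    then have x: "x \<in> carrier TK.TG" by (simp add: E_carrier)
    show "(a \<oplus>\<^bsub>A\<^esub> b) \<odot>\<^bsub>E\<^esub> x = a \<odot>\<^bsub>E\<^esub> x \<oplus>\<^bsub>E\<^esub> b \<odot>\<^bsub>E\<^esub> x"
      unfolding E_add by (rule TK_ext[OF x TK_group]; (intro TK_additive_rules)?)
        (use a b in \<open>auto simp: E_lact_pair l_distr pair_add_left\<close>)
    show "rsmult E x (a \<oplus>\<^bsub>A\<^esub> b) = rsmult E x a \<oplus>\<^bsub>E\<^esub> rsmult E x b"
      unfolding E_add by (rule TK_ext[OF x TK_group]; (intro TK_additive_rules)?)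
        (use a b in \<open>auto simp: E_ract_pair r_distr pair_add_right\<close>)
    show "(a \<otimes>\<^bsub>A\<^esub> b) \<odot>\<^bsub>E\<^esub> x = a \<odot>\<^bsub>E\<^esub> (b \<odot>\<^bsub>E\<^esub> x)"
      by (rule TK_ext[OF x TK_group]; (intro TK_additive_rules)?)
        (use a b in \<open>auto simp: E_lact_pair m_assoc\<close>)
    show "rsmult E x (a \<otimes>\<^bsub>A\<^esub> b) = rsmult E (rsmult E x a) b"
      by (rule TK_ext[OF x TK_group]; (intro TK_additive_rules)?)
        (use a b in \<open>auto simp: E_ract_pair m_assoc\<close>)
    show "rsmult E (a \<odot>\<^bsub>E\<^esub> x) b = a \<odot>\<^bsub>E\<^esub> (rsmult E x b)"
      by (rule TK_ext[OF x TK_group]; (intro TK_additive_rules)?)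
        (use a b in \<open>auto simp: E_ract_pair E_lact_pair\<close>)
  }
next
  fix x assume "x \<in> carrier E"
  then have x: "x \<in> carrier TK.TG" by (simp add: E_carrier)
  show "\<one>\<^bsub>A\<^esub> \<odot>\<^bsub>E\<^esub> x = x"
    by (rule TK_ext[OF x TK_group]; (intro TK_additive_rules)?) (auto simp: E_lact_pair)
  show "rsmult E x \<one>\<^bsub>A\<^esub> = x"
    by (rule TK_ext[OF x TK_group]; (intro TK_additive_rules)?) (auto simp: E_ract_pair)
  fix k assume k: "k \<in> carrier K"
  show "rsmult E x (k \<odot>\<^bsub>A\<^esub> \<one>\<^bsub>A\<^esub>) = (k \<odot>\<^bsub>A\<^esub> \<one>\<^bsub>A\<^esub>) \<odot>\<^bsub>E\<^esub> x"
    by (rule TK_ext[OF x TK_group]; (intro TK_additive_rules)?)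
      (use k in \<open>auto simp: E_ract_pair E_lact_pair smult_mult_left smult_mult_right pair_smult\<close>)
next
  fix x n assume "x \<in> bgr E n"
  then show "x \<in> carrier E" 
    by (cases n) (auto simp: E_bgr_0 E_bgr_Suc E_carrier additive_zero[OF TK_group A_group signed_product_additive])
next
  fix a r x n assume a: "a \<in> gr A r" and x: "x \<in> bgr E n"
  have ac: "a \<in> carrier A" using a by (rule gr_closed)
  show "a \<odot>\<^bsub>E\<^esub> x \<in> bgr E (r + n)"
  proof (cases n)
    case 0
    then show ?thesis using x E_zero_bgr by (simp add: E_bgr_0 additive_zero[OF TK_group TK_group E_lact_additive[OF ac]])
  next
    case (Suc m)
    then obtain X where X: "x = TK.cls X" "X \<in> lists {[a, b] | a b. \<exists>r s. r + s = m \<and> a \<in> gr A r \<and> b \<in> gr A s}" "x \<in> carrier E"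
      using x by (auto simp: E_bgr_Suc)
    then have "X \<in> lists TK.wds" by (fastforce simp: in_lists_conv_set gr_closed)
    moreover have "map (%w. [a \<otimes>\<^bsub>A\<^esub> w ! 0, w ! 1]) X \<in> lists {[a, b] | a b. \<exists>p s. p + s = r + m \<and> a \<in> gr A p \<and> b \<in> gr A s}"
    proof -
      have "[a \<otimes>\<^bsub>A\<^esub> w ! 0, w ! 1] \<in> {[a, b] | a b. \<exists>p s. p + s = r + m \<and> a \<in> gr A p \<and> b \<in> gr A s}" if "w \<in> set X" for w
      proof -
        obtain a' b' p s where w: "w = [a', b']" "p + s = m" "a' \<in> gr A p" "b' \<in> gr A s"
          using X(2) \<open>w \<in> set X\<close> by (auto simp: in_lists_conv_set)
        then have "(r + p) + s = r + m" "a \<otimes>\<^bsub>A\<^esub> a' \<in> gr A (r + p)" using a by (auto intro: gr_mult)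
        then show ?thesis using w by simp (intro exI[of _ "r + p"] exI[of _ s], simp)
      qed
      then show ?thesis by (auto simp: in_lists_conv_set)
    qed
    ultimately have "a \<odot>\<^bsub>E\<^esub> x \<in> TK.cls ` lists {[a, b] | a b. \<exists>p s. p + s = r + m \<and> a \<in> gr A p \<and> b \<in> gr A s}"
      using X(1) ac by (simp add: E_lact_cls)
    moreover have "a \<odot>\<^bsub>E\<^esub> x \<in> carrier E" using X(3) ac by (simp add: E_carrier signed_product_lact)
    ultimately show ?thesis unfolding Suc add_Suc_right E_bgr_Suc by blast
  qed
  show "rsmult E x a \<in> bgr E (n + r)"
  proof (cases n)
    case 0
    then show ?thesis using x E_zero_bgr by (simp add: E_bgr_0 additive_zero[OF TK_group TK_group E_ract_additive[OF ac]])
  next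
    case (Suc m)
    then obtain X where X: "x = TK.cls X" "X \<in> lists {[a, b] | a b. \<exists>r s. r + s = m \<and> a \<in> gr A r \<and> b \<in> gr A s}" "x \<in> carrier E"
      using x by (auto simp: E_bgr_Suc)
    then have "X \<in> lists TK.wds" by (fastforce simp: in_lists_conv_set gr_closed)
    moreover have "map (%w. [w ! 0, w ! 1 \<otimes>\<^bsub>A\<^esub> a]) X \<in> lists {[a, b] | a b. \<exists>p s. p + s = m + r \<and> a \<in> gr A p \<and> b \<in> gr A s}"
    proof -
      have "[w ! 0, w ! 1 \<otimes>\<^bsub>A\<^esub> a] \<in> {[a, b] | a b. \<exists>p s. p + s = m + r \<and> a \<in> gr A p \<and> b \<in> gr A s}" if "w \<in> set X" for w
      proof -
        obtain a' b' p s where w: "w = [a', b']" "p + s = m" "a' \<in> gr A p" "b' \<in> gr A s"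
          using X(2) \<open>w \<in> set X\<close> by (auto simp: in_lists_conv_set)
        then have "p + (s + r) = m + r" "b' \<otimes>\<^bsub>A\<^esub> a \<in> gr A (s + r)" using a by (auto intro: gr_mult)
        then show ?thesis using w by simp (intro exI[of _ p] exI[of _ "s + r"], simp)
      qed
      then show ?thesis by (auto simp: in_lists_conv_set)
    qed
    ultimately have "rsmult E x a \<in> TK.cls ` lists {[a, b] | a b. \<exists>p s. p + s = m + r \<and> a \<in> gr A p \<and> b \<in> gr A s}"
      using X(1) ac by (simp add: E_ract_cls)
    moreover have "rsmult E x a \<in> carrier E" using X(3) ac by (simp add: E_carrier signed_product_ract)
    ultimately show ?thesis unfolding Suc add_Suc E_bgr_Suc by blast
  qed
qed

sublocale EB: algebra_bimodule K A E by (rule E_algebra_bimodule)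

abbreviation "W \<equiv> env K A"
abbreviation "emb \<equiv> env_inj K A"

lemma env_eq: "W = EB.TA" by (simp add: env_def)

lemma emb_eq: "emb a = (a, \<zero>\<^bsub>EB.T.TG\<^esub>)"
  by (simp add: env_inj_def EB.T.TG_zero EB.btensor_eq)

definition D :: "'a \<Rightarrow> 'a \<times> 'a list list set list list set" where
  "D a = (\<zero>\<^bsub>A\<^esub>, EB.T.cls [[env_d1 K A a]])"

lemma W_ring: "ring W" unfolding env_eq by (rule EB.TA_ring)
lemma W_algebra: "assoc_algebra K W" unfolding env_eq by (rule EB.TA_algebra)

lemma d1_eq: "a \<in> carrier A ==> env_d1 K A a = TK.cls [[\<one>\<^bsub>A\<^esub>, a]] \<oplus>\<^bsub>TK.TG\<^esub> TK.cls [[\<ominus>\<^bsub>A\<^esub> parity A a, \<one>\<^bsub>A\<^esub>]]"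
  by (simp add: env_d1_def ktensor_2 TK.cls_add)

lemma d1_closed [simp]: "a \<in> carrier A ==> env_d1 K A a \<in> carrier E"
  by (simp add: E_carrier d1_eq additive_add[OF signed_product_additive] signed_product_pair r_neg)

lemma d1_additive: "env_d1 K A \<in> additive_maps A E"
  by (rule additive_mapsI)
    (simp_all add: E_add, simp add: d1_eq minus_add pair_add_left pair_add_right TKG.a_ac)

lemma d1_scalar:
  assumes "k \<in> carrier K"
  shows "env_d1 K A (k \<odot>\<^bsub>A\<^esub> \<one>\<^bsub>A\<^esub>) = \<zero>\<^bsub>TK.TG\<^esub>"
  using assms pair_smult[of k "\<one>\<^bsub>A\<^esub>" "\<one>\<^bsub>A\<^esub>"] by (simp add: d1_eq pair_neg_left TKG.r_neg)

lemma d1_mult: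
  assumes "a \<in> carrier A" "b \<in> carrier A"
  shows "env_d1 K A (a \<otimes>\<^bsub>A\<^esub> b) = rsmult E (env_d1 K A a) b \<oplus>\<^bsub>E\<^esub> parity A a \<odot>\<^bsub>E\<^esub> (env_d1 K A b)"
proof -
  let ?P = "%x y. TK.cls [[x, y]]"
  let ?S = "TK.TG"
  have "rsmult E (env_d1 K A a) b \<oplus>\<^bsub>E\<^esub> parity A a \<odot>\<^bsub>E\<^esub> (env_d1 K A b) =
    (?P \<one>\<^bsub>A\<^esub> (a \<otimes>\<^bsub>A\<^esub> b) \<oplus>\<^bsub>?S\<^esub> \<ominus>\<^bsub>?S\<^esub> ?P (parity A a) b) \<oplus>\<^bsub>?S\<^esub>
    (?P (parity A a) b \<oplus>\<^bsub>?S\<^esub> ?P (\<ominus>\<^bsub>A\<^esub> (parity A a \<otimes>\<^bsub>A\<^esub> parity A b)) \<one>\<^bsub>A\<^esub>)"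
    using assms by (simp add: d1_eq E_add additive_add[OF E_lact_additive] additive_add[OF E_ract_additive]
        E_lact_pair E_ract_pair pair_neg_left r_minus additive_neg[OF TK_group TK_group E_lact_additive]
        additive_neg[OF TK_group TK_group E_ract_additive])
  also have "\<dots> = ?P \<one>\<^bsub>A\<^esub> (a \<otimes>\<^bsub>A\<^esub> b) \<oplus>\<^bsub>?S\<^esub> ((\<ominus>\<^bsub>?S\<^esub> ?P (parity A a) b \<oplus>\<^bsub>?S\<^esub> ?P (parity A a) b) \<oplus>\<^bsub>?S\<^esub>
      ?P (\<ominus>\<^bsub>A\<^esub> (parity A a \<otimes>\<^bsub>A\<^esub> parity A b)) \<one>\<^bsub>A\<^esub>)"
    using assms by (simp only: TKG.a_assoc TKG.a_closed TKG.a_inv_closed pair_closed m_closed one_closed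
        a_inv_closed parity_closed)
  also have "\<dots> = env_d1 K A (a \<otimes>\<^bsub>A\<^esub> b)"
    using assms by (simp add: TKG.l_neg d1_eq)
  finally show ?thesis by simp
qed

lemma d1_bgr:
  assumes "a \<in> gr A n"
  shows "env_d1 K A a \<in> bgr E (Suc n)"
proof -
  have "[[\<one>\<^bsub>A\<^esub>, a], [\<ominus>\<^bsub>A\<^esub> parity A a, \<one>\<^bsub>A\<^esub>]] \<in> lists {[a, b] | a b. \<exists>r s. r + s = n \<and> a \<in> gr A r \<and> b \<in> gr A s}"
    using assms gr_one gr_neg[OF parity_gr[OF assms]]
    by (auto intro: exI[of _ 0] exI[of _ n])
  then show ?thesis
    unfolding E_bgr_Suc using d1_closed[OF gr_closed[OF assms]] by (auto simp: env_d1_def ktensor_2)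
qed

text \<open>An element of the kernel \<open>J\<close> is $\sum_i a_i \otimes b_i$ with $\sum_i (-1)^{s_i} a_i b_i = 0$, whence it
  equals $\sum_i a_i\,d b_i$: the differentials generate \<open>J\<close> as a left module.\<close>

lemma E_expand:
  assumes X: "X \<in> lists TK.wds" and J: "TK.cls X \<in> carrier E"
  shows "TK.cls X = lsum E (map (%w. (w ! 0) \<odot>\<^bsub>E\<^esub> env_d1 K A (w ! 1)) X)"
proof -
  have c: "w ! 0 \<in> carrier A" "w ! Suc 0 \<in> carrier A" "w = [w ! 0, w ! 1]" if "w \<in> set X" for w
    using X that by (auto simp: in_lists_conv_set elim!: lists_words_2E)
  let ?g = "%c. TK.cls [[\<ominus>\<^bsub>A\<^esub> c, \<one>\<^bsub>A\<^esub>]]"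
  have g: "?g \<in> additive_maps A TK.TG"
    by (auto intro!: additive_mapsI simp: minus_add pair_add_left)
  have "(w ! 0) \<odot>\<^bsub>E\<^esub> env_d1 K A (w ! 1) = TK.cls [w] \<oplus>\<^bsub>TK.TG\<^esub> ?g (w ! 0 \<otimes>\<^bsub>A\<^esub> parity A (w ! 1))"
    if w: "w \<in> set X" for w
    using c(1,2)[OF w] by (subst (3) c(3)[OF w])
      (simp add: d1_eq additive_add[OF E_lact_additive] E_lact_pair r_minus)
  then have "lsum E (map (%w. (w ! 0) \<odot>\<^bsub>E\<^esub> env_d1 K A (w ! 1)) X) =
    lsum TK.TG (map (%w. TK.cls [w] \<oplus>\<^bsub>TK.TG\<^esub> ?g (w ! 0 \<otimes>\<^bsub>A\<^esub> parity A (w ! 1))) X)"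
    unfolding E_lsum by (rule lsum_cong)
  also have "\<dots> = lsum TK.TG (map (%w. TK.cls [w]) X) \<oplus>\<^bsub>TK.TG\<^esub>
      lsum TK.TG (map (%w. ?g (w ! 0 \<otimes>\<^bsub>A\<^esub> parity A (w ! 1))) X)"
    using X c by (intro TKG.lsum_add) (auto intro!: TK.cls_closed simp: in_lists_conv_set)
  also have "lsum TK.TG (map (%w. ?g (w ! 0 \<otimes>\<^bsub>A\<^esub> parity A (w ! 1))) X) = ?g (signed_mult A X)"
    unfolding signed_mult_def using c by (intro additive_lsum_map[OF A_group TK_group g, symmetric]) auto
  also have "\<dots> = \<zero>\<^bsub>TK.TG\<^esub>"
    using J X by (simp add: E_carrier signed_product_cls pair_zero_left)
  also have "lsum TK.TG (map (%w. TK.cls [w]) X) = TK.cls X" using X by (rule TK.cls_lsum[symmetric])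
  also have "TK.cls X \<oplus>\<^bsub>TK.TG\<^esub> \<zero>\<^bsub>TK.TG\<^esub> = TK.cls X" using X by (simp add: TK.cls_closed)
  finally show ?thesis by simp
qed

lemma letter_additive: "(%m. (\<zero>\<^bsub>A\<^esub>, EB.T.cls [[m]])) \<in> additive_maps E W"
  unfolding env_eq
  by (rule additive_mapsI)
    (simp_all add: EB.TA_carrier EB.TA_simps additive_add[OF EB.letter_additive] additive_closed[OF EB.letter_additive])

lemma letter_lact:
  "a \<in> carrier A ==> m \<in> carrier E ==> (\<zero>\<^bsub>A\<^esub>, EB.T.cls [[a \<odot>\<^bsub>E\<^esub> m]]) = emb a \<otimes>\<^bsub>W\<^esub> (\<zero>\<^bsub>A\<^esub>, EB.T.cls [[m]])"
  by (simp add: emb_eq env_eq EB.TA_simps EB.lact_word EB.TG_zeros EB.ract_zero_TG EB.lact_closed)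

lemma letter_ract:
  "a \<in> carrier A ==> m \<in> carrier E ==> (\<zero>\<^bsub>A\<^esub>, EB.T.cls [[rsmult E m a]]) = (\<zero>\<^bsub>A\<^esub>, EB.T.cls [[m]]) \<otimes>\<^bsub>W\<^esub> emb a"
  using EB.ract_word[of a "[]" m]
  by (simp add: emb_eq env_eq EB.TA_simps EB.TG_zeros EB.lact_zero_TG EB.ract_closed)

lemma emb_hom: "emb \<in> ring_hom A W"
  by (rule ring_hom_memI)
    (auto simp: emb_eq env_eq EB.TA_carrier EB.TA_simps EB.TG_zeros)

lemma emb_smult: "k \<in> carrier K ==> a \<in> carrier A ==> emb (k \<odot>\<^bsub>A\<^esub> a) = k \<odot>\<^bsub>W\<^esub> emb a"
  by (simp add: emb_eq env_eq EB.TA_simps EB.TG_zeros)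

lemma emb_linear: "emb \<in> linear_maps K A W"
  using emb_hom by (auto intro!: linear_mapsI simp: emb_smult ring_hom_closed ring_hom_add)

lemma emb_closed [simp]: "a \<in> carrier A ==> emb a \<in> carrier W"
  using emb_linear by (rule linear_closed)

lemma emb_gr: "a \<in> gr A n ==> emb a \<in> gr W n"
  by (simp add: emb_eq env_eq EB.TA_gr)

lemma D_additive: "D \<in> additive_maps A W"
proof -
  have "(%a. (\<zero>\<^bsub>A\<^esub>, EB.T.cls [[env_d1 K A a]])) \<in> additive_maps A W"
    by (rule additive_compose[OF letter_additive d1_additive])
  then show ?thesis by (simp add: D_def[abs_def])
qed

lemma D_closed [simp]: "a \<in> carrier A ==> D a \<in> carrier W"
  using D_additive by (rule additive_closed)

lemma D_mult:
  "a \<in> carrier A ==> b \<in> carrier A ==> D (a \<otimes>\<^bsub>A\<^esub> b) = D a \<otimes>\<^bsub>W\<^esub> emb b \<oplus>\<^bsub>W\<^esub> emb (parity A a) \<otimes>\<^bsub>W\<^esub> D b"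
  unfolding D_def d1_mult
  by (simp add: additive_add[OF letter_additive] letter_lact letter_ract EB.lact_closed EB.ract_closed)

lemma D_scalar: "k \<in> carrier K ==> D (k \<odot>\<^bsub>A\<^esub> \<one>\<^bsub>A\<^esub>) = \<zero>\<^bsub>W\<^esub>"
proof -
  assume "k \<in> carrier K"
  then have "D (k \<odot>\<^bsub>A\<^esub> \<one>\<^bsub>A\<^esub>) = (\<zero>\<^bsub>A\<^esub>, EB.T.cls [[\<zero>\<^bsub>E\<^esub>]])" by (simp add: D_def d1_scalar E_zero)
  also have "\<dots> = \<zero>\<^bsub>W\<^esub>" using additive_zero[OF E_group ring.is_abelian_group[OF W_ring] letter_additive] .
  finally show ?thesis .
qed

lemma D_gr: "a \<in> gr A n ==> D a \<in> gr W (Suc n)"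
proof -
  assume a: "a \<in> gr A n"
  then have "word_degree E [env_d1 K A a] (Suc n)"
    unfolding word_degree_def by (intro exI[of _ "[Suc n]"]) (simp add: d1_bgr)
  then show "D a \<in> gr W (Suc n)"
    using a EB.TG_grI[of "[[env_d1 K A a]]" "Suc n"] by (simp add: D_def env_eq EB.TA_gr gr_closed)
qed

text \<open>The expansion of elements of \<open>J\<close>, read in the envelope: \<open>A\<close> and $dA$ generate it.\<close>

lemma letter_expand:
  assumes X: "X \<in> lists TK.wds" and J: "TK.cls X \<in> carrier E"
  shows "(\<zero>\<^bsub>A\<^esub>, EB.T.cls [[TK.cls X]]) = lsum W (map (%w. emb (w ! 0) \<otimes>\<^bsub>W\<^esub> D (w ! 1)) X)"
proof -
  have c: "w ! 0 \<in> carrier A" "w ! Suc 0 \<in> carrier A" if "w \<in> set X" for w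
    using X that by (auto simp: in_lists_conv_set elim!: lists_words_2E)
  let ?l = "%m. (\<zero>\<^bsub>A\<^esub>, EB.T.cls [[m]])"
  have "?l (TK.cls X) = ?l (lsum E (map (%w. (w ! 0) \<odot>\<^bsub>E\<^esub> env_d1 K A (w ! 1)) X))"
    using E_expand[OF X J] by simp
  also have "\<dots> = lsum W (map (%w. ?l ((w ! 0) \<odot>\<^bsub>E\<^esub> env_d1 K A (w ! 1))) X)"
    using c by (intro additive_lsum_map[OF E_group ring.is_abelian_group[OF W_ring] letter_additive]) (auto intro: EB.lact_closed)
  also have "\<dots> = lsum W (map (%w. emb (w ! 0) \<otimes>\<^bsub>W\<^esub> D (w ! 1)) X)"
    using c by (intro lsum_cong) (auto simp: letter_lact D_def)
  finally show ?thesis .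
qed

lemma env_induct [consumes 1, case_names emb D add mult]:
  assumes x: "x \<in> carrier W"
    and emb: "\<And>a. a \<in> carrier A ==> P (emb a)"
    and D: "\<And>a. a \<in> carrier A ==> P (D a)"
    and add: "\<And>x y. x \<in> carrier W ==> y \<in> carrier W ==> P x ==> P y ==> P (x \<oplus>\<^bsub>W\<^esub> y)"
    and mult: "\<And>x y. x \<in> carrier W ==> y \<in> carrier W ==> P x ==> P y ==> P (x \<otimes>\<^bsub>W\<^esub> y)"
  shows "P x"
proof -
  interpret W: ring W by (rule W_ring)
  have letter: "P (\<zero>\<^bsub>A\<^esub>, EB.T.cls [[m]])" if "m \<in> carrier E" for m
  proof -
    have "m \<in> carrier TK.TG" using that by (simp add: E_carrier)
    then obtain X where X: "X \<in> lists TK.wds" "m = TK.cls X" by (rule TK.TG_cases)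
    have "P (lsum W (map (%w. emb (w ! 0) \<otimes>\<^bsub>W\<^esub> D (w ! 1)) X))" using X(1)
    proof (induction X)
      case Nil
      show ?case using emb[of "\<zero>\<^bsub>A\<^esub>"] additive_zero[OF A_group W.is_abelian_group ring_hom_additive[OF emb_hom]] by simp
    next
      case (Cons w X)
      from Cons obtain a b where w: "w = [a, b]" "a \<in> carrier A" "b \<in> carrier A" by (auto elim!: lists_words_2E)
      have c: "u ! 0 \<in> carrier A" "u ! Suc 0 \<in> carrier A" if "u \<in> set X" for u
        using Cons(2) that by (auto simp: in_lists_conv_set elim!: lists_words_2E)
      have "P (emb a \<otimes>\<^bsub>W\<^esub> D b)" using w by (intro mult emb D) auto
      then show ?case using w Cons.IH c by (auto intro!: add W.lsum_map_closed)
    qed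
    then show ?thesis using letter_expand[of X] X that by simp
  qed
  show ?thesis
    using EB.TA_induct[of x P] x emb letter add mult unfolding env_eq[symmetric] emb_eq[symmetric] by blast
qed

lemma env_graded_induct [consumes 1, case_names emb D add mult]:
  assumes x: "x \<in> gr W n"
    and emb: "\<And>n a. a \<in> gr A n ==> P n (emb a)"
    and D: "\<And>n a. a \<in> gr A n ==> P (Suc n) (D a)"
    and add: "\<And>n x y. x \<in> gr W n ==> y \<in> gr W n ==> P n x ==> P n y ==> P n (x \<oplus>\<^bsub>W\<^esub> y)"
    and mult: "\<And>m n x y. x \<in> gr W m ==> y \<in> gr W n ==> P m x ==> P n y ==> P (m + n) (x \<otimes>\<^bsub>W\<^esub> y)"
  shows "P n x"
proof -
  interpret W: ring W by (rule W_ring)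
  have gr_plus: "u \<in> gr W n ==> v \<in> gr W n ==> u \<oplus>\<^bsub>W\<^esub> v \<in> gr W n" for u v n
    using EB.TA_gr_submodule unfolding submodule_iff_gr[OF EB.TA_module] env_eq by blast
  have zero: "P n \<zero>\<^bsub>W\<^esub>" "\<zero>\<^bsub>W\<^esub> \<in> gr W n" for n
    using emb[OF gr_zero, of n] emb_gr[OF gr_zero, of n]
      additive_zero[OF A_group W.is_abelian_group ring_hom_additive[OF emb_hom]] by simp_all
  have letter: "P n (\<zero>\<^bsub>A\<^esub>, EB.T.cls [[m]])" if "m \<in> bgr E n" for m n
  proof (cases n)
    case 0
    then show ?thesis using that zero(1)[of 0] additive_zero[OF E_group W.is_abelian_group letter_additive]
      by (simp add: E_bgr_0 E_zero)
  next
    case (Suc k)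
    then have "m \<in> bgr E (Suc k)" using that by simp
    then obtain X where X: "m = TK.cls X" "X \<in> lists {[a, b] | a b. \<exists>r s. r + s = k \<and> a \<in> gr A r \<and> b \<in> gr A s}" "m \<in> carrier E"
      by (auto simp: E_bgr_Suc)
    then have wd: "X \<in> lists TK.wds" by (fastforce simp: in_lists_conv_set gr_closed)
    have "P n (lsum W (map (%w. emb (w ! 0) \<otimes>\<^bsub>W\<^esub> D (w ! 1)) X)) \<and>
      lsum W (map (%w. emb (w ! 0) \<otimes>\<^bsub>W\<^esub> D (w ! 1)) X) \<in> gr W n" using X(2)
    proof (induction X)
      case (Cons w X)
      from Cons obtain a b r s where w: "w = [a, b]" "a \<in> gr A r" "b \<in> gr A s" "r + s = k" by auto
      have g: "emb a \<otimes>\<^bsub>W\<^esub> D b \<in> gr W (r + Suc s)"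
        using EB.TA_gr_mult emb_gr[OF w(2)] D_gr[OF w(3)] unfolding env_eq by blast
      have "P (r + Suc s) (emb a \<otimes>\<^bsub>W\<^esub> D b)" using w emb_gr D_gr by (intro mult emb D) auto
      then show ?case using w(1,4) Cons.IH g Suc by (auto intro!: add gr_plus)
    qed (simp add: zero)
    then show ?thesis using letter_expand[OF wd] X by simp
  qed
  show ?thesis
    using EB.TA_graded_induct[of x n P] x emb letter add mult unfolding env_eq[symmetric] emb_eq[symmetric] by blast
qed

text \<open>On \<open>J\<close> the extension is forced to be $\sum_i a_i \otimes b_i \mapsto \sum_i \phi(a_i)\delta(b_i)$. This is
  compatible with the right action only on \<open>J\<close>: the Leibniz rule for \<open>\<delta>\<close> produces the additional term
  $\phi(\sum_i (-1)^{s_i} a_i b_i)\,\delta(y)$. The target is an arbitrary ring; it is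
  applied to rings of matrices, polynomials and functions.\<close>

lemma env_hom_exists:
  assumes R: "ring R" and \<phi>: "\<phi> \<in> ring_hom A R" and \<delta>: "\<delta> \<in> additive_maps A R"
    and leibniz: "\<And>a b. a \<in> carrier A ==> b \<in> carrier A ==> \<delta> (a \<otimes>\<^bsub>A\<^esub> b) = \<delta> a \<otimes>\<^bsub>R\<^esub> \<phi> b \<oplus>\<^bsub>R\<^esub> \<phi> (parity A a) \<otimes>\<^bsub>R\<^esub> \<delta> b"
    and scalar: "\<And>k. k \<in> carrier K ==> \<delta> (k \<odot>\<^bsub>A\<^esub> \<one>\<^bsub>A\<^esub>) = \<zero>\<^bsub>R\<^esub>"
  shows "\<exists>f. f \<in> ring_hom W R \<and> (\<forall>a\<in>carrier A. f (emb a) = \<phi> a) \<and> (\<forall>a\<in>carrier A. f (D a) = \<delta> a)"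
proof -
  interpret R: ring R by fact
  have RG: "abelian_group R" by unfold_locales
  have \<delta>c [simp]: "x \<in> carrier A ==> \<delta> x \<in> carrier R" for x using \<delta> by (rule additive_closed)
  have \<phi>c [simp]: "a \<in> carrier A ==> \<phi> a \<in> carrier R" for a using \<phi> by (rule ring_hom_closed)
  have \<phi>a: "\<phi> \<in> additive_maps A R" using \<phi> by (rule ring_hom_additive)
  let ?F = "%w. \<phi> (w ! 0) \<otimes>\<^bsub>R\<^esub> \<delta> (w ! 1)"
  have bal: "?F \<in> TK.balanced_to R"
  proof (rule pair_fun_balanced[OF RG])
    fix k a b assume k: "k \<in> carrier K" and a: "a \<in> carrier A" and b: "b \<in> carrier A"
    let ?k = "k \<odot>\<^bsub>A\<^esub> \<one>\<^bsub>A\<^esub>"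
    have kc: "?k \<in> carrier A" using k by simp
    have kb: "k \<odot>\<^bsub>A\<^esub> b = ?k \<otimes>\<^bsub>A\<^esub> b" "k \<odot>\<^bsub>A\<^esub> a = a \<otimes>\<^bsub>A\<^esub> ?k"
      using k a b by (simp_all add: smult_mult_left smult_mult_right)
    have "\<delta> (k \<odot>\<^bsub>A\<^esub> b) = \<phi> ?k \<otimes>\<^bsub>R\<^esub> \<delta> b"
      unfolding kb(1) leibniz[OF kc b] using k kc b by (simp add: scalar)
    moreover have "\<phi> (k \<odot>\<^bsub>A\<^esub> a) = \<phi> a \<otimes>\<^bsub>R\<^esub> \<phi> ?k"
      unfolding kb(2) using a kc \<phi> by (simp add: ring_hom_mult)
    ultimately show "\<phi> (k \<odot>\<^bsub>A\<^esub> a) \<otimes>\<^bsub>R\<^esub> \<delta> b = \<phi> a \<otimes>\<^bsub>R\<^esub> \<delta> (k \<odot>\<^bsub>A\<^esub> b)"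
      using a b kc by (simp add: R.m_assoc)
  qed (auto intro!: additive_mapsI simp: ring_hom_add[OF \<phi>] additive_add[OF \<delta>] R.l_distr R.r_distr)
  define \<psi> where "\<psi> = tensor_lift R ?F"
  have \<psi>: "\<psi> \<in> additive_maps TK.TG R" unfolding \<psi>_def by (rule TK.lift_additive[OF RG bal])
  have \<psi>c [simp]: "T \<in> carrier TK.TG ==> \<psi> T \<in> carrier R" for T using \<psi> by (rule additive_closed)
  have \<psi>p: "\<psi> (TK.cls [[a, b]]) = \<phi> a \<otimes>\<^bsub>R\<^esub> \<delta> b" if "a \<in> carrier A" "b \<in> carrier A" for a b
    unfolding \<psi>_def using TK.lift_cls[OF RG bal, of "[[a, b]]"] that by simp
  have lm: "(%x. c \<otimes>\<^bsub>R\<^esub> x) \<in> additive_maps R R" "(%x. x \<otimes>\<^bsub>R\<^esub> c) \<in> additive_maps R R" if "c \<in> carrier R" for c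
    using that by (auto intro!: additive_mapsI simp: R.l_distr R.r_distr)
  have 1: "\<psi> (x \<odot>\<^bsub>E\<^esub> T) = \<phi> x \<otimes>\<^bsub>R\<^esub> \<psi> T" if "x \<in> carrier A" "T \<in> carrier TK.TG" for x T
    by (rule TK_ext[OF that(2) RG additive_compose[OF \<psi> E_lact_additive[OF that(1)]] additive_compose[OF lm(1) \<psi>]])
      (auto simp: that E_lact_pair \<psi>p ring_hom_mult[OF \<phi>] R.m_assoc)
  \<comment> \<open>The additional term contains the signed product, which vanishes on J.\<close>
  have 2: "\<psi> (rsmult E T y) = \<psi> T \<otimes>\<^bsub>R\<^esub> \<phi> y \<oplus>\<^bsub>R\<^esub> \<phi> (signed_product T) \<otimes>\<^bsub>R\<^esub> \<delta> y"
    if "y \<in> carrier A" "T \<in> carrier TK.TG" for y T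
    by (rule TK_ext[OF that(2) RG additive_compose[OF \<psi> E_ract_additive[OF that(1)]]
          additive_maps_plus[OF RG additive_compose[OF lm(2) \<psi>]
            additive_compose[OF lm(2) additive_compose[OF \<phi>a signed_product_additive]]]])
      (auto simp: that E_ract_pair \<psi>p leibniz ring_hom_mult[OF \<phi>] signed_product_pair R.m_assoc R.r_distr)
  have "\<psi> \<in> additive_maps E R" using \<psi> by (auto simp: additive_maps_def E_carrier E_add)
  moreover have "\<psi> (rsmult E T y) = \<psi> T \<otimes>\<^bsub>R\<^esub> \<phi> y" if "y \<in> carrier A" "T \<in> carrier E" for y T
    using 2[of y T] that by (simp add: E_carrier additive_zero[OF A_group RG \<phi>a])
  ultimately obtain f where f: "f \<in> ring_hom W R" "\<And>a. a \<in> carrier A ==> f (emb a) = \<phi> a"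
    "\<And>m. m \<in> carrier E ==> f (\<zero>\<^bsub>A\<^esub>, EB.T.cls [[m]]) = \<psi> m"
    using EB.tensor_hom_exists[OF R \<phi>, of \<psi>] 1 unfolding env_eq[symmetric] emb_eq[symmetric] by (auto simp: E_carrier)
  have "\<delta> \<one>\<^bsub>A\<^esub> = \<zero>\<^bsub>R\<^esub>" using scalar[of "\<one>\<^bsub>K\<^esub>"] by simp
  then have "f (D a) = \<delta> a" if "a \<in> carrier A" for a
    using f(3)[OF d1_closed[OF that]] that
    by (simp add: D_def, simp add: d1_eq additive_add[OF \<psi>] \<psi>p ring_hom_one[OF \<phi>])
  then show ?thesis using f by blast
qed

lemma env_hom_unique:
  assumes "f \<in> ring_hom W R" "g \<in> ring_hom W R" "x \<in> carrier W"
    "\<And>a. a \<in> carrier A ==> f (emb a) = g (emb a)" "\<And>a. a \<in> carrier A ==> f (D a) = g (D a)"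
  shows "f x = g x"
  using assms(3)
  by (induction rule: env_induct) (auto simp: assms(4,5) ring_hom_add[OF assms(1)] ring_hom_add[OF assms(2)]
    ring_hom_mult[OF assms(1)] ring_hom_mult[OF assms(2)])

end

section \<open>Triangular matrices\<close>

text \<open>The triple \<open>(u, v, w)\<close> is the matrix with rows $(u, v)$ and $(0, w)$. A homomorphism
  $x \mapsto (\phi x, \delta x, \psi x)$ into these matrices is a pair of homomorphisms with a derivation
  between them, so derivations out of the envelope are obtained from its universal property.\<close>

definition tri :: "('k, 'a, 'm) module_scheme \<Rightarrow> ('k, 'a \<times> 'a \<times> 'a) module" where
  "tri R = \<lparr>
     carrier = carrier R \<times> carrier R \<times> carrier R,
     mult = (%(u, v, w) (u', v', w'). (u \<otimes>\<^bsub>R\<^esub> u', u \<otimes>\<^bsub>R\<^esub> v' \<oplus>\<^bsub>R\<^esub> v \<otimes>\<^bsub>R\<^esub> w', w \<otimes>\<^bsub>R\<^esub> w')),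
     one = (\<one>\<^bsub>R\<^esub>, \<zero>\<^bsub>R\<^esub>, \<one>\<^bsub>R\<^esub>),
     zero = (\<zero>\<^bsub>R\<^esub>, \<zero>\<^bsub>R\<^esub>, \<zero>\<^bsub>R\<^esub>),
     add = (%(u, v, w) (u', v', w'). (u \<oplus>\<^bsub>R\<^esub> u', v \<oplus>\<^bsub>R\<^esub> v', w \<oplus>\<^bsub>R\<^esub> w')),
     smult = (%k (u, v, w). (k \<odot>\<^bsub>R\<^esub> u, k \<odot>\<^bsub>R\<^esub> v, k \<odot>\<^bsub>R\<^esub> w))\<rparr>"

lemma tri_simps [simp]:
  "carrier (tri R) = carrier R \<times> carrier R \<times> carrier R"
  "(u, v, w) \<otimes>\<^bsub>tri R\<^esub> (u', v', w') = (u \<otimes>\<^bsub>R\<^esub> u', u \<otimes>\<^bsub>R\<^esub> v' \<oplus>\<^bsub>R\<^esub> v \<otimes>\<^bsub>R\<^esub> w', w \<otimes>\<^bsub>R\<^esub> w')"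
  "\<one>\<^bsub>tri R\<^esub> = (\<one>\<^bsub>R\<^esub>, \<zero>\<^bsub>R\<^esub>, \<one>\<^bsub>R\<^esub>)"
  "\<zero>\<^bsub>tri R\<^esub> = (\<zero>\<^bsub>R\<^esub>, \<zero>\<^bsub>R\<^esub>, \<zero>\<^bsub>R\<^esub>)"
  "(u, v, w) \<oplus>\<^bsub>tri R\<^esub> (u', v', w') = (u \<oplus>\<^bsub>R\<^esub> u', v \<oplus>\<^bsub>R\<^esub> v', w \<oplus>\<^bsub>R\<^esub> w')"
  "k \<odot>\<^bsub>tri R\<^esub> (u, v, w) = (k \<odot>\<^bsub>R\<^esub> u, k \<odot>\<^bsub>R\<^esub> v, k \<odot>\<^bsub>R\<^esub> w)"
  by (simp_all add: tri_def)

lemma tri_algebra: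
  assumes "assoc_algebra K R"
  shows "assoc_algebra K (tri R)"
proof -
  interpret R: assoc_algebra K R by fact
  have group: "abelian_group (tri R)"
  proof (rule abelian_groupI)
    fix x assume "x \<in> carrier (tri R)"
    then obtain u v w where "x = (u, v, w)" "u \<in> carrier R" "v \<in> carrier R" "w \<in> carrier R" by auto
    then show "\<exists>y\<in>carrier (tri R). y \<oplus>\<^bsub>tri R\<^esub> x = \<zero>\<^bsub>tri R\<^esub>"
      by (intro bexI[of _ "(\<ominus>\<^bsub>R\<^esub> u, \<ominus>\<^bsub>R\<^esub> v, \<ominus>\<^bsub>R\<^esub> w)"]) (auto simp: R.l_neg)
  qed (auto simp: R.a_ac)
  have "ring (tri R)"
  proof (rule ringI[OF group])
    show "monoid (tri R)"
      by (rule monoidI) (auto simp: R.m_assoc R.l_distr R.r_distr R.a_ac)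
  qed (auto simp: R.l_distr R.r_distr R.a_ac)
  moreover have "module K (tri R)"
    by (rule moduleI[OF _ group]) (auto simp: R.smult_l_distr R.smult_r_distr R.smult_assoc1 intro: R.R.is_cring)
  moreover have "field K" by unfold_locales
  ultimately show ?thesis
    by (intro assoc_algebra.intro assoc_algebra_axioms.intro)
      (auto simp: R.smult_mult_left R.smult_mult_right R.smult_r_distr)
qed

section \<open>The differential of the envelope\<close>

context graded_algebra
begin

sublocale W: assoc_algebra K W by (rule W_algebra)

lemma W_group: "abelian_group W" by unfold_locales

lemma D_add: "a \<in> carrier A ==> b \<in> carrier A ==> D (a \<oplus>\<^bsub>A\<^esub> b) = D a \<oplus>\<^bsub>W\<^esub> D b"
  using D_additive by (rule additive_add)

lemma D_one: "D \<one>\<^bsub>A\<^esub> = \<zero>\<^bsub>W\<^esub>"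
  using D_scalar[of "\<one>\<^bsub>K\<^esub>"] by simp

lemma W_smult: "k \<in> carrier K ==> x \<in> carrier W ==> k \<odot>\<^bsub>W\<^esub> x = emb (k \<odot>\<^bsub>A\<^esub> \<one>\<^bsub>A\<^esub>) \<otimes>\<^bsub>W\<^esub> x"
  using ring_hom_one[OF emb_hom] by (simp add: emb_smult W.smult_mult_left)

text \<open>The parity automorphism and the differential are obtained together, as the first row of a
  homomorphism into triangular matrices whose last diagonal entry is the identity.\<close>

lemma parity_d_exists:
  "\<exists>s d. s \<in> ring_hom W W \<and> d \<in> additive_maps W W \<and>
    (\<forall>a\<in>carrier A. s (emb a) = emb (parity A a) \<and> s (D a) = \<ominus>\<^bsub>W\<^esub> D (parity A a) \<and> d (emb a) = D a \<and> d (D a) = \<zero>\<^bsub>W\<^esub>) \<and>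
    (\<forall>x\<in>carrier W. \<forall>y\<in>carrier W. d (x \<otimes>\<^bsub>W\<^esub> y) = s x \<otimes>\<^bsub>W\<^esub> d y \<oplus>\<^bsub>W\<^esub> d x \<otimes>\<^bsub>W\<^esub> y)"
proof -
  interpret T: assoc_algebra K "tri W" by (rule tri_algebra[OF W_algebra])
  let ?\<phi> = "%a. (emb (parity A a), D a, emb a)"
  let ?\<delta> = "%a. (\<ominus>\<^bsub>W\<^esub> D (parity A a), \<zero>\<^bsub>W\<^esub>, D a)"
  have "\<exists>f. f \<in> ring_hom W (tri W) \<and> (\<forall>a\<in>carrier A. f (emb a) = ?\<phi> a) \<and> (\<forall>a\<in>carrier A. f (D a) = ?\<delta> a)"
  proof (rule env_hom_exists)
    show "ring (tri W)" by unfold_locales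
    show "?\<phi> \<in> ring_hom A (tri W)"
      by (rule ring_hom_memI)
        (auto simp: ring_hom_mult[OF emb_hom] ring_hom_add[OF emb_hom] ring_hom_one[OF emb_hom] D_mult D_add D_one W.a_comm)
    show "?\<delta> \<in> additive_maps A (tri W)"
      by (rule additive_mapsI) (auto simp: D_add W.minus_add)
  next
    fix a b assume "a \<in> carrier A" "b \<in> carrier A"
    then show "?\<delta> (a \<otimes>\<^bsub>A\<^esub> b) = ?\<delta> a \<otimes>\<^bsub>tri W\<^esub> ?\<phi> b \<oplus>\<^bsub>tri W\<^esub> ?\<phi> (parity A a) \<otimes>\<^bsub>tri W\<^esub> ?\<delta> b"
      by (auto simp: D_mult W.minus_add W.l_minus W.r_minus W.l_neg W.r_neg W.a_ac)
  next
    fix k assume "k \<in> carrier K"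
    then show "?\<delta> (k \<odot>\<^bsub>A\<^esub> \<one>\<^bsub>A\<^esub>) = \<zero>\<^bsub>tri W\<^esub>"
      by (auto simp: D_scalar)
  qed
  then obtain f where f: "f \<in> ring_hom W (tri W)" "\<And>a. a \<in> carrier A ==> f (emb a) = ?\<phi> a"
    "\<And>a. a \<in> carrier A ==> f (D a) = ?\<delta> a" by blast
  define s d t where "s x = fst (f x)" and "d x = fst (snd (f x))" and "t x = snd (snd (f x))" for x
  have fx: "f x = (s x, d x, t x)" for x by (simp add: s_def d_def t_def)
  have cl: "s x \<in> carrier W" "d x \<in> carrier W" "t x \<in> carrier W" if "x \<in> carrier W" for x
    using ring_hom_closed[OF f(1) that] by (simp_all add: fx)
  have mult: "s (x \<otimes>\<^bsub>W\<^esub> y) = s x \<otimes>\<^bsub>W\<^esub> s y" "d (x \<otimes>\<^bsub>W\<^esub> y) = s x \<otimes>\<^bsub>W\<^esub> d y \<oplus>\<^bsub>W\<^esub> d x \<otimes>\<^bsub>W\<^esub> t y"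
    "t (x \<otimes>\<^bsub>W\<^esub> y) = t x \<otimes>\<^bsub>W\<^esub> t y" if "x \<in> carrier W" "y \<in> carrier W" for x y
    using ring_hom_mult[OF f(1) that] by (simp_all add: fx)
  have add: "s (x \<oplus>\<^bsub>W\<^esub> y) = s x \<oplus>\<^bsub>W\<^esub> s y" "d (x \<oplus>\<^bsub>W\<^esub> y) = d x \<oplus>\<^bsub>W\<^esub> d y"
    "t (x \<oplus>\<^bsub>W\<^esub> y) = t x \<oplus>\<^bsub>W\<^esub> t y" if "x \<in> carrier W" "y \<in> carrier W" for x y
    using ring_hom_add[OF f(1) that] by (simp_all add: fx)
  have one: "s \<one>\<^bsub>W\<^esub> = \<one>\<^bsub>W\<^esub>" "t \<one>\<^bsub>W\<^esub> = \<one>\<^bsub>W\<^esub>"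
    using ring_hom_one[OF f(1)] by (simp_all add: fx)
  have gen: "s (emb a) = emb (parity A a)" "s (D a) = \<ominus>\<^bsub>W\<^esub> D (parity A a)" "d (emb a) = D a" "d (D a) = \<zero>\<^bsub>W\<^esub>"
    "t (emb a) = emb a" "t (D a) = D a" if "a \<in> carrier A" for a
    using f(2,3)[OF that] by (simp_all add: fx)
  have "t \<in> ring_hom W W" by (rule ring_hom_memI) (auto simp: cl mult add one)
  from env_hom_unique[OF this id_ring_hom] have t: "t x = x" if "x \<in> carrier W" for x
    using that gen by simp
  have "s \<in> ring_hom W W" by (rule ring_hom_memI) (auto simp: cl mult add one)
  moreover have "d \<in> additive_maps W W" by (rule additive_mapsI) (auto simp: cl add)
  ultimately show ?thesis using gen mult(2) t by (intro exI[of _ s] exI[of _ d]) auto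
qed

text \<open>Mark the degree by a variable \<open>t\<close>: the homomorphism into polynomials with $a \mapsto \sum_n a_n t^n$
  and $da \mapsto \sum_n d(a_n)\,t^{n+1}$ sends \<open>x\<close> of degree \<open>n\<close> to $x t^n$, so its coefficients are the
  projections onto the components.\<close>

lemma envelope_projections:
  "\<exists>\<pi>. (\<forall>k. \<pi> k \<in> additive_maps W W) \<and> (\<forall>n x k. x \<in> gr W n \<longrightarrow> \<pi> k x = (if k = n then x else \<zero>\<^bsub>W\<^esub>))"
proof -
  interpret U: UP_ring W "UP W" by (intro UP_ring.intro W_ring)
  let ?M = "monom (UP W)"
  have M: "?M x n = (%i. if i = n then x else \<zero>\<^bsub>W\<^esub>)" if "x \<in> carrier W" for x n
    using that by (simp add: UP_def)
  have padd: "p \<oplus>\<^bsub>UP W\<^esub> q = (%i. p i \<oplus>\<^bsub>W\<^esub> q i)" if "p \<in> carrier (UP W)" "q \<in> carrier (UP W)" for p q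
    using that by (simp add: UP_def)
  have UG: "abelian_group (UP W)" by unfold_locales
  define \<phi> where "\<phi> a = (%n. emb (hcomponent A a n))" for a
  define \<delta> where "\<delta> a = (%n. case n of 0 \<Rightarrow> \<zero>\<^bsub>W\<^esub> | Suc m \<Rightarrow> D (hcomponent A a m))" for a
  have e0: "emb \<zero>\<^bsub>A\<^esub> = \<zero>\<^bsub>W\<^esub>" "D \<zero>\<^bsub>A\<^esub> = \<zero>\<^bsub>W\<^esub>"
    using additive_zero[OF A_group W_group] ring_hom_additive[OF emb_hom] D_additive by blast+
  have hom: "\<phi> a = ?M (emb a) n" "\<delta> a = ?M (D a) (Suc n)" if "a \<in> gr A n" for a n
    using that by (auto simp: \<phi>_def \<delta>_def M gr_closed hcomponent_homogeneous e0 split: nat.split)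
  have cl: "\<phi> a \<in> carrier (UP W) \<and> \<delta> a \<in> carrier (UP W)" if "a \<in> carrier A" for a
    using that
  proof (induction rule: homogeneous_induct)
    case (homogeneous n x)
    then show ?case by (simp add: hom[OF homogeneous] gr_closed)
  next
    case (add x y)
    have "\<phi> (x \<oplus>\<^bsub>A\<^esub> y) = \<phi> x \<oplus>\<^bsub>UP W\<^esub> \<phi> y" "\<delta> (x \<oplus>\<^bsub>A\<^esub> y) = \<delta> x \<oplus>\<^bsub>UP W\<^esub> \<delta> y"
      using add by (auto simp: \<phi>_def[of "x \<oplus>\<^bsub>A\<^esub> y"] \<delta>_def[of "x \<oplus>\<^bsub>A\<^esub> y"] padd hcomponent_add)
        (auto simp: \<phi>_def \<delta>_def ring_hom_add[OF emb_hom] D_add hcomponent_add fun_eq_iff split: nat.split)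
    then show ?case using add by simp
  qed
  have hom_add: "\<phi> (x \<oplus>\<^bsub>A\<^esub> y) = \<phi> x \<oplus>\<^bsub>UP W\<^esub> \<phi> y" "\<delta> (x \<oplus>\<^bsub>A\<^esub> y) = \<delta> x \<oplus>\<^bsub>UP W\<^esub> \<delta> y"
    if "x \<in> carrier A" "y \<in> carrier A" for x y
    using that cl[of x] cl[of y] by (auto simp: \<phi>_def[of "x \<oplus>\<^bsub>A\<^esub> y"] \<delta>_def[of "x \<oplus>\<^bsub>A\<^esub> y"] padd hcomponent_add)
      (auto simp: \<phi>_def \<delta>_def ring_hom_add[OF emb_hom] D_add hcomponent_add fun_eq_iff split: nat.split)
  have mult: "\<phi> (x \<otimes>\<^bsub>A\<^esub> y) = \<phi> x \<otimes>\<^bsub>UP W\<^esub> \<phi> y \<and>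
      \<delta> (x \<otimes>\<^bsub>A\<^esub> y) = \<delta> x \<otimes>\<^bsub>UP W\<^esub> \<phi> y \<oplus>\<^bsub>UP W\<^esub> \<phi> (parity A x) \<otimes>\<^bsub>UP W\<^esub> \<delta> y"
    if "x \<in> carrier A" "y \<in> carrier A" for x y
    using that
  proof (induction arbitrary: y rule: homogeneous_induct)
    case (homogeneous m x)
    note x = homogeneous(1)
    have xc: "x \<in> carrier A" using x by (rule gr_closed)
    from homogeneous(2) show ?case
    proof (induction rule: homogeneous_induct)
      case (homogeneous n y)
      have yc: "y \<in> carrier A" using homogeneous by (rule gr_closed)
      have "?M (D x \<otimes>\<^bsub>W\<^esub> emb y) (Suc m + n) = ?M (D x) (Suc m) \<otimes>\<^bsub>UP W\<^esub> ?M (emb y) n"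
        "?M (emb (parity A x) \<otimes>\<^bsub>W\<^esub> D y) (m + Suc n) = ?M (emb (parity A x)) m \<otimes>\<^bsub>UP W\<^esub> ?M (D y) (Suc n)"
        using xc yc by (intro U.monom_mult; simp)+
      then show ?case
        using x xc yc homogeneous hom[OF gr_mult[OF x homogeneous]] hom[OF x] hom[OF homogeneous] hom[OF parity_gr[OF x]]
        by (simp add: ring_hom_mult[OF emb_hom] D_mult)
    next
      case (add y z)
      then show ?case
        using xc cl[OF xc] cl[OF add(1)] cl[OF add(2)] cl[of "parity A x"]
        by (simp add: r_distr hom_add(1)
            hom_add(2) U.P.r_distr U.P.a_ac)
    qed
  next
    case (add x z)
    then show ?case
      using cl[OF add(1)] cl[OF add(2)] cl[OF add(5)] cl[of "parity A x"] cl[of "parity A z"]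
      by (simp add: l_distr hom_add(1)
          hom_add(2) U.P.l_distr U.P.a_ac)
  qed
  have "\<exists>f. f \<in> ring_hom W (UP W) \<and> (\<forall>a\<in>carrier A. f (emb a) = \<phi> a) \<and> (\<forall>a\<in>carrier A. f (D a) = \<delta> a)"
  proof (rule env_hom_exists)
    show "ring (UP W)" by unfold_locales
    show "\<phi> \<in> ring_hom A (UP W)"
      using cl mult hom_add hom[OF gr_one] ring_hom_one[OF emb_hom] U.monom_one by (intro ring_hom_memI) auto
    show "\<delta> \<in> additive_maps A (UP W)" using cl hom_add by (intro additive_mapsI) auto
  next
    fix k assume k: "k \<in> carrier K"
    then show "\<delta> (k \<odot>\<^bsub>A\<^esub> \<one>\<^bsub>A\<^esub>) = \<zero>\<^bsub>UP W\<^esub>"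
      using hom(2)[OF gr_smult[OF k gr_one]] by (simp add: D_scalar U.monom_zero)
  qed (use mult in auto)
  then obtain f where f: "f \<in> ring_hom W (UP W)" "\<And>a. a \<in> carrier A ==> f (emb a) = \<phi> a" "\<And>a. a \<in> carrier A ==> f (D a) = \<delta> a"
    by blast
  have gr_cl: "x \<in> carrier W" if "x \<in> gr W n" for x n
    using that W.submoduleE(1)[OF EB.TA_gr_submodule[folded env_eq]] by blast
  have fx: "f x = ?M x n" if "x \<in> gr W n" for x n
    using that
  proof (induction rule: env_graded_induct)
    case (mult m n x y)
    then show ?case using gr_cl by (simp add: ring_hom_mult[OF f(1)] U.monom_mult)
  qed (auto simp: f hom gr_closed ring_hom_add[OF f(1)] gr_cl)
  have "(%x. f x k) \<in> additive_maps W W" for k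
    using ring_hom_closed[OF f(1)] ring_hom_add[OF f(1)] U.coeff_closed
    by (intro additive_mapsI) (auto simp: padd UP_def up_def)
  moreover have "f x k = (if k = n then x else \<zero>\<^bsub>W\<^esub>)" if "x \<in> gr W n" for x n k
    using fx[OF that] gr_cl[OF that] by (simp add: M)
  ultimately show ?thesis by (intro exI[of _ "%k x. f x k"]) blast
qed

lemma W_gr_submodule: "submodule (gr W n) K W"
  unfolding env_eq by (rule EB.TA_gr_submodule)

text \<open>Sums of homogeneous elements form a subring containing the generators.\<close>

lemma env_span:
  assumes "x \<in> carrier W"
  shows "\<exists>xs. set xs \<subseteq> (\<Union>n. gr W n) \<and> x = lsum W xs"
  using assms
proof (induction rule: env_induct)
  have gr_cl: "(\<Union>n. gr W n) \<subseteq> carrier W" using W.submoduleE(1)[OF W_gr_submodule] by blast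
  have hom: "\<exists>xs. set xs \<subseteq> (\<Union>n. gr W n) \<and> g a = lsum W xs" if a: "a \<in> carrier A" and g: "g \<in> additive_maps A W"
    and deg: "\<And>n a. a \<in> gr A n ==> \<exists>m. g a \<in> gr W m" for a g
    using a
  proof (induction rule: homogeneous_induct)
    case (homogeneous n a)
    then obtain m where m: "g a \<in> gr W m" using deg by blast
    moreover from this have "g a \<in> carrier W" using gr_cl by blast
    ultimately show ?case by (intro exI[of _ "[g a]"]) auto
  next
    case (add x y)
    then obtain xs ys where "set xs \<subseteq> (\<Union>n. gr W n)" "g x = lsum W xs" "set ys \<subseteq> (\<Union>n. gr W n)" "g y = lsum W ys" by blast
    then show ?case using gr_cl add(1,2) W.lsum_append[of xs ys]
      by (intro exI[of _ "xs @ ys"]) (auto simp: additive_add[OF g])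
  qed
  {
    case (emb a)
    show ?case by (rule hom[OF emb ring_hom_additive[OF emb_hom]]) (use emb_gr in blast)
  next
    case (D a)
    show ?case by (rule hom[OF D D_additive]) (use D_gr in blast)
  next
    case (add x y)
    then obtain xs ys where "set xs \<subseteq> (\<Union>n. gr W n)" "x = lsum W xs" "set ys \<subseteq> (\<Union>n. gr W n)" "y = lsum W ys" by blast
    then show ?case using gr_cl W.lsum_append[of xs ys] by (intro exI[of _ "xs @ ys"]) auto
  next
    case (mult x y)
    then obtain xs ys where xy: "set xs \<subseteq> (\<Union>n. gr W n)" "x = lsum W xs" "set ys \<subseteq> (\<Union>n. gr W n)" "y = lsum W ys" by blast
    then have c: "set xs \<subseteq> carrier W" "set ys \<subseteq> carrier W" using gr_cl by blast+
    have "x \<otimes>\<^bsub>W\<^esub> y = lsum W (map (%u. u \<otimes>\<^bsub>W\<^esub> y) xs)"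
      unfolding xy(2) using c mult(2) by (intro additive_lsum[OF W_group W_group]) (auto intro!: additive_mapsI simp: W.l_distr)
    also have "\<dots> = lsum W (map (%u. lsum W (map (%v. u \<otimes>\<^bsub>W\<^esub> v) ys)) xs)"
      unfolding xy(4) using c by (intro lsum_cong additive_lsum[OF W_group W_group]) (auto intro!: additive_mapsI simp: W.r_distr)
    also have "\<dots> = lsum W (concat (map (%u. map (%v. u \<otimes>\<^bsub>W\<^esub> v) ys) xs))"
    proof (rule W.lsum_concat[symmetric])
      fix u assume "u \<in> set xs"
      then have "u \<otimes>\<^bsub>W\<^esub> v \<in> carrier W" if "v \<in> set ys" for v using that c by blast
      then show "set (map ((\<otimes>\<^bsub>W\<^esub>) u) ys) \<subseteq> carrier W" by (simp add: image_subset_iff)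
    qed
    finally have "x \<otimes>\<^bsub>W\<^esub> y = lsum W (concat (map (%u. map (%v. u \<otimes>\<^bsub>W\<^esub> v) ys) xs))" .
    moreover have "set (concat (map (%u. map (%v. u \<otimes>\<^bsub>W\<^esub> v) ys) xs)) \<subseteq> (\<Union>n. gr W n)"
    proof
      fix z assume "z \<in> set (concat (map (%u. map (%v. u \<otimes>\<^bsub>W\<^esub> v) ys) xs))"
      then obtain u v where z: "z = u \<otimes>\<^bsub>W\<^esub> v" "u \<in> set xs" "v \<in> set ys" by auto
      then obtain m n where "u \<in> gr W m" "v \<in> gr W n" using xy by blast
      then show "z \<in> (\<Union>n. gr W n)" using EB.TA_gr_mult[folded env_eq] z by blast
    qed
    ultimately show ?case by blast
  }
qed

lemma W_graded: "graded_algebra K W"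
proof -
  obtain \<pi> where \<pi>: "\<And>k. \<pi> k \<in> additive_maps W W" "\<And>n x k. x \<in> gr W n ==> \<pi> k x = (if k = n then x else \<zero>\<^bsub>W\<^esub>)"
    using envelope_projections by blast
  show ?thesis
    by (rule graded_algebraI[OF W_algebra W_gr_submodule _ _ env_span \<pi>])
      (auto simp: env_eq intro: EB.TA_gr_one EB.TA_gr_mult)
qed

interpretation WG: graded_algebra K W by (rule W_graded)

text \<open>All properties of the differential are checked on generators. On products the degree and the sign in
  the Leibniz rule depend on \<open>s\<close> being the parity, and $d^2 = 0$ depends on $sd = -ds$.\<close>

lemma differential_exists: "\<exists>d. graded_differential_algebra K W d \<and> (\<forall>a\<in>carrier A. d (emb a) = D a)"
proof -
  obtain s d where s: "s \<in> ring_hom W W" and d: "d \<in> additive_maps W W"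
    and gen: "\<And>a. a \<in> carrier A ==> s (emb a) = emb (parity A a)" "\<And>a. a \<in> carrier A ==> s (D a) = \<ominus>\<^bsub>W\<^esub> D (parity A a)"
      "\<And>a. a \<in> carrier A ==> d (emb a) = D a" "\<And>a. a \<in> carrier A ==> d (D a) = \<zero>\<^bsub>W\<^esub>"
    and d_mult: "\<And>x y. x \<in> carrier W ==> y \<in> carrier W ==> d (x \<otimes>\<^bsub>W\<^esub> y) = s x \<otimes>\<^bsub>W\<^esub> d y \<oplus>\<^bsub>W\<^esub> d x \<otimes>\<^bsub>W\<^esub> y"
    using parity_d_exists by blast
  note sa = ring_hom_additive[OF s]
  have [simp]: "x \<in> carrier W ==> s x \<in> carrier W" "x \<in> carrier W ==> d x \<in> carrier W" for x
    using s d by (auto intro: ring_hom_closed additive_closed)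
  have [simp]: "s \<zero>\<^bsub>W\<^esub> = \<zero>\<^bsub>W\<^esub>" "d \<zero>\<^bsub>W\<^esub> = \<zero>\<^bsub>W\<^esub>"
    using additive_zero[OF W_group W_group] sa d by blast+
  have [simp]: "x \<in> carrier W ==> y \<in> carrier W ==> s (x \<oplus>\<^bsub>W\<^esub> y) = s x \<oplus>\<^bsub>W\<^esub> s y"
    "x \<in> carrier W ==> y \<in> carrier W ==> d (x \<oplus>\<^bsub>W\<^esub> y) = d x \<oplus>\<^bsub>W\<^esub> d y"
    "x \<in> carrier W ==> y \<in> carrier W ==> s (x \<otimes>\<^bsub>W\<^esub> y) = s x \<otimes>\<^bsub>W\<^esub> s y"
    "x \<in> carrier W ==> s (\<ominus>\<^bsub>W\<^esub> x) = \<ominus>\<^bsub>W\<^esub> s x" "x \<in> carrier W ==> d (\<ominus>\<^bsub>W\<^esub> x) = \<ominus>\<^bsub>W\<^esub> d x" for x y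
    using ring_hom_add[OF s] additive_add[OF d] ring_hom_mult[OF s] additive_neg[OF W_group W_group sa]
      additive_neg[OF W_group W_group d] by auto
  have sgn: "s x = gsign W n x" if "x \<in> gr W n" for x n
    using that
  proof (induction rule: env_graded_induct)
    case (emb n a)
    then show ?case by (simp add: gen gr_closed parity_homogeneous[where n=n]
      additive_gsign[OF A_group W_group ring_hom_additive[OF emb_hom]])
  next
    case (D n a)
    then show ?case by (simp add: gen gr_closed parity_homogeneous[where n=n]
      additive_gsign[OF A_group W_group D_additive] W.gsign_Suc)
  next
    case (add n x y)
    then show ?case by (simp add: W.gsign_add WG.gr_closed)
  next
    case (mult m n x y)
    then show ?case by (simp add: W.gsign_mult WG.gr_closed)
  qed
  have deg: "d x \<in> gr W (Suc n)" if "x \<in> gr W n" for x n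
    using that
  proof (induction rule: env_graded_induct)
    case (emb n a)
    then show ?case using D_gr by (simp add: gen gr_closed)
  next
    case (D n a)
    then show ?case by (simp add: gen gr_closed)
  next
    case (add n x y)
    then show ?case by (simp add: WG.gr_closed WG.gr_add)
  next
    case (mult m n x y)
    have "s x \<otimes>\<^bsub>W\<^esub> d y \<in> gr W (m + Suc n)"
      unfolding sgn[OF mult(1)] using mult by (intro WG.gr_mult WG.gr_gsign)
    moreover have "d x \<otimes>\<^bsub>W\<^esub> y \<in> gr W (Suc m + n)"
      using mult by (intro WG.gr_mult)
    ultimately show ?case using mult by (simp add: d_mult WG.gr_closed WG.gr_add)
  qed
  \<comment> \<open>The square of d on a product involves s d, so both identities are proved together.\<close>
  have sq: "d (d x) = \<zero>\<^bsub>W\<^esub> \<and> s (d x) = \<ominus>\<^bsub>W\<^esub> d (s x)" if "x \<in> carrier W" for x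
    using that
  proof (induction rule: env_induct)
    case (mult x y)
    then show ?case
      by (simp add: d_mult
          W.l_minus W.r_minus W.minus_add W.r_neg W.a_ac)
  qed (auto simp: gen W.minus_add)
  have "graded_differential_algebra K W d"
  proof (intro graded_differential_algebra.intro graded_differential_algebra_axioms.intro W_graded)
    show "d \<in> linear_maps K W W"
    proof (rule linear_mapsI)
      fix k x assume "k \<in> carrier K" "x \<in> carrier W"
      then show "d (k \<odot>\<^bsub>W\<^esub> x) = k \<odot>\<^bsub>W\<^esub> d x"
        by (simp add: W_smult d_mult gen D_scalar)
    qed auto
  next
    fix x y n assume x: "x \<in> gr W n" and y: "y \<in> carrier W"
    then have "gsign W n (x \<otimes>\<^bsub>W\<^esub> d y) = gsign W n x \<otimes>\<^bsub>W\<^esub> d y"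
      using W.gsign_mult[of x "d y" n 0] WG.gr_closed by simp
    then show "d (x \<otimes>\<^bsub>W\<^esub> y) = d x \<otimes>\<^bsub>W\<^esub> y \<oplus>\<^bsub>W\<^esub> gsign W n (x \<otimes>\<^bsub>W\<^esub> d y)"
      using x y by (simp add: d_mult sgn[OF x] WG.gr_closed W.a_comm)
  qed (use deg sq in auto)
  then show ?thesis using gen(3) by blast
qed

lemma differential_unique:
  assumes d: "graded_differential_algebra K W d" "\<And>a. a \<in> carrier A ==> d (emb a) = D a"
    and d': "graded_differential_algebra K W d'" "\<And>a. a \<in> carrier A ==> d' (emb a) = D a"
    and x: "x \<in> carrier W"
  shows "d x = d' x"
proof -
  interpret d: graded_differential_algebra K W d by fact
  interpret d': graded_differential_algebra K W d' by fact
  show ?thesis using x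
  proof (induction rule: env_induct)
    case (D a)
    have "d (D a) = \<zero>\<^bsub>W\<^esub>" "d' (D a) = \<zero>\<^bsub>W\<^esub>"
      using d.d_square[of "emb a"] d'.d_square[of "emb a"] d(2) d'(2) D by simp_all
    then show ?case by simp
  qed (auto simp: d(2) d'(2) d.d_mult d'.d_mult)
qed

lemma env_d_spec: "graded_differential_algebra K W (env_d K A)" "a \<in> carrier A ==> env_d K A (emb a) = D a"
proof -
  obtain d where d: "graded_differential_algebra K W d" "\<forall>a\<in>carrier A. d (emb a) = D a"
    using differential_exists by blast
  let ?d = "restrict d (carrier W)"
  interpret d: graded_differential_algebra K W d by fact
  have "graded_differential_algebra K W ?d"
    by (intro graded_differential_algebra.intro graded_differential_algebra_axioms.intro W_graded)
      (auto intro!: linear_mapsI simp: WG.gr_closed d.d_degree d.d_square d.d_derivation linear_smult[OF d.d_linear])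
  moreover have dD: "(\<zero>\<^bsub>A\<^esub>, btensor A E [[env_d1 K A a]]) = D a" for a
    by (simp add: D_def EB.btensor_eq)
  ultimately have ex: "?d \<in> extensional (carrier W) \<and> graded_differential_algebra K W ?d \<and> (\<forall>a\<in>carrier A. ?d (emb a) = D a)"
    using d(2) by simp
  have "\<exists>!d. d \<in> extensional (carrier W) \<and> graded_differential_algebra K W d \<and> (\<forall>a\<in>carrier A. d (emb a) = D a)"
  proof (rule ex1I, rule ex)
    fix d' assume d': "d' \<in> extensional (carrier W) \<and> graded_differential_algebra K W d' \<and> (\<forall>a\<in>carrier A. d' (emb a) = D a)"
    have "d' x = ?d x" if "x \<in> carrier W" for x
      by (rule differential_unique[OF _ _ _ _ that]) (use d' ex in blast)+
    then show "d' = ?d" using d' by (intro extensionalityI[of d' "carrier W" ?d]) auto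
  qed
  from theI'[OF this] show "graded_differential_algebra K W (env_d K A)" "a \<in> carrier A ==> env_d K A (emb a) = D a"
    unfolding env_d_def dD by blast+
qed

text \<open>The twisted derivation on \<open>A\<close> is $a \mapsto d(\alpha a)$; it is one along \<open>\<alpha>\<close> because \<open>\<alpha>\<close>
  preserves degrees and hence parity.\<close>

lemma env_dga_hom_exists:
  assumes B: "graded_differential_algebra K B d" and \<alpha>: "\<alpha> \<in> graded_algebra_hom K A B"
  shows "\<exists>f. f \<in> graded_algebra_hom K W B \<and> (\<forall>x\<in>carrier W. f (env_d K A x) = d (f x)) \<and>
    (\<forall>a\<in>carrier A. f (emb a) = \<alpha> a)"
proof -
  interpret B: graded_differential_algebra K B d by fact
  interpret d: graded_differential_algebra K W "env_d K A" by (rule env_d_spec)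
  have \<alpha>l: "\<alpha> \<in> linear_maps K A B" and \<alpha>h: "\<alpha> \<in> ring_hom A B" and \<alpha>g: "\<And>n x. x \<in> gr A n ==> \<alpha> x \<in> gr B n"
    using \<alpha> by (auto simp: graded_algebra_hom_def)
  note [simp] = ring_hom_closed[OF \<alpha>h]
  have Bg: "graded_algebra K B" by unfold_locales
  have Ag: "graded_algebra K A" by unfold_locales
  have p: "\<alpha> (parity A x) = parity B (\<alpha> x)" if "x \<in> carrier A" for x
    by (rule graded_algebra_hom_parity[OF Ag Bg \<alpha> that])
  have "\<exists>f. f \<in> ring_hom W B \<and> (\<forall>a\<in>carrier A. f (emb a) = \<alpha> a) \<and> (\<forall>a\<in>carrier A. f (D a) = d (\<alpha> a))"
  proof (rule env_hom_exists[OF B.A_ring \<alpha>h])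
    show "(%a. d (\<alpha> a)) \<in> additive_maps A B"
      by (rule additive_compose[OF B.d_additive ring_hom_additive[OF \<alpha>h]])
    show "d (\<alpha> (a \<otimes>\<^bsub>A\<^esub> b)) = d (\<alpha> a) \<otimes>\<^bsub>B\<^esub> \<alpha> b \<oplus>\<^bsub>B\<^esub> \<alpha> (parity A a) \<otimes>\<^bsub>B\<^esub> d (\<alpha> b)"
      if "a \<in> carrier A" "b \<in> carrier A" for a b
      using that by (simp add: ring_hom_mult[OF \<alpha>h] B.d_mult p)
    show "d (\<alpha> (k \<odot>\<^bsub>A\<^esub> \<one>\<^bsub>A\<^esub>)) = \<zero>\<^bsub>B\<^esub>" if "k \<in> carrier K" for k
      using that by (simp add: linear_smult[OF \<alpha>l] ring_hom_one[OF \<alpha>h])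
  qed
  then obtain f where f: "f \<in> ring_hom W B" "\<And>a. a \<in> carrier A ==> f (emb a) = \<alpha> a" "\<And>a. a \<in> carrier A ==> f (D a) = d (\<alpha> a)"
    by blast
  note [simp] = ring_hom_closed[OF f(1)] ring_hom_add[OF f(1)] ring_hom_mult[OF f(1)]
  have fl: "f \<in> linear_maps K W B"
  proof (rule linear_mapsI)
    fix k x assume "k \<in> carrier K" "x \<in> carrier W"
    then show "f (k \<odot>\<^bsub>W\<^esub> x) = k \<odot>\<^bsub>B\<^esub> f x"
      by (simp add: W_smult f linear_smult[OF \<alpha>l] ring_hom_one[OF \<alpha>h] B.smult_mult_left)
  qed auto
  have fg: "f x \<in> gr B n" if "x \<in> gr W n" for x n
    using that
  proof (induction rule: env_graded_induct)
    case (emb n a)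
    then show ?case by (simp add: f gr_closed \<alpha>g)
  next
    case (D n a)
    then show ?case by (simp add: f gr_closed \<alpha>g B.d_degree)
  qed (simp_all add: WG.gr_closed B.gr_add B.gr_mult)
  have fh: "f \<in> graded_algebra_hom K W B" using f(1) fl fg by (simp add: graded_algebra_hom_def)
  have "f (env_d K A x) = d (f x)" if "x \<in> carrier W" for x
    using that
  proof (induction rule: env_induct)
    case (emb a)
    then show ?case by (simp add: env_d_spec f)
  next
    case (D a)
    have "env_d K A (D a) = \<zero>\<^bsub>W\<^esub>" using d.d_square[of "emb a"] D by (simp add: env_d_spec)
    then show ?case using D f additive_zero[OF W_group B.A_group linear_additive[OF fl]] by (simp add: B.d_square)
  next
    case (mult x y)
    then show ?case by (simp add: d.d_mult B.d_mult graded_algebra_hom_parity[OF W_graded Bg fh])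
  qed simp
  then show ?thesis using fh f(2) by blast
qed

lemma env_dga_hom_unique:
  assumes f: "f \<in> graded_algebra_hom K W B" "\<And>x. x \<in> carrier W ==> f (env_d K A x) = d (f x)"
    and g: "g \<in> graded_algebra_hom K W B" "\<And>x. x \<in> carrier W ==> g (env_d K A x) = d (g x)"
    and eq: "\<And>a. a \<in> carrier A ==> f (emb a) = g (emb a)" and x: "x \<in> carrier W"
  shows "f x = g x"
proof (rule env_hom_unique[of f B g x])
  show "f \<in> ring_hom W B" "g \<in> ring_hom W B" using f g by (auto simp: graded_algebra_hom_def)
  fix a assume a: "a \<in> carrier A"
  then show "f (D a) = g (D a)"
    using f(2)[of "emb a"] g(2)[of "emb a"] eq[OF a] by (simp add: env_d_spec)
qed (use x eq in auto)

end

section \<open>The graded algebra of multilinear forms\<close>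

lemma self_module_minus [simp]: "a_inv (self_module K) = a_inv K" "a_minus (self_module K) = a_minus K"
  by (simp_all add: a_inv_def a_minus_def m_inv_def fun_eq_iff)

definition multilinear :: "('k, 'c) ring_scheme \<Rightarrow> ('k, 'h, 'm) module_scheme \<Rightarrow> ('h list \<Rightarrow> 'k) \<Rightarrow> bool" where
  "multilinear K H f \<longleftrightarrow> (\<forall>w\<in>lists (carrier H). f w \<in> carrier K) \<and>
     (\<forall>us\<in>lists (carrier H). \<forall>vs\<in>lists (carrier H). (%x. f (us @ x # vs)) \<in> linear_maps K H (self_module K))"

text \<open>The product of forms by recursion on the word at which it is evaluated: with $f_x = f(x, \dots)$ one
  has $(fg)_x = f()\,g_x + f_x\,g$. The laws of the product then follow by induction on words.\<close>

primrec form_mult :: "('k, 'c) ring_scheme \<Rightarrow> 'h list \<Rightarrow> ('h list \<Rightarrow> 'k) \<Rightarrow> ('h list \<Rightarrow> 'k) \<Rightarrow> 'k" where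
  "form_mult K [] f g = f [] \<otimes>\<^bsub>K\<^esub> g []"
| "form_mult K (x # w) f g = f [] \<otimes>\<^bsub>K\<^esub> g (x # w) \<oplus>\<^bsub>K\<^esub> form_mult K w (%v. f (x # v)) g"

locale linear_space = module K H + field K
  for K :: "('k, 'c) ring_scheme" and H :: "('k, 'h, 'm) module_scheme"
begin

abbreviation "S \<equiv> self_module K"
abbreviation "ws \<equiv> lists (carrier H)"
abbreviation "ml \<equiv> multilinear K H"
abbreviation "C \<equiv> forms K H"

declare in_listsD [rule del] in_listsI [rule del]

lemma S_module: "module K S" by (rule R.module_self)
lemma S_group: "abelian_group S" using S_module by (rule module.axioms)

lemma mlI: "(\<And>w. w \<in> ws ==> f w \<in> carrier K) ==>
  (\<And>us vs. us \<in> ws ==> vs \<in> ws ==> (%x. f (us @ x # vs)) \<in> linear_maps K H S) ==> ml f"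
  by (simp add: multilinear_def)

lemma ml_closed: "ml f ==> w \<in> ws ==> f w \<in> carrier K"
  by (simp add: multilinear_def)

lemma ml_slot: "ml f ==> us \<in> ws ==> vs \<in> ws ==> (%x. f (us @ x # vs)) \<in> linear_maps K H S"
  by (simp add: multilinear_def)

lemma ml_head: "ml f ==> w \<in> ws ==> (%x. f (x # w)) \<in> linear_maps K H S"
  using ml_slot[of f "[]" w] by simp

lemma ml_Cons: "ml f ==> x \<in> carrier H ==> ml (%w. f (x # w))"
  using ml_slot[of f "x # _"] by (intro mlI) (auto simp: ml_closed)

lemma ml_cong:
  assumes "ml g" "\<And>w. w \<in> ws ==> f w = g w"
  shows "ml f"
proof (rule mlI)
  fix us vs assume "us \<in> ws" "vs \<in> ws"
  then show "(%x. f (us @ x # vs)) \<in> linear_maps K H S"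
    using linear_cong[OF module_axioms, of "%x. f (us @ x # vs)" "%x. g (us @ x # vs)" S] ml_slot[OF assms(1)] assms(2)
    by simp
qed (simp add: assms ml_closed)

lemma linear_K_add: "f \<in> linear_maps K M S ==> g \<in> linear_maps K M S ==> (%x. f x \<oplus>\<^bsub>K\<^esub> g x) \<in> linear_maps K M S"
  using linear_maps_add[OF S_module] by simp

lemma linear_K_neg: "f \<in> linear_maps K M S ==> (%x. \<ominus>\<^bsub>K\<^esub> f x) \<in> linear_maps K M S"
  using linear_maps_neg[OF S_module] by simp

lemma linear_K_minus: "f \<in> linear_maps K M S ==> g \<in> linear_maps K M S ==> (%x. f x \<ominus>\<^bsub>K\<^esub> g x) \<in> linear_maps K M S"
  using linear_maps_minus[OF S_module] by simp

lemma linear_K_mult_left: "k \<in> carrier K ==> f \<in> linear_maps K M S ==> (%x. k \<otimes>\<^bsub>K\<^esub> f x) \<in> linear_maps K M S"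
  using linear_maps_smult[OF S_module] by simp

lemma linear_K_mult_right: "k \<in> carrier K ==> f \<in> linear_maps K M S ==> (%x. f x \<otimes>\<^bsub>K\<^esub> k) \<in> linear_maps K M S"
  using linear_maps_smult_left[OF S_module] by simp

lemma linear_K_gsign: "f \<in> linear_maps K M S ==> (%x. gsign K n (f x)) \<in> linear_maps K M S"
  by (cases "even n") (simp_all add: gsign_def linear_K_neg)

lemma linear_K_zero: "(%x. \<zero>\<^bsub>K\<^esub>) \<in> linear_maps K M S"
  by (auto intro!: linear_mapsI)

lemma ml_add: "ml f ==> ml g ==> ml (%w. f w \<oplus>\<^bsub>K\<^esub> g w)"
  by (auto intro!: mlI linear_K_add simp: ml_closed ml_slot)

lemma ml_smult: "k \<in> carrier K ==> ml f ==> ml (%w. k \<otimes>\<^bsub>K\<^esub> f w)"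
  by (auto intro!: mlI linear_K_mult_left simp: ml_closed ml_slot)

lemma ml_neg: "ml f ==> ml (%w. \<ominus>\<^bsub>K\<^esub> f w)"
  by (auto intro!: mlI linear_K_neg simp: ml_closed ml_slot)

lemma ml_zero: "ml (%w. \<zero>\<^bsub>K\<^esub>)"
  by (auto intro!: mlI linear_K_zero)

lemma ml_sign: "ml f ==> ml (%w. gsign K (length w) (f w))"
  using R.gsign_closed by (auto intro!: mlI linear_K_gsign simp: ml_closed ml_slot)

lemma ml_component:
  assumes f: "ml f"
  shows "ml (%w. if length w = n then f w else \<zero>\<^bsub>K\<^esub>)"
proof (rule mlI)
  fix us vs assume "us \<in> ws" "vs \<in> ws"
  then show "(%x. if length (us @ x # vs) = n then f (us @ x # vs) else \<zero>\<^bsub>K\<^esub>) \<in> linear_maps K H S"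
    using ml_slot[OF f] linear_K_zero by (cases "length us + Suc (length vs) = n") auto
qed (simp add: f ml_closed)

lemma form_mult_closed: "ml f ==> ml g ==> w \<in> ws ==> form_mult K w f g \<in> carrier K"
  by (induction w arbitrary: f) (auto simp: ml_closed ml_Cons)

lemma form_mult_cong:
  assumes "w \<in> ws" "\<And>v. v \<in> ws ==> f v = f' v" "\<And>v. v \<in> ws ==> g v = g' v"
  shows "form_mult K w f g = form_mult K w f' g'"
  using assms
proof (induction w arbitrary: f f' rule: list.induct)
  case (Cons x w)
  have c: "x \<in> carrier H" "w \<in> ws" using Cons.prems(1) by simp_all
  have "form_mult K w (%v. f (x # v)) g = form_mult K w (%v. f' (x # v)) g'"
    by (rule Cons.IH[OF c(2)]) (simp_all add: Cons.prems c)
  then show ?case using Cons.prems by simp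
qed simp

lemma form_mult_linear_left:
  assumes "w \<in> ws" "ml g" "\<And>v. v \<in> ws ==> (%z. F z v) \<in> linear_maps K M S"
  shows "(%z. form_mult K w (F z) g) \<in> linear_maps K M S"
  using assms(1,3)
proof (induction w arbitrary: F rule: list.induct)
  case (Cons x w)
  have c: "x \<in> carrier H" "w \<in> ws" using Cons.prems(1) by simp_all
  have "(%z. form_mult K w (%v. F z (x # v)) g) \<in> linear_maps K M S"
    by (rule Cons.IH[OF c(2)]) (simp add: Cons.prems c)
  moreover have "(%z. F z [] \<otimes>\<^bsub>K\<^esub> g (x # w)) \<in> linear_maps K M S"
    using Cons.prems assms(2) by (intro linear_K_mult_right) (simp_all add: ml_closed)
  ultimately show ?case by (simp add: linear_K_add)
next
  case Nil
  then show ?case using assms(2) by (simp add: linear_K_mult_right ml_closed)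
qed

lemma form_mult_linear_right:
  assumes "w \<in> ws" "ml f" "\<And>v. v \<in> ws ==> (%z. G z v) \<in> linear_maps K M S"
  shows "(%z. form_mult K w f (G z)) \<in> linear_maps K M S"
  using assms(1,2)
proof (induction w arbitrary: f rule: list.induct)
  case (Cons x w)
  have c: "x \<in> carrier H" "w \<in> ws" using Cons.prems(1) by simp_all
  have "(%z. form_mult K w (%v. f (x # v)) (G z)) \<in> linear_maps K M S"
    by (rule Cons.IH[OF c(2) ml_Cons[OF Cons.prems(2) c(1)]])
  moreover have "(%z. f [] \<otimes>\<^bsub>K\<^esub> G z (x # w)) \<in> linear_maps K M S"
    using Cons.prems assms(3) by (intro linear_K_mult_left) (simp_all add: ml_closed)
  ultimately show ?case by (simp add: linear_K_add)
next
  case Nil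
  then show ?case using assms(3) by (simp add: linear_K_mult_left ml_closed)
qed

lemma ml_form_mult:
  assumes "ml f" "ml g"
  shows "ml (%w. form_mult K w f g)"
proof (rule mlI)
  fix us vs assume us: "us \<in> ws" and vs: "vs \<in> ws"
  show "(%x. form_mult K (us @ x # vs) f g) \<in> linear_maps K H S"
    using us assms(1)
  proof (induction us arbitrary: f)
    case Nil
    show ?case using Nil assms(2) vs
      by (auto intro!: linear_K_add linear_K_mult_left form_mult_linear_left simp: ml_closed ml_head)
  next
    case (Cons u us)
    show ?case using Cons assms(2) vs ml_slot[OF assms(2), of "u # us" vs]
      by (auto intro!: linear_K_add linear_K_mult_left simp: ml_closed ml_Cons)
  qed
qed (rule form_mult_closed[OF assms])

lemma form_mult_vanish:
  assumes "ml f" "ml g" "w \<in> ws"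
    and "\<And>us vs. us \<in> ws ==> vs \<in> ws ==> w = us @ vs ==> f us = \<zero>\<^bsub>K\<^esub> \<or> g vs = \<zero>\<^bsub>K\<^esub>"
  shows "form_mult K w f g = \<zero>\<^bsub>K\<^esub>"
  using assms(1,3,4)
proof (induction w arbitrary: f)
  case Nil
  then show ?case using Nil(3)[of "[]" "[]"] assms(2) by (auto simp: ml_closed)
next
  case (Cons x w)
  have "f [] \<otimes>\<^bsub>K\<^esub> g (x # w) = \<zero>\<^bsub>K\<^esub>"
    using Cons.prems(1,2) Cons.prems(3)[of "[]" "x # w"] assms(2) by (auto simp: ml_closed)
  moreover have "form_mult K w (%v. f (x # v)) g = \<zero>\<^bsub>K\<^esub>"
  proof (rule Cons.IH)
    fix us vs assume "us \<in> ws" "vs \<in> ws" "w = us @ vs"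
    then show "f (x # us) = \<zero>\<^bsub>K\<^esub> \<or> g vs = \<zero>\<^bsub>K\<^esub>" using Cons.prems(2) Cons.prems(3)[of "x # us" vs] by auto
  qed (use Cons.prems in \<open>auto intro: ml_Cons\<close>)
  ultimately show ?case by simp
qed

lemma form_mult_add_left:
  "ml f ==> ml f' ==> ml g ==> w \<in> ws ==>
   form_mult K w (%v. f v \<oplus>\<^bsub>K\<^esub> f' v) g = form_mult K w f g \<oplus>\<^bsub>K\<^esub> form_mult K w f' g"
proof (induction w arbitrary: f f')
  case (Cons x w)
  have "form_mult K w (%v. f (x # v) \<oplus>\<^bsub>K\<^esub> f' (x # v)) g =
      form_mult K w (%v. f (x # v)) g \<oplus>\<^bsub>K\<^esub> form_mult K w (%v. f' (x # v)) g"
    using Cons.prems by (intro Cons.IH) (simp_all add: ml_Cons)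
  then show ?case using Cons.prems by (simp add: ml_closed form_mult_closed ml_Cons R.l_distr R.a_ac)
qed (simp add: ml_closed R.l_distr)

lemma form_mult_add_right:
  "ml f ==> ml g ==> ml g' ==> w \<in> ws ==>
   form_mult K w f (%v. g v \<oplus>\<^bsub>K\<^esub> g' v) = form_mult K w f g \<oplus>\<^bsub>K\<^esub> form_mult K w f g'"
proof (induction w arbitrary: f)
  case (Cons x w)
  have "form_mult K w (%v. f (x # v)) (%v. g v \<oplus>\<^bsub>K\<^esub> g' v) =
      form_mult K w (%v. f (x # v)) g \<oplus>\<^bsub>K\<^esub> form_mult K w (%v. f (x # v)) g'"
    using Cons.prems by (intro Cons.IH) (simp_all add: ml_Cons)
  then show ?case using Cons.prems by (simp add: ml_closed form_mult_closed ml_Cons R.r_distr R.a_ac)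
qed (simp add: ml_closed R.r_distr)

lemma form_mult_smult_left:
  "k \<in> carrier K ==> ml f ==> ml g ==> w \<in> ws ==>
   form_mult K w (%v. k \<otimes>\<^bsub>K\<^esub> f v) g = k \<otimes>\<^bsub>K\<^esub> form_mult K w f g"
proof (induction w arbitrary: f)
  case (Cons x w)
  have "form_mult K w (%v. k \<otimes>\<^bsub>K\<^esub> f (x # v)) g = k \<otimes>\<^bsub>K\<^esub> form_mult K w (%v. f (x # v)) g"
    using Cons.prems by (intro Cons.IH) (simp_all add: ml_Cons)
  then show ?case using Cons.prems by (simp add: ml_closed form_mult_closed ml_Cons R.r_distr R.m_assoc)
qed (simp add: ml_closed R.m_assoc)

lemma form_mult_smult_right:
  "k \<in> carrier K ==> ml f ==> ml g ==> w \<in> ws ==>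
   form_mult K w f (%v. k \<otimes>\<^bsub>K\<^esub> g v) = k \<otimes>\<^bsub>K\<^esub> form_mult K w f g"
proof (induction w arbitrary: f)
  case (Cons x w)
  have "form_mult K w (%v. f (x # v)) (%v. k \<otimes>\<^bsub>K\<^esub> g v) = k \<otimes>\<^bsub>K\<^esub> form_mult K w (%v. f (x # v)) g"
    using Cons.prems by (intro Cons.IH) (simp_all add: ml_Cons)
  then show ?case using Cons.prems by (simp add: ml_closed form_mult_closed ml_Cons R.r_distr R.m_lcomm)
qed (simp add: ml_closed R.m_lcomm)

lemma form_mult_assoc:
  "ml f ==> ml g ==> ml h ==> w \<in> ws ==>
   form_mult K w (%v. form_mult K v f g) h = form_mult K w f (%v. form_mult K v g h)"
proof (induction w arbitrary: f)
  case (Cons x w)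
  have c: "x \<in> carrier H" "w \<in> ws" using Cons.prems by auto
  have fx: "ml (%v. f (x # v))" and gx: "ml (%v. g (x # v))" using Cons.prems by (auto intro: ml_Cons)
  have f0: "f [] \<in> carrier K" using Cons.prems by (simp add: ml_closed)
  have "form_mult K w (%v. f [] \<otimes>\<^bsub>K\<^esub> g (x # v) \<oplus>\<^bsub>K\<^esub> form_mult K v (%v. f (x # v)) g) h =
    form_mult K w (%v. f [] \<otimes>\<^bsub>K\<^esub> g (x # v)) h \<oplus>\<^bsub>K\<^esub> form_mult K w (%v. form_mult K v (%v. f (x # v)) g) h"
    by (rule form_mult_add_left) (use Cons.prems fx gx f0 c in \<open>auto intro: ml_smult ml_form_mult\<close>)
  also have "form_mult K w (%v. f [] \<otimes>\<^bsub>K\<^esub> g (x # v)) h = f [] \<otimes>\<^bsub>K\<^esub> form_mult K w (%v. g (x # v)) h"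
    by (rule form_mult_smult_left) (use Cons.prems gx f0 c in auto)
  also have "form_mult K w (%v. form_mult K v (%v. f (x # v)) g) h = form_mult K w (%v. f (x # v)) (%v. form_mult K v g h)"
    using Cons.prems fx by (intro Cons.IH) auto
  finally show ?case
    using Cons.prems fx gx c f0
    by (simp add: ml_closed form_mult_closed ml_form_mult R.r_distr R.m_assoc R.a_assoc)
qed (simp add: ml_closed R.m_assoc)

definition form_one :: "'h list \<Rightarrow> 'k" where
  "form_one w = (if w = [] then \<one>\<^bsub>K\<^esub> else \<zero>\<^bsub>K\<^esub>)"

lemma ml_one: "ml form_one"
  by (auto intro!: mlI linear_K_zero simp: form_one_def)

lemma form_mult_one_left: "ml g ==> w \<in> ws ==> form_mult K w form_one g = g w"
proof (cases w)
  case (Cons x v)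
  assume "ml g" "w \<in> ws"
  then have "form_mult K v (%v. \<zero>\<^bsub>K\<^esub>) g = \<zero>\<^bsub>K\<^esub>" using Cons by (intro form_mult_vanish) (auto simp: ml_zero)
  then show ?thesis using Cons \<open>ml g\<close> \<open>w \<in> ws\<close> by (simp add: form_one_def ml_closed)
qed (simp add: form_one_def ml_closed)

lemma form_mult_one_right: "ml f ==> w \<in> ws ==> form_mult K w f form_one = f w"
proof (induction w arbitrary: f)
  case (Cons x w)
  have "form_mult K w (%v. f (x # v)) form_one = f (x # w)"
    using Cons.prems by (intro Cons.IH) (auto intro: ml_Cons)
  then show ?case using Cons.prems by (simp add: ml_closed form_one_def[of "x # w"])
qed (simp add: ml_closed form_one_def)

lemma take_ws: "w \<in> ws ==> take p w \<in> ws"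
  and drop_ws: "w \<in> ws ==> drop p w \<in> ws"
  by (auto simp: in_lists_conv_set dest: in_set_takeD in_set_dropD)

text \<open>A splitting of \<open>x # w\<close> is the one before \<open>x\<close>, with the factor \<open>f []\<close>, or comes from a splitting
  of \<open>w\<close>.\<close>

lemma finsum_form_mult:
  "ml f ==> ml g ==> w \<in> ws ==>
   (\<Oplus>\<^bsub>K\<^esub>p\<in>{..length w}. f (take p w) \<otimes>\<^bsub>K\<^esub> g (drop p w)) = form_mult K w f g"
proof (induction w arbitrary: f)
  case (Cons x w)
  have "f (take p (x # w)) \<otimes>\<^bsub>K\<^esub> g (drop p (x # w)) \<in> carrier K" for p
    using Cons.prems take_ws drop_ws by (intro R.m_closed ml_closed)
  then have "(\<Oplus>\<^bsub>K\<^esub>p\<in>{..Suc (length w)}. f (take p (x # w)) \<otimes>\<^bsub>K\<^esub> g (drop p (x # w))) =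
    (\<Oplus>\<^bsub>K\<^esub>p\<in>{..length w}. f (x # take p w) \<otimes>\<^bsub>K\<^esub> g (drop p w)) \<oplus>\<^bsub>K\<^esub> f [] \<otimes>\<^bsub>K\<^esub> g (x # w)"
    by (subst R.finsum_Suc2) (simp_all add: Pi_iff)
  also have "(\<Oplus>\<^bsub>K\<^esub>p\<in>{..length w}. f (x # take p w) \<otimes>\<^bsub>K\<^esub> g (drop p w)) = form_mult K w (%v. f (x # v)) g"
    using Cons.prems by (intro Cons.IH) (simp_all add: ml_Cons)
  finally show ?case using Cons.prems by (simp add: ml_closed form_mult_closed ml_Cons R.a_comm)
qed (simp add: ml_closed)

text \<open>Only finitely many components are nonzero: the algebra of forms is a direct sum.\<close>

definition bounded_form :: "('h list \<Rightarrow> 'k) \<Rightarrow> bool" where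
  "bounded_form f \<longleftrightarrow> (\<exists>N. \<forall>w\<in>ws. length w \<ge> N \<longrightarrow> f w = \<zero>\<^bsub>K\<^esub>)"

lemma forms_carrier_eq: "forms_carrier K H = {f \<in> extensional ws. ml f \<and> bounded_form f}"
proof -
  have "ml f \<longleftrightarrow> f \<in> ws \<rightarrow> carrier K \<and>
     (\<forall>us\<in>ws. \<forall>vs\<in>ws. \<forall>x\<in>carrier H. \<forall>y\<in>carrier H.
        f (us @ [x \<oplus>\<^bsub>H\<^esub> y] @ vs) = f (us @ [x] @ vs) \<oplus>\<^bsub>K\<^esub> f (us @ [y] @ vs)) \<and>
     (\<forall>us\<in>ws. \<forall>vs\<in>ws. \<forall>k\<in>carrier K. \<forall>x\<in>carrier H.
        f (us @ [k \<odot>\<^bsub>H\<^esub> x] @ vs) = k \<otimes>\<^bsub>K\<^esub> f (us @ [x] @ vs))" for f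
    unfolding multilinear_def linear_maps_def by (auto simp: Pi_iff)
  then show ?thesis unfolding forms_carrier_def bounded_form_def PiE_def by blast
qed

lemma C_carrier: "carrier C = {f \<in> extensional ws. ml f \<and> bounded_form f}"
  by (simp add: forms_def forms_carrier_eq)

lemma C_ml: "f \<in> carrier C ==> ml f"
  by (simp add: C_carrier)

lemma C_eqI: "f \<in> extensional ws ==> g \<in> extensional ws ==> (\<And>w. w \<in> ws ==> f w = g w) ==> f = g"
  by (rule extensionalityI)

lemma C_closedI: "ml f ==> bounded_form f ==> restrict f ws \<in> carrier C"
  unfolding C_carrier by (auto intro: ml_cong simp: bounded_form_def)

lemma C_simps:
  "f \<oplus>\<^bsub>C\<^esub> g = (\<lambda>w\<in>ws. f w \<oplus>\<^bsub>K\<^esub> g w)" "\<zero>\<^bsub>C\<^esub> = (\<lambda>w\<in>ws. \<zero>\<^bsub>K\<^esub>)" "\<one>\<^bsub>C\<^esub> = restrict form_one ws"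
  "k \<odot>\<^bsub>C\<^esub> f = (\<lambda>w\<in>ws. k \<otimes>\<^bsub>K\<^esub> f w)"
  by (simp_all add: forms_def form_one_def[abs_def])

lemma C_mult: "f \<in> carrier C ==> g \<in> carrier C ==> f \<otimes>\<^bsub>C\<^esub> g = (\<lambda>w\<in>ws. form_mult K w f g)"
  by (auto simp: forms_def forms_carrier_eq finsum_form_mult fun_eq_iff restrict_def)

lemma C_gr: "gr C n = {f \<in> carrier C. \<forall>w\<in>ws. length w \<noteq> n \<longrightarrow> f w = \<zero>\<^bsub>K\<^esub>}"
  by (simp add: forms_def)

lemma bounded_add: "bounded_form f ==> bounded_form g ==> bounded_form (%w. f w \<oplus>\<^bsub>K\<^esub> g w)"
proof -
  assume "bounded_form f" "bounded_form g"
  then obtain m n where "\<forall>w\<in>ws. length w \<ge> m \<longrightarrow> f w = \<zero>\<^bsub>K\<^esub>" "\<forall>w\<in>ws. length w \<ge> n \<longrightarrow> g w = \<zero>\<^bsub>K\<^esub>"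
    by (auto simp: bounded_form_def)
  then show ?thesis unfolding bounded_form_def by (intro exI[of _ "max m n"]) auto
qed

lemma bounded_map: "bounded_form f ==> (\<And>w. w \<in> ws ==> f w = \<zero>\<^bsub>K\<^esub> ==> g w = \<zero>\<^bsub>K\<^esub>) ==> bounded_form g"
  unfolding bounded_form_def by blast

lemma bounded_mult:
  assumes "ml f" "ml g" "bounded_form f" "bounded_form g"
  shows "bounded_form (%w. form_mult K w f g)"
proof -
  from assms(3,4) obtain m n where mn: "\<forall>w\<in>ws. length w \<ge> m \<longrightarrow> f w = \<zero>\<^bsub>K\<^esub>" "\<forall>w\<in>ws. length w \<ge> n \<longrightarrow> g w = \<zero>\<^bsub>K\<^esub>"
    by (auto simp: bounded_form_def)
  have "form_mult K w f g = \<zero>\<^bsub>K\<^esub>" if w: "w \<in> ws" "length w \<ge> m + n" for w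
  proof (rule form_mult_vanish[OF assms(1,2) w(1)])
    fix us vs assume "us \<in> ws" "vs \<in> ws" "w = us @ vs"
    moreover from this w have "length us \<ge> m \<or> length vs \<ge> n" by auto
    ultimately show "f us = \<zero>\<^bsub>K\<^esub> \<or> g vs = \<zero>\<^bsub>K\<^esub>" using mn by blast
  qed
  then show ?thesis unfolding bounded_form_def by blast
qed

lemma C_add_closed: "f \<in> carrier C ==> g \<in> carrier C ==> f \<oplus>\<^bsub>C\<^esub> g \<in> carrier C"
  unfolding C_simps by (rule C_closedI) (auto simp: C_carrier ml_add bounded_add)

lemma C_smult_closed: "k \<in> carrier K ==> f \<in> carrier C ==> k \<odot>\<^bsub>C\<^esub> f \<in> carrier C"
  unfolding C_simps by (rule C_closedI) (auto simp: C_carrier ml_smult elim: bounded_map)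

lemma C_mult_closed: "f \<in> carrier C ==> g \<in> carrier C ==> f \<otimes>\<^bsub>C\<^esub> g \<in> carrier C"
  by (simp add: C_mult, rule C_closedI) (auto simp: C_carrier ml_form_mult bounded_mult)

lemma C_zero_closed: "\<zero>\<^bsub>C\<^esub> \<in> carrier C"
  unfolding C_simps by (rule C_closedI) (auto simp: ml_zero bounded_form_def)

lemma C_one_closed: "\<one>\<^bsub>C\<^esub> \<in> carrier C"
  unfolding C_simps by (rule C_closedI) (auto simp: ml_one bounded_form_def form_one_def intro!: exI[of _ 1])

lemma C_ext: "f \<in> carrier C ==> f \<in> extensional ws"
  by (simp add: C_carrier)

lemma C_group: "abelian_group C"
proof (rule abelian_groupI)
  fix f assume f: "f \<in> carrier C"
  have n: "(\<lambda>w\<in>ws. \<ominus>\<^bsub>K\<^esub> f w) \<in> carrier C"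
    using f by (intro C_closedI) (auto simp: C_carrier ml_neg elim: bounded_map)
  show "\<exists>g\<in>carrier C. g \<oplus>\<^bsub>C\<^esub> f = \<zero>\<^bsub>C\<^esub>"
    using f by (intro bexI[OF _ n] C_eqI) (auto simp: C_simps R.l_neg ml_closed C_ml)
  show "\<zero>\<^bsub>C\<^esub> \<oplus>\<^bsub>C\<^esub> f = f"
    using f by (intro C_eqI) (auto simp: C_simps ml_closed C_ml C_ext)
  fix g assume g: "g \<in> carrier C"
  show "f \<oplus>\<^bsub>C\<^esub> g = g \<oplus>\<^bsub>C\<^esub> f"
    using f g by (intro C_eqI) (auto simp: C_simps ml_closed C_ml R.a_comm)
  fix h assume h: "h \<in> carrier C"
  show "f \<oplus>\<^bsub>C\<^esub> g \<oplus>\<^bsub>C\<^esub> h = f \<oplus>\<^bsub>C\<^esub> (g \<oplus>\<^bsub>C\<^esub> h)"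
    using f g h by (intro C_eqI) (auto simp: C_simps ml_closed C_ml R.a_assoc)
qed (auto simp: C_add_closed C_zero_closed)

lemma C_ring: "ring C"
proof (rule ringI[OF C_group])
  show "monoid C"
  proof (rule monoidI)
    fix f g h assume fgh: "f \<in> carrier C" "g \<in> carrier C" "h \<in> carrier C"
    show "f \<otimes>\<^bsub>C\<^esub> g \<otimes>\<^bsub>C\<^esub> h = f \<otimes>\<^bsub>C\<^esub> (g \<otimes>\<^bsub>C\<^esub> h)"
    proof (rule C_eqI)
      fix w assume w: "w \<in> ws"
      have "(f \<otimes>\<^bsub>C\<^esub> g \<otimes>\<^bsub>C\<^esub> h) w = form_mult K w (f \<otimes>\<^bsub>C\<^esub> g) h"
        by (subst C_mult) (use fgh w in \<open>simp_all add: C_mult_closed\<close>)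
      also have "\<dots> = form_mult K w (%v. form_mult K v f g) h"
        using fgh w by (intro form_mult_cong) (auto simp: C_mult)
      also have "\<dots> = form_mult K w f (%v. form_mult K v g h)"
        using fgh w by (intro form_mult_assoc) (auto simp: C_ml)
      also have "\<dots> = form_mult K w f (g \<otimes>\<^bsub>C\<^esub> h)"
        using fgh w by (intro form_mult_cong) (auto simp: C_mult)
      also have "\<dots> = (f \<otimes>\<^bsub>C\<^esub> (g \<otimes>\<^bsub>C\<^esub> h)) w"
        by (subst C_mult) (use fgh w in \<open>simp_all add: C_mult_closed\<close>)
      finally show "(f \<otimes>\<^bsub>C\<^esub> g \<otimes>\<^bsub>C\<^esub> h) w = (f \<otimes>\<^bsub>C\<^esub> (g \<otimes>\<^bsub>C\<^esub> h)) w" .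
    qed (use fgh in \<open>auto simp: C_ext C_mult_closed\<close>)
  next
    fix f assume f: "f \<in> carrier C"
    show "\<one>\<^bsub>C\<^esub> \<otimes>\<^bsub>C\<^esub> f = f"
    proof (rule C_eqI)
      fix w assume w: "w \<in> ws"
      have "(\<one>\<^bsub>C\<^esub> \<otimes>\<^bsub>C\<^esub> f) w = form_mult K w \<one>\<^bsub>C\<^esub> f" using f w by (simp add: C_mult C_one_closed)
      also have "\<dots> = form_mult K w form_one f" using w by (intro form_mult_cong) (auto simp: C_simps)
      finally show "(\<one>\<^bsub>C\<^esub> \<otimes>\<^bsub>C\<^esub> f) w = f w" using f w by (simp add: form_mult_one_left C_ml)
    qed (use f in \<open>auto simp: C_ext C_mult_closed C_one_closed\<close>)
    show "f \<otimes>\<^bsub>C\<^esub> \<one>\<^bsub>C\<^esub> = f"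
    proof (rule C_eqI)
      fix w assume w: "w \<in> ws"
      have "(f \<otimes>\<^bsub>C\<^esub> \<one>\<^bsub>C\<^esub>) w = form_mult K w f \<one>\<^bsub>C\<^esub>" using f w by (simp add: C_mult C_one_closed)
      also have "\<dots> = form_mult K w f form_one" using w by (intro form_mult_cong) (auto simp: C_simps)
      finally show "(f \<otimes>\<^bsub>C\<^esub> \<one>\<^bsub>C\<^esub>) w = f w" using f w by (simp add: form_mult_one_right C_ml)
    qed (use f in \<open>auto simp: C_ext C_mult_closed C_one_closed\<close>)
  qed (auto simp: C_mult_closed C_one_closed)
next
  fix f g h assume fgh: "f \<in> carrier C" "g \<in> carrier C" "h \<in> carrier C"
  show "(f \<oplus>\<^bsub>C\<^esub> g) \<otimes>\<^bsub>C\<^esub> h = f \<otimes>\<^bsub>C\<^esub> h \<oplus>\<^bsub>C\<^esub> g \<otimes>\<^bsub>C\<^esub> h"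
  proof (rule C_eqI)
    fix w assume w: "w \<in> ws"
    have "((f \<oplus>\<^bsub>C\<^esub> g) \<otimes>\<^bsub>C\<^esub> h) w = form_mult K w (f \<oplus>\<^bsub>C\<^esub> g) h" using fgh w by (simp add: C_mult C_add_closed)
    also have "\<dots> = form_mult K w (%v. f v \<oplus>\<^bsub>K\<^esub> g v) h" using w by (intro form_mult_cong) (auto simp: C_simps)
    finally show "((f \<oplus>\<^bsub>C\<^esub> g) \<otimes>\<^bsub>C\<^esub> h) w = (f \<otimes>\<^bsub>C\<^esub> h \<oplus>\<^bsub>C\<^esub> g \<otimes>\<^bsub>C\<^esub> h) w"
      using fgh w by (simp add: form_mult_add_left C_ml C_mult C_simps(1))
  qed (use fgh in \<open>auto simp: C_ext C_mult_closed C_add_closed\<close>)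
  show "h \<otimes>\<^bsub>C\<^esub> (f \<oplus>\<^bsub>C\<^esub> g) = h \<otimes>\<^bsub>C\<^esub> f \<oplus>\<^bsub>C\<^esub> h \<otimes>\<^bsub>C\<^esub> g"
  proof (rule C_eqI)
    fix w assume w: "w \<in> ws"
    have "(h \<otimes>\<^bsub>C\<^esub> (f \<oplus>\<^bsub>C\<^esub> g)) w = form_mult K w h (f \<oplus>\<^bsub>C\<^esub> g)" using fgh w by (simp add: C_mult C_add_closed)
    also have "\<dots> = form_mult K w h (%v. f v \<oplus>\<^bsub>K\<^esub> g v)" using w by (intro form_mult_cong) (auto simp: C_simps)
    finally show "(h \<otimes>\<^bsub>C\<^esub> (f \<oplus>\<^bsub>C\<^esub> g)) w = (h \<otimes>\<^bsub>C\<^esub> f \<oplus>\<^bsub>C\<^esub> h \<otimes>\<^bsub>C\<^esub> g) w"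
      using fgh w by (simp add: form_mult_add_right C_ml C_mult C_simps(1))
  qed (use fgh in \<open>auto simp: C_ext C_mult_closed C_add_closed\<close>)
qed

lemma C_module: "module K C"
  by (rule moduleI[OF _ C_group], unfold_locales, fact C_smult_closed)
    (auto intro!: C_eqI simp: C_ext C_add_closed C_smult_closed,
      auto simp: C_simps ml_closed C_ml R.l_distr R.r_distr R.m_assoc)

lemma C_algebra: "assoc_algebra K C"
proof (intro assoc_algebra.intro assoc_algebra_axioms.intro C_module C_ring)
  show "field K" by unfold_locales
  fix k f g assume k: "k \<in> carrier K" and fg: "f \<in> carrier C" "g \<in> carrier C"
  show "(k \<odot>\<^bsub>C\<^esub> f) \<otimes>\<^bsub>C\<^esub> g = k \<odot>\<^bsub>C\<^esub> (f \<otimes>\<^bsub>C\<^esub> g)"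
  proof (rule C_eqI)
    fix w assume w: "w \<in> ws"
    have "((k \<odot>\<^bsub>C\<^esub> f) \<otimes>\<^bsub>C\<^esub> g) w = form_mult K w (k \<odot>\<^bsub>C\<^esub> f) g" using k fg w by (simp add: C_mult C_smult_closed)
    also have "\<dots> = form_mult K w (%v. k \<otimes>\<^bsub>K\<^esub> f v) g" using w by (intro form_mult_cong) (auto simp: C_simps)
    finally show "((k \<odot>\<^bsub>C\<^esub> f) \<otimes>\<^bsub>C\<^esub> g) w = (k \<odot>\<^bsub>C\<^esub> (f \<otimes>\<^bsub>C\<^esub> g)) w"
      using k fg w by (simp add: form_mult_smult_left C_ml C_mult C_simps(4))
  qed (use k fg in \<open>auto simp: C_ext C_mult_closed C_smult_closed\<close>)
  show "f \<otimes>\<^bsub>C\<^esub> (k \<odot>\<^bsub>C\<^esub> g) = k \<odot>\<^bsub>C\<^esub> (f \<otimes>\<^bsub>C\<^esub> g)"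
  proof (rule C_eqI)
    fix w assume w: "w \<in> ws"
    have "(f \<otimes>\<^bsub>C\<^esub> (k \<odot>\<^bsub>C\<^esub> g)) w = form_mult K w f (k \<odot>\<^bsub>C\<^esub> g)" using k fg w by (simp add: C_mult C_smult_closed)
    also have "\<dots> = form_mult K w f (%v. k \<otimes>\<^bsub>K\<^esub> g v)" using w by (intro form_mult_cong) (auto simp: C_simps)
    finally show "(f \<otimes>\<^bsub>C\<^esub> (k \<odot>\<^bsub>C\<^esub> g)) w = (k \<odot>\<^bsub>C\<^esub> (f \<otimes>\<^bsub>C\<^esub> g)) w"
      using k fg w by (simp add: form_mult_smult_right C_ml C_mult C_simps(4))
  qed (use k fg in \<open>auto simp: C_ext C_mult_closed C_smult_closed\<close>)
qed

definition component :: "nat \<Rightarrow> ('h list \<Rightarrow> 'k) \<Rightarrow> 'h list \<Rightarrow> 'k" where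
  "component n f = (\<lambda>w\<in>ws. if length w = n then f w else \<zero>\<^bsub>K\<^esub>)"

lemma component_gr:
  assumes "f \<in> carrier C"
  shows "component n f \<in> gr C n"
proof -
  have "component n f \<in> carrier C"
    unfolding component_def using assms by (intro C_closedI) (auto simp: C_carrier ml_component elim: bounded_map)
  then show ?thesis by (auto simp: C_gr component_def)
qed

lemma C_graded: "graded_algebra K C"
proof (rule graded_algebraI[OF C_algebra, where \<pi>=component])
  interpret C: ring C by (rule C_ring)
  show "submodule (gr C n) K C" for n
    unfolding submodule_iff_gr[OF C_module]
    by (auto simp: C_gr C_add_closed C_smult_closed) (auto simp: C_simps)
  show "\<one>\<^bsub>C\<^esub> \<in> gr C 0"
    using C_one_closed by (auto simp: C_gr) (auto simp: C_simps form_one_def)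
  show "f \<otimes>\<^bsub>C\<^esub> g \<in> gr C (m + n)" if fg: "f \<in> gr C m" "g \<in> gr C n" for f g m n
  proof -
    have c: "f \<in> carrier C" "g \<in> carrier C" using fg by (auto simp: C_gr)
    have "form_mult K w f g = \<zero>\<^bsub>K\<^esub>" if w: "w \<in> ws" "length w \<noteq> m + n" for w
    proof (rule form_mult_vanish[OF C_ml[OF c(1)] C_ml[OF c(2)] w(1)])
      fix us vs assume "us \<in> ws" "vs \<in> ws" "w = us @ vs"
      moreover from this w have "length us \<noteq> m \<or> length vs \<noteq> n" by auto
      ultimately show "f us = \<zero>\<^bsub>K\<^esub> \<or> g vs = \<zero>\<^bsub>K\<^esub>" using fg by (auto simp: C_gr)
    qed
    then show ?thesis using c C_mult_closed[OF c] by (simp add: C_gr) (simp add: C_mult)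
  qed
  show "component k f = (if k = n then f else \<zero>\<^bsub>C\<^esub>)" if "f \<in> gr C n" for k n f
    using that by (auto simp: C_gr component_def C_simps C_ext intro!: C_eqI)
  show "component k \<in> additive_maps C C" for k
  proof (rule additive_mapsI)
    fix f g assume fg: "f \<in> carrier C" "g \<in> carrier C"
    then show "component k f \<in> carrier C" using component_gr[of f k] by (simp add: C_gr)
    show "component k (f \<oplus>\<^bsub>C\<^esub> g) = component k f \<oplus>\<^bsub>C\<^esub> component k g"
      by (rule C_eqI) (auto simp: component_def C_simps)
  qed
  show "\<exists>xs. set xs \<subseteq> (\<Union>n. gr C n) \<and> f = lsum C xs" if f: "f \<in> carrier C" for f
  proof -
    obtain N where N: "\<forall>w\<in>ws. length w \<ge> N \<longrightarrow> f w = \<zero>\<^bsub>K\<^esub>" using f by (auto simp: C_carrier bounded_form_def)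
    have cc: "component n f \<in> carrier C" for n using component_gr[OF f, of n] by (simp add: C_gr)
    have sum: "lsum C (map (%n. component n f) ns) \<in> carrier C" for ns using cc by (intro C.lsum_map_closed) auto
    have "lsum C (map (%n. component n f) ns) w = (if length w \<in> set ns then f w else \<zero>\<^bsub>K\<^esub>)" if "distinct ns" "w \<in> ws" for ns w
      using that f by (induction ns) (auto simp: C_simps component_def C_ml ml_closed)
    then have "lsum C (map (%n. component n f) [0..<N]) w = f w" if "w \<in> ws" for w using N that by auto
    then have "f = lsum C (map (%n. component n f) [0..<N])"
      using sum[of "[0..<N]"] f by (intro C_eqI) (auto simp: C_ext)
    then show ?thesis using component_gr[OF f] by (intro exI[of _ "map (%n. component n f) [0..<N]"]) auto
  qed
qed

lemma C_parity:
  assumes "f \<in> carrier C"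
  shows "\<forall>w\<in>ws. parity C f w = gsign K (length w) (f w)"
proof -
  interpret C: graded_algebra K C by (rule C_graded)
  have neg: "(\<ominus>\<^bsub>C\<^esub> f) w = \<ominus>\<^bsub>K\<^esub> f w" if "f \<in> carrier C" "w \<in> ws" for f w
  proof -
    have "(\<ominus>\<^bsub>C\<^esub> f \<oplus>\<^bsub>C\<^esub> f) w = \<zero>\<^bsub>K\<^esub>" using that by (simp add: C.l_neg) (simp add: C_simps)
    then have "(\<ominus>\<^bsub>C\<^esub> f) w \<oplus>\<^bsub>K\<^esub> f w = \<zero>\<^bsub>K\<^esub>" using that(2) by (simp add: C_simps)
    then show ?thesis using that C_ml[OF that(1)] C_ml[OF C.a_inv_closed[OF that(1)]] by (simp add: R.minus_equality ml_closed)
  qed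
  from assms show ?thesis
  proof (induction rule: C.homogeneous_induct)
    case (homogeneous n f)
    then have "(gsign C n f) w = gsign K n (f w)" if "w \<in> ws" for w
      using that neg C.gr_closed by (auto simp: gsign_def)
    moreover have "gsign K n (f w) = gsign K (length w) (f w)" if "w \<in> ws" for w
      using homogeneous that by (cases "length w = n") (auto simp: C_gr)
    ultimately show ?case using homogeneous by (simp add: C.parity_homogeneous[where n=n])
  next
    case (add f g)
    then have "\<forall>w\<in>ws. (parity C f \<oplus>\<^bsub>C\<^esub> parity C g) w = gsign K (length w) ((f \<oplus>\<^bsub>C\<^esub> g) w)"
      unfolding C_simps by (simp add: R.gsign_add C_ml ml_closed)
    then show ?case using add(1,2) by simp
  qed
qed

end

section \<open>The operation on multilinear forms\<close>

text \<open>The operators $L_h$ and $i_h$ on forms, by recursion on the word at which the result is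
  evaluated: with \<open>f\<^sub>x = f(x, \<dots>)\<close> one has $(L_h f)_x = \sum L_{h^{(2)}} f_{\mathrm{ad}(h^{(1)})x}$ and
  $(i_h f)_x = \sum (L_{h^{(2)}} f_{h^{(1)} - \varepsilon(h^{(1)})1})_x - i_h f_x$. All identities then
  follow by induction on words.\<close>

definition augment :: "('k, 'h, 'm) hopf_scheme \<Rightarrow> 'h \<Rightarrow> 'h" where
  "augment H h = h \<ominus>\<^bsub>H\<^esub> counit H h \<odot>\<^bsub>H\<^esub> \<one>\<^bsub>H\<^esub>"

primrec lie_form :: "('k, 'c) ring_scheme \<Rightarrow> ('k, 'h, 'm) hopf_scheme \<Rightarrow> 'h list \<Rightarrow> 'h \<Rightarrow> ('h list \<Rightarrow> 'k) \<Rightarrow> 'k" where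
  "lie_form K H [] = (%h f. counit H h \<otimes>\<^bsub>K\<^esub> f [])"
| "lie_form K H (x # w) = (%h f. sw H (self_module K) h (%a b. lie_form K H w b (%v. f (adj H a x # v))))"

primrec op_form :: "('k, 'c) ring_scheme \<Rightarrow> ('k, 'h, 'm) hopf_scheme \<Rightarrow> 'h list \<Rightarrow> 'h \<Rightarrow> ('h list \<Rightarrow> 'k) \<Rightarrow> 'k" where
  "op_form K H [] = (%h f. f [augment H h])"
| "op_form K H (x # w) = (%h f.
     sw H (self_module K) h (%a b. lie_form K H (x # w) b (%v. f (augment H a # v)))
     \<ominus>\<^bsub>K\<^esub> op_form K H w h (%v. f (x # v)))"

context hopf_algebra
begin

sublocale linear_space K H by unfold_locales

abbreviation "L \<equiv> lie_form K H"
abbreviation "I \<equiv> op_form K H"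
abbreviation "aug \<equiv> augment H"
abbreviation "mul \<equiv> form_mult K"

lemma sw_K_closed: "h \<in> carrier H ==> (\<And>a b. a \<in> carrier H ==> b \<in> carrier H ==> F a b \<in> carrier K) ==> sw H S h F \<in> carrier K"
  using sw_closed[OF S_group] by simp

lemma sw_K_add: "h \<in> carrier H ==> (\<And>a b. a \<in> carrier H ==> b \<in> carrier H ==> F a b \<in> carrier K) ==>
   (\<And>a b. a \<in> carrier H ==> b \<in> carrier H ==> G a b \<in> carrier K) ==>
   sw H S h (%a b. F a b \<oplus>\<^bsub>K\<^esub> G a b) = sw H S h F \<oplus>\<^bsub>K\<^esub> sw H S h G"
  using sw_add[OF S_group] by simp

lemma sw_K_minus: "h \<in> carrier H ==> (\<And>a b. a \<in> carrier H ==> b \<in> carrier H ==> F a b \<in> carrier K) ==>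
   (\<And>a b. a \<in> carrier H ==> b \<in> carrier H ==> G a b \<in> carrier K) ==>
   sw H S h (%a b. F a b \<ominus>\<^bsub>K\<^esub> G a b) = sw H S h F \<ominus>\<^bsub>K\<^esub> sw H S h G"
  using sw_minus[OF S_group] by simp

lemma sw_K_smult: "h \<in> carrier H ==> k \<in> carrier K ==> (\<And>a b. a \<in> carrier H ==> b \<in> carrier H ==> F a b \<in> carrier K) ==>
   k \<otimes>\<^bsub>K\<^esub> sw H S h F = sw H S h (%a b. k \<otimes>\<^bsub>K\<^esub> F a b)"
  using sw_smult[OF S_module] by simp

lemma sw_K_counit_left: "f \<in> linear_maps K H S ==> h \<in> carrier H ==> sw H S h (%a b. counit H a \<otimes>\<^bsub>K\<^esub> f b) = f h"
  using sw_counit_left[OF S_module] by simp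

lemma sw_K_counit_right: "f \<in> linear_maps K H S ==> h \<in> carrier H ==> sw H S h (%a b. counit H b \<otimes>\<^bsub>K\<^esub> f a) = f h"
  using sw_counit_right[OF S_module] by simp

lemma sw_K_swap:
  "h \<in> carrier H ==> g \<in> carrier H ==>
   (\<And>a b c e. a \<in> carrier H ==> b \<in> carrier H ==> c \<in> carrier H ==> e \<in> carrier H ==> F a b c e \<in> carrier K) ==>
   sw H S h (%a b. sw H S g (%c e. F a b c e)) = sw H S g (%c e. sw H S h (%a b. F a b c e))"
  by (rule sw_swap[OF S_group]) simp_all

lemma sw_K_zero: "h \<in> carrier H ==> sw H S h (%a b. \<zero>\<^bsub>K\<^esub>) = \<zero>\<^bsub>K\<^esub>"
  unfolding sw_def using R.lsum_zero by simp

lemma aug_closed [simp]: "h \<in> carrier H ==> aug h \<in> carrier H"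
  by (simp add: augment_def)

lemma linear_aug: "f \<in> linear_maps K M H ==> (%x. aug (f x)) \<in> linear_maps K M H"
  unfolding augment_def by (intro linear_intros) (auto simp: H_module)

lemma aug_one: "aug \<one>\<^bsub>H\<^esub> = \<zero>\<^bsub>H\<^esub>"
  by (simp add: augment_def counit_one) (simp add: a_minus_def r_neg)

lemma adj_aug: "h \<in> carrier H ==> g \<in> carrier H ==> adj H h (aug g) = aug (adj H h g)"
proof -
  assume h: "h \<in> carrier H" and g: "g \<in> carrier H"
  have lin: "(%x. adj H h x) \<in> linear_maps K H H" by (rule linear_adj_right[OF h linear_id])
  show ?thesis
    using h g by (simp add: augment_def additive_minus[OF H_group H_group linear_additive[OF lin]] linear_smult[OF lin]
        adj_one_right counit_adj R.m_comm smult_assoc1)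
qed

lemma L_closed: "w \<in> ws ==> h \<in> carrier H ==> (\<And>v. v \<in> ws ==> f v \<in> carrier K) ==> L w h f \<in> carrier K"
proof (induction w arbitrary: h f rule: list.induct)
  case (Cons x w)
  then show ?case by (auto intro!: sw_K_closed)
qed simp

lemma L_cong:
  "w \<in> ws ==> h \<in> carrier H ==> (\<And>v. v \<in> ws ==> length v = length w ==> f v = g v) ==> L w h f = L w h g"
proof (induction w arbitrary: h f g rule: list.induct)
  case (Cons x w)
  have c: "x \<in> carrier H" "w \<in> ws" using Cons.prems(1) by simp_all
  have "L w b (%v. f (adj H a x # v)) = L w b (%v. g (adj H a x # v))" if "a \<in> carrier H" "b \<in> carrier H" for a b
    by (rule Cons.IH[OF c(2) that(2)]) (simp add: Cons.prems(3) c that)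
  then show ?case using Cons.prems(2) by (auto intro!: sw_cong)
qed simp

lemma L_zero: "w \<in> ws ==> h \<in> carrier H ==> L w h (%v. \<zero>\<^bsub>K\<^esub>) = \<zero>\<^bsub>K\<^esub>"
proof (induction w arbitrary: h rule: list.induct)
  case (Cons x w)
  then have "sw H S h (%a b. L w b (%v. \<zero>\<^bsub>K\<^esub>)) = sw H S h (%a b. \<zero>\<^bsub>K\<^esub>)" by (intro sw_cong) auto
  then show ?case using Cons.prems by (simp add: sw_K_zero)
qed simp

lemma L_vanish:
  "w \<in> ws ==> h \<in> carrier H ==> (\<And>v. v \<in> ws ==> length v = length w ==> f v = \<zero>\<^bsub>K\<^esub>) ==> L w h f = \<zero>\<^bsub>K\<^esub>"
  using L_cong[of w h f "%v. \<zero>\<^bsub>K\<^esub>"] L_zero by simp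

lemma L_linear_param:
  "w \<in> ws ==> h \<in> carrier H ==> (\<And>v. v \<in> ws ==> (%z. F z v) \<in> linear_maps K M S) ==> (%z. L w h (F z)) \<in> linear_maps K M S"
proof (induction w arbitrary: h F rule: list.induct)
  case (Cons x w)
  have c: "x \<in> carrier H" "w \<in> ws" using Cons.prems(1) by simp_all
  have "(%z. L w b (%v. F z (adj H a x # v))) \<in> linear_maps K M S" if "a \<in> carrier H" "b \<in> carrier H" for a b
    by (rule Cons.IH[OF c(2) that(2)]) (simp add: Cons.prems(3) c that)
  then show ?case by (auto intro!: linear_sw[OF S_module Cons.prems(2)])
qed (auto intro: linear_K_mult_left)

lemma linear_ml_head: "ml f ==> v \<in> ws ==> g \<in> linear_maps K M H ==> (%z. f (g z # v)) \<in> linear_maps K M S"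
  using linear_maps_compose[OF ml_head] by blast

lemma L_linear: "w \<in> ws ==> ml f ==> (%h. L w h f) \<in> linear_maps K H S"
proof (induction w arbitrary: f rule: list.induct)
  case Nil
  then show ?case using linear_K_mult_right[OF _ counit_linear] by (simp add: ml_closed)
next
  case (Cons x w)
  have c: "x \<in> carrier H" "w \<in> ws" using Cons.prems(1) by simp_all
  have "(%a b. L w b (%v. f (adj H a x # v))) \<in> bilinear_maps K H H S"
    using Cons.prems c
    by (intro bilinear_mapsI Cons.IH L_linear_param linear_ml_head linear_adj_left linear_id ml_Cons) auto
  then show ?case using sw_linear[OF S_module] by simp
qed

lemma L_bilinear:
  "w \<in> ws ==> ml f ==> x \<in> carrier H ==> (%a b. L w b (%v. f (adj H a x # v))) \<in> bilinear_maps K H H S"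
  by (intro bilinear_mapsI L_linear L_linear_param linear_ml_head linear_adj_left linear_id ml_Cons) auto

lemma ml_L:
  assumes f: "ml f" and h: "h \<in> carrier H"
  shows "ml (%w. L w h f)"
proof (rule mlI)
  fix us vs assume "us \<in> ws" "vs \<in> ws"
  then show "(%x. L (us @ x # vs) h f) \<in> linear_maps K H S"
    using f h
  proof (induction us arbitrary: f h rule: list.induct)
    case Nil
    then show ?case
      by (auto intro!: linear_sw[OF S_module] L_linear_param linear_ml_head linear_adj_right linear_id)
  next
    case (Cons u us)
    then show ?case
      by (auto intro!: linear_sw[OF S_module] Cons.IH ml_Cons)
  qed
qed (use assms in \<open>simp add: L_closed ml_closed\<close>)

lemma L_smult:
  "w \<in> ws ==> h \<in> carrier H ==> k \<in> carrier K ==> (\<And>v. v \<in> ws ==> f v \<in> carrier K) ==>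
   L w h (%v. k \<otimes>\<^bsub>K\<^esub> f v) = k \<otimes>\<^bsub>K\<^esub> L w h f"
proof (induction w arbitrary: h f rule: list.induct)
  case (Cons x w)
  have "sw H S h (%a b. L w b (%v. k \<otimes>\<^bsub>K\<^esub> f (adj H a x # v))) = sw H S h (%a b. k \<otimes>\<^bsub>K\<^esub> L w b (%v. f (adj H a x # v)))"
    using Cons.prems by (intro sw_cong Cons.IH) auto
  then show ?case using Cons.prems by (simp add: sw_K_smult L_closed)
qed (simp add: R.m_lcomm)

lemma L_add:
  "w \<in> ws ==> h \<in> carrier H ==> (\<And>v. v \<in> ws ==> f v \<in> carrier K) ==> (\<And>v. v \<in> ws ==> g v \<in> carrier K) ==>
   L w h (%v. f v \<oplus>\<^bsub>K\<^esub> g v) = L w h f \<oplus>\<^bsub>K\<^esub> L w h g"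
proof (induction w arbitrary: h f g rule: list.induct)
  case (Cons x w)
  have "sw H S h (%a b. L w b (%v. f (adj H a x # v) \<oplus>\<^bsub>K\<^esub> g (adj H a x # v))) =
      sw H S h (%a b. L w b (%v. f (adj H a x # v)) \<oplus>\<^bsub>K\<^esub> L w b (%v. g (adj H a x # v)))"
    using Cons.prems by (intro sw_cong Cons.IH) auto
  then show ?case using Cons.prems by (simp add: sw_K_add L_closed)
qed (simp add: R.r_distr)

lemma L_minus:
  assumes "w \<in> ws" "h \<in> carrier H" "\<And>v. v \<in> ws ==> f v \<in> carrier K" "\<And>v. v \<in> ws ==> g v \<in> carrier K"
  shows "L w h (%v. f v \<ominus>\<^bsub>K\<^esub> g v) = L w h f \<ominus>\<^bsub>K\<^esub> L w h g"
proof -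
  have "L w h (%v. f v \<ominus>\<^bsub>K\<^esub> g v) = L w h (%v. f v \<oplus>\<^bsub>K\<^esub> (\<ominus>\<^bsub>K\<^esub> \<one>\<^bsub>K\<^esub>) \<otimes>\<^bsub>K\<^esub> g v)"
    using assms by (intro L_cong) (auto simp: a_minus_def R.l_minus)
  also have "\<dots> = L w h f \<oplus>\<^bsub>K\<^esub> (\<ominus>\<^bsub>K\<^esub> \<one>\<^bsub>K\<^esub>) \<otimes>\<^bsub>K\<^esub> L w h g"
    using assms by (simp add: L_add L_smult)
  finally show ?thesis using assms by (simp add: a_minus_def R.l_minus L_closed)
qed

lemma L_sw:
  assumes "w \<in> ws" "h \<in> carrier H" "k \<in> carrier H"
    "\<And>a b v. a \<in> carrier H ==> b \<in> carrier H ==> v \<in> ws ==> F a b v \<in> carrier K"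
  shows "L w h (%v. sw H S k (%a b. F a b v)) = sw H S k (%a b. L w h (F a b))"
proof -
  have "L w h (%v. lsum S (map (%u. F (u ! 0) (u ! 1) v) us)) = lsum S (map (%u. L w h (F (u ! 0) (u ! 1))) us)"
    if "set us \<subseteq> set (sweedler H k)" for us
    using that
  proof (induction us)
    case Nil
    then show ?case using assms by (simp add: L_zero)
  next
    case (Cons u us)
    have "u ! 0 \<in> carrier H" "u ! 1 \<in> carrier H" using Cons.prems sweedler_nth[OF assms(3)] by auto
    moreover have "lsum K (map (%u. F (u ! 0) (u ! 1) v) us) \<in> carrier K" if "v \<in> ws" for v
      using Cons.prems sweedler_nth[OF assms(3)] assms(4) that by (intro R.lsum_map_closed) auto
    ultimately show ?case using Cons assms by (simp add: L_add)
  qed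
  then show ?thesis unfolding sw_def by simp
qed

lemma L_one: "w \<in> ws ==> ml f ==> L w \<one>\<^bsub>H\<^esub> f = f w"
proof (induction w arbitrary: f rule: list.induct)
  case (Cons x w)
  then have "L (x # w) \<one>\<^bsub>H\<^esub> f = L w \<one>\<^bsub>H\<^esub> (%v. f (adj H \<one>\<^bsub>H\<^esub> x # v))"
    using sw_one[OF S_module L_bilinear] by simp
  also have "\<dots> = f (x # w)" using Cons by (simp add: adj_one_left ml_Cons)
  finally show ?case .
qed (simp add: counit_one ml_closed)

lemma L_single:
  assumes "ml f" "h \<in> carrier H" "x \<in> carrier H"
  shows "L [x] h f = f [adj H h x]"
proof -
  have "(%a. f [adj H a x]) \<in> linear_maps K H S"
    using assms by (intro linear_ml_head linear_adj_left linear_id) auto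
  from sw_K_counit_right[OF this assms(2)] show ?thesis by simp
qed

text \<open>Multiplicativity of the coproduct on the word, and of \<open>ad\<close> on its letters.\<close>

lemma L_L:
  "w \<in> ws ==> ml f ==> h \<in> carrier H ==> g \<in> carrier H ==> L w h (%v. L v g f) = L w (h \<otimes>\<^bsub>H\<^esub> g) f"
proof (induction w arbitrary: f h g rule: list.induct)
  case Nil
  then show ?case by (simp add: counit_mult R.m_assoc ml_closed)
next
  case (Cons x w)
  have c: "x \<in> carrier H" "w \<in> ws" using Cons.prems(1) by simp_all
  note [simp] = c Cons.prems
  have "L (x # w) h (%v. L v g f) = sw H S h (%a b. L w b (%v. sw H S g (%c e. L v e (%v. f (adj H c (adj H a x) # v)))))"
    by simp
  also have "\<dots> = sw H S h (%a b. sw H S g (%c e. L w b (%v. L v e (%v. f (adj H c (adj H a x) # v)))))"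
    by (intro sw_cong L_sw L_closed) (auto simp: ml_closed)
  also have "\<dots> = sw H S h (%a b. sw H S g (%c e. L w (b \<otimes>\<^bsub>H\<^esub> e) (%v. f (adj H (a \<otimes>\<^bsub>H\<^esub> c) x # v))))"
    by (intro sw_cong) (simp_all add: Cons.IH ml_Cons adj_adj)
  also have "\<dots> = L (x # w) (h \<otimes>\<^bsub>H\<^esub> g) f"
    using sw_mult[OF S_module L_bilinear[of w f x], of h g] by simp
  finally show ?case .
qed

lemma mul_lsum_left:
  assumes "w \<in> ws" "ml g" "\<And>u. u \<in> set us ==> ml (F u)"
  shows "mul w (%v. lsum S (map (%u. F u v) us)) g = lsum S (map (%u. mul w (F u) g) us) \<and>
    ml (%v. lsum S (map (%u. F u v) us))"
  using assms(3)
proof (induction us)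
  case Nil
  have "mul w (%v. \<zero>\<^bsub>K\<^esub>) g = \<zero>\<^bsub>K\<^esub>" using assms by (intro form_mult_vanish) (auto simp: ml_zero)
  then show ?case by (simp add: ml_zero)
next
  case (Cons u us)
  then show ?case using assms by (simp add: form_mult_add_left ml_add)
qed

lemma mul_sw_left:
  assumes "w \<in> ws" "ml g" "h \<in> carrier H" "\<And>a b. a \<in> carrier H ==> b \<in> carrier H ==> ml (F a b)"
  shows "mul w (%v. sw H S h (%a b. F a b v)) g = sw H S h (%a b. mul w (F a b) g)"
    and "ml (%v. sw H S h (%a b. F a b v))"
  using mul_lsum_left[OF assms(1,2), of "sweedler H h" "%u. F (u ! 0) (u ! 1)"] assms(4) sweedler_nth[OF assms(3)]
  unfolding sw_def by auto

lemma mul_minus_left: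
  assumes "ml f" "ml f'" "ml g" "w \<in> ws"
  shows "mul w (%v. f v \<ominus>\<^bsub>K\<^esub> f' v) g = mul w f g \<ominus>\<^bsub>K\<^esub> mul w f' g"
proof -
  have "mul w (%v. f v \<ominus>\<^bsub>K\<^esub> f' v) g = mul w (%v. f v \<oplus>\<^bsub>K\<^esub> (\<ominus>\<^bsub>K\<^esub> \<one>\<^bsub>K\<^esub>) \<otimes>\<^bsub>K\<^esub> f' v) g"
    using assms by (intro form_mult_cong) (auto simp: a_minus_def R.l_minus ml_closed)
  also have "\<dots> = mul w f g \<oplus>\<^bsub>K\<^esub> (\<ominus>\<^bsub>K\<^esub> \<one>\<^bsub>K\<^esub>) \<otimes>\<^bsub>K\<^esub> mul w f' g"
    using assms by (simp add: form_mult_add_left form_mult_smult_left ml_smult)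
  finally show ?thesis using assms by (simp add: a_minus_def R.l_minus form_mult_closed)
qed

lemma mul_neg_left:
  assumes "ml f" "ml g" "w \<in> ws"
  shows "mul w (%v. \<ominus>\<^bsub>K\<^esub> f v) g = \<ominus>\<^bsub>K\<^esub> mul w f g"
proof -
  have "mul w (%v. \<ominus>\<^bsub>K\<^esub> f v) g = mul w (%v. (\<ominus>\<^bsub>K\<^esub> \<one>\<^bsub>K\<^esub>) \<otimes>\<^bsub>K\<^esub> f v) g"
    using assms by (intro form_mult_cong) (auto simp: R.l_minus ml_closed)
  then show ?thesis using assms by (simp add: form_mult_smult_left R.l_minus form_mult_closed)
qed

lemma linear_mul_L:
  "w \<in> ws ==> ml f ==> ml g ==> (%b. mul w f (%v. L v b g)) \<in> linear_maps K H S"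
  by (intro form_mult_linear_right L_linear)

text \<open>The first letter goes either to \<open>g\<close>, with a factor \<open>f []\<close> on which $L_h$ acts by the counit, or to
  \<open>f\<close>; in the second case coassociativity regroups the factors of \<open>h\<close>.\<close>

lemma L_mult:
  "w \<in> ws ==> ml f ==> ml g ==> h \<in> carrier H ==>
   L w h (%v. mul v f g) = sw H S h (%a b. mul w (%v. L v a f) (%v. L v b g))"
proof (induction w arbitrary: f h rule: list.induct)
  case Nil
  have "sw H S h (%a b. (counit H a \<otimes>\<^bsub>K\<^esub> f []) \<otimes>\<^bsub>K\<^esub> (counit H b \<otimes>\<^bsub>K\<^esub> g [])) =
    sw H S h (%a b. counit H a \<otimes>\<^bsub>K\<^esub> (f [] \<otimes>\<^bsub>K\<^esub> (counit H b \<otimes>\<^bsub>K\<^esub> g [])))"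
    using Nil by (intro sw_cong) (auto simp: R.m_assoc ml_closed)
  also have "\<dots> = f [] \<otimes>\<^bsub>K\<^esub> (counit H h \<otimes>\<^bsub>K\<^esub> g [])"
    using Nil by (intro sw_K_counit_left linear_K_mult_left linear_K_mult_right counit_linear) (auto simp: ml_closed)
  finally show ?case using Nil by (simp add: R.m_lcomm ml_closed)
next
  case (Cons x w)
  have c: "x \<in> carrier H" "w \<in> ws" using Cons.prems(1) by simp_all
  note [simp] = c Cons.prems
  have f0 [simp]: "f [] \<in> carrier K" by (simp add: ml_closed)
  have [simp]: "ml (%v. f (y # v))" "ml (%v. g (y # v))" if "y \<in> carrier H" for y using that by (simp_all add: ml_Cons)
  have [simp]: "ml (%v. L v b f')" if "ml f'" "b \<in> carrier H" for f' b using that by (simp add: ml_L)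
  have [simp]: "L w b f' \<in> carrier K" "L (x # w) b f' \<in> carrier K" if "ml f'" "b \<in> carrier H" for f' b
    using that by (simp_all add: L_closed ml_closed del: lie_form.simps)
  note [simp] = form_mult_closed
  have Lmul [simp]: "ml (%v. mul v f' g)" if "ml f'" for f' using that by (simp add: ml_form_mult)
  have "L (x # w) h (%v. mul v f g) =
    sw H S h (%a b. L w b (%v. f [] \<otimes>\<^bsub>K\<^esub> g (adj H a x # v) \<oplus>\<^bsub>K\<^esub> mul v (%v. f (adj H a x # v)) g))"
    by simp
  also have "\<dots> = sw H S h (%a b. f [] \<otimes>\<^bsub>K\<^esub> L w b (%v. g (adj H a x # v)) \<oplus>\<^bsub>K\<^esub>
      sw H S b (%c e. mul w (%v. L v c (%v. f (adj H a x # v))) (%v. L v e g)))"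
    by (intro sw_cong) (simp_all add: L_add L_smult ml_closed Cons.IH)
  also have "\<dots> = f [] \<otimes>\<^bsub>K\<^esub> L (x # w) h g \<oplus>\<^bsub>K\<^esub>
      sw H S h (%a b. sw H S b (%c e. mul w (%v. L v c (%v. f (adj H a x # v))) (%v. L v e g)))"
    by (simp add: sw_K_add sw_K_closed sw_K_smult)
  also have "sw H S h (%a b. sw H S b (%c e. mul w (%v. L v c (%v. f (adj H a x # v))) (%v. L v e g))) =
    sw H S h (%a b. sw H S a (%c e. mul w (%v. L v e (%v. f (adj H c x # v))) (%v. L v b g)))"
    by (rule sw_coassoc[OF S_module, symmetric])
      (auto intro!: linear_mul_L form_mult_linear_left L_linear L_linear_param linear_ml_head linear_adj_left linear_id)
  also have "\<dots> = sw H S h (%a b. mul w (%v. L (x # v) a f) (%v. L v b g))"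
    by (intro sw_cong) (simp_all add: mul_sw_left)
  also have "f [] \<otimes>\<^bsub>K\<^esub> L (x # w) h g = sw H S h (%a b. (counit H a \<otimes>\<^bsub>K\<^esub> f []) \<otimes>\<^bsub>K\<^esub> L (x # w) b g)"
  proof -
    have "sw H S h (%a b. counit H a \<otimes>\<^bsub>K\<^esub> (f [] \<otimes>\<^bsub>K\<^esub> L (x # w) b g)) = f [] \<otimes>\<^bsub>K\<^esub> L (x # w) h g"
      by (intro sw_K_counit_left linear_K_mult_left L_linear) (simp_all del: lie_form.simps)
    moreover have "sw H S h (%a b. counit H a \<otimes>\<^bsub>K\<^esub> (f [] \<otimes>\<^bsub>K\<^esub> L (x # w) b g)) =
      sw H S h (%a b. (counit H a \<otimes>\<^bsub>K\<^esub> f []) \<otimes>\<^bsub>K\<^esub> L (x # w) b g)"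
      by (intro sw_cong) (simp_all add: R.m_assoc del: lie_form.simps)
    ultimately show ?thesis by simp
  qed
  also have "sw H S h (%a b. (counit H a \<otimes>\<^bsub>K\<^esub> f []) \<otimes>\<^bsub>K\<^esub> L (x # w) b g) \<oplus>\<^bsub>K\<^esub>
      sw H S h (%a b. mul w (%v. L (x # v) a f) (%v. L v b g)) =
      sw H S h (%a b. mul (x # w) (%v. L v a f) (%v. L v b g))"
  proof -
    have "ml (%v. L (x # v) a f)" if "a \<in> carrier H" for a
      using ml_Cons[OF ml_L[of f a]] that by simp
    then show ?thesis
      by (subst sw_K_add[symmetric]) (simp_all del: lie_form.simps(2))
  qed
  finally show ?case .
qed

lemma I_closed: "w \<in> ws ==> h \<in> carrier H ==> (\<And>v. v \<in> ws ==> f v \<in> carrier K) ==> I w h f \<in> carrier K"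
proof (induction w arbitrary: f rule: list.induct)
  case (Cons x w)
  have c: "x \<in> carrier H" "w \<in> ws" using Cons.prems(1) by simp_all
  have "sw H S h (%a b. L (x # w) b (%v. f (aug a # v))) \<in> carrier K"
    by (intro sw_K_closed L_closed Cons.prems) (simp_all add: Cons.prems)
  moreover have "I w h (%v. f (x # v)) \<in> carrier K"
    by (rule Cons.IH[OF c(2) Cons.prems(2)]) (simp add: Cons.prems c)
  ultimately show ?case by (simp del: lie_form.simps)
qed simp

lemma I_cong:
  "w \<in> ws ==> h \<in> carrier H ==> (\<And>v. v \<in> ws ==> length v = Suc (length w) ==> f v = g v) ==> I w h f = I w h g"
proof (induction w arbitrary: f g rule: list.induct)
  case (Cons x w)
  have c: "x \<in> carrier H" "w \<in> ws" using Cons.prems(1) by simp_all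
  have "I w h (%v. f (x # v)) = I w h (%v. g (x # v))"
    by (rule Cons.IH[OF c(2) Cons.prems(2)]) (simp add: Cons.prems(3) c)
  moreover have "L (x # w) b (%v. f (aug a # v)) = L (x # w) b (%v. g (aug a # v))" if "a \<in> carrier H" "b \<in> carrier H" for a b
    by (rule L_cong[OF Cons.prems(1) that(2)]) (simp add: Cons.prems(3) c that)
  then have "sw H S h (%a b. L (x # w) b (%v. f (aug a # v))) = sw H S h (%a b. L (x # w) b (%v. g (aug a # v)))"
    by (intro sw_cong Cons.prems)
  ultimately show ?case by (simp del: lie_form.simps)
qed simp

lemma I_zero: "w \<in> ws ==> h \<in> carrier H ==> I w h (%v. \<zero>\<^bsub>K\<^esub>) = \<zero>\<^bsub>K\<^esub>"
proof (induction w rule: list.induct)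
  case (Cons x w)
  then have "sw H S h (%a b. L (x # w) b (%v. \<zero>\<^bsub>K\<^esub>)) = sw H S h (%a b. \<zero>\<^bsub>K\<^esub>)" by (intro sw_cong L_zero) auto
  then show ?case using Cons by (simp add: sw_K_zero a_minus_def del: lie_form.simps)
qed simp

lemma I_vanish:
  "w \<in> ws ==> h \<in> carrier H ==> (\<And>v. v \<in> ws ==> length v = Suc (length w) ==> f v = \<zero>\<^bsub>K\<^esub>) ==> I w h f = \<zero>\<^bsub>K\<^esub>"
  using I_cong[of w h f "%v. \<zero>\<^bsub>K\<^esub>"] I_zero by simp

lemma I_linear_param:
  "w \<in> ws ==> h \<in> carrier H ==> (\<And>v. v \<in> ws ==> (%z. F z v) \<in> linear_maps K M S) ==> (%z. I w h (F z)) \<in> linear_maps K M S"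
proof (induction w arbitrary: F rule: list.induct)
  case (Cons x w)
  have c: "x \<in> carrier H" "w \<in> ws" using Cons.prems(1) by simp_all
  have "(%z. I w h (%v. F z (x # v))) \<in> linear_maps K M S"
    by (rule Cons.IH[OF c(2) Cons.prems(2)]) (simp add: Cons.prems(3) c)
  moreover have "(%z. sw H S h (%a b. L (x # w) b (%v. F z (aug a # v)))) \<in> linear_maps K M S"
    using Cons.prems by (intro linear_sw[OF S_module] L_linear_param) auto
  ultimately show ?case by (simp add: linear_K_minus del: lie_form.simps)
qed auto

lemma L_aug_bilinear:
  "w \<in> ws ==> ml f ==> (%a b. L w b (%v. f (aug a # v))) \<in> bilinear_maps K H H S"
  by (intro bilinear_mapsI L_linear L_linear_param linear_ml_head linear_aug linear_id ml_Cons) auto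

lemma I_linear: "w \<in> ws ==> ml f ==> (%h. I w h f) \<in> linear_maps K H S"
proof (induction w arbitrary: f rule: list.induct)
  case Nil
  then show ?case using linear_ml_head[OF _ _ linear_aug[OF linear_id]] by simp
next
  case (Cons x w)
  then show ?case
    using sw_linear[OF S_module L_aug_bilinear[of "x # w" f]]
    by (simp add: linear_K_minus ml_Cons del: lie_form.simps)
qed

lemma ml_I:
  assumes f: "ml f" and h: "h \<in> carrier H"
  shows "ml (%w. I w h f)"
proof (rule mlI)
  fix us vs assume us: "us \<in> ws" and vs: "vs \<in> ws"
  have Lsw: "(%x. sw H S h (%a b. L (us @ x # vs) b (%v. f (aug a # v)))) \<in> linear_maps K H S"
    if "us \<in> ws" "ml f" for us f
    using that vs h ml_slot[OF ml_L[OF ml_Cons[OF that(2) aug_closed]]]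
    by (intro linear_sw[OF S_module]) auto
  from us f show "(%x. I (us @ x # vs) h f) \<in> linear_maps K H S"
  proof (induction us arbitrary: f rule: list.induct)
    case Nil
    have "(%x. I vs h (%v. f (x # v))) \<in> linear_maps K H S"
      using Nil vs h by (intro I_linear_param) (auto intro: ml_head)
    then show ?case using Lsw[OF Nil] by (simp add: linear_K_minus del: lie_form.simps)
  next
    case (Cons u us)
    have "(%x. I (us @ x # vs) h (%v. f (u # v))) \<in> linear_maps K H S"
      using Cons.prems by (intro Cons.IH) (auto intro: ml_Cons)
    then show ?case using Lsw[OF Cons.prems] by (simp add: linear_K_minus del: lie_form.simps)
  qed
qed (use assms in \<open>simp add: I_closed ml_closed\<close>)

lemma I_smult:
  assumes "w \<in> ws" "h \<in> carrier H" "k \<in> carrier K" "\<And>v. v \<in> ws ==> f v \<in> carrier K"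
  shows "I w h (%v. k \<otimes>\<^bsub>K\<^esub> f v) = k \<otimes>\<^bsub>K\<^esub> I w h f"
proof -
  have lin: "(%k. I w h (%v. k \<otimes>\<^bsub>K\<^esub> f v)) \<in> linear_maps K S S"
    using assms module.linear_id[OF S_module] by (intro I_linear_param linear_K_mult_right) auto
  have "I w h (%v. k \<otimes>\<^bsub>K\<^esub> f v) = I w h (%v. (k \<otimes>\<^bsub>K\<^esub> \<one>\<^bsub>K\<^esub>) \<otimes>\<^bsub>K\<^esub> f v)" using assms(3) by simp
  also have "\<dots> = k \<otimes>\<^bsub>K\<^esub> I w h (%v. \<one>\<^bsub>K\<^esub> \<otimes>\<^bsub>K\<^esub> f v)"
    using linear_smult[OF lin assms(3), of "\<one>\<^bsub>K\<^esub>"] by simp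
  also have "I w h (%v. \<one>\<^bsub>K\<^esub> \<otimes>\<^bsub>K\<^esub> f v) = I w h f"
    using assms by (intro I_cong) auto
  finally show ?thesis .
qed

lemma I_add:
  "w \<in> ws ==> h \<in> carrier H ==> (\<And>v. v \<in> ws ==> f v \<in> carrier K) ==> (\<And>v. v \<in> ws ==> g v \<in> carrier K) ==>
   I w h (%v. f v \<oplus>\<^bsub>K\<^esub> g v) = I w h f \<oplus>\<^bsub>K\<^esub> I w h g"
proof (induction w arbitrary: f g rule: list.induct)
  case (Cons x w)
  have "sw H S h (%a b. L (x # w) b (%v. f (aug a # v) \<oplus>\<^bsub>K\<^esub> g (aug a # v))) =
      sw H S h (%a b. L (x # w) b (%v. f (aug a # v)) \<oplus>\<^bsub>K\<^esub> L (x # w) b (%v. g (aug a # v)))"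
    using Cons.prems by (intro sw_cong L_add) auto
  also have "\<dots> = sw H S h (%a b. L (x # w) b (%v. f (aug a # v))) \<oplus>\<^bsub>K\<^esub> sw H S h (%a b. L (x # w) b (%v. g (aug a # v)))"
    using Cons.prems by (intro sw_K_add L_closed) auto
  finally show ?case
    using Cons.prems Cons.IH[of "%v. f (x # v)" "%v. g (x # v)"]
    by (simp add: sw_K_closed L_closed I_closed a_minus_def R.minus_add R.a_ac del: lie_form.simps)
qed simp

lemma I_sw:
  assumes "w \<in> ws" "h \<in> carrier H" "k \<in> carrier H"
    "\<And>a b v. a \<in> carrier H ==> b \<in> carrier H ==> v \<in> ws ==> F a b v \<in> carrier K"
  shows "I w h (%v. sw H S k (%a b. F a b v)) = sw H S k (%a b. I w h (F a b))"
proof -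
  have "I w h (%v. lsum S (map (%u. F (u ! 0) (u ! 1) v) us)) = lsum S (map (%u. I w h (F (u ! 0) (u ! 1))) us)"
    if "set us \<subseteq> set (sweedler H k)" for us
    using that
  proof (induction us)
    case Nil
    then show ?case using assms by (simp add: I_zero)
  next
    case (Cons u us)
    have "u ! 0 \<in> carrier H" "u ! 1 \<in> carrier H" using Cons.prems sweedler_nth[OF assms(3)] by auto
    moreover have "lsum K (map (%u. F (u ! 0) (u ! 1) v) us) \<in> carrier K" if "v \<in> ws" for v
      using Cons.prems sweedler_nth[OF assms(3)] assms(4) that by (intro R.lsum_map_closed) auto
    ultimately show ?case using Cons assms by (simp add: I_add)
  qed
  then show ?thesis unfolding sw_def by simp
qed

lemma I_one: "w \<in> ws ==> ml f ==> I w \<one>\<^bsub>H\<^esub> f = \<zero>\<^bsub>K\<^esub>"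
proof (induction w arbitrary: f rule: list.induct)
  case Nil
  then show ?case
    using additive_zero[OF H_group S_group linear_additive[OF ml_head[OF Nil(2,1)]]] by (simp add: aug_one)
next
  case (Cons x w)
  have "sw H S \<one>\<^bsub>H\<^esub> (%a b. L (x # w) b (%v. f (aug a # v))) = L (x # w) \<one>\<^bsub>H\<^esub> (%v. f (aug \<one>\<^bsub>H\<^esub> # v))"
    using Cons.prems by (intro sw_one[OF S_module] L_aug_bilinear)
  also have "\<dots> = f (aug \<one>\<^bsub>H\<^esub> # x # w)" using Cons.prems by (intro L_one ml_Cons) auto
  also have "\<dots> = \<zero>\<^bsub>K\<^esub>"
    using additive_zero[OF H_group S_group linear_additive[OF ml_head[OF Cons.prems(2,1)]]] by (simp add: aug_one)
  finally show ?case using Cons by (simp add: ml_Cons a_minus_def del: lie_form.simps)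
qed

lemma ml_sw:
  "h \<in> carrier H ==> (\<And>a b. a \<in> carrier H ==> b \<in> carrier H ==> ml (F a b)) ==> ml (%v. sw H S h (%a b. F a b v))"
  by (rule mul_sw_left(2)[of "[]" "%v. \<zero>\<^bsub>K\<^esub>"]) (simp_all add: ml_zero)

text \<open>The parity automorphism, evaluated at a word.\<close>

definition sgn :: "('h list \<Rightarrow> 'k) \<Rightarrow> 'h list \<Rightarrow> 'k" where
  "sgn f v = gsign K (length v) (f v)"

lemma ml_sgn: "ml f ==> ml (sgn f)"
  using ml_sign[of f] by (simp add: sgn_def[abs_def])

text \<open>The twisted Leibniz rule. Splitting off the first letter of the word, the sign $(-1)^a$ of the
  degree of the first factor is produced by the alternating sign in the recursion for $i_h$.\<close>

lemma I_mult:
  "w \<in> ws ==> ml f ==> ml g ==> h \<in> carrier H ==>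
   I w h (%v. mul v f g) = sw H S h (%a b. mul w (%v. I v a f) (%v. L v b g)) \<oplus>\<^bsub>K\<^esub> mul w (sgn f) (%v. I v h g)"
proof (induction w arbitrary: f rule: list.induct)
  case Nil
  have "sw H S h (%a b. f [aug a] \<otimes>\<^bsub>K\<^esub> (counit H b \<otimes>\<^bsub>K\<^esub> g [])) =
    sw H S h (%a b. counit H b \<otimes>\<^bsub>K\<^esub> (f [aug a] \<otimes>\<^bsub>K\<^esub> g []))"
    using Nil by (intro sw_cong) (auto simp: R.m_lcomm ml_closed)
  also have "\<dots> = f [aug h] \<otimes>\<^bsub>K\<^esub> g []"
    using Nil by (intro sw_K_counit_right linear_K_mult_right linear_ml_head linear_aug linear_id) (auto simp: ml_closed)
  finally show ?case using Nil by (simp add: sgn_def R.a_comm ml_closed)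
next
  case (Cons x w)
  have c: "x \<in> carrier H" "w \<in> ws" using Cons.prems(1) by simp_all
  note [simp] = c Cons.prems
  note [simp del] = lie_form.simps
  have f0 [simp]: "f [] \<in> carrier K" by (simp add: ml_closed)
  have [simp]: "ml (%v. f (y # v))" "ml (%v. g (y # v))" if "y \<in> carrier H" for y using that by (simp_all add: ml_Cons)
  have [simp]: "ml (%v. L v b f')" "ml (%v. I v b f')" if "ml f'" "b \<in> carrier H" for f' b using that by (simp_all add: ml_L ml_I)
  have [simp]: "ml (%v. L (y # v) b f')" "ml (%v. I (y # v) b f')" if "ml f'" "b \<in> carrier H" "y \<in> carrier H" for f' b y
    using that ml_Cons[OF ml_L[of f' b]] ml_Cons[OF ml_I[of f' b]] by simp_all
  have [simp]: "L v b f' \<in> carrier K" "I v b f' \<in> carrier K" if "v \<in> ws" "ml f'" "b \<in> carrier H" for f' b v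
    using that by (simp_all add: L_closed I_closed ml_closed)
  note [simp] = form_mult_closed sw_K_closed ml_form_mult ml_sgn ml_closed
  let ?mL = "%c e y. mul w (%v. L (x # v) c (%v. f (y # v))) (%v. L v e g)"
  \<comment> \<open>Both sides are combinations of these six sums: those with P come from placing the new argument first, the others from the recursion.\<close>
  define P0 where "P0 = sw H S h (%a b. L (x # w) b (%v. g (aug a # v)))"
  define P1 where "P1 = sw H S h (%a b. f [aug a] \<otimes>\<^bsub>K\<^esub> L (x # w) b g)"
  define P2 where "P2 = sw H S h (%a b. sw H S b (%c e. ?mL c e (aug a)))"
  define Q1 where "Q1 = sw H S h (%a b. mul w (%v. I v a (%v. f (x # v))) (%v. L v b g))"
  define Q2 where "Q2 = mul w (sgn (%v. f (x # v))) (%v. I v h g)"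
  define O' where "O' = I w h (%v. g (x # v))"
  have cl [simp]: "P0 \<in> carrier K" "P1 \<in> carrier K" "P2 \<in> carrier K" "Q1 \<in> carrier K" "Q2 \<in> carrier K" "O' \<in> carrier K"
    by (simp_all add: P0_def P1_def P2_def Q1_def Q2_def O'_def)
  have "L (x # w) b (%v. mul (aug a # v) f g) =
      f [] \<otimes>\<^bsub>K\<^esub> L (x # w) b (%v. g (aug a # v)) \<oplus>\<^bsub>K\<^esub> (f [aug a] \<otimes>\<^bsub>K\<^esub> L (x # w) b g \<oplus>\<^bsub>K\<^esub> sw H S b (%c e. ?mL c e (aug a)))"
    if [simp]: "a \<in> carrier H" "b \<in> carrier H" for a b
  proof -
    have "L (x # w) b (%v. mul (aug a # v) f g) =
      f [] \<otimes>\<^bsub>K\<^esub> L (x # w) b (%v. g (aug a # v)) \<oplus>\<^bsub>K\<^esub> L (x # w) b (%v. mul v (%v. f (aug a # v)) g)"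
      by (simp add: L_add L_smult)
    also have "L (x # w) b (%v. mul v (%v. f (aug a # v)) g) =
      sw H S b (%c e. mul (x # w) (%v. L v c (%v. f (aug a # v))) (%v. L v e g))"
      by (rule L_mult) simp_all
    also have "\<dots> = sw H S b (%c e. (counit H c \<otimes>\<^bsub>K\<^esub> f [aug a]) \<otimes>\<^bsub>K\<^esub> L (x # w) e g \<oplus>\<^bsub>K\<^esub> ?mL c e (aug a))"
      by (simp add: lie_form.simps(1))
    also have "\<dots> = sw H S b (%c e. counit H c \<otimes>\<^bsub>K\<^esub> (f [aug a] \<otimes>\<^bsub>K\<^esub> L (x # w) e g)) \<oplus>\<^bsub>K\<^esub> sw H S b (%c e. ?mL c e (aug a))"
      by (simp add: sw_K_add, intro arg_cong2[where f="(\<oplus>\<^bsub>K\<^esub>)"] sw_cong) (simp_all add: R.m_assoc)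
    also have "sw H S b (%c e. counit H c \<otimes>\<^bsub>K\<^esub> (f [aug a] \<otimes>\<^bsub>K\<^esub> L (x # w) e g)) = f [aug a] \<otimes>\<^bsub>K\<^esub> L (x # w) b g"
      by (intro sw_K_counit_left linear_K_mult_left L_linear) simp_all
    finally show ?thesis .
  qed
  then have "sw H S h (%a b. L (x # w) b (%v. mul (aug a # v) f g)) =
    sw H S h (%a b. f [] \<otimes>\<^bsub>K\<^esub> L (x # w) b (%v. g (aug a # v)) \<oplus>\<^bsub>K\<^esub> (f [aug a] \<otimes>\<^bsub>K\<^esub> L (x # w) b g \<oplus>\<^bsub>K\<^esub> sw H S b (%c e. ?mL c e (aug a))))"
    by (intro sw_cong) simp_all
  also have "\<dots> = f [] \<otimes>\<^bsub>K\<^esub> P0 \<oplus>\<^bsub>K\<^esub> (P1 \<oplus>\<^bsub>K\<^esub> P2)"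
    by (simp add: sw_K_add sw_K_smult P0_def P1_def P2_def)
  finally have P: "sw H S h (%a b. L (x # w) b (%v. mul (aug a # v) f g)) = f [] \<otimes>\<^bsub>K\<^esub> P0 \<oplus>\<^bsub>K\<^esub> (P1 \<oplus>\<^bsub>K\<^esub> P2)" .
  have Q: "I w h (%v. mul (x # v) f g) = f [] \<otimes>\<^bsub>K\<^esub> O' \<oplus>\<^bsub>K\<^esub> (Q1 \<oplus>\<^bsub>K\<^esub> Q2)"
    by (simp add: I_add I_smult Cons.IH O'_def Q1_def Q2_def)
  have lhs: "I (x # w) h (%v. mul v f g) = (f [] \<otimes>\<^bsub>K\<^esub> P0 \<oplus>\<^bsub>K\<^esub> (P1 \<oplus>\<^bsub>K\<^esub> P2)) \<ominus>\<^bsub>K\<^esub> (f [] \<otimes>\<^bsub>K\<^esub> O' \<oplus>\<^bsub>K\<^esub> (Q1 \<oplus>\<^bsub>K\<^esub> Q2))"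
    by (simp only: op_form.simps P Q)
  have "mul w (%v. I (x # v) a f) (%v. L v b g) = sw H S a (%c e. ?mL e b (aug c)) \<ominus>\<^bsub>K\<^esub> mul w (%v. I v a (%v. f (x # v))) (%v. L v b g)"
    if [simp]: "a \<in> carrier H" "b \<in> carrier H" for a b
    by (simp add: mul_minus_left mul_sw_left ml_sw)
  then have "sw H S h (%a b. mul (x # w) (%v. I v a f) (%v. L v b g)) =
    sw H S h (%a b. f [aug a] \<otimes>\<^bsub>K\<^esub> L (x # w) b g \<oplus>\<^bsub>K\<^esub> (sw H S a (%c e. ?mL e b (aug c)) \<ominus>\<^bsub>K\<^esub> mul w (%v. I v a (%v. f (x # v))) (%v. L v b g)))"
    by (intro sw_cong) simp_all
  also have "\<dots> = P1 \<oplus>\<^bsub>K\<^esub> (sw H S h (%a b. sw H S a (%c e. ?mL e b (aug c))) \<ominus>\<^bsub>K\<^esub> Q1)"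
    by (simp add: sw_K_add sw_K_minus P1_def Q1_def)
  also have "sw H S h (%a b. sw H S a (%c e. ?mL e b (aug c))) = P2"
    unfolding P2_def
    by (rule sw_coassoc[OF S_module])
      (auto intro!: linear_mul_L form_mult_linear_left L_linear L_linear_param linear_ml_head linear_aug linear_id)
  finally have R1: "sw H S h (%a b. mul (x # w) (%v. I v a f) (%v. L v b g)) = P1 \<oplus>\<^bsub>K\<^esub> (P2 \<ominus>\<^bsub>K\<^esub> Q1)" .
  have "mul w (%v. sgn f (x # v)) (%v. I v h g) = mul w (%v. \<ominus>\<^bsub>K\<^esub> sgn (%v. f (x # v)) v) (%v. I v h g)"
    by (intro form_mult_cong) (simp_all add: sgn_def R.gsign_Suc)
  also have "\<dots> = \<ominus>\<^bsub>K\<^esub> Q2" unfolding Q2_def by (rule mul_neg_left) simp_all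
  finally have R2: "mul (x # w) (sgn f) (%v. I v h g) = f [] \<otimes>\<^bsub>K\<^esub> (P0 \<ominus>\<^bsub>K\<^esub> O') \<oplus>\<^bsub>K\<^esub> \<ominus>\<^bsub>K\<^esub> Q2"
    by (simp add: P0_def O'_def sgn_def)
  show ?case unfolding lhs R1 R2
    by (simp add: a_minus_def R.minus_add R.r_distr R.r_minus R.a_ac)
qed

text \<open>In the recursion for $i_g$ the argument $\mathrm{ad}(h^{(2)})g$ is itself decomposed by the coproduct;
  \<open>adj_comult\<close> identifies the result with that of first applying $L_h$.\<close>

lemma I_L:
  "w \<in> ws ==> ml f ==> h \<in> carrier H ==> g \<in> carrier H ==>
   I w g (%v. L v h f) = sw H S h (%a b. L w a (%v. I v (adj H b g) f))"
proof (induction w arbitrary: f h rule: list.induct)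
  case Nil
  have "sw H S h (%a b. counit H a \<otimes>\<^bsub>K\<^esub> f [aug (adj H b g)]) = f [aug (adj H h g)]"
    using Nil by (intro sw_K_counit_left linear_ml_head linear_aug linear_adj_left linear_id) auto
  then show ?case using Nil L_single[of f h "aug g"] by (simp add: adj_aug del: lie_form.simps(2))
next
  case (Cons x w)
  have c: "x \<in> carrier H" "w \<in> ws" using Cons.prems(1) by simp_all
  note [simp] = c Cons.prems
  note [simp del] = lie_form.simps
  have [simp]: "ml (%v. f (y # v))" if "y \<in> carrier H" for y using that by (simp_all add: ml_Cons)
  have [simp]: "ml (%v. L v b f')" "ml (%v. I v b f')" if "ml f'" "b \<in> carrier H" for f' b using that by (simp_all add: ml_L ml_I)
  have [simp]: "L v b f' \<in> carrier K" "I v b f' \<in> carrier K" if "v \<in> ws" "ml f'" "b \<in> carrier H" for f' b v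
    using that by (simp_all add: L_closed I_closed ml_closed)
  note [simp] = sw_K_closed
  have Lc [simp]: "L v b (%v. sw H S k (%p q. L (y # v) q (%v. f (aug p # v)))) \<in> carrier K"
    if "v \<in> ws" "b \<in> carrier H" "k \<in> carrier H" "y \<in> carrier H" for v b k y
    using that by (auto intro!: L_closed sw_K_closed simp: ml_closed)
  have [simp]: "L v b (%v. I v k f') \<in> carrier K"
    if "v \<in> ws" "b \<in> carrier H" "k \<in> carrier H" "ml f'" for v b k f'
    using that by (auto intro!: L_closed sw_K_closed simp: ml_closed)
  let ?G = "%p q. L (x # w) q (%v. f (aug p # v))"
  \<comment> \<open>The terms in which the new argument comes first (T1) and the terms from the recursion (T2).\<close>
  define T2 where "T2 = sw H S h (%a b. sw H S b (%c e. L w c (%v. I v (adj H e g) (%v. f (adj H a x # v)))))"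
  define T1 where "T1 = sw H S h (%a b. sw H S g (%c e. ?G (adj H a c) (e \<otimes>\<^bsub>H\<^esub> b)))"
  have "sw H S g (%c e. L (x # w) e (%v. L (aug c # v) h f)) =
    sw H S g (%c e. L (x # w) e (%v. sw H S h (%a b. L v b (%v. f (adj H a (aug c) # v)))))"
    by (simp add: lie_form.simps(2)[where x="aug _"])
  also have "\<dots> = sw H S g (%c e. sw H S h (%a b. L (x # w) e (%v. L v b (%v. f (adj H a (aug c) # v)))))"
    by (intro sw_cong L_sw) simp_all
  also have "\<dots> = sw H S g (%c e. sw H S h (%a b. ?G (adj H a c) (e \<otimes>\<^bsub>H\<^esub> b)))"
    by (intro sw_cong) (simp_all add: L_L adj_aug)
  also have "\<dots> = T1" unfolding T1_def by (intro sw_K_swap) simp_all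
  finally have l1: "sw H S g (%c e. L (x # w) e (%v. L (aug c # v) h f)) = T1" .
  have "I w g (%v. L (x # v) h f) = I w g (%v. sw H S h (%a b. L v b (%v. f (adj H a x # v))))"
    by (simp add: lie_form.simps(2))
  also have "\<dots> = sw H S h (%a b. I w g (%v. L v b (%v. f (adj H a x # v))))"
    by (intro I_sw) simp_all
  also have "\<dots> = T2" unfolding T2_def by (intro sw_cong Cons.IH) simp_all
  finally have l2: "I w g (%v. L (x # v) h f) = T2" .
  have "L (x # w) a (%v. I v k f) = sw H S k (%p q. ?G p (a \<otimes>\<^bsub>H\<^esub> q)) \<ominus>\<^bsub>K\<^esub> sw H S a (%c e. L w e (%v. I v k (%v. f (adj H c x # v))))"
    if [simp]: "a \<in> carrier H" "k \<in> carrier H" for a k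
  proof -
    have "L (x # w) a (%v. I v k f) = sw H S a (%c e. L w e (%v. sw H S k (%p q. L (adj H c x # v) q (%v. f (aug p # v))) \<ominus>\<^bsub>K\<^esub> I v k (%v. f (adj H c x # v))))"
      by (simp add: lie_form.simps(2)[where x=x])
    also have "\<dots> = sw H S a (%c e. L w e (%v. sw H S k (%p q. L (adj H c x # v) q (%v. f (aug p # v)))) \<ominus>\<^bsub>K\<^esub> L w e (%v. I v k (%v. f (adj H c x # v))))"
      by (intro sw_cong L_minus) simp_all
    also have "\<dots> = sw H S a (%c e. L w e (%v. sw H S k (%p q. L (adj H c x # v) q (%v. f (aug p # v))))) \<ominus>\<^bsub>K\<^esub> sw H S a (%c e. L w e (%v. I v k (%v. f (adj H c x # v))))"
      by (intro sw_K_minus) simp_all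
    also have "sw H S a (%c e. L w e (%v. sw H S k (%p q. L (adj H c x # v) q (%v. f (aug p # v))))) =
      L (x # w) a (%v. sw H S k (%p q. L v q (%v. f (aug p # v))))"
      by (simp add: lie_form.simps(2)[where x=x])
    also have "\<dots> = sw H S k (%p q. L (x # w) a (%v. L v q (%v. f (aug p # v))))"
      by (intro L_sw) simp_all
    also have "\<dots> = sw H S k (%p q. ?G p (a \<otimes>\<^bsub>H\<^esub> q))"
      by (intro sw_cong L_L) simp_all
    finally show ?thesis .
  qed
  then have "sw H S h (%a b. L (x # w) a (%v. I v (adj H b g) f)) =
    sw H S h (%a b. sw H S (adj H b g) (%p q. ?G p (a \<otimes>\<^bsub>H\<^esub> q)) \<ominus>\<^bsub>K\<^esub> sw H S a (%c e. L w e (%v. I v (adj H b g) (%v. f (adj H c x # v)))))"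
    by (intro sw_cong) simp_all
  also have "\<dots> = sw H S h (%a b. sw H S (adj H b g) (%p q. ?G p (a \<otimes>\<^bsub>H\<^esub> q))) \<ominus>\<^bsub>K\<^esub>
      sw H S h (%a b. sw H S a (%c e. L w e (%v. I v (adj H b g) (%v. f (adj H c x # v)))))"
    by (intro sw_K_minus) simp_all
  also have "sw H S h (%a b. sw H S (adj H b g) (%p q. ?G p (a \<otimes>\<^bsub>H\<^esub> q))) = T1"
    unfolding T1_def by (rule adj_comult[OF S_module L_aug_bilinear]) simp_all
  also have "sw H S h (%a b. sw H S a (%c e. L w e (%v. I v (adj H b g) (%v. f (adj H c x # v))))) = T2"
    unfolding T2_def
    by (rule sw_coassoc[OF S_module])
      (auto intro!: L_linear_param L_linear I_linear_param linear_ml_head linear_adj_left linear_id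
        linear_maps_compose[OF I_linear])
  finally show ?case by (simp add: l1 l2)
qed

lemma iter_sweedler_words:
  "h \<in> carrier H ==> u \<in> set (iter_sweedler H n h) ==> u \<in> ws \<and> length u = Suc n"
proof (induction n arbitrary: h u)
  case (Suc n)
  then obtain v w where v: "v \<in> set (sweedler H h)" "w \<in> set (iter_sweedler H n (v ! 1))" "u = v ! 0 # w" by auto
  then show ?case using Suc.IH[of "v ! 1" w] sweedler_nth[OF Suc.prems(1) v(1)] by simp
qed simp

lemma map2_adj_words: "us \<in> ws ==> w \<in> ws ==> map2 (adj H) us w \<in> ws"
proof (induction us arbitrary: w rule: list.induct)
  case (Cons u us)
  then show ?case by (cases w) auto
qed simp

lemma lsum_iter_Suc:
  assumes "h \<in> carrier H" "\<And>a u. a \<in> carrier H ==> u \<in> ws ==> length u = Suc n ==> F (a # u) \<in> carrier K"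
  shows "lsum K (map F (iter_sweedler H (Suc n) h)) =
    sw H S h (%a b. lsum K (map (%u. F (a # u)) (iter_sweedler H n b)))"
proof -
  have "map F (iter_sweedler H (Suc n) h) =
    concat (map (%v. map (%u. F (v ! 0 # u)) (iter_sweedler H n (v ! 1))) (sweedler H h))"
    by (simp add: map_concat comp_def)
  also have "lsum K \<dots> = lsum K (map (%v. lsum K (map (%u. F (v ! 0 # u)) (iter_sweedler H n (v ! 1)))) (sweedler H h))"
  proof (rule R.lsum_concat)
    fix v assume v: "v \<in> set (sweedler H h)"
    note n = sweedler_nth[OF assms(1) v]
    show "set (map (%u. F (v ! 0 # u)) (iter_sweedler H n (v ! 1))) \<subseteq> carrier K"
      using assms(2)[OF n(1)] iter_sweedler_words[OF n(3)] by auto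
  qed
  finally show ?thesis by (simp add: sw_def)
qed

text \<open>The words of the iterated coproduct are built from the front, as is the recursion for $L_h$.\<close>

lemma lsum_iter_L:
  "w \<in> ws ==> w \<noteq> [] ==> ml f ==> h \<in> carrier H ==>
   lsum K (map (%u. f (map2 (adj H) u w)) (iter_sweedler H (length w - 1) h)) = L w h f"
proof (induction w arbitrary: f h rule: list.induct)
  case (Cons x w)
  have c: "x \<in> carrier H" "w \<in> ws" using Cons.prems(1) by simp_all
  show ?case
  proof (cases w)
    case Nil
    then show ?thesis using Cons.prems c L_single[of f h x] by (simp add: ml_closed)
  next
    case (Cons y w')
    have "lsum K (map (%u. f (map2 (adj H) u (x # w))) (iter_sweedler H (Suc (length w')) h)) =
      sw H S h (%a b. lsum K (map (%u. f (map2 (adj H) (a # u) (x # w))) (iter_sweedler H (length w') b)))"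
      by (rule lsum_iter_Suc[OF Cons.prems(4)])
        (use Cons.prems c in \<open>simp add: ml_closed map2_adj_words\<close>)
    also have "\<dots> = sw H S h (%a b. L w b (%v. f (adj H a x # v)))"
    proof (rule sw_cong[OF Cons.prems(4)])
      fix a b assume "a \<in> carrier H" "b \<in> carrier H"
      then show "lsum K (map (%u. f (map2 (adj H) (a # u) (x # w))) (iter_sweedler H (length w') b)) = L w b (%v. f (adj H a x # v))"
        using Cons.IH[of "%v. f (adj H a x # v)" b] Cons Cons.prems c by (simp add: ml_Cons)
    qed
    finally show ?thesis using Cons by simp
  qed
qed simp

lemma finsum_lessThan_Suc_shift:
  assumes "\<And>i. i \<le> n ==> g i \<in> carrier K"
  shows "finsum K g {..<Suc n} = g 0 \<oplus>\<^bsub>K\<^esub> (\<Oplus>\<^bsub>K\<^esub>i\<in>{..<n}. g (Suc i))"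
proof (cases n)
  case 0
  then show ?thesis using assms by (simp add: lessThan_Suc)
next
  case (Suc m)
  have "finsum K g {..Suc m} = (\<Oplus>\<^bsub>K\<^esub>i\<in>{..m}. g (Suc i)) \<oplus>\<^bsub>K\<^esub> g 0"
    using assms Suc by (intro R.finsum_Suc2) (auto simp: Pi_iff)
  moreover have "(\<Oplus>\<^bsub>K\<^esub>i\<in>{..m}. g (Suc i)) \<in> carrier K" using assms Suc by (intro R.finsum_closed) (auto simp: Pi_iff)
  ultimately show ?thesis using assms[of 0] Suc by (simp add: lessThan_Suc_atMost R.a_comm)
qed

lemma finsum_K_neg:
  assumes "\<And>i. i < n ==> g i \<in> carrier K"
  shows "(\<Oplus>\<^bsub>K\<^esub>i\<in>{..<(n::nat)}. \<ominus>\<^bsub>K\<^esub> g i) = \<ominus>\<^bsub>K\<^esub> (\<Oplus>\<^bsub>K\<^esub>i\<in>{..<n}. g i)"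
proof -
  have "a_inv K \<in> additive_maps K K" by (auto intro!: additive_mapsI simp: R.minus_add)
  moreover have "abelian_group K" by unfold_locales
  ultimately show ?thesis using assms by (intro additive_finsum[symmetric]) auto
qed

definition op_term :: "'h \<Rightarrow> 'h list \<Rightarrow> ('h list \<Rightarrow> 'k) \<Rightarrow> nat \<Rightarrow> 'k" where
  "op_term h w f p = gsign K p (lsum K (map (%u. f (take p w @ [aug (hd u)] @ map2 (adj H) (tl u) (drop p w))) (iter_sweedler H (length w - p) h)))"

lemma op_sum_closed:
  assumes "w \<in> ws" "ml f" "h \<in> carrier H"
  shows "lsum K (map (%u. f (take p w @ [aug (hd u)] @ map2 (adj H) (tl u) (drop p w))) (iter_sweedler H (length w - p) h)) \<in> carrier K"
proof (rule R.lsum_map_closed)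
  fix u assume u: "u \<in> set (iter_sweedler H (length w - p) h)"
  from iter_sweedler_words[OF assms(3) u] obtain a us where "u = a # us" "a \<in> carrier H" "us \<in> ws" by (cases u) auto
  then show "f (take p w @ [aug (hd u)] @ map2 (adj H) (tl u) (drop p w)) \<in> carrier K"
    using assms by (intro ml_closed) (auto simp: take_ws drop_ws map2_adj_words)
qed

lemma op_term_closed: "w \<in> ws ==> ml f ==> h \<in> carrier H ==> op_term h w f p \<in> carrier K"
  unfolding op_term_def by (intro R.gsign_closed op_sum_closed)

text \<open>The summand $p = 0$, with the new argument in front of the word, is the first term of the recursion.
  The other summands keep the first letter, and lowering \<open>p\<close> by one changes their signs.\<close>

lemma finsum_op_term:
  "w \<in> ws ==> ml f ==> h \<in> carrier H ==>
   finsum K (op_term h w f) {..<length w} \<oplus>\<^bsub>K\<^esub> gsign K (length w) (f (w @ [aug h])) = I w h f"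
proof (induction w arbitrary: f rule: list.induct)
  case Nil
  then show ?case by (simp add: ml_closed)
next
  case (Cons x w)
  have c: "x \<in> carrier H" "w \<in> ws" using Cons.prems(1) by simp_all
  note fx = ml_Cons[OF Cons.prems(2) c(1)]
  let ?T = "op_term h w (%v. f (x # v))"
  let ?e = "gsign K (length w) (f (x # w @ [aug h]))"
  have Tc: "?T p \<in> carrier K" for p by (rule op_term_closed[OF c(2) fx Cons.prems(3)])
  have ec: "?e \<in> carrier K" using Cons.prems c by (simp add: ml_closed)
  have "op_term h (x # w) f 0 = sw H S h (%a b. L (x # w) b (%v. f (aug a # v)))"
  proof -
    have "op_term h (x # w) f 0 = lsum K (map (%u. f (aug (hd u) # map2 (adj H) (tl u) (x # w))) (iter_sweedler H (Suc (length w)) h))"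
      using op_term_closed[OF Cons.prems, of 0] by (simp add: op_term_def R.gsign_0 del: iter_sweedler.simps)
    also have "\<dots> = sw H S h (%a b. lsum K (map (%u. f (aug a # map2 (adj H) u (x # w))) (iter_sweedler H (length w) b)))"
      by (subst lsum_iter_Suc) (use Cons.prems in \<open>simp_all add: ml_closed map2_adj_words\<close>)
    also have "\<dots> = sw H S h (%a b. L (x # w) b (%v. f (aug a # v)))"
    proof (rule sw_cong[OF Cons.prems(3)])
      fix a b assume "a \<in> carrier H" "b \<in> carrier H"
      then show "lsum K (map (%u. f (aug a # map2 (adj H) u (x # w))) (iter_sweedler H (length w) b)) = L (x # w) b (%v. f (aug a # v))"
        using lsum_iter_L[of "x # w" "%v. f (aug a # v)" b] Cons.prems by (simp add: ml_Cons del: lie_form.simps)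
    qed
    finally show ?thesis .
  qed
  moreover have "op_term h (x # w) f (Suc p) = \<ominus>\<^bsub>K\<^esub> ?T p" for p
  proof -
    have "lsum K (map (%u. f (x # take p w @ [aug (hd u)] @ map2 (adj H) (tl u) (drop p w))) (iter_sweedler H (length w - p) h)) \<in> carrier K"
      using op_sum_closed[OF c(2) fx Cons.prems(3), of p] by simp
    then show ?thesis by (simp add: op_term_def R.gsign_Suc)
  qed
  moreover have "finsum K (op_term h (x # w) f) {..<Suc (length w)} =
    op_term h (x # w) f 0 \<oplus>\<^bsub>K\<^esub> (\<Oplus>\<^bsub>K\<^esub>p\<in>{..<length w}. op_term h (x # w) f (Suc p))"
    by (rule finsum_lessThan_Suc_shift) (rule op_term_closed[OF Cons.prems])
  moreover have "gsign K (Suc (length w)) (f (x # w @ [aug h])) = \<ominus>\<^bsub>K\<^esub> ?e"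
    using Cons.prems c by (simp add: R.gsign_Suc ml_closed)
  moreover have "finsum K ?T {..<length w} \<in> carrier K" using Tc by (intro R.finsum_closed) auto
  moreover have "finsum K ?T {..<length w} \<oplus>\<^bsub>K\<^esub> ?e = I w h (%v. f (x # v))"
    using Cons.IH[OF c(2) fx Cons.prems(3)] by simp
  moreover have "sw H S h (%a b. L (x # w) b (%v. f (aug a # v))) \<in> carrier K"
    using Cons.prems by (intro sw_K_closed L_closed) (auto simp: ml_closed)
  ultimately show ?case
    using Tc ec by (simp add: finsum_K_neg a_minus_def R.minus_add R.a_assoc del: lie_form.simps flip: \<open>finsum K ?T {..<length w} \<oplus>\<^bsub>K\<^esub> ?e = I w h (%v. f (x # v))\<close>)
qed

lemma forms_lie_eq: "h \<in> carrier H ==> ml f ==> forms_lie K H h f = (\<lambda>w\<in>ws. L w h f)"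
  unfolding forms_lie_def by (rule restrict_ext) (auto simp: lsum_iter_L[symmetric])

lemma forms_op_eq: "h \<in> carrier H ==> ml f ==> forms_op K H h f = (\<lambda>w\<in>ws. I w h f)"
  unfolding forms_op_def
  by (rule restrict_ext) (simp add: finsum_op_term[symmetric] op_term_def[abs_def] augment_def)

abbreviation "Lop \<equiv> forms_lie K H"
abbreviation "Iop \<equiv> forms_op K H"

lemma Lop_closed [simp]:
  assumes "h \<in> carrier H" "f \<in> carrier C"
  shows "Lop h f \<in> carrier C"
proof -
  obtain N where N: "\<forall>w\<in>ws. length w \<ge> N \<longrightarrow> f w = \<zero>\<^bsub>K\<^esub>" using assms by (auto simp: C_carrier bounded_form_def)
  have "bounded_form (%w. L w h f)"
    unfolding bounded_form_def using N assms by (intro exI[of _ N]) (auto intro!: L_vanish)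
  then show ?thesis using assms by (auto simp: forms_lie_eq C_ml ml_L intro!: C_closedI)
qed

lemma Iop_closed [simp]:
  assumes "h \<in> carrier H" "f \<in> carrier C"
  shows "Iop h f \<in> carrier C"
proof -
  obtain N where N: "\<forall>w\<in>ws. length w \<ge> N \<longrightarrow> f w = \<zero>\<^bsub>K\<^esub>" using assms by (auto simp: C_carrier bounded_form_def)
  have "bounded_form (%w. I w h f)"
    unfolding bounded_form_def using N assms by (intro exI[of _ N]) (auto intro!: I_vanish)
  then show ?thesis using assms by (auto simp: forms_op_eq C_ml ml_I intro!: C_closedI)
qed

lemma Lop_apply: "h \<in> carrier H ==> f \<in> carrier C ==> w \<in> ws ==> Lop h f w = L w h f"
  by (simp add: forms_lie_eq C_ml)

lemma Iop_apply: "h \<in> carrier H ==> f \<in> carrier C ==> w \<in> ws ==> Iop h f w = I w h f"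
  by (simp add: forms_op_eq C_ml)

lemma C_add_apply: "w \<in> ws ==> (f \<oplus>\<^bsub>C\<^esub> g) w = f w \<oplus>\<^bsub>K\<^esub> g w"
  and C_smult_apply: "w \<in> ws ==> (k \<odot>\<^bsub>C\<^esub> f) w = k \<otimes>\<^bsub>K\<^esub> f w"
  and C_zero_apply: "w \<in> ws ==> \<zero>\<^bsub>C\<^esub> w = \<zero>\<^bsub>K\<^esub>"
  by (simp_all add: C_simps)

lemma C_mult_apply: "f \<in> carrier C ==> g \<in> carrier C ==> w \<in> ws ==> (f \<otimes>\<^bsub>C\<^esub> g) w = mul w f g"
  by (simp add: C_mult)

lemma C_sw_apply:
  assumes "h \<in> carrier H" "\<And>a b. a \<in> carrier H ==> b \<in> carrier H ==> F a b \<in> carrier C" "w \<in> ws"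
  shows "sw H C h F w = sw H S h (%a b. F a b w)"
proof -
  have "(%f. f w) \<in> additive_maps C S"
    using assms(3) by (intro additive_mapsI) (auto simp: C_add_apply ml_closed C_ml)
  from sw_hom[OF C_group S_group this assms(1,2)] show ?thesis .
qed

lemma C_eq: "f \<in> carrier C ==> g \<in> carrier C ==> (\<And>w. w \<in> ws ==> f w = g w) ==> f = g"
  by (rule C_eqI) (auto simp: C_ext)

lemma Lop_linear: "h \<in> carrier H ==> Lop h \<in> linear_maps K C C"
proof (rule linear_mapsI)
  fix f g assume *: "h \<in> carrier H" "f \<in> carrier C" "g \<in> carrier C"
  show "Lop h (f \<oplus>\<^bsub>C\<^esub> g) = Lop h f \<oplus>\<^bsub>C\<^esub> Lop h g"
  proof (rule C_eq)
    fix w assume w: "w \<in> ws"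
    have "Lop h (f \<oplus>\<^bsub>C\<^esub> g) w = L w h (%v. f v \<oplus>\<^bsub>K\<^esub> g v)"
      using * w by (simp add: Lop_apply C_add_closed) (intro L_cong, auto simp: C_add_apply)
    then show "Lop h (f \<oplus>\<^bsub>C\<^esub> g) w = (Lop h f \<oplus>\<^bsub>C\<^esub> Lop h g) w"
      using * w by (simp add: C_add_apply Lop_apply L_add ml_closed C_ml)
  qed (use * in \<open>auto simp: C_add_closed\<close>)
next
  fix k f assume *: "h \<in> carrier H" "k \<in> carrier K" "f \<in> carrier C"
  show "Lop h (k \<odot>\<^bsub>C\<^esub> f) = k \<odot>\<^bsub>C\<^esub> Lop h f"
  proof (rule C_eq)
    fix w assume w: "w \<in> ws"
    have "Lop h (k \<odot>\<^bsub>C\<^esub> f) w = L w h (%v. k \<otimes>\<^bsub>K\<^esub> f v)"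
      using * w by (simp add: Lop_apply C_smult_closed) (intro L_cong, auto simp: C_smult_apply)
    then show "Lop h (k \<odot>\<^bsub>C\<^esub> f) w = (k \<odot>\<^bsub>C\<^esub> Lop h f) w"
      using * w by (simp add: C_smult_apply Lop_apply L_smult ml_closed C_ml)
  qed (use * in \<open>auto simp: C_smult_closed\<close>)
qed simp

lemma Iop_linear: "h \<in> carrier H ==> Iop h \<in> linear_maps K C C"
proof (rule linear_mapsI)
  fix f g assume *: "h \<in> carrier H" "f \<in> carrier C" "g \<in> carrier C"
  show "Iop h (f \<oplus>\<^bsub>C\<^esub> g) = Iop h f \<oplus>\<^bsub>C\<^esub> Iop h g"
  proof (rule C_eq)
    fix w assume w: "w \<in> ws"
    have "Iop h (f \<oplus>\<^bsub>C\<^esub> g) w = I w h (%v. f v \<oplus>\<^bsub>K\<^esub> g v)"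
      using * w by (simp add: Iop_apply C_add_closed) (intro I_cong, auto simp: C_add_apply)
    then show "Iop h (f \<oplus>\<^bsub>C\<^esub> g) w = (Iop h f \<oplus>\<^bsub>C\<^esub> Iop h g) w"
      using * w by (simp add: C_add_apply Iop_apply I_add ml_closed C_ml)
  qed (use * in \<open>auto simp: C_add_closed\<close>)
next
  fix k f assume *: "h \<in> carrier H" "k \<in> carrier K" "f \<in> carrier C"
  show "Iop h (k \<odot>\<^bsub>C\<^esub> f) = k \<odot>\<^bsub>C\<^esub> Iop h f"
  proof (rule C_eq)
    fix w assume w: "w \<in> ws"
    have "Iop h (k \<odot>\<^bsub>C\<^esub> f) w = I w h (%v. k \<otimes>\<^bsub>K\<^esub> f v)"
      using * w by (simp add: Iop_apply C_smult_closed) (intro I_cong, auto simp: C_smult_apply)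
    then show "Iop h (k \<odot>\<^bsub>C\<^esub> f) w = (k \<odot>\<^bsub>C\<^esub> Iop h f) w"
      using * w by (simp add: C_smult_apply Iop_apply I_smult ml_closed C_ml)
  qed (use * in \<open>auto simp: C_smult_closed\<close>)
qed simp

lemma Lop_linear_hopf: "f \<in> carrier C ==> (%h. Lop h f) \<in> linear_maps K H C"
proof (rule linear_mapsI)
  fix h g assume *: "f \<in> carrier C" "h \<in> carrier H" "g \<in> carrier H"
  show "Lop (h \<oplus>\<^bsub>H\<^esub> g) f = Lop h f \<oplus>\<^bsub>C\<^esub> Lop g f"
    using * linear_add[OF L_linear[OF _ C_ml[OF *(1)]]]
    by (intro C_eq) (auto simp: C_add_apply Lop_apply C_add_closed)
next
  fix k h assume *: "f \<in> carrier C" "k \<in> carrier K" "h \<in> carrier H"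
  show "Lop (k \<odot>\<^bsub>H\<^esub> h) f = k \<odot>\<^bsub>C\<^esub> Lop h f"
    using * linear_smult[OF L_linear[OF _ C_ml[OF *(1)]]]
    by (intro C_eq) (auto simp: C_smult_apply Lop_apply C_smult_closed)
qed simp

lemma Iop_linear_hopf: "f \<in> carrier C ==> (%h. Iop h f) \<in> linear_maps K H C"
proof (rule linear_mapsI)
  fix h g assume *: "f \<in> carrier C" "h \<in> carrier H" "g \<in> carrier H"
  show "Iop (h \<oplus>\<^bsub>H\<^esub> g) f = Iop h f \<oplus>\<^bsub>C\<^esub> Iop g f"
    using * linear_add[OF I_linear[OF _ C_ml[OF *(1)]]]
    by (intro C_eq) (auto simp: C_add_apply Iop_apply C_add_closed)
next
  fix k h assume *: "f \<in> carrier C" "k \<in> carrier K" "h \<in> carrier H"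
  show "Iop (k \<odot>\<^bsub>H\<^esub> h) f = k \<odot>\<^bsub>C\<^esub> Iop h f"
    using * linear_smult[OF I_linear[OF _ C_ml[OF *(1)]]]
    by (intro C_eq) (auto simp: C_smult_apply Iop_apply C_smult_closed)
qed simp

lemma Lop_mult:
  assumes "h \<in> carrier H" "f \<in> carrier C" "g \<in> carrier C"
  shows "Lop h (f \<otimes>\<^bsub>C\<^esub> g) = sw H C h (%a b. Lop a f \<otimes>\<^bsub>C\<^esub> Lop b g)"
proof (rule C_eq)
  fix w assume w: "w \<in> ws"
  have "Lop h (f \<otimes>\<^bsub>C\<^esub> g) w = L w h (%v. mul v f g)"
    using assms w by (simp add: Lop_apply C_mult_closed) (intro L_cong, auto simp: C_mult_apply)
  also have "\<dots> = sw H S h (%a b. mul w (%v. L v a f) (%v. L v b g))"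
    using assms w by (intro L_mult) (auto simp: C_ml)
  also have "\<dots> = sw H S h (%a b. (Lop a f \<otimes>\<^bsub>C\<^esub> Lop b g) w)"
    using assms w by (intro sw_cong) (auto simp: C_mult_apply Lop_apply intro!: form_mult_cong)
  finally show "Lop h (f \<otimes>\<^bsub>C\<^esub> g) w = sw H C h (%a b. Lop a f \<otimes>\<^bsub>C\<^esub> Lop b g) w"
    using assms w by (simp add: C_sw_apply C_mult_closed)
qed (use assms in \<open>auto intro!: sw_closed C_group simp: C_mult_closed\<close>)

lemma Iop_mult:
  assumes "h \<in> carrier H" "f \<in> carrier C" "g \<in> carrier C"
  shows "Iop h (f \<otimes>\<^bsub>C\<^esub> g) = sw H C h (%a b. Iop a f \<otimes>\<^bsub>C\<^esub> Lop b g) \<oplus>\<^bsub>C\<^esub> parity C f \<otimes>\<^bsub>C\<^esub> Iop h g"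
proof -
  interpret Cg: graded_algebra K C by (rule C_graded)
  have swc: "sw H C h (%a b. Iop a f \<otimes>\<^bsub>C\<^esub> Lop b g) \<in> carrier C"
    using assms by (auto intro!: sw_closed C_group simp: C_mult_closed)
  show ?thesis
  proof (rule C_eq)
    fix w assume w: "w \<in> ws"
    have "Iop h (f \<otimes>\<^bsub>C\<^esub> g) w = I w h (%v. mul v f g)"
      using assms w by (simp add: Iop_apply C_mult_closed) (intro I_cong, auto simp: C_mult_apply)
    also have "\<dots> = sw H S h (%a b. mul w (%v. I v a f) (%v. L v b g)) \<oplus>\<^bsub>K\<^esub> mul w (sgn f) (%v. I v h g)"
      using assms w by (intro I_mult) (auto simp: C_ml)
    also have "sw H S h (%a b. mul w (%v. I v a f) (%v. L v b g)) = sw H S h (%a b. (Iop a f \<otimes>\<^bsub>C\<^esub> Lop b g) w)"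
      using assms w by (intro sw_cong) (auto simp: C_mult_apply Lop_apply Iop_apply intro!: form_mult_cong)
    also have "mul w (sgn f) (%v. I v h g) = (parity C f \<otimes>\<^bsub>C\<^esub> Iop h g) w"
      using assms w C_parity[OF assms(2)] by (auto simp: C_mult_apply Iop_apply sgn_def intro!: form_mult_cong)
    finally show "Iop h (f \<otimes>\<^bsub>C\<^esub> g) w = (sw H C h (%a b. Iop a f \<otimes>\<^bsub>C\<^esub> Lop b g) \<oplus>\<^bsub>C\<^esub> parity C f \<otimes>\<^bsub>C\<^esub> Iop h g) w"
      using assms w by (simp add: C_sw_apply C_mult_closed C_add_apply)
  qed (use assms swc in \<open>auto simp: C_mult_closed C_add_closed\<close>)
qed

lemma Lop_Lop:
  assumes "h \<in> carrier H" "g \<in> carrier H" "f \<in> carrier C"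
  shows "Lop h (Lop g f) = Lop (h \<otimes>\<^bsub>H\<^esub> g) f"
proof (rule C_eq)
  fix w assume w: "w \<in> ws"
  have "Lop h (Lop g f) w = L w h (%v. L v g f)"
    using assms w by (simp add: Lop_apply) (intro L_cong, auto simp: Lop_apply)
  then show "Lop h (Lop g f) w = Lop (h \<otimes>\<^bsub>H\<^esub> g) f w" using assms w by (simp add: L_L C_ml Lop_apply)
qed (use assms in auto)

lemma Iop_Lop:
  assumes "h \<in> carrier H" "g \<in> carrier H" "f \<in> carrier C"
  shows "Iop g (Lop h f) = sw H C h (%a b. Lop a (Iop (adj H b g) f))"
proof (rule C_eq)
  fix w assume w: "w \<in> ws"
  have "Iop g (Lop h f) w = I w g (%v. L v h f)"
    using assms w by (simp add: Iop_apply) (intro I_cong, auto simp: Lop_apply)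
  also have "\<dots> = sw H S h (%a b. L w a (%v. I v (adj H b g) f))"
    using assms w by (intro I_L) (auto simp: C_ml)
  also have "\<dots> = sw H S h (%a b. Lop a (Iop (adj H b g) f) w)"
    using assms w by (intro sw_cong) (auto simp: Lop_apply Iop_apply intro!: L_cong)
  finally show "Iop g (Lop h f) w = sw H C h (%a b. Lop a (Iop (adj H b g) f)) w"
    using assms w by (simp add: C_sw_apply)
qed (use assms in \<open>auto intro!: sw_closed C_group\<close>)

lemma Lop_one: "f \<in> carrier C ==> Lop \<one>\<^bsub>H\<^esub> f = f"
  by (rule C_eq) (auto simp: Lop_apply L_one C_ml)

lemma Iop_one: "f \<in> carrier C ==> Iop \<one>\<^bsub>H\<^esub> f = \<zero>\<^bsub>C\<^esub>"
  by (rule C_eq) (simp_all add: Iop_apply I_one C_ml C_zero_closed C_zero_apply)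

lemma Lop_gr: "h \<in> carrier H ==> f \<in> gr C n ==> Lop h f \<in> gr C n"
  by (auto simp: C_gr Lop_apply intro!: L_vanish)

lemma Iop_gr: "h \<in> carrier H ==> f \<in> gr C (Suc n) ==> Iop h f \<in> gr C n"
  by (auto simp: C_gr Iop_apply intro!: I_vanish)

lemma Iop_gr_0: "h \<in> carrier H ==> f \<in> gr C 0 ==> Iop h f = \<zero>\<^bsub>C\<^esub>"
  by (rule C_eq) (auto simp: C_gr Iop_apply C_zero_closed C_zero_apply intro!: I_vanish)

lemma gsign_K_eq: "x \<in> carrier K ==> gsign K n x = gsign K n \<one>\<^bsub>K\<^esub> \<otimes>\<^bsub>K\<^esub> x"
  by (simp add: gsign_def R.l_minus)

lemma Lop_parity:
  assumes "h \<in> carrier H" "f \<in> carrier C"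
  shows "Lop h (parity C f) = parity C (Lop h f)"
proof -
  interpret Cg: graded_algebra K C by (rule C_graded)
  show ?thesis
  proof (rule C_eq)
    fix w assume w: "w \<in> ws"
    have "Lop h (parity C f) w = L w h (%v. gsign K (length w) \<one>\<^bsub>K\<^esub> \<otimes>\<^bsub>K\<^esub> f v)"
      using assms w C_parity[OF assms(2)]
      by (simp add: Lop_apply, intro L_cong) (auto simp: gsign_K_eq[symmetric] ml_closed C_ml)
    also have "\<dots> = gsign K (length w) (L w h f)"
      using assms w by (simp add: L_smult ml_closed C_ml gsign_K_eq[symmetric] L_closed)
    finally show "Lop h (parity C f) w = parity C (Lop h f) w"
      using assms w C_parity[of "Lop h f"] by (simp add: Lop_apply)
  qed (use assms in auto)
qed

lemma Iop_parity:
  assumes "h \<in> carrier H" "f \<in> carrier C"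
  shows "Iop h (parity C f) = \<ominus>\<^bsub>C\<^esub> parity C (Iop h f)"
proof -
  interpret Cg: graded_algebra K C by (rule C_graded)
  have "Iop h (parity C f) \<oplus>\<^bsub>C\<^esub> parity C (Iop h f) = \<zero>\<^bsub>C\<^esub>"
  proof (rule C_eq)
    fix w assume w: "w \<in> ws"
    have "Iop h (parity C f) w = I w h (%v. gsign K (Suc (length w)) \<one>\<^bsub>K\<^esub> \<otimes>\<^bsub>K\<^esub> f v)"
      using assms w C_parity[OF assms(2)]
      by (simp add: Iop_apply, intro I_cong) (auto simp: gsign_K_eq[symmetric] ml_closed C_ml)
    also have "\<dots> = gsign K (Suc (length w)) (I w h f)"
      using assms w by (simp add: I_smult ml_closed C_ml gsign_K_eq[of "I w h f"] I_closed)
    also have "\<dots> = \<ominus>\<^bsub>K\<^esub> gsign K (length w) (I w h f)"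
      using assms w by (simp add: R.gsign_Suc I_closed ml_closed C_ml)
    finally show "(Iop h (parity C f) \<oplus>\<^bsub>C\<^esub> parity C (Iop h f)) w = \<zero>\<^bsub>C\<^esub> w"
      using assms w C_parity[of "Iop h f"]
      by (simp add: C_add_apply Iop_apply I_closed ml_closed C_ml R.l_neg) (simp add: C_simps)
  qed (use assms in \<open>auto simp: C_add_closed C_zero_closed\<close>)
  then show ?thesis using assms by (simp add: Cg.minus_equality)
qed

section \<open>Convolution\<close>

text \<open>Linear maps from \<open>H\<close> to an algebra under the convolution product. A family of maps
  $L_h$ with $L_h(xy) = \sum L_{h^{(1)}}(x)L_{h^{(2)}}(y)$ is a homomorphism $x \mapsto (h \mapsto L_h x)$ into this
  ring, which is how the twisted Leibniz rules become multiplicativity.\<close>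

definition conv :: "('k, 'b, 'n) module_scheme \<Rightarrow> ('h \<Rightarrow> 'b) ring" where
  "conv B = \<lparr>
     carrier = {\<phi> \<in> extensional (carrier H). \<phi> \<in> linear_maps K H B},
     mult = (%\<phi> \<psi>. \<lambda>h\<in>carrier H. sw H B h (%a b. \<phi> a \<otimes>\<^bsub>B\<^esub> \<psi> b)),
     one = (\<lambda>h\<in>carrier H. counit H h \<odot>\<^bsub>B\<^esub> \<one>\<^bsub>B\<^esub>),
     zero = (\<lambda>h\<in>carrier H. \<zero>\<^bsub>B\<^esub>),
     add = (%\<phi> \<psi>. \<lambda>h\<in>carrier H. \<phi> h \<oplus>\<^bsub>B\<^esub> \<psi> h)\<rparr>"

lemma conv_simps:
  "carrier (conv B) = {\<phi> \<in> extensional (carrier H). \<phi> \<in> linear_maps K H B}"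
  "\<phi> \<otimes>\<^bsub>conv B\<^esub> \<psi> = (\<lambda>h\<in>carrier H. sw H B h (%a b. \<phi> a \<otimes>\<^bsub>B\<^esub> \<psi> b))"
  "\<one>\<^bsub>conv B\<^esub> = (\<lambda>h\<in>carrier H. counit H h \<odot>\<^bsub>B\<^esub> \<one>\<^bsub>B\<^esub>)"
  "\<zero>\<^bsub>conv B\<^esub> = (\<lambda>h\<in>carrier H. \<zero>\<^bsub>B\<^esub>)"
  "\<phi> \<oplus>\<^bsub>conv B\<^esub> \<psi> = (\<lambda>h\<in>carrier H. \<phi> h \<oplus>\<^bsub>B\<^esub> \<psi> h)"
  by (simp_all add: conv_def)

lemma linear_restrict: "f \<in> linear_maps K H B ==> restrict f (carrier H) \<in> linear_maps K H B"
  by (rule linear_cong[OF H_module, of _ f]) auto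

lemma conv_eqI: "\<phi> \<in> extensional (carrier H) ==> \<psi> \<in> extensional (carrier H) ==>
  (\<And>h. h \<in> carrier H ==> \<phi> h = \<psi> h) ==> \<phi> = \<psi>"
  by (rule extensionalityI)

lemma conv_ring:
  assumes "assoc_algebra K B"
  shows "ring (conv B)"
proof -
  interpret B: assoc_algebra K B by fact
  have BG: "abelian_group B" and BM: "module K B" and BR: "ring B" by unfold_locales
  have bil: "(%a b. \<phi> a \<otimes>\<^bsub>B\<^esub> \<psi> b) \<in> bilinear_maps K H H B" if "\<phi> \<in> linear_maps K H B" "\<psi> \<in> linear_maps K H B" for \<phi> \<psi>
    using that by (auto intro!: bilinear_mapsI B.linear_mult_left B.linear_mult_right intro: linear_closed)
  note lc = linear_closed[where M=H and N=B and K=K]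
  have one: "(%h. counit H h \<odot>\<^bsub>B\<^esub> \<one>\<^bsub>B\<^esub>) \<in> linear_maps K H B"
    by (intro linear_maps_smult_left[OF BM] counit_linear) simp
  have mult_closed: "(\<lambda>h\<in>carrier H. sw H B h (%a b. \<phi> a \<otimes>\<^bsub>B\<^esub> \<psi> b)) \<in> linear_maps K H B"
    if "\<phi> \<in> linear_maps K H B" "\<psi> \<in> linear_maps K H B" for \<phi> \<psi>
    by (rule linear_restrict, rule sw_linear[OF BM bil[OF that]])
  have grp: "abelian_group (conv B)"
  proof (rule abelian_groupI)
    fix \<phi> assume p: "\<phi> \<in> carrier (conv B)"
    show "\<zero>\<^bsub>conv B\<^esub> \<oplus>\<^bsub>conv B\<^esub> \<phi> = \<phi>"
      by (rule conv_eqI) (use p lc in \<open>auto simp: conv_simps\<close>)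
    show "\<exists>\<psi>\<in>carrier (conv B). \<psi> \<oplus>\<^bsub>conv B\<^esub> \<phi> = \<zero>\<^bsub>conv B\<^esub>"
      using p by (intro bexI[of _ "\<lambda>h\<in>carrier H. \<ominus>\<^bsub>B\<^esub> \<phi> h"])
        (auto simp: conv_simps B.l_neg linear_restrict linear_maps_neg[OF BM] lc intro!: conv_eqI)
  qed (auto simp: conv_simps B.a_ac lc linear_restrict linear_maps_add[OF BM] intro!: conv_eqI linear_mapsI)
  show ?thesis
  proof (rule ringI[OF grp])
    show "monoid (conv B)"
    proof (rule monoidI)
      fix \<phi> \<psi> \<chi> assume p: "\<phi> \<in> carrier (conv B)" "\<psi> \<in> carrier (conv B)" "\<chi> \<in> carrier (conv B)"
      then have l: "\<phi> \<in> linear_maps K H B" "\<psi> \<in> linear_maps K H B" "\<chi> \<in> linear_maps K H B" by (auto simp: conv_simps)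
      show "\<phi> \<otimes>\<^bsub>conv B\<^esub> \<psi> \<otimes>\<^bsub>conv B\<^esub> \<chi> = \<phi> \<otimes>\<^bsub>conv B\<^esub> (\<psi> \<otimes>\<^bsub>conv B\<^esub> \<chi>)"
      proof (rule conv_eqI)
        fix h assume h: "h \<in> carrier H"
        have "(\<phi> \<otimes>\<^bsub>conv B\<^esub> \<psi> \<otimes>\<^bsub>conv B\<^esub> \<chi>) h = sw H B h (%a b. sw H B a (%c e. \<phi> c \<otimes>\<^bsub>B\<^esub> (\<psi> e \<otimes>\<^bsub>B\<^esub> \<chi> b)))"
          using h l lc by (auto simp: conv_simps sw_mult_right[OF BR] B.m_assoc intro!: sw_cong)
        also have "\<dots> = sw H B h (%a b. sw H B b (%c e. \<phi> a \<otimes>\<^bsub>B\<^esub> (\<psi> c \<otimes>\<^bsub>B\<^esub> \<chi> e)))"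
          using l lc by (intro sw_coassoc[OF BM h] B.linear_mult_left B.linear_mult_right) auto
        also have "\<dots> = (\<phi> \<otimes>\<^bsub>conv B\<^esub> (\<psi> \<otimes>\<^bsub>conv B\<^esub> \<chi>)) h"
          using h l lc by (auto simp: conv_simps sw_mult_left[OF BR] intro!: sw_cong)
        finally show "(\<phi> \<otimes>\<^bsub>conv B\<^esub> \<psi> \<otimes>\<^bsub>conv B\<^esub> \<chi>) h = (\<phi> \<otimes>\<^bsub>conv B\<^esub> (\<psi> \<otimes>\<^bsub>conv B\<^esub> \<chi>)) h" .
      qed (auto simp: conv_simps)
    next
      fix \<phi> assume p: "\<phi> \<in> carrier (conv B)"
      then have l: "\<phi> \<in> linear_maps K H B" by (auto simp: conv_simps)
      show "\<one>\<^bsub>conv B\<^esub> \<otimes>\<^bsub>conv B\<^esub> \<phi> = \<phi>"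
      proof (rule conv_eqI)
        fix h assume h: "h \<in> carrier H"
        have "(\<one>\<^bsub>conv B\<^esub> \<otimes>\<^bsub>conv B\<^esub> \<phi>) h = sw H B h (%a b. counit H a \<odot>\<^bsub>B\<^esub> \<phi> b)"
          using h l lc by (auto simp: conv_simps B.smult_mult_left intro!: sw_cong)
        then show "(\<one>\<^bsub>conv B\<^esub> \<otimes>\<^bsub>conv B\<^esub> \<phi>) h = \<phi> h" using sw_counit_left[OF BM l h] by simp
      qed (use p in \<open>auto simp: conv_simps\<close>)
      show "\<phi> \<otimes>\<^bsub>conv B\<^esub> \<one>\<^bsub>conv B\<^esub> = \<phi>"
      proof (rule conv_eqI)
        fix h assume h: "h \<in> carrier H"
        have "(\<phi> \<otimes>\<^bsub>conv B\<^esub> \<one>\<^bsub>conv B\<^esub>) h = sw H B h (%a b. counit H b \<odot>\<^bsub>B\<^esub> \<phi> a)"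
          using h l lc by (auto simp: conv_simps B.smult_mult_right intro!: sw_cong)
        then show "(\<phi> \<otimes>\<^bsub>conv B\<^esub> \<one>\<^bsub>conv B\<^esub>) h = \<phi> h" using sw_counit_right[OF BM l h] by simp
      qed (use p in \<open>auto simp: conv_simps\<close>)
    qed (auto simp: conv_simps linear_restrict one mult_closed)
  next
    fix \<phi> \<psi> \<chi> assume p: "\<phi> \<in> carrier (conv B)" "\<psi> \<in> carrier (conv B)" "\<chi> \<in> carrier (conv B)"
    then have l: "\<phi> \<in> linear_maps K H B" "\<psi> \<in> linear_maps K H B" "\<chi> \<in> linear_maps K H B" by (auto simp: conv_simps)
    show "(\<phi> \<oplus>\<^bsub>conv B\<^esub> \<psi>) \<otimes>\<^bsub>conv B\<^esub> \<chi> = \<phi> \<otimes>\<^bsub>conv B\<^esub> \<chi> \<oplus>\<^bsub>conv B\<^esub> \<psi> \<otimes>\<^bsub>conv B\<^esub> \<chi>"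
    proof (rule conv_eqI)
      fix h assume h: "h \<in> carrier H"
      have "((\<phi> \<oplus>\<^bsub>conv B\<^esub> \<psi>) \<otimes>\<^bsub>conv B\<^esub> \<chi>) h = sw H B h (%a b. \<phi> a \<otimes>\<^bsub>B\<^esub> \<chi> b \<oplus>\<^bsub>B\<^esub> \<psi> a \<otimes>\<^bsub>B\<^esub> \<chi> b)"
        using h l lc by (auto simp: conv_simps B.l_distr intro!: sw_cong)
      then show "((\<phi> \<oplus>\<^bsub>conv B\<^esub> \<psi>) \<otimes>\<^bsub>conv B\<^esub> \<chi>) h = (\<phi> \<otimes>\<^bsub>conv B\<^esub> \<chi> \<oplus>\<^bsub>conv B\<^esub> \<psi> \<otimes>\<^bsub>conv B\<^esub> \<chi>) h"
        using h l lc by (auto simp: conv_simps sw_add[OF BG])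
    qed (auto simp: conv_simps)
    show "\<chi> \<otimes>\<^bsub>conv B\<^esub> (\<phi> \<oplus>\<^bsub>conv B\<^esub> \<psi>) = \<chi> \<otimes>\<^bsub>conv B\<^esub> \<phi> \<oplus>\<^bsub>conv B\<^esub> \<chi> \<otimes>\<^bsub>conv B\<^esub> \<psi>"
    proof (rule conv_eqI)
      fix h assume h: "h \<in> carrier H"
      have "(\<chi> \<otimes>\<^bsub>conv B\<^esub> (\<phi> \<oplus>\<^bsub>conv B\<^esub> \<psi>)) h = sw H B h (%a b. \<chi> a \<otimes>\<^bsub>B\<^esub> \<phi> b \<oplus>\<^bsub>B\<^esub> \<chi> a \<otimes>\<^bsub>B\<^esub> \<psi> b)"
        using h l lc by (auto simp: conv_simps B.r_distr intro!: sw_cong)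
      then show "(\<chi> \<otimes>\<^bsub>conv B\<^esub> (\<phi> \<oplus>\<^bsub>conv B\<^esub> \<psi>)) h = (\<chi> \<otimes>\<^bsub>conv B\<^esub> \<phi> \<oplus>\<^bsub>conv B\<^esub> \<chi> \<otimes>\<^bsub>conv B\<^esub> \<psi>) h"
        using h l lc by (auto simp: conv_simps sw_add[OF BG])
    qed (auto simp: conv_simps)
  qed
qed

end

section \<open>The operation on the Weil algebra\<close>

lemma tri_group: "assoc_algebra K B ==> abelian_group (tri B)"
  using tri_algebra assoc_algebra.axioms(3) ring.is_abelian_group by blast

lemma tri_neg:
  assumes B: "assoc_algebra K B" and "u \<in> carrier B" "v \<in> carrier B" "w \<in> carrier B"
  shows "\<ominus>\<^bsub>tri B\<^esub> (u, v, w) = (\<ominus>\<^bsub>B\<^esub> u, \<ominus>\<^bsub>B\<^esub> v, \<ominus>\<^bsub>B\<^esub> w)"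
proof -
  interpret B: assoc_algebra K B by fact
  interpret T: abelian_group "tri B" using B by (rule tri_group)
  show ?thesis using assms(2-4) by (intro T.minus_equality) (auto simp: B.l_neg)
qed

lemma tri_linear:
  "f \<in> linear_maps K M B ==> g \<in> linear_maps K M B ==> h \<in> linear_maps K M B ==>
   (%x. (f x, g x, h x)) \<in> linear_maps K M (tri B)"
  by (rule linear_mapsI) (auto simp: linear_closed linear_add linear_smult)

text \<open>The operator $D(u, v, w) = (-du,\ w - \sigma u - dv,\ dw)$, where \<open>\<sigma>\<close> is the parity, is a
  differential on triangular matrices, graded with respect to \<open>\<Sigma>(u, v, w) = (\<sigma>u, -\<sigma>v, \<sigma>w)\<close>.
  For $(u, v, w) = (\varepsilon(h)\sigma x, i_h x, L_h x)$, commutation with \<open>D\<close> is the relation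
  $L_h = d i_h + i_h d + \varepsilon(h)$.\<close>

context graded_differential_algebra
begin

definition tri_d :: "'a \<times> 'a \<times> 'a \<Rightarrow> 'a \<times> 'a \<times> 'a" where
  "tri_d = (%(u, v, w). (\<ominus>\<^bsub>A\<^esub> d u, w \<oplus>\<^bsub>A\<^esub> \<ominus>\<^bsub>A\<^esub> parity A u \<oplus>\<^bsub>A\<^esub> \<ominus>\<^bsub>A\<^esub> d v, d w))"

definition tri_parity :: "'a \<times> 'a \<times> 'a \<Rightarrow> 'a \<times> 'a \<times> 'a" where
  "tri_parity = (%(u, v, w). (parity A u, \<ominus>\<^bsub>A\<^esub> parity A v, parity A w))"

lemma A_algebra: "assoc_algebra K A" by unfold_locales

lemma tri_d_additive: "tri_d \<in> additive_maps (tri A) (tri A)"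
  by (rule additive_mapsI) (auto simp: tri_d_def minus_add a_ac)

lemma tri_parity_additive: "tri_parity \<in> additive_maps (tri A) (tri A)"
  by (rule additive_mapsI) (auto simp: tri_parity_def minus_add)

lemma tri_d_linear: "tri_d \<in> linear_maps K (tri A) (tri A)"
  by (rule linear_mapsI)
    (auto simp: tri_d_def minus_add a_ac linear_smult[OF d_linear] smult_r_distr smult_r_minus)

lemma tri_d_closed [simp]: "x \<in> carrier (tri A) ==> tri_d x \<in> carrier (tri A)"
  using tri_d_additive by (rule additive_closed)

lemma tri_parity_closed [simp]: "x \<in> carrier (tri A) ==> tri_parity x \<in> carrier (tri A)"
  using tri_parity_additive by (rule additive_closed)

lemma tri_d_square: "x \<in> carrier (tri A) ==> tri_d (tri_d x) = \<zero>\<^bsub>tri A\<^esub>"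
proof -
  assume "x \<in> carrier (tri A)"
  then obtain u v w where x: "x = (u, v, w)" "u \<in> carrier A" "v \<in> carrier A" "w \<in> carrier A" by auto
  have "d w \<oplus>\<^bsub>A\<^esub> parity A (d u) \<oplus>\<^bsub>A\<^esub> (\<ominus>\<^bsub>A\<^esub> d w \<oplus>\<^bsub>A\<^esub> \<ominus>\<^bsub>A\<^esub> parity A (d u)) = \<zero>\<^bsub>A\<^esub>"
    using x by (subst minus_add[symmetric]) (auto simp: r_neg)
  then show ?thesis using x by (simp add: tri_d_def d_square d_parity minus_add a_ac)
qed

lemma tri_d_parity: "x \<in> carrier (tri A) ==> tri_parity (tri_d x) = \<ominus>\<^bsub>tri A\<^esub> tri_d (tri_parity x)"
  by (auto simp: tri_d_def tri_parity_def tri_neg[OF A_algebra] d_parity minus_add a_ac)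

lemma tri_parity_mult:
  "x \<in> carrier (tri A) ==> y \<in> carrier (tri A) ==> tri_parity (x \<otimes>\<^bsub>tri A\<^esub> y) = tri_parity x \<otimes>\<^bsub>tri A\<^esub> tri_parity y"
  by (auto simp: tri_parity_def minus_add l_minus r_minus)

lemma tri_d_mult:
  assumes "x \<in> carrier (tri A)" "y \<in> carrier (tri A)"
  shows "tri_d (x \<otimes>\<^bsub>tri A\<^esub> y) = tri_d x \<otimes>\<^bsub>tri A\<^esub> y \<oplus>\<^bsub>tri A\<^esub> tri_parity x \<otimes>\<^bsub>tri A\<^esub> tri_d y"
proof -
  obtain u v w u' v' w' where x: "x = (u, v, w)" "y = (u', v', w')"
    "u \<in> carrier A" "v \<in> carrier A" "w \<in> carrier A" "u' \<in> carrier A" "v' \<in> carrier A" "w' \<in> carrier A"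
    using assms by auto
  define m where "m = parity A u \<otimes>\<^bsub>A\<^esub> w'"
  define n where "n = parity A v \<otimes>\<^bsub>A\<^esub> d w'"
  have c: "m \<in> carrier A" "n \<in> carrier A" using x by (auto simp: m_def n_def)
  have e: "\<And>z. z \<in> carrier A ==> m \<oplus>\<^bsub>A\<^esub> (\<ominus>\<^bsub>A\<^esub> m \<oplus>\<^bsub>A\<^esub> z) = z" using c by (simp add: r_neg2)
  show ?thesis using x c
    by (simp add: tri_d_def tri_parity_def d_mult minus_add l_minus r_minus l_distr r_distr m_def[symmetric] n_def[symmetric]
        a_ac e)
qed

end

context hopf_algebra
begin

lemma sw_tri:
  assumes B: "assoc_algebra K B" and h: "h \<in> carrier H"
    and F: "\<And>a b. a \<in> carrier H ==> b \<in> carrier H ==> F a b \<in> carrier (tri B)"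
  shows "sw H (tri B) h F = (sw H B h (%a b. fst (F a b)), sw H B h (%a b. fst (snd (F a b))), sw H B h (%a b. snd (snd (F a b))))"
proof -
  interpret B: assoc_algebra K B by fact
  have BG: "abelian_group B" by unfold_locales
  have p: "fst \<in> additive_maps (tri B) B" "(%x. fst (snd x)) \<in> additive_maps (tri B) B" "(%x. snd (snd x)) \<in> additive_maps (tri B) B"
    by (auto intro!: additive_mapsI)
  note T = tri_group[OF B]
  show ?thesis
    using sw_hom[OF T BG p(1) h, of F] sw_hom[OF T BG p(2) h, of F] sw_hom[OF T BG p(3) h, of F] F
    by (simp add: prod_eq_iff)
qed

lemma sw_counit_mult:
  assumes B: "assoc_algebra K B" and x: "x \<in> carrier B" and g: "g \<in> linear_maps K H B" and h: "h \<in> carrier H"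
  shows "sw H B h (%a b. (counit H a \<odot>\<^bsub>B\<^esub> x) \<otimes>\<^bsub>B\<^esub> g b) = x \<otimes>\<^bsub>B\<^esub> g h"
proof -
  interpret B: assoc_algebra K B by fact
  have BM: "module K B" by unfold_locales
  have "sw H B h (%a b. (counit H a \<odot>\<^bsub>B\<^esub> x) \<otimes>\<^bsub>B\<^esub> g b) = sw H B h (%a b. counit H a \<odot>\<^bsub>B\<^esub> (x \<otimes>\<^bsub>B\<^esub> g b))"
    using h x linear_closed[OF g] by (intro sw_cong) (auto simp: B.smult_mult_left)
  also have "\<dots> = x \<otimes>\<^bsub>B\<^esub> g h"
    by (intro sw_counit_left[OF BM _ h] B.linear_mult_left x g)
  finally show ?thesis .
qed

lemma sw_submodule:
  assumes "graded_algebra K B" "h \<in> carrier H" "\<And>a b. a \<in> carrier H ==> b \<in> carrier H ==> F a b \<in> gr B n"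
  shows "sw H B h F \<in> gr B n"
proof -
  interpret B: graded_algebra K B by fact
  have s: "lsum B (map f us) \<in> gr B n" if "\<And>u. u \<in> set us ==> f u \<in> gr B n" for f :: "'h list \<Rightarrow> _" and us
    using that by (induction us) (auto intro: B.gr_add)
  show ?thesis unfolding sw_def by (rule s) (use assms(3) sweedler_nth[OF assms(2)] in auto)
qed

interpretation Cg: graded_algebra K C by (rule C_graded)

abbreviation "W \<equiv> env K C"
abbreviation "d \<equiv> env_d K C"
abbreviation "e \<equiv> env_inj K C"

interpretation Wd: graded_differential_algebra K W d by (rule Cg.env_d_spec)

lemma e_hom: "e \<in> graded_algebra_hom K C W"
  using Cg.emb_linear Cg.emb_hom Cg.emb_gr by (simp add: graded_algebra_hom_def)

lemma e_parity: "a \<in> carrier C ==> e (parity C a) = parity W (e a)"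
  by (rule graded_algebra_hom_parity[OF C_graded Cg.W_graded e_hom])

lemma d_e: "a \<in> carrier C ==> d (e a) = Cg.D a"
  by (rule Cg.env_d_spec)

text \<open>All components of the unit form other than the constant one vanish.\<close>

lemma Lop_unit: "h \<in> carrier H ==> Lop h \<one>\<^bsub>C\<^esub> = counit H h \<odot>\<^bsub>C\<^esub> \<one>\<^bsub>C\<^esub>"
proof (rule C_eq)
  fix w assume h: "h \<in> carrier H" and w: "w \<in> ws"
  have "Lop h \<one>\<^bsub>C\<^esub> w = L w h \<one>\<^bsub>C\<^esub>" using h w by (simp add: Lop_apply C_one_closed)
  also have "\<dots> = counit H h \<otimes>\<^bsub>K\<^esub> \<one>\<^bsub>C\<^esub> w"
  proof (cases w)
    case Nil
    then show ?thesis by simp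
  next
    case (Cons x v)
    have "L w h \<one>\<^bsub>C\<^esub> = \<zero>\<^bsub>K\<^esub>" using h w Cons by (intro L_vanish) (auto simp: C_simps form_one_def)
    then show ?thesis using h w Cons by (simp add: C_simps form_one_def)
  qed
  finally show "Lop h \<one>\<^bsub>C\<^esub> w = (counit H h \<odot>\<^bsub>C\<^esub> \<one>\<^bsub>C\<^esub>) w" using w by (simp add: C_smult_apply)
qed (auto simp: C_one_closed C_smult_closed)

text \<open>The values which the product rules and the connection prescribe on forms.\<close>

definition weil_gen where
  "weil_gen a = (\<lambda>h\<in>carrier H. (counit H h \<odot>\<^bsub>W\<^esub> e (parity C a), e (Iop h a), e (Lop h a)))"

lemma W_alg: "assoc_algebra K W" by (rule Cg.W_algebra)
lemma W_ring: "ring W" by (rule Cg.W_ring)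
lemma W_group: "abelian_group W" by (rule Cg.W_group)
lemma W_mod: "module K W" by (rule Cg.W.module_axioms)
lemma T_alg: "assoc_algebra K (tri W)" by (rule tri_algebra[OF W_alg])
lemma T_group: "abelian_group (tri W)" by (rule tri_group[OF W_alg])

lemma weil_gen_linear: "a \<in> carrier C ==> (%h. (counit H h \<odot>\<^bsub>W\<^esub> e (parity C a), e (Iop h a), e (Lop h a))) \<in> linear_maps K H (tri W)"
  by (intro tri_linear linear_maps_smult_left[OF W_mod] counit_linear linear_maps_compose[OF Cg.emb_linear]
      Iop_linear_hopf Lop_linear_hopf) auto

lemma weil_gen_hom: "weil_gen \<in> ring_hom C (conv (tri W))"
proof (rule ring_hom_memI)
  fix a assume a: "a \<in> carrier C"
  show "weil_gen a \<in> carrier (conv (tri W))"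
    unfolding weil_gen_def conv_simps using linear_restrict[OF weil_gen_linear[OF a]] by simp
  fix b assume b: "b \<in> carrier C"
  have ext: "weil_gen (a \<otimes>\<^bsub>C\<^esub> b) \<in> extensional (carrier H)" "weil_gen (a \<oplus>\<^bsub>C\<^esub> b) \<in> extensional (carrier H)"
    by (simp_all add: weil_gen_def)
  show "weil_gen (a \<otimes>\<^bsub>C\<^esub> b) = weil_gen a \<otimes>\<^bsub>conv (tri W)\<^esub> weil_gen b"
  proof (rule conv_eqI[OF ext(1)])
    fix h assume h: "h \<in> carrier H"
    have hom: "e (sw H C h F) = sw H W h (%x y. e (F x y))" if "\<And>x y. x \<in> carrier H ==> y \<in> carrier H ==> F x y \<in> carrier C" for F
      by (rule sw_hom[OF C_group W_group linear_additive[OF Cg.emb_linear] h that])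
    have "(weil_gen a \<otimes>\<^bsub>conv (tri W)\<^esub> weil_gen b) h = sw H (tri W) h (%x y. weil_gen a x \<otimes>\<^bsub>tri W\<^esub> weil_gen b y)"
      using h by (simp add: conv_simps)
    also have "\<dots> = (sw H W h (%x y. (counit H x \<odot>\<^bsub>W\<^esub> e (parity C a)) \<otimes>\<^bsub>W\<^esub> (counit H y \<odot>\<^bsub>W\<^esub> e (parity C b))),
      sw H W h (%x y. (counit H x \<odot>\<^bsub>W\<^esub> e (parity C a)) \<otimes>\<^bsub>W\<^esub> e (Iop y b) \<oplus>\<^bsub>W\<^esub> e (Iop x a) \<otimes>\<^bsub>W\<^esub> e (Lop y b)),
      sw H W h (%x y. e (Lop x a) \<otimes>\<^bsub>W\<^esub> e (Lop y b)))"
      using a b h by (subst sw_tri[OF W_alg]) (auto simp: weil_gen_def intro!: sw_cong)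
    also have "sw H W h (%x y. (counit H x \<odot>\<^bsub>W\<^esub> e (parity C a)) \<otimes>\<^bsub>W\<^esub> (counit H y \<odot>\<^bsub>W\<^esub> e (parity C b))) =
      counit H h \<odot>\<^bsub>W\<^esub> e (parity C (a \<otimes>\<^bsub>C\<^esub> b))"
      using a b h
      by (subst sw_counit_mult[OF W_alg])
        (auto simp: ring_hom_mult[OF Cg.emb_hom] Cg.W.smult_mult_right intro!: linear_maps_smult_left[OF W_mod] counit_linear)
    also have "sw H W h (%x y. (counit H x \<odot>\<^bsub>W\<^esub> e (parity C a)) \<otimes>\<^bsub>W\<^esub> e (Iop y b) \<oplus>\<^bsub>W\<^esub> e (Iop x a) \<otimes>\<^bsub>W\<^esub> e (Lop y b)) =
      e (parity C a) \<otimes>\<^bsub>W\<^esub> e (Iop h b) \<oplus>\<^bsub>W\<^esub> sw H W h (%x y. e (Iop x a) \<otimes>\<^bsub>W\<^esub> e (Lop y b))"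
      using a b h
      by (simp add: sw_add[OF W_group] sw_counit_mult[OF W_alg] linear_maps_compose[OF Cg.emb_linear Iop_linear_hopf])
    also have "\<dots> = e (Iop h (a \<otimes>\<^bsub>C\<^esub> b))"
    proof -
      have "e (sw H C h (%x y. Iop x a \<otimes>\<^bsub>C\<^esub> Lop y b)) = sw H W h (%x y. e (Iop x a) \<otimes>\<^bsub>W\<^esub> e (Lop y b))"
        using a b h by (simp add: hom C_mult_closed) (intro sw_cong; simp add: ring_hom_mult[OF Cg.emb_hom])
      moreover have "sw H C h (%x y. Iop x a \<otimes>\<^bsub>C\<^esub> Lop y b) \<in> carrier C"
        using a b h by (intro sw_closed C_group) (auto simp: C_mult_closed)
      moreover have "sw H W h (%x y. e (Iop x a) \<otimes>\<^bsub>W\<^esub> e (Lop y b)) \<in> carrier W"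
        using a b h by (intro sw_closed W_group) auto
      ultimately show ?thesis using a b h
        by (simp add: Iop_mult ring_hom_add[OF Cg.emb_hom] ring_hom_mult[OF Cg.emb_hom] Cg.W.a_comm)
    qed
    also have "sw H W h (%x y. e (Lop x a) \<otimes>\<^bsub>W\<^esub> e (Lop y b)) = e (Lop h (a \<otimes>\<^bsub>C\<^esub> b))"
      using a b h by (simp add: Lop_mult hom C_mult_closed) (intro sw_cong; simp add: ring_hom_mult[OF Cg.emb_hom])
    finally have eq: "(weil_gen a \<otimes>\<^bsub>conv (tri W)\<^esub> weil_gen b) h =
      (counit H h \<odot>\<^bsub>W\<^esub> e (parity C (a \<otimes>\<^bsub>C\<^esub> b)), e (Iop h (a \<otimes>\<^bsub>C\<^esub> b)), e (Lop h (a \<otimes>\<^bsub>C\<^esub> b)))" .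
    show "weil_gen (a \<otimes>\<^bsub>C\<^esub> b) h = (weil_gen a \<otimes>\<^bsub>conv (tri W)\<^esub> weil_gen b) h"
      unfolding eq using h by (simp add: weil_gen_def)
  qed (simp add: conv_simps)
  show "weil_gen (a \<oplus>\<^bsub>C\<^esub> b) = weil_gen a \<oplus>\<^bsub>conv (tri W)\<^esub> weil_gen b"
    using a b by (intro conv_eqI[OF ext(2)])
      (auto simp: conv_simps weil_gen_def linear_add[OF Cg.emb_linear] linear_add[OF Iop_linear] linear_add[OF Lop_linear]
        Cg.W.smult_r_distr)
next
  show "weil_gen \<one>\<^bsub>C\<^esub> = \<one>\<^bsub>conv (tri W)\<^esub>"
    by (rule conv_eqI)
      (auto simp: conv_simps weil_gen_def Iop_gr_0[OF _ Cg.gr_one] Lop_unit ring_hom_one[OF Cg.emb_hom]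
        linear_smult[OF Cg.emb_linear] additive_zero[OF C_group W_group linear_additive[OF Cg.emb_linear]])
qed

lemma weil_gen_closed [simp]: "a \<in> carrier C ==> h \<in> carrier H ==> weil_gen a h \<in> carrier W \<times> carrier W \<times> carrier W"
  by (simp add: weil_gen_def)

lemma weil_gen_parity: "a \<in> carrier C ==> h \<in> carrier H ==> weil_gen (parity C a) h = Wd.tri_parity (weil_gen a h)"
  by (simp add: weil_gen_def Wd.tri_parity_def Iop_parity Lop_parity e_parity
      additive_neg[OF C_group W_group linear_additive[OF Cg.emb_linear]])

lemma weil_gen_scalar:
  "k \<in> carrier K ==> h \<in> carrier H ==> weil_gen (k \<odot>\<^bsub>C\<^esub> \<one>\<^bsub>C\<^esub>) h = counit H h \<odot>\<^bsub>tri W\<^esub> (k \<odot>\<^bsub>tri W\<^esub> \<one>\<^bsub>tri W\<^esub>)"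
  by (simp add: weil_gen_def linear_smult[OF Iop_linear] linear_smult[OF Lop_linear] Iop_gr_0[OF _ Cg.gr_one] Lop_unit
      ring_hom_one[OF Cg.emb_hom] linear_smult[OF Cg.emb_linear]
      additive_zero[OF C_group W_group linear_additive[OF Cg.emb_linear]] Cg.W.smult_assoc1[symmetric] R.m_comm)

text \<open>The derivation for the universal property is $a \mapsto D(h \mapsto \cdots)$, the operator \<open>D\<close> applied to
  the values on forms. Commutation with \<open>\<Sigma>\<close> and \<open>D\<close> holds on generators, and is inherited by products
  since convolution respects both operators.\<close>

lemma weil_hom_exists:
  "\<exists>f. f \<in> ring_hom W (conv (tri W)) \<and>
    (\<forall>a\<in>carrier C. f (e a) = weil_gen a) \<and>
    (\<forall>x\<in>carrier W. \<forall>h\<in>carrier H. f (parity W x) h = Wd.tri_parity (f x h) \<and> f (d x) h = Wd.tri_d (f x h))"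
proof -
  interpret T: assoc_algebra K "tri W" by (rule T_alg)
  have R: "ring (conv (tri W))" by (rule conv_ring[OF T_alg])
  have TR: "ring (tri W)" by unfold_locales
  define \<delta> where "\<delta> a = (\<lambda>h\<in>carrier H. Wd.tri_d (weil_gen a h))" for a
  have \<phi>l: "weil_gen a \<in> linear_maps K H (tri W)" if "a \<in> carrier C" for a
    using ring_hom_closed[OF weil_gen_hom that] by (simp add: conv_simps)
  have \<delta>l: "\<delta> a \<in> linear_maps K H (tri W)" if "a \<in> carrier C" for a
    unfolding \<delta>_def by (rule linear_restrict, rule linear_maps_compose[OF Wd.tri_d_linear \<phi>l[OF that]])
  have swd: "Wd.tri_d (sw H (tri W) h F) = sw H (tri W) h (%x y. Wd.tri_d (F x y))"
    if "h \<in> carrier H" "\<And>x y. x \<in> carrier H ==> y \<in> carrier H ==> F x y \<in> carrier (tri W)" for h F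
    by (rule sw_hom[OF T_group T_group Wd.tri_d_additive that])
  have swp: "Wd.tri_parity (sw H (tri W) h F) = sw H (tri W) h (%x y. Wd.tri_parity (F x y))"
    if "h \<in> carrier H" "\<And>x y. x \<in> carrier H ==> y \<in> carrier H ==> F x y \<in> carrier (tri W)" for h F
    by (rule sw_hom[OF T_group T_group Wd.tri_parity_additive that])
  have leibniz: "Wd.tri_d (sw H (tri W) h (%x y. p x \<otimes>\<^bsub>tri W\<^esub> q y)) =
      sw H (tri W) h (%x y. Wd.tri_d (p x) \<otimes>\<^bsub>tri W\<^esub> q y) \<oplus>\<^bsub>tri W\<^esub> sw H (tri W) h (%x y. Wd.tri_parity (p x) \<otimes>\<^bsub>tri W\<^esub> Wd.tri_d (q y))"
    if h: "h \<in> carrier H" and pq: "\<And>x. x \<in> carrier H ==> p x \<in> carrier (tri W)" "\<And>x. x \<in> carrier H ==> q x \<in> carrier (tri W)" for h p q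
  proof -
    have "Wd.tri_d (sw H (tri W) h (%x y. p x \<otimes>\<^bsub>tri W\<^esub> q y)) = sw H (tri W) h (%x y. Wd.tri_d (p x) \<otimes>\<^bsub>tri W\<^esub> q y \<oplus>\<^bsub>tri W\<^esub> Wd.tri_parity (p x) \<otimes>\<^bsub>tri W\<^esub> Wd.tri_d (q y))"
      using h pq by (subst swd) (auto intro!: sw_cong T.m_closed Wd.tri_d_mult simp del: tri_simps)
    also have "\<dots> = sw H (tri W) h (%x y. Wd.tri_d (p x) \<otimes>\<^bsub>tri W\<^esub> q y) \<oplus>\<^bsub>tri W\<^esub> sw H (tri W) h (%x y. Wd.tri_parity (p x) \<otimes>\<^bsub>tri W\<^esub> Wd.tri_d (q y))"
      using h pq by (intro sw_add[OF T_group]) (auto intro!: T.m_closed simp del: tri_simps)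
    finally show ?thesis .
  qed
  note gc = linear_closed[OF \<phi>l]
  have "\<exists>f. f \<in> ring_hom W (conv (tri W)) \<and> (\<forall>a\<in>carrier C. f (e a) = weil_gen a) \<and> (\<forall>a\<in>carrier C. f (Cg.D a) = \<delta> a)"
  proof (rule Cg.env_hom_exists[OF R weil_gen_hom])
    show "\<delta> \<in> additive_maps C (conv (tri W))"
    proof (rule additive_mapsI)
      fix a b assume a: "a \<in> carrier C" and b: "b \<in> carrier C"
      show "\<delta> a \<in> carrier (conv (tri W))" using \<delta>l[OF a] by (simp add: conv_simps) (simp add: \<delta>_def)
      show "\<delta> (a \<oplus>\<^bsub>C\<^esub> b) = \<delta> a \<oplus>\<^bsub>conv (tri W)\<^esub> \<delta> b"
        by (rule conv_eqI)
          (use a b gc in \<open>auto simp: \<delta>_def conv_simps ring_hom_add[OF weil_gen_hom] additive_add[OF Wd.tri_d_additive] simp del: tri_simps\<close>)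
    qed
  next
    fix a b assume a: "a \<in> carrier C" and b: "b \<in> carrier C"
    show "\<delta> (a \<otimes>\<^bsub>C\<^esub> b) = \<delta> a \<otimes>\<^bsub>conv (tri W)\<^esub> weil_gen b \<oplus>\<^bsub>conv (tri W)\<^esub> weil_gen (parity C a) \<otimes>\<^bsub>conv (tri W)\<^esub> \<delta> b"
    proof (rule conv_eqI)
      fix h assume h: "h \<in> carrier H"
      have "\<delta> (a \<otimes>\<^bsub>C\<^esub> b) h = Wd.tri_d (sw H (tri W) h (%x y. weil_gen a x \<otimes>\<^bsub>tri W\<^esub> weil_gen b y))"
        using h a b by (simp add: \<delta>_def ring_hom_mult[OF weil_gen_hom]) (simp add: conv_simps)
      also have "\<dots> = sw H (tri W) h (%x y. Wd.tri_d (weil_gen a x) \<otimes>\<^bsub>tri W\<^esub> weil_gen b y) \<oplus>\<^bsub>tri W\<^esub>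
          sw H (tri W) h (%x y. Wd.tri_parity (weil_gen a x) \<otimes>\<^bsub>tri W\<^esub> Wd.tri_d (weil_gen b y))"
        using gc a b by (intro leibniz h) auto
      also have "\<dots> = sw H (tri W) h (%x y. \<delta> a x \<otimes>\<^bsub>tri W\<^esub> weil_gen b y) \<oplus>\<^bsub>tri W\<^esub>
          sw H (tri W) h (%x y. weil_gen (parity C a) x \<otimes>\<^bsub>tri W\<^esub> \<delta> b y)"
        using h a by (intro arg_cong2[where f="(\<oplus>\<^bsub>tri W\<^esub>)"] sw_cong) (auto simp: \<delta>_def weil_gen_parity)
      finally show "\<delta> (a \<otimes>\<^bsub>C\<^esub> b) h = (\<delta> a \<otimes>\<^bsub>conv (tri W)\<^esub> weil_gen b \<oplus>\<^bsub>conv (tri W)\<^esub> weil_gen (parity C a) \<otimes>\<^bsub>conv (tri W)\<^esub> \<delta> b) h"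
        using h by (simp add: conv_simps)
    qed (auto simp: \<delta>_def conv_simps)
  next
    fix k assume k: "k \<in> carrier K"
    show "\<delta> (k \<odot>\<^bsub>C\<^esub> \<one>\<^bsub>C\<^esub>) = \<zero>\<^bsub>conv (tri W)\<^esub>"
    proof (rule conv_eqI)
      fix h assume h: "h \<in> carrier H"
      have "Wd.tri_d \<one>\<^bsub>tri W\<^esub> = \<zero>\<^bsub>tri W\<^esub>"
        using Wd.d_scalar[of "\<one>\<^bsub>K\<^esub>"] by (simp add: Wd.tri_d_def Cg.W.r_neg)
      then have "Wd.tri_d (counit H h \<odot>\<^bsub>tri W\<^esub> (k \<odot>\<^bsub>tri W\<^esub> \<one>\<^bsub>tri W\<^esub>)) = \<zero>\<^bsub>tri W\<^esub>"
        using h k by (simp add: linear_smult[OF Wd.tri_d_linear] T.smult_r_null del: tri_simps) 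
      then show "\<delta> (k \<odot>\<^bsub>C\<^esub> \<one>\<^bsub>C\<^esub>) h = \<zero>\<^bsub>conv (tri W)\<^esub> h"
        using h k by (simp add: \<delta>_def weil_gen_scalar conv_simps del: tri_simps)
    qed (auto simp: \<delta>_def conv_simps)
  qed
  then obtain f where f: "f \<in> ring_hom W (conv (tri W))" "\<And>a. a \<in> carrier C ==> f (e a) = weil_gen a"
    "\<And>a. a \<in> carrier C ==> f (Cg.D a) = \<delta> a" by blast
  have fc [simp]: "f x h \<in> carrier (tri W)" if "x \<in> carrier W" "h \<in> carrier H" for x h
    using ring_hom_closed[OF f(1) that(1)] that(2) linear_closed[of "f x" K H "tri W" h] by (simp add: conv_simps del: tri_simps)
  have f_add: "f (x \<oplus>\<^bsub>W\<^esub> y) h = f x h \<oplus>\<^bsub>tri W\<^esub> f y h" if "x \<in> carrier W" "y \<in> carrier W" "h \<in> carrier H" for x y h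
    using that by (simp add: ring_hom_add[OF f(1)]) (simp add: conv_simps)
  have f_mult: "f (x \<otimes>\<^bsub>W\<^esub> y) h = sw H (tri W) h (%a b. f x a \<otimes>\<^bsub>tri W\<^esub> f y b)" if "x \<in> carrier W" "y \<in> carrier W" "h \<in> carrier H" for x y h
    using that by (simp add: ring_hom_mult[OF f(1)]) (simp add: conv_simps)
  have ev: "(%x. f x h) \<in> additive_maps W (tri W)" if "h \<in> carrier H" for h
    using that fc f_add by (intro additive_mapsI)
  have f_zero: "f \<zero>\<^bsub>W\<^esub> h = \<zero>\<^bsub>tri W\<^esub>" if "h \<in> carrier H" for h
    using additive_zero[OF W_group T_group ev[OF that]] .
  have f_neg: "f (\<ominus>\<^bsub>W\<^esub> x) h = \<ominus>\<^bsub>tri W\<^esub> f x h" if "h \<in> carrier H" "x \<in> carrier W" for h x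
    using additive_neg[OF W_group T_group ev[OF that(1)] that(2)] .
  have s: "\<forall>h\<in>carrier H. f (parity W x) h = Wd.tri_parity (f x h)" if "x \<in> carrier W" for x
    using that
  proof (induction rule: Cg.env_induct)
    case (emb a)
    then show ?case by (simp add: f e_parity[symmetric] weil_gen_parity)
  next
    case (D a)
    have "parity W (Cg.D a) = \<ominus>\<^bsub>W\<^esub> Cg.D (parity C a)"
      using Wd.d_parity[of "e a"] D by (simp add: e_parity[symmetric] d_e)
    moreover have "\<ominus>\<^bsub>tri W\<^esub> Wd.tri_d (weil_gen (parity C a) h) = Wd.tri_parity (Wd.tri_d (weil_gen a h))" if "h \<in> carrier H" for h
      using that D gc[OF D that] by (simp only: weil_gen_parity Wd.tri_d_parity)
    ultimately show ?case using D by (simp add: f_neg f(3) \<delta>_def del: tri_simps)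
  next
    case (add x y)
    then show ?case by (simp add: f_add additive_add[OF Wd.tri_parity_additive] del: tri_simps)
  next
    case (mult x y)
    show ?case
    proof
      fix h assume h: "h \<in> carrier H"
      have "f (parity W (x \<otimes>\<^bsub>W\<^esub> y)) h = sw H (tri W) h (%a b. Wd.tri_parity (f x a) \<otimes>\<^bsub>tri W\<^esub> Wd.tri_parity (f y b))"
        using mult h by (simp add: f_mult del: tri_simps) (intro sw_cong; simp)
      also have "\<dots> = sw H (tri W) h (%a b. Wd.tri_parity (f x a \<otimes>\<^bsub>tri W\<^esub> f y b))"
        using mult h by (intro sw_cong) (auto simp: Wd.tri_parity_mult simp del: tri_simps)
      also have "\<dots> = Wd.tri_parity (f (x \<otimes>\<^bsub>W\<^esub> y) h)"
        using mult h by (simp add: f_mult swp del: tri_simps)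
      finally show "f (parity W (x \<otimes>\<^bsub>W\<^esub> y)) h = Wd.tri_parity (f (x \<otimes>\<^bsub>W\<^esub> y) h)" .
    qed
  qed
  have "\<forall>h\<in>carrier H. f (d x) h = Wd.tri_d (f x h)" if "x \<in> carrier W" for x
    using that
  proof (induction rule: Cg.env_induct)
    case (emb a)
    then show ?case by (simp add: f d_e \<delta>_def)
  next
    case (D a)
    have "d (Cg.D a) = \<zero>\<^bsub>W\<^esub>" using Wd.d_square[of "e a"] D by (simp add: d_e)
    then show ?case using D gc[OF D] by (simp add: f_zero f(3) \<delta>_def Wd.tri_d_square del: tri_simps)
  next
    case (add x y)
    then show ?case by (simp add: f_add additive_add[OF Wd.tri_d_additive] del: tri_simps)
  next
    case (mult x y)
    show ?case
    proof
      fix h assume h: "h \<in> carrier H"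
      have "f (d (x \<otimes>\<^bsub>W\<^esub> y)) h = sw H (tri W) h (%a b. f (d x) a \<otimes>\<^bsub>tri W\<^esub> f y b) \<oplus>\<^bsub>tri W\<^esub> sw H (tri W) h (%a b. f (parity W x) a \<otimes>\<^bsub>tri W\<^esub> f (d y) b)"
        using mult(1,2) h by (simp add: Wd.d_mult f_add f_mult del: tri_simps)
      also have "\<dots> = sw H (tri W) h (%a b. Wd.tri_d (f x a) \<otimes>\<^bsub>tri W\<^esub> f y b) \<oplus>\<^bsub>tri W\<^esub> sw H (tri W) h (%a b. Wd.tri_parity (f x a) \<otimes>\<^bsub>tri W\<^esub> Wd.tri_d (f y b))"
        using mult h s by (intro arg_cong2[where f="(\<oplus>\<^bsub>tri W\<^esub>)"] sw_cong) auto
      also have "\<dots> = Wd.tri_d (f (x \<otimes>\<^bsub>W\<^esub> y) h)"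
        using mult(1,2) h by (simp add: f_mult leibniz del: tri_simps)
      finally show "f (d (x \<otimes>\<^bsub>W\<^esub> y)) h = Wd.tri_d (f (x \<otimes>\<^bsub>W\<^esub> y) h)" .
    qed
  qed
  then show ?thesis using f s by blast
qed

definition weil_hom where
  "weil_hom = (SOME f. f \<in> ring_hom W (conv (tri W)) \<and>
    (\<forall>a\<in>carrier C. f (e a) = weil_gen a) \<and>
    (\<forall>x\<in>carrier W. \<forall>h\<in>carrier H. f (parity W x) h = Wd.tri_parity (f x h) \<and> f (d x) h = Wd.tri_d (f x h)))"

text \<open>The entries of the matrix: the operation $i_h$ and its Lie derivative $L_h$.\<close>

definition weil_i where "weil_i h x = fst (snd (weil_hom x h))"
definition weil_l where "weil_l h x = snd (snd (weil_hom x h))"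

lemma weil_hom:
  shows weil_hom_ring: "weil_hom \<in> ring_hom W (conv (tri W))"
    and weil_hom_e: "a \<in> carrier C ==> weil_hom (e a) = weil_gen a"
    and weil_hom_parity: "x \<in> carrier W ==> h \<in> carrier H ==> weil_hom (parity W x) h = Wd.tri_parity (weil_hom x h)"
    and weil_hom_d: "x \<in> carrier W ==> h \<in> carrier H ==> weil_hom (d x) h = Wd.tri_d (weil_hom x h)"
  using someI_ex[OF weil_hom_exists] unfolding weil_hom_def by blast+

lemma weil_hom_linear_hopf: "x \<in> carrier W ==> (%h. weil_hom x h) \<in> linear_maps K H (tri W)"
  using ring_hom_closed[OF weil_hom_ring] by (simp add: conv_simps)

lemma weil_hom_closed: "x \<in> carrier W ==> h \<in> carrier H ==> weil_hom x h \<in> carrier (tri W)"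
  using weil_hom_linear_hopf by (rule linear_closed)

lemma weil_hom_add:
  "x \<in> carrier W ==> y \<in> carrier W ==> h \<in> carrier H ==> weil_hom (x \<oplus>\<^bsub>W\<^esub> y) h = weil_hom x h \<oplus>\<^bsub>tri W\<^esub> weil_hom y h"
  by (simp add: ring_hom_add[OF weil_hom_ring]) (simp add: conv_simps)

lemma weil_hom_mult:
  "x \<in> carrier W ==> y \<in> carrier W ==> h \<in> carrier H ==>
   weil_hom (x \<otimes>\<^bsub>W\<^esub> y) h = sw H (tri W) h (%a b. weil_hom x a \<otimes>\<^bsub>tri W\<^esub> weil_hom y b)"
  by (simp add: ring_hom_mult[OF weil_hom_ring]) (simp add: conv_simps)

text \<open>A ring homomorphism need not be linear, but scalars act by multiplication with elements of degree zero
  in \<open>C\<close>, whose images are known.\<close>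

lemma weil_hom_smult:
  assumes k: "k \<in> carrier K" and x: "x \<in> carrier W" and h: "h \<in> carrier H"
  shows "weil_hom (k \<odot>\<^bsub>W\<^esub> x) h = k \<odot>\<^bsub>tri W\<^esub> weil_hom x h"
proof -
  interpret T: assoc_algebra K "tri W" by (rule T_alg)
  have "weil_hom (k \<odot>\<^bsub>W\<^esub> x) h = sw H (tri W) h (%a b. weil_gen (k \<odot>\<^bsub>C\<^esub> \<one>\<^bsub>C\<^esub>) a \<otimes>\<^bsub>tri W\<^esub> weil_hom x b)"
    using k x h by (simp add: Cg.W_smult weil_hom_mult weil_hom_e)
  also have "\<dots> = sw H (tri W) h (%a b. (counit H a \<odot>\<^bsub>tri W\<^esub> (k \<odot>\<^bsub>tri W\<^esub> \<one>\<^bsub>tri W\<^esub>)) \<otimes>\<^bsub>tri W\<^esub> weil_hom x b)"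
    using k by (intro sw_cong h) (simp add: weil_gen_scalar del: tri_simps)
  also have "\<dots> = (k \<odot>\<^bsub>tri W\<^esub> \<one>\<^bsub>tri W\<^esub>) \<otimes>\<^bsub>tri W\<^esub> weil_hom x h"
    using k by (intro sw_counit_mult[OF T_alg _ weil_hom_linear_hopf[OF x] h] T.smult_closed T.one_closed)
  also have "\<dots> = k \<odot>\<^bsub>tri W\<^esub> weil_hom x h"
    using k weil_hom_closed[OF x h] by (simp add: T.smult_mult_left del: tri_simps)
  finally show ?thesis .
qed

text \<open>On forms the first diagonal entry is $\varepsilon(h)\sigma$ by construction; \<open>D\<close> and the convolution
  product preserve this shape.\<close>

lemma weil_hom_counit:
  "x \<in> carrier W ==> \<forall>h\<in>carrier H. fst (weil_hom x h) = counit H h \<odot>\<^bsub>W\<^esub> parity W x"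
proof (induction rule: Cg.env_induct)
  case (emb a)
  then show ?case by (simp add: weil_hom_e weil_gen_def e_parity)
next
  case (D a)
  show ?case
  proof
    fix h assume h: "h \<in> carrier H"
    have "fst (weil_hom (Cg.D a) h) = \<ominus>\<^bsub>W\<^esub> d (counit H h \<odot>\<^bsub>W\<^esub> parity W (e a))"
      using D h weil_hom_d[of "e a" h] by (simp add: d_e weil_hom_e weil_gen_def Wd.tri_d_def e_parity)
    also have "\<dots> = counit H h \<odot>\<^bsub>W\<^esub> \<ominus>\<^bsub>W\<^esub> d (parity W (e a))"
      using D h by (simp add: linear_smult[OF Wd.d_linear] Cg.W.smult_r_minus)
    also have "\<ominus>\<^bsub>W\<^esub> d (parity W (e a)) = parity W (Cg.D a)"
      using D by (simp add: Wd.d_parity d_e)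
    finally show "fst (weil_hom (Cg.D a) h) = counit H h \<odot>\<^bsub>W\<^esub> parity W (Cg.D a)" .
  qed
next
  case (add x y)
  have "fst (p \<oplus>\<^bsub>tri W\<^esub> q) = fst p \<oplus>\<^bsub>W\<^esub> fst q" for p q by (cases p; cases q) simp
  with add show ?case by (simp add: weil_hom_add Cg.W.smult_r_distr)
next
  case (mult x y)
  show ?case
  proof
    fix h assume h: "h \<in> carrier H"
    have f: "fst (p \<otimes>\<^bsub>tri W\<^esub> q) = fst p \<otimes>\<^bsub>W\<^esub> fst q" for p q by (cases p; cases q) simp
    have "fst (weil_hom (x \<otimes>\<^bsub>W\<^esub> y) h) = sw H W h (%a b. fst (weil_hom x a) \<otimes>\<^bsub>W\<^esub> fst (weil_hom y b))"
      using mult h ring.ring_simprules(5)[OF assoc_algebra.axioms(3)[OF T_alg] weil_hom_closed weil_hom_closed]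
      by (simp add: weil_hom_mult sw_tri[OF W_alg] f)
    also have "\<dots> = sw H W h (%a b. (counit H a \<odot>\<^bsub>W\<^esub> parity W x) \<otimes>\<^bsub>W\<^esub> (counit H b \<odot>\<^bsub>W\<^esub> parity W y))"
      using mult by (intro sw_cong h) simp
    also have "\<dots> = parity W x \<otimes>\<^bsub>W\<^esub> (counit H h \<odot>\<^bsub>W\<^esub> parity W y)"
      using mult h by (intro sw_counit_mult[OF W_alg] linear_maps_smult_left[OF W_mod] counit_linear) auto
    finally show "fst (weil_hom (x \<otimes>\<^bsub>W\<^esub> y) h) = counit H h \<odot>\<^bsub>W\<^esub> parity W (x \<otimes>\<^bsub>W\<^esub> y)"
      using mult h by (simp add: Cg.W.smult_mult_right)
  qed
qed

lemma weil_hom_eq: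
  "x \<in> carrier W ==> h \<in> carrier H ==> weil_hom x h = (counit H h \<odot>\<^bsub>W\<^esub> parity W x, weil_i h x, weil_l h x)"
  using weil_hom_counit by (simp add: prod_eq_iff weil_i_def weil_l_def)

lemma weil_closed [simp]:
  assumes "x \<in> carrier W" "h \<in> carrier H"
  shows "weil_i h x \<in> carrier W" "weil_l h x \<in> carrier W"
  using weil_hom_closed[OF assms] by (auto simp: weil_i_def weil_l_def)

lemma weil_add:
  assumes "x \<in> carrier W" "y \<in> carrier W" "h \<in> carrier H"
  shows "weil_i h (x \<oplus>\<^bsub>W\<^esub> y) = weil_i h x \<oplus>\<^bsub>W\<^esub> weil_i h y" "weil_l h (x \<oplus>\<^bsub>W\<^esub> y) = weil_l h x \<oplus>\<^bsub>W\<^esub> weil_l h y"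
  using weil_hom_add[OF assms] assms by (simp_all add: weil_hom_eq)

lemma weil_linear: "h \<in> carrier H ==> weil_i h \<in> linear_maps K W W" "h \<in> carrier H ==> weil_l h \<in> linear_maps K W W"
  using weil_hom_smult by (auto intro!: linear_mapsI simp: weil_add weil_hom_eq)

lemma weil_linear_hopf:
  assumes "x \<in> carrier W"
  shows "(%h. weil_i h x) \<in> linear_maps K H W" "(%h. weil_l h x) \<in> linear_maps K H W"
proof -
  have "(%z. fst (snd z)) \<in> linear_maps K (tri W) W" "(%z. snd (snd z)) \<in> linear_maps K (tri W) W"
    by (auto intro!: linear_mapsI)
  then show "(%h. weil_i h x) \<in> linear_maps K H W" "(%h. weil_l h x) \<in> linear_maps K H W"
    unfolding weil_i_def weil_l_def using weil_hom_linear_hopf[OF assms] by (auto intro: linear_maps_compose)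
qed

lemma weil_e: "a \<in> carrier C ==> h \<in> carrier H ==> weil_i h (e a) = e (Iop h a)"
  "a \<in> carrier C ==> h \<in> carrier H ==> weil_l h (e a) = e (Lop h a)"
  by (simp_all add: weil_i_def weil_l_def weil_hom_e weil_gen_def)

lemma weil_parity: "x \<in> carrier W ==> h \<in> carrier H ==> weil_l h (parity W x) = parity W (weil_l h x)"
  using weil_hom_parity[of x h] by (simp add: weil_hom_eq Wd.tri_parity_def)

lemma weil_i_d:
  assumes "x \<in> carrier W" "h \<in> carrier H"
  shows "weil_i h (d x) = weil_l h x \<oplus>\<^bsub>W\<^esub> \<ominus>\<^bsub>W\<^esub> (counit H h \<odot>\<^bsub>W\<^esub> x) \<oplus>\<^bsub>W\<^esub> \<ominus>\<^bsub>W\<^esub> d (weil_i h x)"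
    "weil_l h (d x) = d (weil_l h x)"
  using weil_hom_d[OF assms] assms by (simp_all add: weil_hom_eq Wd.tri_d_def)

lemma weil_lie: "x \<in> carrier W ==> h \<in> carrier H ==> lie H W d weil_i h x = weil_l h x"
proof -
  assume a: "x \<in> carrier W" "h \<in> carrier H"
  define p q where "p = counit H h \<odot>\<^bsub>W\<^esub> x" and "q = d (weil_i h x)"
  have "p \<in> carrier W" "q \<in> carrier W" using a by (auto simp: p_def q_def)
  then have "q \<oplus>\<^bsub>W\<^esub> (weil_l h x \<oplus>\<^bsub>W\<^esub> \<ominus>\<^bsub>W\<^esub> p \<oplus>\<^bsub>W\<^esub> \<ominus>\<^bsub>W\<^esub> q) \<oplus>\<^bsub>W\<^esub> p = weil_l h x"
    using a Cg.W.minus_add[of p q] Cg.W.r_neg[of "p \<oplus>\<^bsub>W\<^esub> q"] Cg.W.a_ac by (smt (verit) Cg.W.add.inv_closed Cg.W.a_closed Cg.W.r_zero weil_closed(2))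
  then show ?thesis using a by (simp add: lie_def weil_i_d p_def q_def)
qed

lemma weil_mult:
  assumes x: "x \<in> carrier W" and y: "y \<in> carrier W" and h: "h \<in> carrier H"
  shows "weil_i h (x \<otimes>\<^bsub>W\<^esub> y) = parity W x \<otimes>\<^bsub>W\<^esub> weil_i h y \<oplus>\<^bsub>W\<^esub> sw H W h (%a b. weil_i a x \<otimes>\<^bsub>W\<^esub> weil_l b y)"
    "weil_l h (x \<otimes>\<^bsub>W\<^esub> y) = sw H W h (%a b. weil_l a x \<otimes>\<^bsub>W\<^esub> weil_l b y)"
proof -
  have "weil_hom (x \<otimes>\<^bsub>W\<^esub> y) h = sw H (tri W) h (%a b. (counit H a \<odot>\<^bsub>W\<^esub> parity W x, weil_i a x, weil_l a x) \<otimes>\<^bsub>tri W\<^esub> (counit H b \<odot>\<^bsub>W\<^esub> parity W y, weil_i b y, weil_l b y))"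
    using assms by (simp add: weil_hom_mult del: tri_simps) (intro sw_cong; simp add: weil_hom_eq)
  also have "\<dots> = (sw H W h (%a b. (counit H a \<odot>\<^bsub>W\<^esub> parity W x) \<otimes>\<^bsub>W\<^esub> (counit H b \<odot>\<^bsub>W\<^esub> parity W y)),
      sw H W h (%a b. (counit H a \<odot>\<^bsub>W\<^esub> parity W x) \<otimes>\<^bsub>W\<^esub> weil_i b y \<oplus>\<^bsub>W\<^esub> weil_i a x \<otimes>\<^bsub>W\<^esub> weil_l b y),
      sw H W h (%a b. weil_l a x \<otimes>\<^bsub>W\<^esub> weil_l b y))"
    using assms by (subst sw_tri[OF W_alg]) auto
  also have "sw H W h (%a b. (counit H a \<odot>\<^bsub>W\<^esub> parity W x) \<otimes>\<^bsub>W\<^esub> weil_i b y \<oplus>\<^bsub>W\<^esub> weil_i a x \<otimes>\<^bsub>W\<^esub> weil_l b y) =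
      parity W x \<otimes>\<^bsub>W\<^esub> weil_i h y \<oplus>\<^bsub>W\<^esub> sw H W h (%a b. weil_i a x \<otimes>\<^bsub>W\<^esub> weil_l b y)"
    using assms by (simp add: sw_add[OF W_group] sw_counit_mult[OF W_alg] weil_linear_hopf)
  finally show "weil_i h (x \<otimes>\<^bsub>W\<^esub> y) = parity W x \<otimes>\<^bsub>W\<^esub> weil_i h y \<oplus>\<^bsub>W\<^esub> sw H W h (%a b. weil_i a x \<otimes>\<^bsub>W\<^esub> weil_l b y)"
    "weil_l h (x \<otimes>\<^bsub>W\<^esub> y) = sw H W h (%a b. weil_l a x \<otimes>\<^bsub>W\<^esub> weil_l b y)"
    by (simp_all add: weil_i_def weil_l_def)
qed

lemma weil_bilinear:
  assumes "x \<in> carrier W" "y \<in> carrier W"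
  shows "(%a b. weil_i a x \<otimes>\<^bsub>W\<^esub> weil_l b y) \<in> bilinear_maps K H H W" "(%a b. weil_l a x \<otimes>\<^bsub>W\<^esub> weil_l b y) \<in> bilinear_maps K H H W"
  using assms by (auto intro!: bilinear_mapsI Cg.W.linear_mult_left Cg.W.linear_mult_right weil_linear_hopf)

text \<open>For the identities below, a generator $d a$ is treated as \<open>d\<close> applied to \<open>a\<close>: each identity
  holds on forms and is inherited by products and differentials.\<close>

lemma weil_one: "x \<in> carrier W ==> weil_i \<one>\<^bsub>H\<^esub> x = \<zero>\<^bsub>W\<^esub> \<and> weil_l \<one>\<^bsub>H\<^esub> x = x"
proof (induction rule: Cg.env_induct)
  case (emb a)
  then show ?case
    by (simp add: weil_e Iop_one Lop_one additive_zero[OF C_group W_group linear_additive[OF Cg.emb_linear]])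
next
  case (D a)
  then show ?case using weil_i_d[of "e a" "\<one>\<^bsub>H\<^esub>"]
    by (simp add: weil_e Iop_one Lop_one additive_zero[OF C_group W_group linear_additive[OF Cg.emb_linear]]
        counit_one Cg.W.r_neg d_e)
next
  case (add x y)
  then show ?case by (simp add: weil_add)
next
  case (mult x y)
  then show ?case by (simp add: weil_mult sw_one[OF W_mod weil_bilinear(1)] sw_one[OF W_mod weil_bilinear(2)])
qed

lemma weil_lie_lie:
  "x \<in> carrier W ==> \<forall>h\<in>carrier H. \<forall>g\<in>carrier H. weil_l h (weil_l g x) = weil_l (h \<otimes>\<^bsub>H\<^esub> g) x"
proof (induction rule: Cg.env_induct)
  case (emb a)
  then show ?case by (simp add: weil_e Lop_Lop)
next
  case (D a)
  then show ?case by (simp add: d_e[symmetric] weil_i_d weil_e Lop_Lop)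
next
  case (add x y)
  then show ?case by (simp add: weil_add)
next
  case (mult x y)
  show ?case
  proof (intro ballI)
    fix h g assume h: "h \<in> carrier H" and g: "g \<in> carrier H"
    have "weil_l h (weil_l g (x \<otimes>\<^bsub>W\<^esub> y)) = sw H W g (%c e. weil_l h (weil_l c x \<otimes>\<^bsub>W\<^esub> weil_l e y))"
      using mult h g by (simp add: weil_mult)
        (intro sw_hom[OF W_group W_group linear_additive[OF weil_linear(2)]]; simp)
    also have "\<dots> = sw H W g (%c e. sw H W h (%a b. weil_l (a \<otimes>\<^bsub>H\<^esub> c) x \<otimes>\<^bsub>W\<^esub> weil_l (b \<otimes>\<^bsub>H\<^esub> e) y))"
      using mult h g by (auto simp: weil_mult intro!: sw_cong)
    also have "\<dots> = sw H W h (%a b. sw H W g (%c e. weil_l (a \<otimes>\<^bsub>H\<^esub> c) x \<otimes>\<^bsub>W\<^esub> weil_l (b \<otimes>\<^bsub>H\<^esub> e) y))"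
      using mult h g by (intro sw_swap W_group) auto
    also have "\<dots> = weil_l (h \<otimes>\<^bsub>H\<^esub> g) (x \<otimes>\<^bsub>W\<^esub> y)"
      using mult h g by (simp add: weil_mult sw_mult[OF W_mod weil_bilinear(2)])
    finally show "weil_l h (weil_l g (x \<otimes>\<^bsub>W\<^esub> y)) = weil_l (h \<otimes>\<^bsub>H\<^esub> g) (x \<otimes>\<^bsub>W\<^esub> y)" .
  qed
qed

lemma weil_i_lie_e:
  assumes z: "z \<in> carrier C" and h: "h \<in> carrier H" and g: "g \<in> carrier H"
  shows "weil_i g (weil_l h (e z)) = sw H W h (%a b. weil_l a (weil_i (adj H b g) (e z)))"
proof -
  have "e (sw H C h (%a b. Lop a (Iop (adj H b g) z))) = sw H W h (%a b. e (Lop a (Iop (adj H b g) z)))"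
    using assms by (intro sw_hom[OF C_group W_group linear_additive[OF Cg.emb_linear]]) auto
  also have "\<dots> = sw H W h (%a b. weil_l a (weil_i (adj H b g) (e z)))"
    using assms by (intro sw_cong) (auto simp: weil_e)
  finally show ?thesis using assms by (simp add: weil_e Iop_Lop)
qed

lemma weil_i_lie:
  "x \<in> carrier W ==> \<forall>h\<in>carrier H. \<forall>g\<in>carrier H. weil_i g (weil_l h x) = sw H W h (%a b. weil_l a (weil_i (adj H b g) x))"
proof (induction rule: Cg.env_induct)
  case (emb a)
  then show ?case by (blast intro: weil_i_lie_e)
next
  case (add x y)
  then show ?case by (auto simp: weil_add simp flip: sw_add[OF W_group] intro!: sw_cong)
next
  case (D z)
  define x where "x = e z"
  have x [simp]: "x \<in> carrier W" using D by (simp add: x_def)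
  note IH = weil_i_lie_e[OF D, folded x_def]
  show ?case
  proof (intro ballI)
    fix h g assume h [simp]: "h \<in> carrier H" and g [simp]: "g \<in> carrier H"
    let ?s = "sw H W h"
    have 1: "?s (%a b. weil_l a (weil_l (adj H b g) x)) = weil_l g (weil_l h x)"
    proof -
      have "?s (%a b. weil_l a (weil_l (adj H b g) x)) = ?s (%a b. weil_l (a \<otimes>\<^bsub>H\<^esub> adj H b g) x)"
        by (intro sw_cong) (simp_all add: weil_lie_lie)
      also have "\<dots> = weil_l (sw H H h (%a b. a \<otimes>\<^bsub>H\<^esub> adj H b g)) x"
        by (intro sw_hom[OF H_group W_group linear_additive[OF weil_linear_hopf(2)], symmetric]) simp_all
      finally show ?thesis by (simp add: adj_exchange weil_lie_lie)
    qed
    have 2: "?s (%a b. counit H (adj H b g) \<odot>\<^bsub>W\<^esub> weil_l a x) = counit H g \<odot>\<^bsub>W\<^esub> weil_l h x"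
    proof -
      have "?s (%a b. counit H (adj H b g) \<odot>\<^bsub>W\<^esub> weil_l a x) = ?s (%a b. counit H g \<odot>\<^bsub>W\<^esub> (counit H b \<odot>\<^bsub>W\<^esub> weil_l a x))"
        by (intro sw_cong) (simp_all add: counit_adj Cg.W.smult_assoc1[symmetric] R.m_comm)
      also have "\<dots> = counit H g \<odot>\<^bsub>W\<^esub> ?s (%a b. counit H b \<odot>\<^bsub>W\<^esub> weil_l a x)"
        by (intro sw_smult[symmetric] W_mod) simp_all
      finally show ?thesis by (simp add: sw_counit_right[OF W_mod weil_linear_hopf(2)])
    qed
    have 3: "?s (%a b. d (weil_l a (weil_i (adj H b g) x))) = d (weil_i g (weil_l h x))"
      unfolding IH[OF h g] by (intro sw_hom[symmetric] W_group Wd.d_additive) simp_all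
    have "?s (%a b. weil_l a (weil_i (adj H b g) (d x))) =
      ?s (%a b. weil_l a (weil_l (adj H b g) x) \<oplus>\<^bsub>W\<^esub> \<ominus>\<^bsub>W\<^esub> (counit H (adj H b g) \<odot>\<^bsub>W\<^esub> weil_l a x) \<oplus>\<^bsub>W\<^esub> \<ominus>\<^bsub>W\<^esub> d (weil_l a (weil_i (adj H b g) x)))"
      by (intro sw_cong)
        (simp_all add: weil_i_d weil_add additive_neg[OF W_group W_group linear_additive[OF weil_linear(2)]] linear_smult[OF weil_linear(2)])
    also have "\<dots> = weil_l g (weil_l h x) \<oplus>\<^bsub>W\<^esub> \<ominus>\<^bsub>W\<^esub> (counit H g \<odot>\<^bsub>W\<^esub> weil_l h x) \<oplus>\<^bsub>W\<^esub> \<ominus>\<^bsub>W\<^esub> d (weil_i g (weil_l h x))"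
      by (simp add: sw_add[OF W_group] sw_neg[OF W_group] 1 2 3)
    finally show "weil_i g (weil_l h (Cg.D z)) = ?s (%a b. weil_l a (weil_i (adj H b g) (Cg.D z)))"
      using D by (simp add: weil_i_d x_def[symmetric] d_e[symmetric])
  qed
next
  case (mult x y)
  note [simp] = mult(1,2)
  show ?case
  proof (intro ballI)
    fix h g assume h [simp]: "h \<in> carrier H" and g [simp]: "g \<in> carrier H"
    let ?s = "sw H W"
    note lin = linear_intros linear_adj_left linear_adj_right Cg.W.linear_mult_left Cg.W.linear_mult_right
      linear_maps_compose[OF weil_linear_hopf(1)] linear_maps_compose[OF weil_linear_hopf(2)]
      linear_maps_compose[OF weil_linear(1)] linear_maps_compose[OF weil_linear(2)]
    have lhom: "weil_l k (?s l F) = ?s l (%a b. weil_l k (F a b))"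
      if "k \<in> carrier H" "l \<in> carrier H" "\<And>a b. a \<in> carrier H ==> b \<in> carrier H ==> F a b \<in> carrier W" for k l F
      by (rule sw_hom[OF W_group W_group linear_additive[OF weil_linear(2)[OF that(1)]] that(2,3)])
    have ihom: "weil_i k (?s l F) = ?s l (%a b. weil_i k (F a b))"
      if "k \<in> carrier H" "l \<in> carrier H" "\<And>a b. a \<in> carrier H ==> b \<in> carrier H ==> F a b \<in> carrier W" for k l F
      by (rule sw_hom[OF W_group W_group linear_additive[OF weil_linear(1)[OF that(1)]] that(2,3)])
    \<comment> \<open>The two terms of the product rule: i acting on y (T1), and i acting on x (T2).\<close>
    define T1 where "T1 = ?s h (%a b. ?s b (%p q. parity W (weil_l a x) \<otimes>\<^bsub>W\<^esub> weil_l p (weil_i (adj H q g) y)))"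
    define T2 where "T2 = ?s h (%a b. ?s b (%p q. ?s (adj H q g) (%c e. weil_l a (weil_i c x) \<otimes>\<^bsub>W\<^esub> weil_l (p \<otimes>\<^bsub>H\<^esub> e) y)))"
    have l1: "?s h (%a b. parity W (weil_l a x) \<otimes>\<^bsub>W\<^esub> weil_i g (weil_l b y)) = T1"
      unfolding T1_def using mult(4) by (intro sw_cong) (simp_all add: sw_mult_left[OF W_ring])
    have "?s h (%a b. ?s g (%c e. weil_i c (weil_l a x) \<otimes>\<^bsub>W\<^esub> weil_l e (weil_l b y))) =
      ?s h (%a b. ?s g (%c e. ?s a (%p q. weil_l p (weil_i (adj H q c) x) \<otimes>\<^bsub>W\<^esub> weil_l (e \<otimes>\<^bsub>H\<^esub> b) y)))"
      using mult(3) by (intro sw_cong) (simp_all add: weil_lie_lie sw_mult_right[OF W_ring])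
    also have "\<dots> = ?s h (%a b. ?s a (%p q. ?s g (%c e. weil_l p (weil_i (adj H q c) x) \<otimes>\<^bsub>W\<^esub> weil_l (e \<otimes>\<^bsub>H\<^esub> b) y)))"
      by (intro sw_cong sw_swap W_group) simp_all
    also have "\<dots> = ?s h (%a b. ?s b (%p q. ?s g (%c e. weil_l a (weil_i (adj H p c) x) \<otimes>\<^bsub>W\<^esub> weil_l (e \<otimes>\<^bsub>H\<^esub> q) y)))"
      by (intro sw_coassoc W_mod; (intro lin)?) (simp_all add: W_mod H_module)
    also have "\<dots> = T2" unfolding T2_def
      by (intro sw_cong adj_comult[symmetric, where F="%u v. weil_l a (weil_i u x) \<otimes>\<^bsub>W\<^esub> weil_l v y" for a] W_mod; (intro lin)?) (simp_all add: W_mod H_module)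
    finally have l2: "?s h (%a b. ?s g (%c e. weil_i c (weil_l a x) \<otimes>\<^bsub>W\<^esub> weil_l e (weil_l b y))) = T2" .
    have "?s h (%a b. weil_l a (parity W x \<otimes>\<^bsub>W\<^esub> weil_i (adj H b g) y)) =
      ?s h (%a b. ?s a (%p q. parity W (weil_l p x) \<otimes>\<^bsub>W\<^esub> weil_l q (weil_i (adj H b g) y)))"
      by (auto simp: weil_mult weil_parity intro!: sw_cong)
    also have "\<dots> = T1" unfolding T1_def
      by (intro sw_coassoc W_mod; (intro lin linear_maps_compose[OF Wd.parity_linear])?) (simp_all add: W_mod H_module)
    finally have r1: "?s h (%a b. weil_l a (parity W x \<otimes>\<^bsub>W\<^esub> weil_i (adj H b g) y)) = T1" .
    have "?s h (%a b. weil_l a (?s (adj H b g) (%c e. weil_i c x \<otimes>\<^bsub>W\<^esub> weil_l e y))) =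
      ?s h (%a b. ?s (adj H b g) (%c e. ?s a (%p q. weil_l p (weil_i c x) \<otimes>\<^bsub>W\<^esub> weil_l (q \<otimes>\<^bsub>H\<^esub> e) y)))"
      by (auto simp: lhom weil_mult weil_lie_lie intro!: sw_cong)
    also have "\<dots> = ?s h (%a b. ?s a (%p q. ?s (adj H b g) (%c e. weil_l p (weil_i c x) \<otimes>\<^bsub>W\<^esub> weil_l (q \<otimes>\<^bsub>H\<^esub> e) y)))"
      by (intro sw_cong sw_swap W_group) simp_all
    also have "\<dots> = T2" unfolding T2_def
      by (intro sw_coassoc W_mod; (intro lin)?) (simp_all add: W_mod H_module)
    finally have r2: "?s h (%a b. weil_l a (?s (adj H b g) (%c e. weil_i c x \<otimes>\<^bsub>W\<^esub> weil_l e y))) = T2" .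
    have "weil_i g (weil_l h (x \<otimes>\<^bsub>W\<^esub> y)) = ?s h (%a b. parity W (weil_l a x) \<otimes>\<^bsub>W\<^esub> weil_i g (weil_l b y) \<oplus>\<^bsub>W\<^esub> ?s g (%c e. weil_i c (weil_l a x) \<otimes>\<^bsub>W\<^esub> weil_l e (weil_l b y)))"
      by (auto simp: ihom weil_mult intro!: sw_cong)
    also have "\<dots> = T1 \<oplus>\<^bsub>W\<^esub> T2"
      by (subst sw_add[OF W_group]) (auto simp: l1 l2 intro!: sw_closed W_group)
    also have "\<dots> = ?s h (%a b. weil_l a (parity W x \<otimes>\<^bsub>W\<^esub> weil_i (adj H b g) y) \<oplus>\<^bsub>W\<^esub> weil_l a (?s (adj H b g) (%c e. weil_i c x \<otimes>\<^bsub>W\<^esub> weil_l e y)))"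
      by (subst sw_add[OF W_group]) (auto simp: r1 r2 intro!: sw_closed W_group weil_closed)
    also have "\<dots> = ?s h (%a b. weil_l a (weil_i (adj H b g) (x \<otimes>\<^bsub>W\<^esub> y)))"
      by (intro sw_cong) (auto simp: weil_mult(1) weil_add intro!: weil_add(2)[symmetric] sw_closed W_group)
    finally show "weil_i g (weil_l h (x \<otimes>\<^bsub>W\<^esub> y)) = ?s h (%a b. weil_l a (weil_i (adj H b g) (x \<otimes>\<^bsub>W\<^esub> y)))" .
  qed
qed

lemma weil_gr:
  "x \<in> gr W n ==> \<forall>h\<in>carrier H. weil_l h x \<in> gr W n \<and> (case n of 0 \<Rightarrow> weil_i h x = \<zero>\<^bsub>W\<^esub> | Suc m \<Rightarrow> weil_i h x \<in> gr W m)"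
proof (induction rule: Cg.env_graded_induct)
  case (emb n a)
  then show ?case
    by (auto simp: weil_e Cg.gr_closed Lop_gr Iop_gr_0 Iop_gr Cg.emb_gr
        additive_zero[OF C_group W_group linear_additive[OF Cg.emb_linear]] split: nat.split)
next
  case (D n a)
  show ?case
  proof
    fix h assume h: "h \<in> carrier H"
    have a: "a \<in> carrier C" "e a \<in> gr W n" using D by (auto simp: Cg.gr_closed Cg.emb_gr)
    have l: "e (Lop h a) \<in> gr W n" using D h by (simp add: Lop_gr Cg.emb_gr)
    have "d (e (Iop h a)) \<in> gr W n"
    proof (cases n)
      case 0
      then show ?thesis using D h
        by (simp add: Iop_gr_0 additive_zero[OF C_group W_group linear_additive[OF Cg.emb_linear]])
    next
      case (Suc m)
      then show ?thesis using D h Wd.d_degree[of "e (Iop h a)" m] by (simp add: Iop_gr Cg.emb_gr)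
    qed
    then have "weil_i h (d (e a)) \<in> gr W n"
      using a l h by (auto simp: weil_i_d weil_e intro!: Wd.gr_add Wd.gr_neg Wd.gr_smult)
    moreover have "weil_l h (d (e a)) \<in> gr W (Suc n)" using a l h Wd.d_degree by (simp add: weil_i_d weil_e)
    ultimately show "weil_l h (Cg.D a) \<in> gr W (Suc n) \<and> (case Suc n of 0 \<Rightarrow> weil_i h (Cg.D a) = \<zero>\<^bsub>W\<^esub> | Suc m \<Rightarrow> weil_i h (Cg.D a) \<in> gr W m)"
      using a by (simp add: d_e)
  qed
next
  case (add n x y)
  then show ?case by (auto simp: weil_add Wd.gr_closed Wd.gr_add split: nat.splits)
next
  case (mult m n x y)
  have c: "x \<in> carrier W" "y \<in> carrier W" using mult by (auto simp: Wd.gr_closed)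
  have 1: "(weil_i h x \<otimes>\<^bsub>W\<^esub> weil_l k y = \<zero>\<^bsub>W\<^esub> \<or> (\<exists>j. m + n = Suc j \<and> weil_i h x \<otimes>\<^bsub>W\<^esub> weil_l k y \<in> gr W j)) \<and> (m = 0 \<longrightarrow> weil_i h x \<otimes>\<^bsub>W\<^esub> weil_l k y = \<zero>\<^bsub>W\<^esub>)"
    if "h \<in> carrier H" "k \<in> carrier H" for h k
    using mult(3,4) that c by (cases m) (auto intro: Wd.gr_mult)
  have 2: "(parity W x \<otimes>\<^bsub>W\<^esub> weil_i h y = \<zero>\<^bsub>W\<^esub> \<or> (\<exists>j. m + n = Suc j \<and> parity W x \<otimes>\<^bsub>W\<^esub> weil_i h y \<in> gr W j))"
    if "h \<in> carrier H" for h
    using mult that c Wd.parity_gr[OF mult(1)] by (cases n) (auto intro: Wd.gr_mult)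
  show ?case
  proof
    fix h assume h: "h \<in> carrier H"
    have l: "weil_l h (x \<otimes>\<^bsub>W\<^esub> y) \<in> gr W (m + n)"
      using mult c h by (auto simp: weil_mult intro!: sw_submodule[OF Cg.W_graded] Wd.gr_mult)
    show "weil_l h (x \<otimes>\<^bsub>W\<^esub> y) \<in> gr W (m + n) \<and> (case m + n of 0 \<Rightarrow> weil_i h (x \<otimes>\<^bsub>W\<^esub> y) = \<zero>\<^bsub>W\<^esub> | Suc j \<Rightarrow> weil_i h (x \<otimes>\<^bsub>W\<^esub> y) \<in> gr W j)"
    proof (cases "m + n")
      case 0
      then have "sw H W h (%a b. weil_i a x \<otimes>\<^bsub>W\<^esub> weil_l b y) = sw H W h (%a b. \<zero>\<^bsub>W\<^esub>)"
        using 1 h by (intro sw_cong) auto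
      moreover have "sw H W h (%a b. \<zero>\<^bsub>W\<^esub>) = \<zero>\<^bsub>W\<^esub>"
        using sw_hom[OF W_group W_group additive_mapsI[of W "%_. \<zero>\<^bsub>W\<^esub>" W] h, of "%a b. \<zero>\<^bsub>W\<^esub>"] by simp
      ultimately show ?thesis using l 0 2[OF h] c h by (simp add: weil_mult)
    next
      case (Suc j)
      then have "sw H W h (%a b. weil_i a x \<otimes>\<^bsub>W\<^esub> weil_l b y) \<in> gr W j"
        using 1 h by (intro sw_submodule[OF Cg.W_graded]) (metis Wd.gr_zero nat.inject)+
      then show ?thesis using l Suc 2[OF h] c h by (auto simp: weil_mult intro!: Wd.gr_add)
    qed
  qed
qed

lemma weil_operation: "hopf_operation_with_connection K H W d (\<lambda>h\<in>carrier H. \<lambda>x\<in>carrier W. weil_i h x) e"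
proof -
  let ?i = "\<lambda>h\<in>carrier H. \<lambda>x\<in>carrier W. weil_i h x"
  have lie [simp]: "lie H W d ?i h x = weil_l h x" if "h \<in> carrier H" "x \<in> carrier W" for h x
    using that weil_lie[of x h] by (simp add: lie_def)
  have gr: "gsign W n (x \<otimes>\<^bsub>W\<^esub> y) = parity W x \<otimes>\<^bsub>W\<^esub> y" if "x \<in> gr W n" "y \<in> carrier W" for x y n
    using that Cg.W.gsign_mult[of x y n 0] by (simp add: Wd.parity_homogeneous[where n=n] Wd.gr_closed)
  show ?thesis
  proof (intro hopf_operation_with_connection.intro hopf_operation.intro hopf_operation_axioms.intro
      hopf_operation_with_connection_axioms.intro)
    show "hopf_algebra K H" "graded_differential_algebra K W d" by unfold_locales
  next
    fix h assume h: "h \<in> carrier H"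
    then show "?i h \<in> linear_maps K W W" by (simp add: linear_cong[OF W_mod _ weil_linear(1)])
    fix x n
    show "?i h x \<in> gr W n" if "x \<in> gr W (Suc n)"
      using weil_gr[OF that] h that by (simp add: Wd.gr_closed)
    show "?i h x = \<zero>\<^bsub>W\<^esub>" if "x \<in> gr W 0"
      using weil_gr[OF that] h that by (simp add: Wd.gr_closed)
  next
    fix x assume x: "x \<in> carrier W"
    then show "(%h. ?i h x) \<in> linear_maps K H W" by (simp add: linear_cong[OF H_module _ weil_linear_hopf(1)[OF x]])
    show "?i \<one>\<^bsub>H\<^esub> x = \<zero>\<^bsub>W\<^esub>" using x weil_one by simp
  next
    fix h x a y assume h: "h \<in> carrier H" and x: "x \<in> gr W a" and y: "y \<in> carrier W"
    have c: "x \<in> carrier W" using x by (rule Wd.gr_closed)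
    have "lsum W (map (%u. ?i (u ! 0) x \<otimes>\<^bsub>W\<^esub> lie H W d ?i (u ! 1) y) (sweedler H h)) = sw H W h (%a b. weil_i a x \<otimes>\<^bsub>W\<^esub> weil_l b y)"
      unfolding sw_def using c y sweedler_nth[OF h] by (intro lsum_cong) auto
    then show "?i h (x \<otimes>\<^bsub>W\<^esub> y) = lsum W (map (%u. ?i (u ! 0) x \<otimes>\<^bsub>W\<^esub> lie H W d ?i (u ! 1) y) (sweedler H h)) \<oplus>\<^bsub>W\<^esub> gsign W a (x \<otimes>\<^bsub>W\<^esub> ?i h y)"
      using h c y x by (simp add: gr weil_mult Cg.W.a_comm sw_closed[OF W_group])
  next
    fix g h x assume g: "g \<in> carrier H" and h: "h \<in> carrier H" and x: "x \<in> carrier W"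
    have "lsum W (map (%u. lie H W d ?i (u ! 0) (?i (adj H (u ! 1) g) x)) (sweedler H h)) = sw H W h (%a b. weil_l a (weil_i (adj H b g) x))"
      unfolding sw_def using g x sweedler_nth[OF h] by (intro lsum_cong) auto
    then show "?i g (lie H W d ?i h x) = lsum W (map (%u. lie H W d ?i (u ! 0) (?i (adj H (u ! 1) g) x)) (sweedler H h))"
      using g h x weil_i_lie by simp
    show "lie H W d ?i h (lie H W d ?i g x) = lie H W d ?i (h \<otimes>\<^bsub>H\<^esub> g) x"
      using g h x weil_lie_lie by simp
  next
    show "e \<in> graded_algebra_hom K C W" by (rule e_hom)
    fix h \<Psi> assume "h \<in> carrier H" "\<Psi> \<in> carrier C"
    then show "?i h (e \<Psi>) = e (Iop h \<Psi>)" "lie H W d ?i h (e \<Psi>) = e (Lop h \<Psi>)" by (simp_all add: weil_e)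
  qed
qed

section \<open>The universal property of the Weil algebra\<close>

text \<open>The product rule for $i_h$ involves $L_h$, and with it $i_h d$. The induction therefore
  establishes agreement on \<open>x\<close> and on $dx$ at the same time.\<close>

lemma operation_compatible:
  assumes W: "hopf_operation_with_connection K H W d j e"
    and \<Omega>: "hopf_operation_with_connection K H \<Omega> \<delta> i \<alpha>"
    and f: "f \<in> graded_algebra_hom K W \<Omega>" and fd: "\<And>x. x \<in> carrier W ==> f (d x) = \<delta> (f x)"
    and fe: "\<And>a. a \<in> carrier C ==> f (e a) = \<alpha> a"
    and h: "h \<in> carrier H" and x: "x \<in> carrier W"
  shows "f (j h x) = i h (f x)"
proof -
  interpret Wo: hopf_operation_with_connection K H W d j e by fact
  interpret O: hopf_operation_with_connection K H \<Omega> \<delta> i \<alpha> by fact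
  have fl: "f \<in> linear_maps K W \<Omega>" and fr: "f \<in> ring_hom W \<Omega>" and fg: "\<And>n x. x \<in> gr W n ==> f x \<in> gr \<Omega> n"
    using f by (auto simp: graded_algebra_hom_def)
  have OG: "abelian_group \<Omega>" by (rule O.A_group)
  note fa = linear_additive[OF fl]
  note [simp] = linear_closed[OF fl] linear_add[OF fl] ring_hom_mult[OF fr]
    linear_closed[OF Wo.i_linear] linear_closed[OF O.i_linear]
  have lie_c [simp]: "lie H W d j h x \<in> carrier W" if "h \<in> carrier H" "x \<in> carrier W" for h x
    using that by (simp add: lie_def)
  have lie_c' [simp]: "lie H \<Omega> \<delta> i h x \<in> carrier \<Omega>" if "h \<in> carrier H" "x \<in> carrier \<Omega>" for h x
    using that by (simp add: lie_def)
  have jm: "j h (x \<otimes>\<^bsub>W\<^esub> y) = sw H W h (%a b. j a x \<otimes>\<^bsub>W\<^esub> lie H W d j b y) \<oplus>\<^bsub>W\<^esub> gsign W n (x \<otimes>\<^bsub>W\<^esub> j h y)"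
    if "h \<in> carrier H" "x \<in> gr W n" "y \<in> carrier W" for h x y n
    using Wo.i_mult[OF that] by (simp add: sw_def)
  have im: "i h (x \<otimes>\<^bsub>\<Omega>\<^esub> y) = sw H \<Omega> h (%a b. i a x \<otimes>\<^bsub>\<Omega>\<^esub> lie H \<Omega> \<delta> i b y) \<oplus>\<^bsub>\<Omega>\<^esub> gsign \<Omega> n (x \<otimes>\<^bsub>\<Omega>\<^esub> i h y)"
    if "h \<in> carrier H" "x \<in> gr \<Omega> n" "y \<in> carrier \<Omega>" for h x y n
    using O.i_mult[OF that] by (simp add: sw_def)
  let ?Q = "%x. \<forall>h\<in>carrier H. f (j h x) = i h (f x)"
  have lie_f: "f (lie H W d j h x) = lie H \<Omega> \<delta> i h (f x)"
    if "h \<in> carrier H" "x \<in> carrier W" "?Q x" "?Q (d x)" for h x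
    using that by (simp add: lie_def fd linear_smult[OF fl])
  have Qmult: "?Q (x \<otimes>\<^bsub>W\<^esub> y)" if x: "x \<in> gr W n" "y \<in> carrier W" and Q: "?Q x" "?Q y" "?Q (d y)" for x y n
  proof
    fix h assume h: "h \<in> carrier H"
    have c: "x \<in> carrier W" using x by (simp add: Wd.gr_closed)
    have "f (sw H W h (%a b. j a x \<otimes>\<^bsub>W\<^esub> lie H W d j b y)) = sw H \<Omega> h (%a b. f (j a x \<otimes>\<^bsub>W\<^esub> lie H W d j b y))"
      using c x h by (intro sw_hom[OF W_group OG fa]) auto
    also have "\<dots> = sw H \<Omega> h (%a b. i a (f x) \<otimes>\<^bsub>\<Omega>\<^esub> lie H \<Omega> \<delta> i b (f y))"
      using c x h Q by (intro sw_cong) (simp_all add: lie_f)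
    finally show "f (j h (x \<otimes>\<^bsub>W\<^esub> y)) = i h (f (x \<otimes>\<^bsub>W\<^esub> y))"
      using h x c Q by (simp add: jm im[OF _ fg[OF x(1)]] sw_closed[OF W_group] additive_gsign[OF W_group OG fa])
  qed
  have Qadd: "?Q (x \<oplus>\<^bsub>W\<^esub> y)" if "x \<in> carrier W" "y \<in> carrier W" "?Q x" "?Q y" for x y
    using that by (simp add: linear_add[OF Wo.i_linear] linear_add[OF O.i_linear])
  have zero: "f (j h \<zero>\<^bsub>W\<^esub>) = i h (f \<zero>\<^bsub>W\<^esub>)" if "h \<in> carrier H" for h
    using that by (simp add: additive_zero[OF W_group OG fa] additive_zero[OF W_group W_group linear_additive[OF Wo.i_linear]]
        additive_zero[OF OG OG linear_additive[OF O.i_linear]])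
  have gen: "?Q (e a) \<and> ?Q (d (e a))" if a: "a \<in> carrier C" for a
  proof
    show Qe: "?Q (e a)"
      using a by (simp add: Wo.connection_op O.connection_op fe)
    show "?Q (d (e a))"
    proof
      fix h assume h: "h \<in> carrier H"
      have *: "f (lie H W d j h (e a)) = lie H \<Omega> \<delta> i h (\<alpha> a)"
        using a h by (simp add: Wo.connection_lie O.connection_lie fe)
      have "\<alpha> a \<in> carrier \<Omega>" using a fe[OF a] linear_closed[OF fl, of "e a"] by simp
      with * show "f (j h (d (e a))) = i h (f (d (e a)))"
        using h a Qe by (simp add: lie_def fd fe linear_smult[OF fl])
    qed
  qed
  have "x \<in> gr W n ==> ?Q x \<and> ?Q (d x)" for x n
  proof (induction rule: Cg.env_graded_induct)
    case (emb n a)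
    then show ?case using gen by (simp add: Cg.gr_closed)
  next
    case (D n a)
    then have "a \<in> carrier C" by (simp add: Cg.gr_closed)
    moreover then have "d (Cg.D a) = \<zero>\<^bsub>W\<^esub>" using Wd.d_square[of "e a"] by (simp add: d_e)
    ultimately show ?case using gen[of a] zero by (simp add: d_e)
  next
    case (add n x y)
    then show ?case using Qadd Wd.gr_closed by (simp add: Qadd)
  next
    case (mult m n x y)
    have c: "x \<in> carrier W" "y \<in> carrier W" using mult by (auto simp: Wd.gr_closed)
    have "?Q (d x \<otimes>\<^bsub>W\<^esub> y)" using mult c by (intro Qmult[OF Wd.d_degree]) auto
    moreover have "?Q (d (d y))" using c zero by (simp add: Wd.d_square)
    then have "?Q (parity W x \<otimes>\<^bsub>W\<^esub> d y)"
    proof -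
      assume dd: "?Q (d (d y))"
      have "?Q (parity W x)"
        using mult c by (auto simp: Wd.parity_homogeneous[where n=m] additive_gsign[OF W_group OG fa]
            additive_gsign[OF W_group W_group linear_additive[OF Wo.i_linear]] additive_gsign[OF OG OG linear_additive[OF O.i_linear]])
      then show ?thesis using mult c dd by (intro Qmult[OF Wd.parity_gr]) auto
    qed
    ultimately have "?Q (d (x \<otimes>\<^bsub>W\<^esub> y))"
      unfolding Wd.d_mult[OF c] using c by (intro Qadd) auto
    moreover have "?Q (x \<otimes>\<^bsub>W\<^esub> y)" using mult c by (intro Qmult) auto
    ultimately show ?case by blast
  qed
  note Qh = this
  from x have "?Q x"
  proof (induction rule: Wd.homogeneous_induct)
    case (homogeneous n x)
    then show ?case using Qh by blast
  next
    case (add x y)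
    then show ?case by (rule Qadd)
  qed
  then show ?thesis using h by blast
qed

lemma identity_hom: "(%x. x) \<in> graded_algebra_hom K W W"
  by (auto simp: graded_algebra_hom_def ring_hom_def intro!: linear_mapsI)

text \<open>Uniqueness, which gives the definite description its meaning, is compatibility with the identity of
  \<open>W\<close>; extensionality fixes the values outside the carriers.\<close>

lemma weil_op_spec: "hopf_operation_with_connection K H (weil K H) (weil_d K H) (weil_op K H) (weil_conn K H)"
proof -
  let ?i = "\<lambda>h\<in>carrier H. \<lambda>x\<in>carrier W. weil_i h x"
  let ?P = "%i. i \<in> carrier H \<rightarrow>\<^sub>E extensional (carrier W) \<and> hopf_operation_with_connection K H W d i e"
  have "\<exists>!i. ?P i"
  proof (rule ex1I)
    show "?P ?i" using weil_operation by auto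
  next
    fix i assume i: "?P i"
    have "i h x = weil_i h x" if "h \<in> carrier H" "x \<in> carrier W" for h x
      using operation_compatible[OF conjunct2[OF i] weil_operation identity_hom _ _ that] that by simp
    moreover have "i h \<in> extensional (carrier W)" if "h \<in> carrier H" for h using i that by blast
    ultimately have "i h = ?i h" if "h \<in> carrier H" for h
      using that by (intro extensionalityI[of _ "carrier W"]) auto
    moreover have "i \<in> extensional (carrier H)" using i by (auto simp: PiE_def)
    ultimately show "i = ?i" by (intro extensionalityI[of _ "carrier H"]) auto
  qed
  from theI'[OF this] show ?thesis
    unfolding weil_op_def weil_def weil_d_def weil_conn_def by blast
qed

lemma weil_universal:
  assumes \<Omega>: "hopf_operation_with_connection K H \<Omega> \<delta> i \<alpha>"
  shows "\<exists>!f. f \<in> extensional (carrier (weil K H)) \<and>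
    connection_morphism K H (weil K H) (weil_d K H) (weil_op K H) (weil_conn K H) \<Omega> \<delta> i \<alpha> f"
proof -
  interpret O: hopf_operation_with_connection K H \<Omega> \<delta> i \<alpha> by fact
  have \<Omega>d: "graded_differential_algebra K \<Omega> \<delta>" by unfold_locales
  have W: "hopf_operation_with_connection K H W d (weil_op K H) e"
    using weil_op_spec by (simp add: weil_def weil_d_def weil_conn_def)
  interpret Wo: hopf_operation_with_connection K H W d "weil_op K H" e by fact
  obtain f where f: "f \<in> graded_algebra_hom K W \<Omega>" "\<And>x. x \<in> carrier W ==> f (d x) = \<delta> (f x)"
    "\<And>a. a \<in> carrier C ==> f (e a) = \<alpha> a"
    using Cg.env_dga_hom_exists[OF \<Omega>d O.connection_hom] by blast
  let ?f = "restrict f (carrier W)"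
  have "?f \<in> graded_algebra_hom K W \<Omega>"
    using f(1) by (auto simp: graded_algebra_hom_def linear_maps_def ring_hom_def Wd.gr_closed)
  moreover have "f (weil_op K H h x) = i h (f x)" if "h \<in> carrier H" "x \<in> carrier W" for h x
    by (rule operation_compatible[OF W \<Omega> f that])
  ultimately have "connection_morphism K H W d (weil_op K H) e \<Omega> \<delta> i \<alpha> ?f"
    using f(2,3) by (auto simp: connection_morphism_def linear_closed[OF Wo.i_linear])
  moreover have "g = ?f"
    if g: "g \<in> extensional (carrier W)" "connection_morphism K H W d (weil_op K H) e \<Omega> \<delta> i \<alpha> g" for g
  proof (rule extensionalityI[OF g(1)])
    fix x assume x: "x \<in> carrier W"
    have "g x = f x"
      by (rule Cg.env_dga_hom_unique[OF _ _ f(1,2) _ x]) (use g(2) f(3) in \<open>auto simp: connection_morphism_def\<close>)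
    then show "g x = ?f x" using x by simp
  qed simp
  ultimately have "\<exists>!f. f \<in> extensional (carrier W) \<and> connection_morphism K H W d (weil_op K H) e \<Omega> \<delta> i \<alpha> f"
    by (intro ex1I[of _ ?f]) auto
  then show ?thesis by (simp add: weil_def weil_d_def weil_conn_def)
qed

end

theorem theorem13:
  fixes K :: "'k ring" and H :: "('k, 'h) hopf" and \<Omega> :: "('k, 'w) galgebra"
    and d :: "'w \<Rightarrow> 'w" and i :: "'h \<Rightarrow> 'w \<Rightarrow> 'w" and \<alpha> :: "('h list \<Rightarrow> 'k) \<Rightarrow> 'w"
  assumes "field K" and "hopf_algebra K H"
    and "hopf_operation_with_connection K H \<Omega> d i \<alpha>"
  shows "\<exists>!f. f \<in> extensional (carrier (weil K H)) \<and>
    connection_morphism K H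
      (weil K H) (weil_d K H) (weil_op K H) (weil_conn K H)
      \<Omega> d i \<alpha> f"
  by (rule hopf_algebra.weil_universal[OF assms(2,3)])

end
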